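(* Let $M$ be an almost Hermitian surface, i.e. a (connected, smooth) $4$-manifold with an almost Hermitian structure $(J,g)$, treated as a $4$-manifold along with a spin$^{\mathrm c}$-structure $(\sigma^+,\sigma^-,\kappa)$ and a fixed global unit $C^\infty$ section $\psi$ of $\sigma^+$. Let $\pi:G_2^+M\to M$ be the bundle of oriented tangent planes, let $\lambda^+$ and $\mu^+$ be the complex line bundles over $G_2^+M$ associated with the spin$^{\mathrm c}$-structure, so that $\pi^*\sigma^+=\lambda^+\oplus\mu^+$, and let $Q,\overline Q\subset G_2^+M$ be the oriented $6$-dimensional submanifolds determined by $J$. Then $\lambda^+$ and $\mu^+$ are Poincaré-dual to $\overline Q$ and $Q$, respectively. More precisely, the $\lambda^+$ and $\mu^+$ components $\phi,\chi$ of $\pi^*\psi$ relative to the decomposition $\pi^*\sigma^+=\lambda^+\oplus\mu^+$ are transverse to the zero sections in $\lambda^+$ and $\mu^+$, and their respective oriented manifolds of zeros are $\overline Q$ (for $\phi$) and $Q$ (for $\chi$).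
   Context: **Spin$^{\mathrm c}(4)$-geometries.** A spin$^{\mathrm c}(4)$-geometry is a triple $(\mathcal S^+,\mathcal S^-,\mathcal K)$ of two Hermitian planes (complex dimension 2) $\mathcal S^\pm$ and a Hermitian line $\mathcal K$, with fixed norm-preserving isomorphic identifications $[\mathcal S^\pm]^{\wedge 2}=\mathcal K$, where $|\phi\wedge\chi|^2=|\phi|^2|\chi|^2-|\langle\phi,\chi\rangle|^2$. For $A\in\mathrm{Hom}_{\mathbf C}(\mathcal S^+,\mathcal S^-)$, $\det A\in\mathbf C$ is the scalar by which $A^{\wedge2}:[\mathcal S^+]^{\wedge2}=\mathcal K\to[\mathcal S^-]^{\wedge2}=\mathcal K$ acts. $A$ is a homothety if $|A\phi|=|A|\,|\phi|$ for some $|A|\ge0$ and all $\phi\in\mathcal S^+$. Let $\mathcal V=\{A\in\mathrm{Hom}_{\mathbf C}(\mathcal S^+,\mathcal S^-): A\text{ is a homothety and }\det A\in[0,\infty)\}$. This is a real $4$-dimensional vector space with the Euclidean norm $A\mapsto|A|$. It is canonically oriented: for orthonormal bases $(\phi^\pm,\chi^\pm)$ of $\mathcal S^\pm$ with $\phi^+\wedge\chi^+=\phi^-\wedge\chi^-$, the map $A\mapsto(a,b)$, where $A\phi^+=a\phi^-+b\chi^-$, is an isomorphism $\mathcal V\to\mathbf C^2$, declared orientation-preserving. **Orientations.** A complex vector space with complex basis $(e_1,\dots,e_n)$ is oriented by the real basis $(e_1,ie_1,\dots,e_n,ie_n)$; almost complex manifolds are oriented accordingly. Total spaces of bundles and zero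 sets of transverse sections (all real dimensions being even) are oriented by the direct-sum convention: if $K\subset N$ is the zero set of a section $\phi$ of a complex line bundle, transverse to the zero section, then for $\xi\in K$ and a complement $C$ of $T_\xi K$ in $T_\xi N$, oriented so that the differential of $\phi$ in a local trivialization maps $C$ onto the fibre preserving orientation, $T_\xi N=T_\xi K\oplus C$ as oriented spaces. **Spin$^{\mathrm c}$-structures.** A spin$^{\mathrm c}$-structure over a $4$-manifold $M$ is a triple $(\sigma^+,\sigma^-,\kappa)$ of complex vector bundles over $M$ of ranks $2,2,1$ with Hermitian fibre metrics, whose fibres at each $y\in M$ form a spin$^{\mathrm c}(4)$-geometry such that the associated space $\mathcal V=\mathcal V_y$ is identified with $T_yM$, everything depending smoothly on $y$. The evaluation pairing $T_yM\times\sigma^+_y\to\sigma^-_y$, $(v,\phi)\mapsto v\phi$, is called Clifford multiplication. $M$ thereby acquires an orientation and a Riemannian metric $g$. **Almost Hermitian structures.** An almost Hermitian structure $(J,g)$ on $M$ consists of an almost complex structure $J$ and a Riemannian metric $g$ compatible with $J$. Almost Hermitian structures on a $4$-manifold $M$ are in a natural bijective correspondence with pairs formed by a spin$^{\mathrm c}$-structure $(\sigma^+,\sigma^-,\kappa)$ over $M$ and a global unit $C^\infty$ section $\psi$ of $\sigma^+$: given such a pair, the Clifford multiplication $v\mapsto v\psi$ is a norm-preserving real isomorphism $TM\to\sigma^-$, and pulling back the complex structure of $\sigma^-$ yields $J$, compatible with the metric $g$ of the spin$^{\mathrm c}$-structure. The orientation of $M$ is the one determined by $J$. **The Grassmannian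 bundle.** For a real vector space $W$, $G_2^+(W)$ is the Grassmannian of oriented real $2$-planes in $W$. If $W$ is Euclidean, $T_{\mathcal T}[G_2^+(W)]=\mathrm{Hom}_{\mathbf R}(\mathcal T,W/\mathcal T)$ is a complex vector space with $iA=A\circ i_{\mathcal T}$, where $i_{\mathcal T}$ is the positive rotation by $\pi/2$ in the oriented Euclidean plane $\mathcal T$; this makes $G_2^+(W)$ almost complex, hence oriented. For an oriented $4$-manifold $M$, $G_2^+M=\{(y,\mathcal T):y\in M,\ \mathcal T\in G_2^+(T_yM)\}$, with projection $\pi$ to $M$, is oriented as a bundle with oriented base $M$ and oriented fibres $G_2^+(T_yM)$. **The submanifolds $Q,\overline Q$.** For an almost complex structure $J$ on $M$, $Q$ (resp. $\overline Q$) is the set of $(y,\mathcal T)\in G_2^+M$ such that $\mathcal T$ is a $J$-complex line in $T_yM$ with its complex-line orientation (resp. with the opposite of its complex-line orientation). Both are $\mathbf{CP}^1$-bundles over $M$, with fibres that are copies of the complex projective line of all complex lines in $T_yM$. They are oriented by the direct sum of the orientation of $M$ and the orientation of the fibres *opposite* to the natural complex orientation of the projective line of $T_yM$. **The line bundles $\lambda^+,\mu^+$.** For a spin$^{\mathrm c}(4)$-geometry, and complex lines $\mathcal L\subset\mathcal S^+$, $\mathcal L'\subset\mathcal S^-$, put $\Psi(\mathcal L,\mathcal L')=\{A\in\mathcal V:A\mathcal L\subset\mathcal L'\}$, a real plane oriented via its natural real isomorphism (restriction to $\mathcal L$) with the complex line $\mathrm{Hom}_{\mathbf C}(\mathcal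 L,\mathcal L')$. Then $\Psi:P(\mathcal S^+)\times P(\mathcal S^-)\to G_2^+(\mathcal V)$ is a diffeomorphism ($P(\,\cdot\,)$ denoting the complex projective line). For a spin$^{\mathrm c}$-structure over $M$, $\lambda^+$ is the complex line bundle over $G_2^+M$ whose fibre at $(y,\mathcal T)$ is the line $\mathcal L\subset\sigma^+_y$ with $\Psi(\mathcal L,\mathcal L')=\mathcal T$ for some $\mathcal L'\subset\sigma^-_y$, where $\mathcal V_y=T_yM$; $\mu^+$ is the orthogonal complement of $\lambda^+$ in $\pi^*\sigma^+$. **Poincaré-dual.** Let $K$ be a compact, oriented, not necessarily connected, codimension-two submanifold of an oriented even-dimensional real manifold $N$, and let $\lambda$ be a complex line bundle over $N$. One says that $\lambda$ is Poincaré-dual to $K$ if $K$ is the canonically oriented set of zeros of some $C^\infty$ section of $\lambda$ transverse to the zero section. *)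

theory Defs
  imports
    "Jordan_Normal_Form.Determinant"
    "HOL-Analysis.Analysis"
    "HOL-Library.Function_Algebras"
    "HOL-Library.Numeral_Type"
begin

no_notation Matrix.vec_index (infixl "$" 100)

section \<open>Linear algebra\<close>

instantiation "fun" :: (type, real_vector) real_vector
begin

definition scaleR_fun :: "real \<Rightarrow> ('a \<Rightarrow> 'b) \<Rightarrow> 'a \<Rightarrow> 'b" where
  "scaleR_fun r f = (\<lambda>x. r *\<^sub>R f x)"

instance
  by standard (auto simp: scaleR_fun_def fun_eq_iff scaleR_right_distrib scaleR_left_distrib)

end

text \<open>
  Fibres of complex vector bundles are complex subspaces of an ambient complex vector space, given
  by a type of the following class.  This is no restriction: any bundle over a fixed base has its
  fibres embedded in the direct sum of all of them.
\<close>

class complex_vector = real_vector +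
  fixes scaleC :: "complex \<Rightarrow> 'a \<Rightarrow> 'a"  (infixr "*\<^sub>C" 75)
  assumes scaleC_right_distrib: "c *\<^sub>C (x + y) = c *\<^sub>C x + c *\<^sub>C y"
    and scaleC_left_distrib: "(c + d) *\<^sub>C x = c *\<^sub>C x + d *\<^sub>C x"
    and scaleC_scaleC: "c *\<^sub>C d *\<^sub>C x = (c * d) *\<^sub>C x"
    and scaleC_one: "1 *\<^sub>C x = x"
    and scaleR_scaleC: "r *\<^sub>R x = complex_of_real r *\<^sub>C x"

lemma vector_space_scaleC:
  "vector_space (scaleC :: complex \<Rightarrow> 'a \<Rightarrow> 'a::complex_vector)"
  by standard (simp_all add: scaleC_right_distrib scaleC_left_distrib scaleC_scaleC scaleC_one)

abbreviation csubspace :: "'s::complex_vector set \<Rightarrow> bool" where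
  "csubspace \<equiv> module.subspace scaleC"

abbreviation cdim :: "'s::complex_vector set \<Rightarrow> nat" where
  "cdim \<equiv> vector_space.dim scaleC"

definition complex_lines :: "'s::complex_vector set \<Rightarrow> 's set set" where
  "complex_lines S = {L. L \<subseteq> S \<and> csubspace L \<and> cdim L = 1}"

text \<open>Homomorphisms between subspaces are functions on the ambient type.  Complex ones are
  normalized to be \<open>0\<close> off the source, so that they form a vector space of functions.\<close>

definition real_hom :: "'v::real_vector set \<Rightarrow> 'w::real_vector set \<Rightarrow> ('v \<Rightarrow> 'w) set" where
  "real_hom P W = {A. (\<forall>u\<in>P. A u \<in> W) \<and>
     (\<forall>u\<in>P. \<forall>v\<in>P. \<forall>a b. A (a *\<^sub>R u + b *\<^sub>R v) = a *\<^sub>R A u + b *\<^sub>R A v)}"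

definition complex_hom ::
    "'s::complex_vector set \<Rightarrow> 't::complex_vector set \<Rightarrow> ('s \<Rightarrow> 't) set" where
  "complex_hom S S' = {A. (\<forall>u\<in>S. A u \<in> S') \<and> (\<forall>u. u \<notin> S \<longrightarrow> A u = 0) \<and>
     (\<forall>u\<in>S. \<forall>v\<in>S. \<forall>a b. A (a *\<^sub>C u + b *\<^sub>C v) = a *\<^sub>C A u + b *\<^sub>C A v)}"

definition hermitian_space :: "nat \<Rightarrow> 's::complex_vector set \<Rightarrow> ('s \<Rightarrow> 's \<Rightarrow> complex) \<Rightarrow> bool" where
  "hermitian_space n S h \<longleftrightarrow> csubspace S \<and> cdim S = n \<and>
     (\<forall>u\<in>S. \<forall>v\<in>S. \<forall>w\<in>S. \<forall>a b. h (a *\<^sub>C u + b *\<^sub>C v) w = a * h u w + b * h v w) \<and>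
     (\<forall>u\<in>S. \<forall>v\<in>S. h u v = cnj (h v u)) \<and>
     (\<forall>u\<in>S. u \<noteq> 0 \<longrightarrow> Re (h u u) > 0)"

definition hnorm :: "('s \<Rightarrow> 's \<Rightarrow> complex) \<Rightarrow> 's \<Rightarrow> real" where
  "hnorm h u = sqrt (Re (h u u))"

text \<open>An oriented finite-dimensional real vector space is represented by the set of its positively
  oriented ordered bases; in particular this is how oriented planes are represented.\<close>

definition basis_list :: "'v::real_vector list \<Rightarrow> 'v set \<Rightarrow> bool" where
  "basis_list bs W \<longleftrightarrow> distinct bs \<and> independent (set bs) \<and> span (set bs) = W"

definition orient_class :: "'v::real_vector list \<Rightarrow> 'v list set" where
  "orient_class bs = {cs. length cs = length bs \<and>
     (\<exists>A \<in> carrier_mat (length bs) (length bs). Determinant.det A > 0 \<and>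
        (\<forall>i<length bs. cs ! i = (\<Sum>j<length bs. (A $$ (i, j)) *\<^sub>R bs ! j)))}"

definition opposite :: "'v::real_vector list set \<Rightarrow> 'v list set" where
  "opposite T = (\<lambda>bs. (- hd bs) # tl bs) ` T"

definition underlying :: "'v::real_vector list set \<Rightarrow> 'v set" where
  "underlying T = span (\<Union>bs\<in>T. set bs)"

definition oriented_planes :: "'v::real_vector set \<Rightarrow> 'v list set set" where
  "oriented_planes W = {orient_class [u, v] | u v. u \<in> W \<and> v \<in> W \<and> u \<noteq> v \<and> independent {u, v}}"

text \<open>
  The orientation \<open>(e\<^sub>1, i e\<^sub>1, \<dots>, e\<^sub>n, i e\<^sub>n)\<close> of \<open>W\<close>.  Here the complex structure on \<open>W\<close> is the one
  which multiplication by the imaginary unit \<open>I\<close> of a complex vector space \<open>S\<close> induces through a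
  real-linear map \<open>e\<close> of \<open>S\<close> onto \<open>W\<close> whose kernel is a complex subspace.
\<close>

definition complex_orientation ::
    "('b \<Rightarrow> 'b) \<Rightarrow> ('b \<Rightarrow> 'v::real_vector) \<Rightarrow> 'b set \<Rightarrow> 'v set \<Rightarrow> 'v list set" where
  "complex_orientation I e S W =
     {bs. \<exists>as. set as \<subseteq> S \<and> basis_list (concat (map (\<lambda>a. [e a, e (I a)]) as)) W \<and>
        bs \<in> orient_class (concat (map (\<lambda>a. [e a, e (I a)]) as))}"


section \<open>Manifolds\<close>

text \<open>\<open>C\<^sup>k\<close> and \<open>C\<^sup>\<infinity>\<close> maps on an open subset of a Euclidean space.\<close>

primrec Ck_on :: "nat \<Rightarrow> ('e::euclidean_space \<Rightarrow> 'f::euclidean_space) \<Rightarrow> 'e set \<Rightarrow> bool" where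
  "Ck_on 0 = (\<lambda>h S. continuous_on S h)"
| "Ck_on (Suc k) = (\<lambda>h S. (\<forall>x\<in>S. h differentiable (at x)) \<and>
     (\<forall>v. Ck_on k (\<lambda>x. frechet_derivative h (at x) v) S))"

definition smooth_on :: "'e::euclidean_space set \<Rightarrow> ('e \<Rightarrow> 'f::euclidean_space) \<Rightarrow> bool" where
  "smooth_on S h \<longleftrightarrow> (\<forall>k. Ck_on k h S)"

text \<open>A manifold is given by an atlas; its points and its topology are determined by the atlas.\<close>

type_synonym ('a, 'e) chart = "'a set \<times> ('a \<Rightarrow> 'e)"
type_synonym ('a, 'e) manifold = "('a, 'e) chart set"

definition points :: "('a, 'e) manifold \<Rightarrow> 'a set" where
  "points M = \<Union>(fst ` M)"

definition chart_inv :: "('a, 'e) chart \<Rightarrow> 'e \<Rightarrow> 'a" where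
  "chart_inv c = inv_into (fst c) (snd c)"

definition smooth_atlas :: "('a, 'e::euclidean_space) manifold \<Rightarrow> bool" where
  "smooth_atlas M \<longleftrightarrow>
     (\<forall>c\<in>M. inj_on (snd c) (fst c) \<and> open (snd c ` fst c)) \<and>
     (\<forall>c\<in>M. \<forall>d\<in>M. open (snd c ` (fst c \<inter> fst d)) \<and>
        smooth_on (snd c ` (fst c \<inter> fst d)) (snd d \<circ> chart_inv c))"

definition open_in :: "('a, 'e::euclidean_space) manifold \<Rightarrow> 'a set \<Rightarrow> bool" where
  "open_in M W \<longleftrightarrow> W \<subseteq> points M \<and> (\<forall>c\<in>M. open (snd c ` (W \<inter> fst c)))"

definition manifold_topology :: "('a, 'e::euclidean_space) manifold \<Rightarrow> 'a topology" where
  "manifold_topology M = topology (open_in M)"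

definition smooth_manifold :: "('a, 'e::euclidean_space) manifold \<Rightarrow> bool" where
  "smooth_manifold M \<longleftrightarrow> smooth_atlas M \<and> Hausdorff_space (manifold_topology M) \<and>
     second_countable (manifold_topology M)"

definition smooth_fun ::
    "('a, 'e::euclidean_space) manifold \<Rightarrow> 'a set \<Rightarrow> ('a \<Rightarrow> 'f::euclidean_space) \<Rightarrow> bool" where
  "smooth_fun M W h \<longleftrightarrow> (\<forall>c\<in>M. smooth_on (snd c ` (fst c \<inter> W)) (h \<circ> chart_inv c))"

text \<open>Tangent vectors are families of components, one for each chart, and \<open>0\<close> for charts not
  containing the base point.\<close>

type_synonym ('a, 'e) tangent = "('a, 'e) chart \<Rightarrow> 'e"

definition smooth_curve_at ::
    "('a, 'e::euclidean_space) manifold \<Rightarrow> 'a \<Rightarrow> (real \<Rightarrow> 'a) \<Rightarrow> bool" where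
  "smooth_curve_at M x \<gamma> \<longleftrightarrow> \<gamma> 0 = x \<and>
     (\<exists>c\<in>M. \<exists>\<epsilon>>0. \<gamma> ` {-\<epsilon><..<\<epsilon>} \<subseteq> fst c \<and> smooth_on {-\<epsilon><..<\<epsilon>} (snd c \<circ> \<gamma>))"

definition velocity ::
    "('a, 'e::euclidean_space) manifold \<Rightarrow> (real \<Rightarrow> 'a) \<Rightarrow> ('a, 'e) tangent" where
  "velocity M \<gamma> = (\<lambda>c. if c \<in> M \<and> \<gamma> 0 \<in> fst c
     then vector_derivative (snd c \<circ> \<gamma>) (at 0) else 0)"

text \<open>The tangent space at \<open>x\<close> of a submanifold \<open>K\<close>.\<close>

definition tangent_space_of ::
    "('a, 'e::euclidean_space) manifold \<Rightarrow> 'a set \<Rightarrow> 'a \<Rightarrow> ('a, 'e) tangent set" where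
  "tangent_space_of M K x = {velocity M \<gamma> | \<gamma>. smooth_curve_at M x \<gamma> \<and>
     (\<exists>\<epsilon>>0. \<gamma> ` {-\<epsilon><..<\<epsilon>} \<subseteq> K)}"

abbreviation tangent_space ::
    "('a, 'e::euclidean_space) manifold \<Rightarrow> 'a \<Rightarrow> ('a, 'e) tangent set" where
  "tangent_space M \<equiv> tangent_space_of M (points M)"

text \<open>The derivative of a vector-valued function along a tangent vector at \<open>x\<close>; it does not depend
  on the chart chosen.\<close>

definition deriv_along ::
    "('a, 'e::euclidean_space) manifold \<Rightarrow> ('a \<Rightarrow> 'f::euclidean_space) \<Rightarrow> 'a \<Rightarrow>
     ('a, 'e) tangent \<Rightarrow> 'f" where
  "deriv_along M h x v = (let c = (SOME c. c \<in> M \<and> x \<in> fst c) in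
     frechet_derivative (h \<circ> chart_inv c) (at (snd c x)) (v c))"

definition differential ::
    "('a, 'e::euclidean_space) manifold \<Rightarrow> ('b, 'f::euclidean_space) manifold \<Rightarrow> ('a \<Rightarrow> 'b) \<Rightarrow>
     'a \<Rightarrow> ('a, 'e) tangent \<Rightarrow> ('b, 'f) tangent" where
  "differential M N F x v = (\<lambda>d. if d \<in> N \<and> F x \<in> fst d
     then deriv_along M (snd d \<circ> F) x v else 0)"

definition smooth_field ::
    "('a, 'e::euclidean_space) manifold \<Rightarrow> 'a set \<Rightarrow> ('a \<Rightarrow> ('a, 'e) tangent) \<Rightarrow> bool" where
  "smooth_field M W X \<longleftrightarrow> (\<forall>x\<in>W. X x \<in> tangent_space M x) \<and>
     (\<forall>c\<in>M. smooth_on (snd c ` (fst c \<inter> W)) (\<lambda>z. X (chart_inv c z) c))"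


section \<open>Complex vector bundles\<close>

record ('a, 's, 'n::finite) vbundle =
  fibre :: "'a \<Rightarrow> 's set"
  trivs :: "('a set \<times> ('a \<Rightarrow> 's \<Rightarrow> complex ^ 'n)) set"

definition fibrewise_iso ::
    "'a set \<Rightarrow> ('a \<Rightarrow> 's::complex_vector set) \<Rightarrow> ('a \<Rightarrow> 's \<Rightarrow> complex ^ 'n) \<Rightarrow> bool" where
  "fibrewise_iso W E t \<longleftrightarrow> (\<forall>x\<in>W. bij_betw (t x) (E x) UNIV \<and>
     (\<forall>u\<in>E x. \<forall>v\<in>E x. \<forall>a b. t x (a *\<^sub>C u + b *\<^sub>C v) = a *s t x u + b *s t x v))"

definition vector_bundle ::
    "('a, 'e::euclidean_space) manifold \<Rightarrow> ('a, 's::complex_vector, 'n::finite, 'z) vbundle_scheme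
     \<Rightarrow> bool" where
  "vector_bundle M E \<longleftrightarrow>
     (\<forall>x\<in>points M. csubspace (fibre E x)) \<and>
     (\<forall>(W, t)\<in>trivs E. open_in M W \<and> fibrewise_iso W (fibre E) t) \<and>
     (\<forall>x\<in>points M. \<exists>(W, t)\<in>trivs E. x \<in> W) \<and>
     (\<forall>(W, t)\<in>trivs E. \<forall>(W', t')\<in>trivs E. \<forall>w.
        smooth_fun M (W \<inter> W') (\<lambda>x. t' x (inv_into (fibre E x) (t x) w)))"

definition smooth_section ::
    "('a, 'e::euclidean_space) manifold \<Rightarrow> ('a, 's::complex_vector, 'n::finite, 'z) vbundle_scheme
     \<Rightarrow> 'a set \<Rightarrow> ('a \<Rightarrow> 's) \<Rightarrow> bool" where
  "smooth_section M E W s \<longleftrightarrow> (\<forall>x\<in>W. s x \<in> fibre E x) \<and>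
     (\<forall>(W', t)\<in>trivs E. smooth_fun M (W \<inter> W') (\<lambda>x. t x (s x)))"

definition pullback_bundle ::
    "'b set \<Rightarrow> ('b \<Rightarrow> 'a) \<Rightarrow> ('a, 's, 'n::finite, 'z) vbundle_scheme \<Rightarrow> ('b, 's, 'n) vbundle" where
  "pullback_bundle X F E = \<lparr>fibre = (\<lambda>x. fibre E (F x)),
     trivs = {(F -` W \<inter> X, \<lambda>x. t (F x)) | W t. (W, t) \<in> trivs E}\<rparr>"

text \<open>The line bundle formed by lines \<open>L x\<close> in the fibres of \<open>E\<close>, with all local trivializations
  whose inverses are smooth into \<open>E\<close>.\<close>

definition line_subbundle ::
    "('a, 'e::euclidean_space) manifold \<Rightarrow> ('a, 's::complex_vector, 'n::finite, 'z) vbundle_scheme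
     \<Rightarrow> ('a \<Rightarrow> 's set) \<Rightarrow> ('a, 's, 1) vbundle" where
  "line_subbundle M E L = \<lparr>fibre = L,
     trivs = {(W, t). open_in M W \<and> fibrewise_iso W L t \<and>
       (\<forall>w. smooth_section M E W (\<lambda>x. inv_into (L x) (t x) w))}\<rparr>"

record ('a, 's, 'n::finite) hermitian_bundle = "('a, 's, 'n) vbundle" +
  bundle_metric :: "'a \<Rightarrow> 's \<Rightarrow> 's \<Rightarrow> complex"

definition hermitian_vector_bundle ::
    "('a, 'e::euclidean_space) manifold \<Rightarrow> ('a, 's::complex_vector, 'n::finite) hermitian_bundle
     \<Rightarrow> bool" where
  "hermitian_vector_bundle M E \<longleftrightarrow> vector_bundle M E \<and>
     (\<forall>x\<in>points M. hermitian_space CARD('n) (fibre E x) (bundle_metric E x)) \<and>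
     (\<forall>W s s'. open_in M W \<and> smooth_section M E W s \<and> smooth_section M E W s' \<longrightarrow>
        smooth_fun M W (\<lambda>x. bundle_metric E x (s x) (s' x)))"


section \<open>Poincare duality\<close>

definition fibre_orientation :: "(complex ^ 'n::finite) list set" where
  "fibre_orientation = complex_orientation (\<lambda>w. \<i> *s w) id UNIV UNIV"

definition zero_set :: "('a, 'e) manifold \<Rightarrow> ('a \<Rightarrow> 's::zero) \<Rightarrow> 'a set" where
  "zero_set N s = {x \<in> points N. s x = 0}"

definition transverse_to_zero ::
    "('a, 'e::euclidean_space) manifold \<Rightarrow> ('a, 's::complex_vector, 'n::finite, 'z) vbundle_scheme
     \<Rightarrow> ('a \<Rightarrow> 's) \<Rightarrow> bool" where
  "transverse_to_zero N E s \<longleftrightarrow> (\<forall>x\<in>zero_set N s. \<exists>(W, t)\<in>trivs E. x \<in> W \<and>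
     deriv_along N (\<lambda>z. t z (s z)) x ` tangent_space N x = UNIV)"

text \<open>An orientation of a manifold or submanifold assigns to each point the set of positively
  oriented bases of the tangent space.  For the zero set, the complement \<open>C\<close> of its tangent space
  is spanned by \<open>cs\<close>.\<close>

definition zero_set_orientation ::
    "('a, 'e::euclidean_space) manifold \<Rightarrow> ('a \<Rightarrow> ('a, 'e) tangent list set) \<Rightarrow>
     ('a, 's::complex_vector, 'n::finite, 'z) vbundle_scheme \<Rightarrow> ('a \<Rightarrow> 's) \<Rightarrow>
     'a \<Rightarrow> ('a, 'e) tangent list set" where
  "zero_set_orientation N oN E s x =
     {bs. basis_list bs (tangent_space_of N (zero_set N s) x) \<and>
       (\<exists>(W, t)\<in>trivs E. \<exists>cs. x \<in> W \<and> set cs \<subseteq> tangent_space N x \<and>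
          map (deriv_along N (\<lambda>z. t z (s z)) x) cs \<in> fibre_orientation \<and> bs @ cs \<in> oN x)}"

definition transverse_section_with_zeros ::
    "('a, 'e::euclidean_space) manifold \<Rightarrow> ('a \<Rightarrow> ('a, 'e) tangent list set) \<Rightarrow>
     ('a, 's::complex_vector, 'n::finite, 'z) vbundle_scheme \<Rightarrow> ('a \<Rightarrow> 's) \<Rightarrow>
     'a set \<Rightarrow> ('a \<Rightarrow> ('a, 'e) tangent list set) \<Rightarrow> bool" where
  "transverse_section_with_zeros N oN E s K oK \<longleftrightarrow>
     smooth_section N E (points N) s \<and> transverse_to_zero N E s \<and>
     zero_set N s = K \<and> (\<forall>x\<in>K. zero_set_orientation N oN E s x = oK x)"

text \<open>\<open>K\<close> is a codimension-two submanifold, being the zero set of a transverse section; its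
  compactness is not part of the notion, so that non-compact base manifolds are admitted.\<close>

definition poincare_dual ::
    "('a, 'e::euclidean_space) manifold \<Rightarrow> ('a \<Rightarrow> ('a, 'e) tangent list set) \<Rightarrow>
     ('a, 's::complex_vector, 1, 'z) vbundle_scheme \<Rightarrow>
     'a set \<Rightarrow> ('a \<Rightarrow> ('a, 'e) tangent list set) \<Rightarrow> bool" where
  "poincare_dual N oN E K oK \<longleftrightarrow> vector_bundle N E \<and>
     (\<exists>s. transverse_section_with_zeros N oN E s K oK)"


section \<open>Spin-c structures\<close>

text \<open>An isomorphic identification of the exterior square of \<open>S\<close> with \<open>K\<close> amounts to
  \<open>(\<phi>, \<chi>) \<mapsto> \<phi> \<and> \<chi>\<close>, an alternating bilinear map into \<open>K\<close>; the norm condition makes it nonzero.\<close>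

definition wedge_identification ::
    "'s::complex_vector set \<Rightarrow> ('s \<Rightarrow> 's \<Rightarrow> complex) \<Rightarrow> 'k::complex_vector set \<Rightarrow>
     ('k \<Rightarrow> 'k \<Rightarrow> complex) \<Rightarrow> ('s \<Rightarrow> 's \<Rightarrow> 'k) \<Rightarrow> bool" where
  "wedge_identification S h K k w \<longleftrightarrow>
     (\<forall>u\<in>S. \<forall>v\<in>S. w u v \<in> K \<and> w u v = - w v u) \<and>
     (\<forall>u\<in>S. \<forall>v\<in>S. \<forall>x\<in>S. \<forall>a b. w (a *\<^sub>C u + b *\<^sub>C v) x = a *\<^sub>C w u x + b *\<^sub>C w v x) \<and>
     (\<forall>u\<in>S. \<forall>v\<in>S. (hnorm k (w u v))\<^sup>2 = (hnorm h u)\<^sup>2 * (hnorm h v)\<^sup>2 - (cmod (h u v))\<^sup>2)"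

record ('s, 't, 'k) spinc4 =
  plane_plus :: "'s set"
  metric_plus :: "'s \<Rightarrow> 's \<Rightarrow> complex"
  plane_minus :: "'t set"
  metric_minus :: "'t \<Rightarrow> 't \<Rightarrow> complex"
  hermitian_line :: "'k set"
  metric_line :: "'k \<Rightarrow> 'k \<Rightarrow> complex"
  wedge_plus :: "'s \<Rightarrow> 's \<Rightarrow> 'k"
  wedge_minus :: "'t \<Rightarrow> 't \<Rightarrow> 'k"

definition spinc4_geometry ::
    "('s::complex_vector, 't::complex_vector, 'k::complex_vector) spinc4 \<Rightarrow> bool" where
  "spinc4_geometry G \<longleftrightarrow>
     hermitian_space 2 (plane_plus G) (metric_plus G) \<and>
     hermitian_space 2 (plane_minus G) (metric_minus G) \<and>
     hermitian_space 1 (hermitian_line G) (metric_line G) \<and>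
     wedge_identification (plane_plus G) (metric_plus G) (hermitian_line G) (metric_line G) (wedge_plus G) \<and>
     wedge_identification (plane_minus G) (metric_minus G) (hermitian_line G) (metric_line G) (wedge_minus G)"

definition spinc4_det ::
    "('s::complex_vector, 't::complex_vector, 'k::complex_vector) spinc4 \<Rightarrow> ('s \<Rightarrow> 't) \<Rightarrow> complex"
  where "spinc4_det G A = (THE d. \<forall>u\<in>plane_plus G. \<forall>v\<in>plane_plus G.
     wedge_minus G (A u) (A v) = d *\<^sub>C wedge_plus G u v)"

definition homothety ::
    "('s::complex_vector, 't::complex_vector, 'k::complex_vector) spinc4 \<Rightarrow> ('s \<Rightarrow> 't) \<Rightarrow>
     real \<Rightarrow> bool" where
  "homothety G A r \<longleftrightarrow> r \<ge> 0 \<and>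
     (\<forall>u\<in>plane_plus G. hnorm (metric_minus G) (A u) = r * hnorm (metric_plus G) u)"

definition homothety_norm ::
    "('s::complex_vector, 't::complex_vector, 'k::complex_vector) spinc4 \<Rightarrow> ('s \<Rightarrow> 't) \<Rightarrow> real"
  where "homothety_norm G A = (THE r. homothety G A r)"

definition spinc4_space ::
    "('s::complex_vector, 't::complex_vector, 'k::complex_vector) spinc4 \<Rightarrow> ('s \<Rightarrow> 't) set" where
  "spinc4_space G = {A \<in> complex_hom (plane_plus G) (plane_minus G).
     (\<exists>r. homothety G A r) \<and> spinc4_det G A \<in> complex_of_real ` {0..}}"

definition Psi ::
    "('s::complex_vector, 't::complex_vector, 'k::complex_vector) spinc4 \<Rightarrow> 's set \<Rightarrow> 't set \<Rightarrow>
     ('s \<Rightarrow> 't) list set" where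
  "Psi G L L' = {bs. basis_list bs {A \<in> spinc4_space G. A ` L \<subseteq> L'} \<and>
     map (\<lambda>A u. if u \<in> L then A u else 0) bs \<in>
       complex_orientation (\<lambda>B u. \<i> *\<^sub>C B u) id (complex_hom L L') (complex_hom L L')}"

text \<open>In a spin-c structure, \<open>clifford S y\<close> is the identification of the tangent space at \<open>y\<close> with
  the space \<open>\<V>\<^sub>y\<close> of homomorphisms, so that \<open>clifford S y v \<phi>\<close> is the Clifford product of \<open>v\<close> and \<open>\<phi>\<close>.\<close>

record ('a, 'e, 's, 't, 'k) spinc =
  sigma_plus :: "('a, 's, 2) hermitian_bundle"
  sigma_minus :: "('a, 't, 2) hermitian_bundle"
  kappa :: "('a, 'k, 1) hermitian_bundle"
  wedge_sigma_plus :: "'a \<Rightarrow> 's \<Rightarrow> 's \<Rightarrow> 'k"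
  wedge_sigma_minus :: "'a \<Rightarrow> 't \<Rightarrow> 't \<Rightarrow> 'k"
  clifford :: "'a \<Rightarrow> ('a, 'e) tangent \<Rightarrow> 's \<Rightarrow> 't"

definition geometry_at :: "('a, 'e, 's, 't, 'k) spinc \<Rightarrow> 'a \<Rightarrow> ('s, 't, 'k) spinc4" where
  "geometry_at S y = \<lparr>
     plane_plus = fibre (sigma_plus S) y, metric_plus = bundle_metric (sigma_plus S) y,
     plane_minus = fibre (sigma_minus S) y, metric_minus = bundle_metric (sigma_minus S) y,
     hermitian_line = fibre (kappa S) y, metric_line = bundle_metric (kappa S) y,
     wedge_plus = wedge_sigma_plus S y, wedge_minus = wedge_sigma_minus S y\<rparr>"

definition spinc_structure ::
    "('a, 'e::euclidean_space) manifold \<Rightarrow>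
     ('a, 'e, 's::complex_vector, 't::complex_vector, 'k::complex_vector) spinc \<Rightarrow> bool" where
  "spinc_structure M S \<longleftrightarrow>
     hermitian_vector_bundle M (sigma_plus S) \<and>
     hermitian_vector_bundle M (sigma_minus S) \<and>
     hermitian_vector_bundle M (kappa S) \<and>
     (\<forall>y\<in>points M. spinc4_geometry (geometry_at S y) \<and>
        bij_betw (clifford S y) (tangent_space M y) (spinc4_space (geometry_at S y)) \<and>
        clifford S y \<in> real_hom (tangent_space M y) (spinc4_space (geometry_at S y))) \<and>
     (\<forall>W s s'. open_in M W \<and> smooth_section M (sigma_plus S) W s \<and>
        smooth_section M (sigma_plus S) W s' \<longrightarrow>
        smooth_section M (kappa S) W (\<lambda>y. wedge_sigma_plus S y (s y) (s' y))) \<and>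
     (\<forall>W s s'. open_in M W \<and> smooth_section M (sigma_minus S) W s \<and>
        smooth_section M (sigma_minus S) W s' \<longrightarrow>
        smooth_section M (kappa S) W (\<lambda>y. wedge_sigma_minus S y (s y) (s' y))) \<and>
     (\<forall>W X s. open_in M W \<and> smooth_field M W X \<and> smooth_section M (sigma_plus S) W s \<longrightarrow>
        smooth_section M (sigma_minus S) W (\<lambda>y. clifford S y (X y) (s y)))"


section \<open>Almost Hermitian structures\<close>

definition almost_hermitian ::
    "('a, 'e::euclidean_space) manifold \<Rightarrow> ('a \<Rightarrow> ('a, 'e) tangent \<Rightarrow> ('a, 'e) tangent) \<Rightarrow>
     ('a \<Rightarrow> ('a, 'e) tangent \<Rightarrow> ('a, 'e) tangent \<Rightarrow> real) \<Rightarrow> bool" where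
  "almost_hermitian M J g \<longleftrightarrow>
     (\<forall>y\<in>points M. J y \<in> real_hom (tangent_space M y) (tangent_space M y) \<and>
        (\<forall>v\<in>tangent_space M y. J y (J y v) = - v) \<and>
        (\<forall>u\<in>tangent_space M y. \<forall>v\<in>tangent_space M y. \<forall>w\<in>tangent_space M y. \<forall>a b.
           g y (a *\<^sub>R u + b *\<^sub>R v) w = a * g y u w + b * g y v w) \<and>
        (\<forall>u\<in>tangent_space M y. \<forall>v\<in>tangent_space M y.
           g y u v = g y v u \<and> g y (J y u) (J y v) = g y u v) \<and>
        (\<forall>u\<in>tangent_space M y. u \<noteq> 0 \<longrightarrow> g y u u > 0)) \<and>
     (\<forall>W X. open_in M W \<and> smooth_field M W X \<longrightarrow> smooth_field M W (\<lambda>y. J y (X y))) \<and>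
     (\<forall>W X Y. open_in M W \<and> smooth_field M W X \<and> smooth_field M W Y \<longrightarrow>
        smooth_fun M W (\<lambda>y. g y (X y) (Y y)))"

definition unit_section ::
    "('a, 'e::euclidean_space) manifold \<Rightarrow> ('a, 's::complex_vector, 'n::finite) hermitian_bundle
     \<Rightarrow> ('a \<Rightarrow> 's) \<Rightarrow> bool" where
  "unit_section M E \<psi> \<longleftrightarrow> smooth_section M E (points M) \<psi> \<and>
     (\<forall>y\<in>points M. hnorm (bundle_metric E y) (\<psi> y) = 1)"

text \<open>The natural bijective correspondence between almost Hermitian structures and spin-c structures
  with a unit section of the positive spinor bundle.\<close>

definition corresponds ::
    "('a, 'e::euclidean_space) manifold \<Rightarrow> ('a \<Rightarrow> ('a, 'e) tangent \<Rightarrow> ('a, 'e) tangent) \<Rightarrow>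
     ('a \<Rightarrow> ('a, 'e) tangent \<Rightarrow> ('a, 'e) tangent \<Rightarrow> real) \<Rightarrow>
     ('a, 'e, 's::complex_vector, 't::complex_vector, 'k::complex_vector) spinc \<Rightarrow>
     ('a \<Rightarrow> 's) \<Rightarrow> bool" where
  "corresponds M J g S \<psi> \<longleftrightarrow> (\<forall>y\<in>points M. \<forall>v\<in>tangent_space M y.
     clifford S y (J y v) (\<psi> y) = \<i> *\<^sub>C clifford S y v (\<psi> y) \<and>
     g y v v = (homothety_norm (geometry_at S y) (clifford S y v))\<^sup>2)"

definition almost_complex_orientation ::
    "('a, 'e::euclidean_space) manifold \<Rightarrow> ('a \<Rightarrow> ('a, 'e) tangent \<Rightarrow> ('a, 'e) tangent) \<Rightarrow>
     'a \<Rightarrow> ('a, 'e) tangent list set" where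
  "almost_complex_orientation M J y =
     complex_orientation (J y) id (tangent_space M y) (tangent_space M y)"


section \<open>The bundle of oriented tangent planes\<close>

text \<open>The points of the total space are pairs \<open>(y, T)\<close> with \<open>T\<close> an oriented plane in the tangent
  space at \<open>y\<close>.  A basis \<open>B\<close> of the model space of a chart \<open>c\<close> of \<open>M\<close> gives rise to a chart of the total
  space: its domain consists of those planes which, in the components relative to \<open>c\<close>, are projected
  isomorphically and preserving orientation onto the plane with the basis \<open>(B\<^sub>0, B\<^sub>1)\<close>, along the plane
  spanned by \<open>B\<^sub>2, B\<^sub>3\<close>.\<close>

type_synonym 'a plane_point = "'a \<times> ('a, real ^ 4) tangent list set"

definition graph_plane :: "(real ^ 4) list \<Rightarrow> real ^ 4 \<Rightarrow> (real ^ 4) list set" where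
  "graph_plane B q = orient_class
     [B ! 0 + (q $ 1) *\<^sub>R (B ! 2) + (q $ 2) *\<^sub>R (B ! 3),
      B ! 1 + (q $ 3) *\<^sub>R (B ! 2) + (q $ 4) *\<^sub>R (B ! 3)]"

definition plane_components ::
    "('a, real ^ 4) chart \<Rightarrow> ('a, real ^ 4) tangent list set \<Rightarrow> (real ^ 4) list set" where
  "plane_components c T = map (\<lambda>v. v c) ` T"

definition plane_chart ::
    "('a, real ^ 4) manifold \<Rightarrow> ('a, real ^ 4) chart \<Rightarrow> (real ^ 4) list \<Rightarrow>
     ('a plane_point, (real ^ 4) \<times> (real ^ 4)) chart" where
  "plane_chart M c B =
     ({(y, T). y \<in> fst c \<and> T \<in> oriented_planes (tangent_space M y) \<and>
        (\<exists>q. plane_components c T = graph_plane B q)},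
      \<lambda>(y, T). (snd c y, THE q. plane_components c T = graph_plane B q))"

definition plane_bundle ::
    "('a, real ^ 4) manifold \<Rightarrow> ('a plane_point, (real ^ 4) \<times> (real ^ 4)) manifold" where
  "plane_bundle M = {plane_chart M c B | c B. c \<in> M \<and> basis_list B UNIV}"

text \<open>Direct-sum orientation of the total space \<open>K\<close> (a submanifold of the bundle of oriented planes)
  of a bundle over \<open>M\<close>: an oriented base \<open>hs\<close> followed by an oriented fibre \<open>vs\<close>.\<close>

definition bundle_orientation ::
    "('a, real ^ 4) manifold \<Rightarrow> 'a plane_point set \<Rightarrow>
     ('a \<Rightarrow> ('a, real ^ 4) tangent list set) \<Rightarrow>
     ('a plane_point \<Rightarrow> ('a plane_point, (real ^ 4) \<times> (real ^ 4)) tangent list set) \<Rightarrow>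
     'a plane_point \<Rightarrow> ('a plane_point, (real ^ 4) \<times> (real ^ 4)) tangent list set" where
  "bundle_orientation M K oM oF x =
     {bs. \<exists>hs vs. set hs \<subseteq> tangent_space_of (plane_bundle M) K x \<and>
        map (differential (plane_bundle M) M fst x) hs \<in> oM (fst x) \<and>
        vs \<in> oF x \<and> bs \<in> orient_class (hs @ vs)}"

definition vertical_space ::
    "('a, real ^ 4) manifold \<Rightarrow> 'a plane_point set \<Rightarrow> 'a plane_point \<Rightarrow>
     ('a plane_point, (real ^ 4) \<times> (real ^ 4)) tangent set" where
  "vertical_space M K x = tangent_space_of (plane_bundle M) {z \<in> K. fst z = fst x} x"

text \<open>\<open>rotation\<close> is the positive rotation by \<open>\<pi>/2\<close> in the oriented Euclidean plane \<open>T\<close>.\<close>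

definition rotation ::
    "('v::real_vector \<Rightarrow> 'v \<Rightarrow> real) \<Rightarrow> 'v list set \<Rightarrow> 'v \<Rightarrow> 'v" where
  "rotation g T u = (if u = 0 then 0 else (THE w. [u, w] \<in> T \<and> g u w = 0 \<and> g w w = g u u))"

text \<open>\<open>Hom(T, W/T)\<close>, for \<open>W\<close> the tangent space at \<open>y\<close>, is identified with the vertical space as usual:
  the class of a lift \<open>A \<in> Hom(T, W)\<close> corresponds to the velocity of \<open>t \<mapsto> (id + tA)T\<close>, which depends
  only on \<open>A\<close> modulo \<open>T\<close>.\<close>

definition plane_fibre_orientation ::
    "('a, real ^ 4) manifold \<Rightarrow> ('a \<Rightarrow> ('a, real ^ 4) tangent \<Rightarrow> ('a, real ^ 4) tangent \<Rightarrow> real) \<Rightarrow>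
     'a plane_point \<Rightarrow> ('a plane_point, (real ^ 4) \<times> (real ^ 4)) tangent list set" where
  "plane_fibre_orientation M g x = (case x of (y, T) \<Rightarrow>
     complex_orientation (\<lambda>A. A \<circ> rotation (g y) T)
       (\<lambda>A. velocity (plane_bundle M) (\<lambda>t. (y, map (\<lambda>u. u + t *\<^sub>R A u) ` T)))
       (real_hom (underlying T) (tangent_space M y))
       (vertical_space M (points (plane_bundle M)) x))"

definition plane_bundle_orientation ::
    "('a, real ^ 4) manifold \<Rightarrow> ('a \<Rightarrow> ('a, real ^ 4) tangent \<Rightarrow> ('a, real ^ 4) tangent) \<Rightarrow>
     ('a \<Rightarrow> ('a, real ^ 4) tangent \<Rightarrow> ('a, real ^ 4) tangent \<Rightarrow> real) \<Rightarrow>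
     'a plane_point \<Rightarrow> ('a plane_point, (real ^ 4) \<times> (real ^ 4)) tangent list set" where
  "plane_bundle_orientation M J g = bundle_orientation M (points (plane_bundle M))
     (almost_complex_orientation M J) (plane_fibre_orientation M g)"

definition lambda_fibre ::
    "('a, real ^ 4, 's::complex_vector, 't::complex_vector, 'k::complex_vector) spinc \<Rightarrow>
     'a plane_point \<Rightarrow> 's set" where
  "lambda_fibre S x = (case x of (y, T) \<Rightarrow>
     (THE L. L \<in> complex_lines (fibre (sigma_plus S) y) \<and>
        (\<exists>L'\<in>complex_lines (fibre (sigma_minus S) y).
           map (clifford S y) ` T = Psi (geometry_at S y) L L')))"

definition mu_fibre ::
    "('a, real ^ 4, 's::complex_vector, 't::complex_vector, 'k::complex_vector) spinc \<Rightarrow>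
     'a plane_point \<Rightarrow> 's set" where
  "mu_fibre S x = {u \<in> fibre (sigma_plus S) (fst x).
     \<forall>v\<in>lambda_fibre S x. bundle_metric (sigma_plus S) (fst x) u v = 0}"

definition spinor_pullback ::
    "('a, real ^ 4) manifold \<Rightarrow>
     ('a, real ^ 4, 's::complex_vector, 't::complex_vector, 'k::complex_vector) spinc \<Rightarrow>
     ('a plane_point, 's, 2) vbundle" where
  "spinor_pullback M S = pullback_bundle (points (plane_bundle M)) fst (sigma_plus S)"

definition lambda_plus ::
    "('a, real ^ 4) manifold \<Rightarrow>
     ('a, real ^ 4, 's::complex_vector, 't::complex_vector, 'k::complex_vector) spinc \<Rightarrow>
     ('a plane_point, 's, 1) vbundle" where
  "lambda_plus M S = line_subbundle (plane_bundle M) (spinor_pullback M S) (lambda_fibre S)"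

definition mu_plus ::
    "('a, real ^ 4) manifold \<Rightarrow>
     ('a, real ^ 4, 's::complex_vector, 't::complex_vector, 'k::complex_vector) spinc \<Rightarrow>
     ('a plane_point, 's, 1) vbundle" where
  "mu_plus M S = line_subbundle (plane_bundle M) (spinor_pullback M S) (mu_fibre S)"

text \<open>The component in \<open>L\<close> of \<open>u \<in> L \<oplus> L'\<close>.\<close>

definition component :: "'s::complex_vector set \<Rightarrow> 's set \<Rightarrow> 's \<Rightarrow> 's" where
  "component L L' u = (THE v. v \<in> L \<and> u - v \<in> L')"

definition lambda_component ::
    "('a, real ^ 4, 's::complex_vector, 't::complex_vector, 'k::complex_vector) spinc \<Rightarrow>
     ('a \<Rightarrow> 's) \<Rightarrow> 'a plane_point \<Rightarrow> 's" where
  "lambda_component S \<psi> x = component (lambda_fibre S x) (mu_fibre S x) (\<psi> (fst x))"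

definition mu_component ::
    "('a, real ^ 4, 's::complex_vector, 't::complex_vector, 'k::complex_vector) spinc \<Rightarrow>
     ('a \<Rightarrow> 's) \<Rightarrow> 'a plane_point \<Rightarrow> 's" where
  "mu_component S \<psi> x = component (mu_fibre S x) (lambda_fibre S x) (\<psi> (fst x))"


section \<open>The submanifolds of complex lines\<close>

text \<open>The \<open>J\<close>-complex lines in a real vector space \<open>W\<close>, and such a line as an oriented plane.\<close>

definition J_lines :: "('v::real_vector \<Rightarrow> 'v) \<Rightarrow> 'v set \<Rightarrow> 'v set set" where
  "J_lines J W = {span {u, J u} | u. u \<in> W \<and> u \<noteq> 0}"

definition oriented_line :: "('v::real_vector \<Rightarrow> 'v) \<Rightarrow> 'v set \<Rightarrow> 'v list set" where
  "oriented_line J l = complex_orientation J id l l"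

definition J_hom :: "('v::real_vector \<Rightarrow> 'v) \<Rightarrow> 'v set \<Rightarrow> 'v set \<Rightarrow> ('v \<Rightarrow> 'v) set" where
  "J_hom J l W = {A \<in> real_hom l W. \<forall>u\<in>l. A (J u) = J (A u)}"

text \<open>The submanifold \<open>Q\<close> is obtained for \<open>f = id\<close>, and \<open>Qbar\<close> for \<open>f = opposite\<close>.\<close>

definition line_planes ::
    "('a, real ^ 4) manifold \<Rightarrow> ('a \<Rightarrow> ('a, real ^ 4) tangent \<Rightarrow> ('a, real ^ 4) tangent) \<Rightarrow>
     (('a, real ^ 4) tangent list set \<Rightarrow> ('a, real ^ 4) tangent list set) \<Rightarrow>
     'a plane_point set" where
  "line_planes M J f = {(y, f (oriented_line (J y) l)) | y l.
     y \<in> points M \<and> l \<in> J_lines (J y) (tangent_space M y)}"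

text \<open>The fibre has the orientation opposite to that of the projective line of all \<open>J\<close>-complex lines
  \<open>l\<close> in the tangent space \<open>W\<close>.  The tangent space of the latter is the space of \<open>J\<close>-linear
  homomorphisms from \<open>l\<close> to \<open>W/l\<close>; again these are represented by lifts \<open>A\<close>, and \<open>A\<close> corresponds to
  the velocity of \<open>t \<mapsto> (id + tA)l\<close>.\<close>

definition line_fibre_orientation ::
    "('a, real ^ 4) manifold \<Rightarrow> ('a \<Rightarrow> ('a, real ^ 4) tangent \<Rightarrow> ('a, real ^ 4) tangent) \<Rightarrow>
     (('a, real ^ 4) tangent list set \<Rightarrow> ('a, real ^ 4) tangent list set) \<Rightarrow>
     'a plane_point \<Rightarrow> ('a plane_point, (real ^ 4) \<times> (real ^ 4)) tangent list set" where
  "line_fibre_orientation M J f x = (case x of (y, T) \<Rightarrow>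
     opposite (complex_orientation (\<lambda>A. J y \<circ> A)
       (\<lambda>A. velocity (plane_bundle M)
          (\<lambda>t. (y, f (oriented_line (J y) ((\<lambda>u. u + t *\<^sub>R A u) ` underlying T)))))
       (J_hom (J y) (underlying T) (tangent_space M y))
       (vertical_space M (line_planes M J f) x)))"

definition line_planes_orientation ::
    "('a, real ^ 4) manifold \<Rightarrow> ('a \<Rightarrow> ('a, real ^ 4) tangent \<Rightarrow> ('a, real ^ 4) tangent) \<Rightarrow>
     (('a, real ^ 4) tangent list set \<Rightarrow> ('a, real ^ 4) tangent list set) \<Rightarrow>
     'a plane_point \<Rightarrow> ('a plane_point, (real ^ 4) \<times> (real ^ 4)) tangent list set" where
  "line_planes_orientation M J f = bundle_orientation M (line_planes M J f)
     (almost_complex_orientation M J) (line_fibre_orientation M J f)"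

definition Q_set ::
    "('a, real ^ 4) manifold \<Rightarrow> ('a \<Rightarrow> ('a, real ^ 4) tangent \<Rightarrow> ('a, real ^ 4) tangent) \<Rightarrow>
     'a plane_point set" where
  "Q_set M J = line_planes M J id"

definition Q_orientation ::
    "('a, real ^ 4) manifold \<Rightarrow> ('a \<Rightarrow> ('a, real ^ 4) tangent \<Rightarrow> ('a, real ^ 4) tangent) \<Rightarrow>
     'a plane_point \<Rightarrow> ('a plane_point, (real ^ 4) \<times> (real ^ 4)) tangent list set" where
  "Q_orientation M J = line_planes_orientation M J id"

definition Qbar_set ::
    "('a, real ^ 4) manifold \<Rightarrow> ('a \<Rightarrow> ('a, real ^ 4) tangent \<Rightarrow> ('a, real ^ 4) tangent) \<Rightarrow>
     'a plane_point set" where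
  "Qbar_set M J = line_planes M J opposite"

definition Qbar_orientation ::
    "('a, real ^ 4) manifold \<Rightarrow> ('a \<Rightarrow> ('a, real ^ 4) tangent \<Rightarrow> ('a, real ^ 4) tangent) \<Rightarrow>
     'a plane_point \<Rightarrow> ('a plane_point, (real ^ 4) \<times> (real ^ 4)) tangent list set" where
  "Qbar_orientation M J = line_planes_orientation M J opposite"

end

theory Submission
  imports Defs
begin

text \<open>
  Complete \<open>\<psi>\<close> locally to a unitary frame \<open>(\<psi>, \<xi>)\<close> of \<open>\<sigma>\<^sup>+\<close>, and for tangent vectors \<open>u, v\<close> put
  \<open>\<omega>(u, v) = g(J u, v)\<close> and \<open>\<beta>(u, v) = \<langle>v \<psi>, u \<xi>\<rangle>\<close>; the form \<open>\<beta>\<close> is alternating and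
  \<open>J\<close>-complex bilinear.  The adjoint of Clifford multiplication by \<open>u\<close>, composed with that by \<open>v\<close>,
  has a trace-free part whose matrix in the frame is made of \<open>\<omega>\<close> and \<open>\<beta>\<close>, and \<open>\<lambda>\<^sup>+\<close>, \<open>\<mu>\<^sup>+\<close>
  at the plane oriented by \<open>(u, v)\<close> are its two eigenlines, labelled by \<open>\<eta> = 1\<close> and \<open>\<eta> = -1\<close>.
  Hence the \<open>\<xi>\<close>-coefficient of the \<open>\<eta>\<close>-component of \<open>\<psi>\<close> is
  \<open>- i \<eta> \<beta>(u, v) / (2 \<surd>(\<omega>\<^sup>2 + |\<beta>|\<^sup>2))\<close>, and the component vanishes precisely on
  the planes oriented by \<open>(u, \<epsilon> J u)\<close> with \<open>\<epsilon> = - \<eta>\<close>.  At such a plane choose \<open>w\<close> outside it.  To first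
  order \<open>\<beta>\<close> on the nearby plane spanned by \<open>u + q\<^sub>1 w + q\<^sub>2 J w\<close> and \<open>\<epsilon> J u + q\<^sub>3 w + q\<^sub>4 J w\<close>
  equals \<open>\<beta>(u, w) ((q\<^sub>3 + \<epsilon> q\<^sub>2) + i (q\<^sub>4 - \<epsilon> q\<^sub>1))\<close>, where \<open>\<beta>(u, w)\<close> is nonzero.  This gives
  transversality in the fibre directions, the tangent spaces of the zero sets and, by a comparison of
  \<open>4 \<times> 4\<close> determinants, the orientations.
\<close>

section \<open>Smooth maps\<close>

no_notation Matrix.scalar_prod (infix "\<bullet>" 70)

text \<open>A plane is \<open>Psi\<close> of lines \<open>L\<close>, \<open>L'\<close> when Clifford
  multiplication by its vectors maps \<open>L\<close> into \<open>L'\<close>; then on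
  \<open>L\<close> the vector \<open>v\<close> acts as a complex multiple z of \<open>u\<close>, and
  the orientation says Im z > 0. This is why \<open>L\<close> is an eigenline and why \<lambda> gets
  \<eta> = 1. Transversality refers to trivializations of the line bundle, whereas the section is
  known as a spinor. The link is the \<eta>-component of \<xi>, which does not vanish near a zero:
  the section is it times a nonvanishing smooth factor times \<beta>. In any trivialization the
  derivative at the zero is therefore that of \<beta> up to a nonzero complex factor, which changes
  neither kernel nor orientation. Fibre directions already give surjectivity, so base vectors lift
  into the kernel and only fibres are compared. Two signs meet there: the complex orientation of the
  Grassmannian is the negative one in the coordinates q, and the fibres of Q and Qbar are reversed
  by definition. They cancel for both values of \<epsilon>.\<close>

lemma Ck_on_cong:
  assumes "open S" "\<And>x. x \<in> S \<Longrightarrow> f x = h x" "Ck_on k f S"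
  shows "Ck_on k h S"
  using assms(2,3)
proof (induction k arbitrary: f h)
  case 0 then show ?case using continuous_on_cong[of S S f h] by simp
next
  case (Suc k)
  have d: "(h has_derivative frechet_derivative f (at x)) (at x)" if "x \<in> S" for x
  proof -
    have "(f has_derivative frechet_derivative f (at x)) (at x)"
      using Suc.prems that frechet_derivative_works by auto
    then show ?thesis
      by (rule has_derivative_transform_within_open[OF _ \<open>open S\<close> that]) (use Suc.prems in auto)
  qed
  have e: "frechet_derivative h (at x) = frechet_derivative f (at x)" if "x \<in> S" for x
    using d[OF that] frechet_derivative_at by metis
  have "Ck_on k (\<lambda>x. frechet_derivative h (at x) v) S" for v
    by (rule Suc.IH[of "\<lambda>x. frechet_derivative f (at x) v"]) (use e Suc.prems in auto)
  then show ?case using d by (auto simp: differentiable_def)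
qed

lemma Ck_on_subset: "Ck_on k f S \<Longrightarrow> T \<subseteq> S \<Longrightarrow> Ck_on k f T"
proof (induction k arbitrary: f)
  case 0 then show ?case by (simp add: continuous_on_subset)
next
  case (Suc k)
  have "Ck_on k (\<lambda>x. frechet_derivative f (at x) v) T" for v
    by (rule Suc.IH) (use Suc.prems in simp_all)
  then show ?case using Suc.prems by (simp add: subset_eq)
qed

lemma Ck_on_SucI:
  assumes "open S" "\<And>x. x \<in> S \<Longrightarrow> (f has_derivative D x) (at x)" "\<And>v. Ck_on k (\<lambda>x. D x v) S"
  shows "Ck_on (Suc k) f S"
proof -
  have e: "D x = frechet_derivative f (at x)" if "x \<in> S" for x
    using frechet_derivative_at[OF assms(2)[OF that]] by simp
  have "Ck_on k (\<lambda>x. frechet_derivative f (at x) v) S" for v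
    by (rule Ck_on_cong[OF assms(1) _ assms(3)]) (simp add: e)
  then show ?thesis using assms(2) by (auto simp: differentiable_def)
qed

lemma Ck_on_derivative:
  "Ck_on (Suc k) f S \<Longrightarrow> x \<in> S \<Longrightarrow> (f has_derivative frechet_derivative f (at x)) (at x)"
  using frechet_derivative_works by auto

lemma Ck_on_Suc_imp: "Ck_on (Suc k) f S \<Longrightarrow> Ck_on k f S"
proof (induction k arbitrary: f)
  case 0
  then have "f differentiable_on S"
    by (auto simp: differentiable_on_def intro: differentiable_at_withinI)
  then show ?case by (simp add: differentiable_imp_continuous_on)
next
  case (Suc k)
  then show ?case by auto
qed

lemma Ck_on_const: "Ck_on k (\<lambda>x. c) S"
  by (induction k arbitrary: c) auto

lemma Ck_on_bounded_linear:
  assumes "open S" "bounded_linear L" "Ck_on k f S"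
  shows "Ck_on k (\<lambda>x. L (f x)) S"
  using assms(3)
proof (induction k arbitrary: f)
  case 0 then show ?case using assms(2) by (simp add: bounded_linear.continuous_on)
next
  case (Suc k)
  show ?case
  proof (rule Ck_on_SucI[OF assms(1)])
    fix x assume "x \<in> S"
    show "((\<lambda>x. L (f x)) has_derivative (\<lambda>v. L (frechet_derivative f (at x) v))) (at x)"
      by (rule bounded_linear.has_derivative[OF assms(2) Ck_on_derivative[OF Suc.prems \<open>x \<in> S\<close>]])
  qed (use Suc in auto)
qed

lemma Ck_on_add:
  assumes "open S" "Ck_on k f S" "Ck_on k h S"
  shows "Ck_on k (\<lambda>x. f x + h x) S"
  using assms(2,3)
proof (induction k arbitrary: f h)
  case 0 then show ?case by (auto intro: continuous_intros)
next
  case (Suc k)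
  show ?case
  proof (rule Ck_on_SucI[OF assms(1)])
    fix x assume "x \<in> S"
    show "((\<lambda>x. f x + h x) has_derivative (\<lambda>v. frechet_derivative f (at x) v + frechet_derivative h (at x) v)) (at x)"
      by (intro has_derivative_add Ck_on_derivative[OF Suc.prems(1) \<open>x \<in> S\<close>] Ck_on_derivative[OF Suc.prems(2) \<open>x \<in> S\<close>])
  qed (use Suc in auto)
qed

lemma Ck_on_sum:
  assumes "open S" "\<And>i. i \<in> I \<Longrightarrow> Ck_on k (f i) S"
  shows "Ck_on k (\<lambda>x. \<Sum>i\<in>I. f i x) S"
  using assms by (induction I rule: infinite_finite_induct) (auto intro: Ck_on_add Ck_on_const)

lemma Ck_on_bilinear:
  assumes "open S" "bounded_bilinear b" "Ck_on k f S" "Ck_on k h S"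
  shows "Ck_on k (\<lambda>x. b (f x) (h x)) S"
  using assms(3,4)
proof (induction k arbitrary: f h)
  case 0 then show ?case using assms(2) by (simp add: bounded_bilinear.continuous_on)
next
  case (Suc k)
  show ?case
  proof (rule Ck_on_SucI[OF assms(1)])
    fix x assume "x \<in> S"
    show "((\<lambda>x. b (f x) (h x)) has_derivative
      (\<lambda>v. b (f x) (frechet_derivative h (at x) v) + b (frechet_derivative f (at x) v) (h x))) (at x)"
      by (intro bounded_bilinear.FDERIV[OF assms(2)] Ck_on_derivative[OF Suc.prems(1) \<open>x \<in> S\<close>] Ck_on_derivative[OF Suc.prems(2) \<open>x \<in> S\<close>])
  next
    fix v
    show "Ck_on k (\<lambda>x. b (f x) (frechet_derivative h (at x) v) + b (frechet_derivative f (at x) v) (h x)) S"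
      using Suc.prems by (intro Ck_on_add[OF assms(1)] Suc.IH Ck_on_Suc_imp[of k f] Ck_on_Suc_imp[of k h]) auto
  qed
qed

text \<open>\<open>Ck_on\<close> controls derivatives in fixed directions only. Expanding in the
  basis handles a direction that varies with the point, as the chain rule produces.\<close>

lemma frechet_derivative_basis:
  fixes f :: "'e::euclidean_space \<Rightarrow> 'f::euclidean_space"
  assumes "f differentiable (at x)"
  shows "frechet_derivative f (at x) v = (\<Sum>b\<in>Basis. (v \<bullet> b) *\<^sub>R frechet_derivative f (at x) b)"
proof -
  have l: "linear (frechet_derivative f (at x))"
    using assms linear_frechet_derivative by blast
  have "frechet_derivative f (at x) v = frechet_derivative f (at x) (\<Sum>b\<in>Basis. (v \<bullet> b) *\<^sub>R b)"
    by (simp add: euclidean_representation)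
  also have "\<dots> = (\<Sum>b\<in>Basis. (v \<bullet> b) *\<^sub>R frechet_derivative f (at x) b)"
    by (simp add: linear_sum[OF l] linear_cmul[OF l])
  finally show ?thesis .
qed

lemma Ck_on_compose:
  fixes f :: "'e::euclidean_space \<Rightarrow> 'f::euclidean_space" and h :: "'d::euclidean_space \<Rightarrow> 'e"
  assumes "open S" "open T" "Ck_on k f T" "Ck_on k h S" "h ` S \<subseteq> T"
  shows "Ck_on k (\<lambda>x. f (h x)) S"
  using assms(3,4)
proof (induction k arbitrary: f)
  case 0
  then show ?case using continuous_on_compose2[of T f S h] assms(5) by auto
next
  case (Suc k)
  have fd: "f differentiable (at (h x))" if "x \<in> S" for x
    using Suc.prems assms(5) that by auto
  show ?case
  proof (rule Ck_on_SucI[OF assms(1)])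
    fix x assume "x \<in> S"
    have "(f has_derivative frechet_derivative f (at (h x))) (at (h x))"
      using fd[OF \<open>x \<in> S\<close>] frechet_derivative_works by blast
    from has_derivative_compose[OF Ck_on_derivative[OF Suc.prems(2) \<open>x \<in> S\<close>] this]
    show "((\<lambda>x. f (h x)) has_derivative
        (\<lambda>v. \<Sum>b\<in>Basis. (frechet_derivative h (at x) v \<bullet> b) *\<^sub>R frechet_derivative f (at (h x)) b)) (at x)"
      by (rule has_derivative_eq_rhs) (rule ext, rule frechet_derivative_basis[OF fd[OF \<open>x \<in> S\<close>]])
  next
    fix v
    have "Ck_on k (\<lambda>x. frechet_derivative f (at (h x)) b) S" for b
      using Suc.IH[of "\<lambda>y. frechet_derivative f (at y) b", OF _ Ck_on_Suc_imp[OF Suc.prems(2)]] Suc.prems(1) by simp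
    moreover have "Ck_on k (\<lambda>x. frechet_derivative h (at x) v \<bullet> b) S" for b
      using Suc.prems by (simp add: Ck_on_bounded_linear[OF assms(1) bounded_linear_inner_left])
    ultimately show "Ck_on k (\<lambda>x. \<Sum>b\<in>Basis. (frechet_derivative h (at x) v \<bullet> b) *\<^sub>R frechet_derivative f (at (h x)) b) S"
      by (intro Ck_on_sum[OF assms(1)] Ck_on_bilinear[OF assms(1) bounded_bilinear_scaleR])
  qed
qed

text \<open>The derivative of the inverse is a polynomial in the inverse and the derivative of
  \<open>f\<close>, so the induction hypothesis about the inverse itself, one order lower, closes
  the step. The square root below follows the same pattern.\<close>

lemma Ck_on_inverse:
  fixes f :: "'e::euclidean_space \<Rightarrow> 'f::{euclidean_space,real_normed_field}"
  assumes "open S" "Ck_on k f S" "\<And>x. x \<in> S \<Longrightarrow> f x \<noteq> 0"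
  shows "Ck_on k (\<lambda>x. inverse (f x)) S"
  using assms(2)
proof (induction k)
  case 0 then show ?case using assms(3) by (auto intro!: continuous_intros)
next
  case (Suc k)
  note IH = Suc.IH[OF Ck_on_Suc_imp[OF Suc.prems]]
  show ?case
  proof (rule Ck_on_SucI[OF assms(1)])
    fix x assume "x \<in> S"
    show "((\<lambda>x. inverse (f x)) has_derivative
        (\<lambda>v. - (inverse (f x) * frechet_derivative f (at x) v * inverse (f x)))) (at x)"
      by (rule Deriv.has_derivative_inverse[OF assms(3)[OF \<open>x \<in> S\<close>] Ck_on_derivative[OF Suc.prems \<open>x \<in> S\<close>]])
  next
    fix v
    show "Ck_on k (\<lambda>x. - (inverse (f x) * frechet_derivative f (at x) v * inverse (f x))) S"
      using Suc.prems IH by (intro Ck_on_bounded_linear[OF assms(1) bounded_linear_minus[OF bounded_linear_ident]]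
        Ck_on_bilinear[OF assms(1) bounded_bilinear_mult]) auto
  qed
qed

lemma Ck_on_sqrt:
  fixes f :: "'e::euclidean_space \<Rightarrow> real"
  assumes "open S" "Ck_on k f S" "\<And>x. x \<in> S \<Longrightarrow> f x > 0"
  shows "Ck_on k (\<lambda>x. sqrt (f x)) S"
  using assms(2)
proof (induction k)
  case 0 then show ?case by (auto intro!: continuous_intros)
next
  case (Suc k)
  note IH = Suc.IH[OF Ck_on_Suc_imp[OF Suc.prems]]
  show ?case
  proof (rule Ck_on_SucI[OF assms(1)])
    fix x assume "x \<in> S"
    show "((\<lambda>x. sqrt (f x)) has_derivative
        (\<lambda>v. (inverse (sqrt (f x)) * frechet_derivative f (at x) v) / 2)) (at x)"
      using Ck_on_derivative[OF Suc.prems \<open>x \<in> S\<close>] assms(3)[OF \<open>x \<in> S\<close>]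
      by (auto intro!: derivative_eq_intros simp: field_simps)
  next
    fix v
    show "Ck_on k (\<lambda>x. (inverse (sqrt (f x)) * frechet_derivative f (at x) v) / 2) S"
      using Suc.prems IH assms(3)
      by (intro Ck_on_bounded_linear[OF assms(1) bounded_linear_divide]
        Ck_on_bilinear[OF assms(1) bounded_bilinear_mult] Ck_on_inverse[OF assms(1)]) force+
  qed
qed

text \<open>Derivatives are taken \<open>at x\<close>, hence see a full neighbourhood of the point
  and do not depend on the set; this is why \<open>S\<close> may be arbitrary.\<close>

lemma Ck_on_local:
  assumes "\<And>x. x \<in> S \<Longrightarrow> \<exists>U. open U \<and> x \<in> U \<and> Ck_on k f U"
  shows "Ck_on k f S"
  using assms
proof (induction k arbitrary: f)
  case 0
  then have "isCont f x" if "x \<in> S" for x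
    using that continuous_on_eq_continuous_at by auto
  then show ?case by (simp add: continuous_at_imp_continuous_on)
next
  case (Suc k)
  have "Ck_on k (\<lambda>x. frechet_derivative f (at x) v) S" for v
  proof (rule Suc.IH)
    fix x assume "x \<in> S"
    then show "\<exists>U. open U \<and> x \<in> U \<and> Ck_on k (\<lambda>x. frechet_derivative f (at x) v) U"
      using Suc.prems[of x] unfolding Ck_on.simps(2) by blast
  qed
  then show ?case using Suc.prems by fastforce
qed

lemma smooth_on_cong:
  "smooth_on S f \<Longrightarrow> open S \<Longrightarrow> (\<And>x. x \<in> S \<Longrightarrow> f x = h x) \<Longrightarrow> smooth_on S h"
  using Ck_on_cong unfolding smooth_on_def by blast

lemma smooth_on_subset: "smooth_on S f \<Longrightarrow> T \<subseteq> S \<Longrightarrow> smooth_on T f"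
  using Ck_on_subset unfolding smooth_on_def by blast

lemma smooth_on_local:
  "(\<And>x. x \<in> S \<Longrightarrow> \<exists>U. open U \<and> x \<in> U \<and> smooth_on U f) \<Longrightarrow> smooth_on S f"
  unfolding smooth_on_def by (meson Ck_on_local)

lemma smooth_on_has_derivative:
  "smooth_on S f \<Longrightarrow> x \<in> S \<Longrightarrow> (f has_derivative frechet_derivative f (at x)) (at x)"
  unfolding smooth_on_def by (blast intro: Ck_on_derivative)

lemma smooth_on_differentiable: "smooth_on S f \<Longrightarrow> x \<in> S \<Longrightarrow> f differentiable (at x)"
  using smooth_on_has_derivative differentiableI by blast

lemma smooth_on_continuous_on: "smooth_on S f \<Longrightarrow> continuous_on S f"
  by (simp add: smooth_on_def) (metis Ck_on.simps(1))

lemma smooth_on_frechet_derivative: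
  "smooth_on S f \<Longrightarrow> smooth_on S (\<lambda>x. frechet_derivative f (at x) v)"
  unfolding smooth_on_def
proof
  fix k assume "\<forall>k. Ck_on k f S"
  then have "Ck_on (Suc k) f S" by blast
  then show "Ck_on k (\<lambda>x. frechet_derivative f (at x) v) S" by simp
qed

lemma smooth_on_const: "smooth_on S (\<lambda>x. c)"
  by (simp add: smooth_on_def Ck_on_const)

lemma smooth_on_linear:
  fixes L :: "'f::euclidean_space \<Rightarrow> 'g::euclidean_space"
  shows "open S \<Longrightarrow> linear L \<Longrightarrow> smooth_on S f \<Longrightarrow> smooth_on S (\<lambda>x. L (f x))"
  by (auto simp: smooth_on_def linear_conv_bounded_linear intro: Ck_on_bounded_linear)

lemma smooth_on_id: "smooth_on S (\<lambda>x. x)"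
proof -
  have "Ck_on k (\<lambda>x. x) S" for k
    by (cases k) (auto simp: frechet_derivative_ident Ck_on_const)
  then show ?thesis by (simp add: smooth_on_def)
qed

lemma smooth_on_linear':
  fixes L :: "'f::euclidean_space \<Rightarrow> 'g::euclidean_space"
  shows "open S \<Longrightarrow> linear L \<Longrightarrow> smooth_on S L"
  using smooth_on_linear[OF _ _ smooth_on_id] by blast

lemma smooth_on_add:
  "open S \<Longrightarrow> smooth_on S f \<Longrightarrow> smooth_on S h \<Longrightarrow> smooth_on S (\<lambda>x. f x + h x)"
  by (auto simp: smooth_on_def intro: Ck_on_add)

lemma smooth_on_sum:
  "open S \<Longrightarrow> (\<And>i. i \<in> I \<Longrightarrow> smooth_on S (f i)) \<Longrightarrow> smooth_on S (\<lambda>x. \<Sum>i\<in>I. f i x)"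
  by (auto simp: smooth_on_def intro: Ck_on_sum)

lemma smooth_on_uminus:
  "open S \<Longrightarrow> smooth_on S f \<Longrightarrow> smooth_on S (\<lambda>x. - f x)"
  by (rule smooth_on_linear[where L=uminus]) (auto intro: linear_uminus)

lemma smooth_on_diff:
  "open S \<Longrightarrow> smooth_on S f \<Longrightarrow> smooth_on S h \<Longrightarrow> smooth_on S (\<lambda>x. f x - h x)"
  using smooth_on_add[OF _ _ smooth_on_uminus] by fastforce

lemma smooth_on_bilinear:
  "open S \<Longrightarrow> bounded_bilinear b \<Longrightarrow> smooth_on S f \<Longrightarrow> smooth_on S h \<Longrightarrow> smooth_on S (\<lambda>x. b (f x) (h x))"
  by (auto simp: smooth_on_def intro: Ck_on_bilinear)

lemma smooth_on_scaleR:
  "open S \<Longrightarrow> smooth_on S f \<Longrightarrow> smooth_on S h \<Longrightarrow> smooth_on S (\<lambda>x. f x *\<^sub>R h x)"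
  by (rule smooth_on_bilinear[OF _ bounded_bilinear_scaleR])

lemma smooth_on_mult:
  fixes f h :: "'e::euclidean_space \<Rightarrow> 'f::{euclidean_space,real_normed_algebra}"
  shows "open S \<Longrightarrow> smooth_on S f \<Longrightarrow> smooth_on S h \<Longrightarrow> smooth_on S (\<lambda>x. f x * h x)"
  by (rule smooth_on_bilinear[OF _ bounded_bilinear_mult])

lemma smooth_on_divide:
  fixes f h :: "'e::euclidean_space \<Rightarrow> 'f::{euclidean_space,real_normed_field}"
  assumes "open S" "smooth_on S f" "smooth_on S h" "\<And>x. x \<in> S \<Longrightarrow> h x \<noteq> 0"
  shows "smooth_on S (\<lambda>x. f x / h x)"
proof -
  have "smooth_on S (\<lambda>x. inverse (h x))"
    using assms by (auto simp: smooth_on_def intro: Ck_on_inverse)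
  then show ?thesis using smooth_on_mult[OF assms(1,2)] by (simp add: divide_inverse)
qed

lemma smooth_on_sqrt:
  fixes f :: "'e::euclidean_space \<Rightarrow> real"
  shows "open S \<Longrightarrow> smooth_on S f \<Longrightarrow> (\<And>x. x \<in> S \<Longrightarrow> f x > 0) \<Longrightarrow> smooth_on S (\<lambda>x. sqrt (f x))"
  by (auto simp: smooth_on_def intro: Ck_on_sqrt)

lemma smooth_on_compose:
  fixes f :: "'e::euclidean_space \<Rightarrow> 'f::euclidean_space" and h :: "'d::euclidean_space \<Rightarrow> 'e"
  shows "open S \<Longrightarrow> open T \<Longrightarrow> smooth_on T f \<Longrightarrow> smooth_on S h \<Longrightarrow> h ` S \<subseteq> T \<Longrightarrow> smooth_on S (\<lambda>x. f (h x))"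
  by (auto simp: smooth_on_def intro: Ck_on_compose)

lemma smooth_on_vec:
  fixes f :: "'e::euclidean_space \<Rightarrow> 'f::euclidean_space ^ 'n"
  assumes "open S" "\<And>i. smooth_on S (\<lambda>x. f x $ i)"
  shows "smooth_on S f"
proof -
  have "smooth_on S (\<lambda>x. \<Sum>i\<in>UNIV. (\<chi> j. if j = i then f x $ i else 0))"
  proof (intro smooth_on_sum[OF assms(1)])
    fix i :: 'n
    have "linear (\<lambda>c. (\<chi> j. if j = i then c else 0) :: 'f ^ 'n)"
      by (auto intro!: linearI simp: vec_eq_iff)
    from smooth_on_linear[OF assms(1) this assms(2)[of i]]
    show "smooth_on S (\<lambda>x. (\<chi> j. if j = i then f x $ i else 0) :: 'f ^ 'n)" .
  qed
  moreover have "(\<Sum>i\<in>UNIV. (\<chi> j. if j = i then f x $ i else 0)) = f x" for x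
    by (simp add: vec_eq_iff)
  ultimately show ?thesis by simp
qed

lemma smooth_on_nth:
  fixes f :: "'e::euclidean_space \<Rightarrow> 'f::euclidean_space ^ 'n"
  shows "open S \<Longrightarrow> smooth_on S f \<Longrightarrow> smooth_on S (\<lambda>x. f x $ i)"
  by (rule smooth_on_linear[where L="\<lambda>v. v $ i"]) (auto intro!: linearI)

lemma smooth_on_Pair:
  fixes f :: "'e::euclidean_space \<Rightarrow> 'f::euclidean_space" and h :: "'e \<Rightarrow> 'g::euclidean_space"
  assumes "open S" "smooth_on S f" "smooth_on S h"
  shows "smooth_on S (\<lambda>x. (f x, h x))"
proof -
  have "linear (\<lambda>a. (a, 0) :: 'f \<times> 'g)" "linear (\<lambda>a. (0, a) :: 'f \<times> 'g)"
    by (auto intro!: linearI)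
  from smooth_on_add[OF assms(1) smooth_on_linear[OF assms(1) this(1) assms(2)]
    smooth_on_linear[OF assms(1) this(2) assms(3)]]
  show ?thesis by simp
qed

lemmas smooth_on_intros = smooth_on_const smooth_on_id smooth_on_add smooth_on_uminus smooth_on_diff
  smooth_on_scaleR smooth_on_mult smooth_on_divide smooth_on_Pair smooth_on_nth

section \<open>Orientation classes of bases\<close>

definition mat_act :: "real mat \<Rightarrow> 'v::real_vector list \<Rightarrow> 'v list" where
  "mat_act A bs = map (\<lambda>i. \<Sum>j<length bs. A $$ (i, j) *\<^sub>R bs ! j) [0..<length bs]"

lemma length_mat_act [simp]: "length (mat_act A bs) = length bs"
  by (simp add: mat_act_def)

lemma nth_mat_act: "i < length bs \<Longrightarrow> mat_act A bs ! i = (\<Sum>j<length bs. A $$ (i, j) *\<^sub>R bs ! j)"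
  by (simp add: mat_act_def)

text \<open>The rows of the matrix hold the coefficients of the new vectors, so
  \<open>mat_act\<close> is a left action and an orientation class is an orbit of the matrices of
  positive determinant.\<close>

lemma orient_class_mat_act:
  "orient_class bs = {mat_act A bs | A. A \<in> carrier_mat (length bs) (length bs) \<and> Determinant.det A > 0}"
proof -
  have "cs = mat_act A bs \<longleftrightarrow> length cs = length bs \<and>
      (\<forall>i<length bs. cs ! i = (\<Sum>j<length bs. (A $$ (i, j)) *\<^sub>R bs ! j))" for cs A
    by (auto simp: list_eq_iff_nth_eq nth_mat_act)
  then show ?thesis unfolding orient_class_def by blast
qed

lemma mat_act_mult:
  assumes "A \<in> carrier_mat (length bs) (length bs)" "B \<in> carrier_mat (length bs) (length bs)"
  shows "mat_act (A * B) bs = mat_act A (mat_act B bs)"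
proof (rule nth_equalityI)
  fix i assume "i < length (mat_act (A * B) bs)"
  then have i: "i < length bs" by simp
  have "mat_act (A * B) bs ! i = (\<Sum>j<length bs. \<Sum>k<length bs. (A $$ (i, k) * B $$ (k, j)) *\<^sub>R bs ! j)"
    using i assms by (simp add: nth_mat_act scalar_prod_def scaleR_sum_left lessThan_atLeast0)
  also have "\<dots> = (\<Sum>k<length bs. A $$ (i, k) *\<^sub>R (\<Sum>j<length bs. B $$ (k, j) *\<^sub>R bs ! j))"
    by (subst sum.swap) (simp add: scaleR_sum_right)
  also have "\<dots> = mat_act A (mat_act B bs) ! i"
    using i by (simp add: nth_mat_act)
  finally show "mat_act (A * B) bs ! i = mat_act A (mat_act B bs) ! i" .
qed simp

lemma sum_delta_scaleR: "(\<Sum>j<n::nat. (if i = j then 1 else 0) *\<^sub>R f j) = (if i < n then f i else (0::'v::real_vector))"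
proof -
  have "(\<Sum>j<n. (if i = j then 1 else 0) *\<^sub>R f j) = (\<Sum>j<n. if i = j then f j else 0)"
    by (intro sum.cong) auto
  then show ?thesis by (subst (asm) sum.delta') auto
qed

lemma mat_act_one: "mat_act (1\<^sub>m (length bs)) bs = bs"
proof (rule nth_equalityI)
  fix i assume "i < length (mat_act (1\<^sub>m (length bs)) bs)"
  then have i: "i < length bs" by simp
  have "mat_act (1\<^sub>m (length bs)) bs ! i = (\<Sum>j<length bs. (if i = j then 1 else 0) *\<^sub>R bs ! j)"
    unfolding nth_mat_act[OF i] using i by (intro sum.cong) auto
  then show "mat_act (1\<^sub>m (length bs)) bs ! i = bs ! i" using i by (simp add: sum_delta_scaleR)
qed simp

lemma orient_class_mat_actI:
  "cs = mat_act A bs \<Longrightarrow> A \<in> carrier_mat (length bs) (length bs) \<Longrightarrow> Determinant.det A > 0 \<Longrightarrow>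
    cs \<in> orient_class bs"
  unfolding orient_class_mat_act by blast

lemma orient_class_refl: "bs \<in> orient_class bs"
  unfolding orient_class_mat_act
  by (rule CollectI, rule exI[of _ "1\<^sub>m (length bs)"]) (simp add: mat_act_one)

lemma orient_class_trans:
  assumes "cs \<in> orient_class bs" "bs \<in> orient_class as"
  shows "cs \<in> orient_class as"
proof -
  obtain A B where A: "cs = mat_act A bs" "A \<in> carrier_mat (length bs) (length bs)" "Determinant.det A > 0"
    and B: "bs = mat_act B as" "B \<in> carrier_mat (length as) (length as)" "Determinant.det B > 0"
    using assms unfolding orient_class_mat_act by blast
  have l: "length bs = length as" by (simp add: B)
  have "cs = mat_act (A * B) as" using A B l by (simp add: mat_act_mult)
  moreover have "Determinant.det (A * B) > 0" using A B l by (simp add: det_mult)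
  moreover have "A * B \<in> carrier_mat (length as) (length as)" using A B l by auto
  ultimately show ?thesis by (metis orient_class_mat_actI)
qed

lemma real_mat_inverse:
  assumes "A \<in> carrier_mat n n" "Determinant.det A \<noteq> (0::real)"
  obtains B where "B \<in> carrier_mat n n" "B * A = 1\<^sub>m n" "A * B = 1\<^sub>m n"
    "Determinant.det B * Determinant.det A = 1"
proof -
  from det_non_zero_imp_unit[OF assms] obtain B where B: "B \<in> carrier_mat n n" "B * A = 1\<^sub>m n" "A * B = 1\<^sub>m n"
    unfolding Units_def ring_mat_def by auto
  moreover have "Determinant.det B * Determinant.det A = 1"
    using B assms(1) by (metis det_mult det_one)
  ultimately show ?thesis using that by blast
qed

lemma orient_class_sym:
  assumes "cs \<in> orient_class bs"
  shows "bs \<in> orient_class cs"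
proof -
  obtain A where A: "cs = mat_act A bs" "A \<in> carrier_mat (length bs) (length bs)" "Determinant.det A > 0"
    using assms unfolding orient_class_mat_act by blast
  then obtain B where B: "B \<in> carrier_mat (length bs) (length bs)" "B * A = 1\<^sub>m (length bs)"
      "Determinant.det B * Determinant.det A = 1"
    using real_mat_inverse[of A "length bs"] by (metis less_irrefl)
  have "mat_act B cs = bs" using A B by (metis mat_act_mult mat_act_one)
  moreover have "Determinant.det B > 0" by (rule zero_less_mult_pos2[OF _ A(3)]) (simp add: B(3))
  moreover have "B \<in> carrier_mat (length cs) (length cs)" using A B by simp
  ultimately show ?thesis by (metis orient_class_mat_actI)
qed

lemma orient_class_eq: "cs \<in> orient_class bs \<Longrightarrow> orient_class cs = orient_class bs"
  using orient_class_sym orient_class_trans by blast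

lemma orient_class_eq_iff: "orient_class cs = orient_class bs \<longleftrightarrow> cs \<in> orient_class bs"
  using orient_class_eq orient_class_refl by blast

lemma mat_act_map:
  assumes "\<And>c. f (\<Sum>j<length bs. c j *\<^sub>R bs ! j) = (\<Sum>j<length bs. c j *\<^sub>R f (bs ! j))"
  shows "mat_act A (map f bs) = map f (mat_act A bs)"
  by (rule nth_equalityI) (simp_all add: nth_mat_act assms)

text \<open>Linearity is demanded only on combinations of \<open>bs\<close>, because Clifford
  multiplication and the maps deforming a plane are linear merely on a subspace of their ambient
  type.\<close>

lemma orient_class_map:
  assumes "\<And>c. f (\<Sum>j<length bs. c j *\<^sub>R bs ! j) = (\<Sum>j<length bs. c j *\<^sub>R f (bs ! j))"
  shows "orient_class (map f bs) = map f ` orient_class bs"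
  unfolding orient_class_mat_act using mat_act_map[OF assms] by (auto simp: image_iff)

lemma orient_class_map_linear: "linear f \<Longrightarrow> orient_class (map f bs) = map f ` orient_class bs"
  by (rule orient_class_map) (simp add: linear_sum linear_cmul)

lemma mat_act_append:
  assumes "A \<in> carrier_mat (length xs) (length xs)" "B \<in> carrier_mat (length xs) (length ys)"
    "C \<in> carrier_mat (length ys) (length xs)" "D \<in> carrier_mat (length ys) (length ys)"
  shows "mat_act (four_block_mat A B C D) (xs @ ys) =
    map (\<lambda>i. (\<Sum>j<length xs. A $$ (i, j) *\<^sub>R xs ! j) + (\<Sum>j<length ys. B $$ (i, j) *\<^sub>R ys ! j)) [0..<length xs] @
    map (\<lambda>i. (\<Sum>j<length xs. C $$ (i, j) *\<^sub>R xs ! j) + (\<Sum>j<length ys. D $$ (i, j) *\<^sub>R ys ! j)) [0..<length ys]"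
    (is "_ = ?R")
proof (rule nth_equalityI)
  have s: "sum h {..<n + m} = sum h {..<n} + (\<Sum>j<m. h (n + j))" for h :: "nat \<Rightarrow> 'a" and n m
    by (induction m) (simp_all add: add.assoc)
  fix i assume "i < length (mat_act (four_block_mat A B C D) (xs @ ys))"
  then have i: "i < length xs + length ys" by simp
  show "mat_act (four_block_mat A B C D) (xs @ ys) ! i = ?R ! i"
    using assms i by (auto simp: nth_mat_act s nth_append intro!: arg_cong2[of _ _ _ _ "(+)"] sum.cong)
qed simp

lemma orient_class_append:
  assumes "xs' \<in> orient_class xs" "ys' \<in> orient_class ys"
  shows "xs' @ ys' \<in> orient_class (xs @ ys)"
proof -
  let ?n = "length xs" and ?m = "length ys"
  obtain A D where A: "xs' = mat_act A xs" "A \<in> carrier_mat ?n ?n" "Determinant.det A > 0"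
    and D: "ys' = mat_act D ys" "D \<in> carrier_mat ?m ?m" "Determinant.det D > 0"
    using assms unfolding orient_class_mat_act by blast
  let ?M = "four_block_mat A (0\<^sub>m ?n ?m) (0\<^sub>m ?m ?n) D"
  have "Determinant.det ?M > 0"
    using det_four_block_mat_lower_left_zero[OF A(2) zero_carrier_mat refl D(2)] A D by simp
  moreover have "mat_act ?M (xs @ ys) = xs' @ ys'"
    using A D by (subst mat_act_append) (auto simp: mat_act_def)
  moreover have "?M \<in> carrier_mat (length (xs @ ys)) (length (xs @ ys))" using A D by auto
  ultimately show ?thesis by (metis orient_class_mat_actI)
qed

lemma in_span_list:
  "x \<in> span (set ys) \<Longrightarrow> \<exists>c. x = (\<Sum>j<length ys. c j *\<^sub>R ys ! j)"
proof (induction ys arbitrary: x)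
  case (Cons y ys)
  obtain k where "x - k *\<^sub>R y \<in> span (set ys)"
    using Cons.prems by (auto simp: span_insert)
  then obtain c where c: "x - k *\<^sub>R y = (\<Sum>j<length ys. c j *\<^sub>R ys ! j)" using Cons.IH by blast
  have "x = (\<Sum>j<length (y # ys). (case j of 0 \<Rightarrow> k | Suc j \<Rightarrow> c j) *\<^sub>R (y # ys) ! j)"
    using c by (simp only: length_Cons sum.lessThan_Suc_shift) (simp add: algebra_simps)
  then show ?case by blast
qed simp

lemma span_list_mat:
  assumes "\<forall>i<n. f i \<in> span (set ys)"
  obtains B where "B \<in> carrier_mat n (length ys)" "\<And>i. i < n \<Longrightarrow> f i = (\<Sum>j<length ys. B $$ (i, j) *\<^sub>R ys ! j)"
proof -
  from assms in_span_list have "\<forall>i. \<exists>c. i < n \<longrightarrow> f i = (\<Sum>j<length ys. c j *\<^sub>R ys ! j)" by blast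
  then obtain c where c: "\<And>i. i < n \<Longrightarrow> f i = (\<Sum>j<length ys. c i j *\<^sub>R ys ! j)" by metis
  show ?thesis by (rule that[of "Matrix.mat n (length ys) (\<lambda>(i, j). c i j)"]) (auto simp: c)
qed

text \<open>Adding combinations of \<open>ys\<close> to \<open>xs\<close> is a block triangular base
  change of determinant one. It permits replacing horizontal vectors by other lifts of the same base
  vectors.\<close>

lemma orient_class_shear_left:
  assumes "length xs' = length xs" "\<forall>i<length xs. xs' ! i - xs ! i \<in> span (set ys)"
  shows "xs' @ ys \<in> orient_class (xs @ ys)"
proof -
  let ?n = "length xs" and ?m = "length ys"
  obtain B where B: "B \<in> carrier_mat ?n ?m" "\<And>i. i < ?n \<Longrightarrow> xs' ! i - xs ! i = (\<Sum>j<?m. B $$ (i, j) *\<^sub>R ys ! j)"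
    by (rule span_list_mat[OF assms(2)]) blast
  let ?M = "four_block_mat (1\<^sub>m ?n) B (0\<^sub>m ?m ?n) (1\<^sub>m ?m)"
  have "Determinant.det ?M > 0"
    using det_four_block_mat_lower_left_zero[OF one_carrier_mat B(1) refl one_carrier_mat] by simp
  moreover have "mat_act ?M (xs @ ys) = xs' @ ys"
  proof -
    have 1: "xs' = map (\<lambda>i. (\<Sum>j<?n. 1\<^sub>m ?n $$ (i, j) *\<^sub>R xs ! j) + (\<Sum>j<?m. B $$ (i, j) *\<^sub>R ys ! j)) [0..<?n]"
      using assms(1)
      by (intro nth_equalityI) (auto simp flip: B(2) simp: sum_delta_scaleR)
    have 2: "ys = map (\<lambda>i. (\<Sum>j<?n. 0\<^sub>m ?m ?n $$ (i, j) *\<^sub>R xs ! j) + (\<Sum>j<?m. 1\<^sub>m ?m $$ (i, j) *\<^sub>R ys ! j)) [0..<?m]"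
      by (intro nth_equalityI) (auto simp: sum_delta_scaleR)
    show ?thesis using B(1) by (subst mat_act_append) (auto simp flip: 1 2)
  qed
  moreover have "?M \<in> carrier_mat (length (xs @ ys)) (length (xs @ ys))" using B by auto
  ultimately show ?thesis by (metis orient_class_mat_actI)
qed

text \<open>The transposed block shape; it serves to change a complement of a kernel modulo that
  kernel.\<close>

lemma orient_class_shear_right:
  assumes "length ys' = length ys" "\<forall>i<length ys. ys' ! i - ys ! i \<in> span (set xs)"
  shows "xs @ ys' \<in> orient_class (xs @ ys)"
proof -
  let ?n = "length xs" and ?m = "length ys"
  obtain B where B: "B \<in> carrier_mat ?m ?n" "\<And>i. i < ?m \<Longrightarrow> ys' ! i - ys ! i = (\<Sum>j<?n. B $$ (i, j) *\<^sub>R xs ! j)"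
    by (rule span_list_mat[OF assms(2)]) blast
  let ?M = "four_block_mat (1\<^sub>m ?n) (0\<^sub>m ?n ?m) B (1\<^sub>m ?m)"
  have "Determinant.det ?M > 0"
    using det_four_block_mat_upper_right_zero[OF one_carrier_mat refl B(1) one_carrier_mat] by simp
  moreover have "mat_act ?M (xs @ ys) = xs @ ys'"
  proof -
    have 1: "xs = map (\<lambda>i. (\<Sum>j<?n. 1\<^sub>m ?n $$ (i, j) *\<^sub>R xs ! j) + (\<Sum>j<?m. 0\<^sub>m ?n ?m $$ (i, j) *\<^sub>R ys ! j)) [0..<?n]"
      by (intro nth_equalityI) (auto simp: sum_delta_scaleR)
    have 2: "ys' = map (\<lambda>i. (\<Sum>j<?n. B $$ (i, j) *\<^sub>R xs ! j) + (\<Sum>j<?m. 1\<^sub>m ?m $$ (i, j) *\<^sub>R ys ! j)) [0..<?m]"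
      using assms(1)
      by (intro nth_equalityI) (auto simp flip: B(2) simp: sum_delta_scaleR)
    show ?thesis using B(1) by (subst mat_act_append) (auto simp flip: 1 2)
  qed
  moreover have "?M \<in> carrier_mat (length (xs @ ys)) (length (xs @ ys))" using B by auto
  ultimately show ?thesis by (metis orient_class_mat_actI)
qed

lemma span_list_combination: "(\<Sum>j<length bs. c j *\<^sub>R bs ! j) \<in> span (set bs)"
  by (intro span_sum span_scale span_base) auto

lemma independent_list_coeffs:
  assumes "distinct bs" "independent (set bs)"
    and "(\<Sum>j<length bs. c j *\<^sub>R bs ! j) = (\<Sum>j<length bs. d j *\<^sub>R bs ! j)" "i < length bs"
  shows "c i = d i"
proof -
  define n where "n v = (THE j. j < length bs \<and> bs ! j = v)" for v
  have n: "n (bs ! j) = j" if "j < length bs" for j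
    unfolding n_def using that assms(1) by (auto simp: nth_eq_iff_index_eq intro!: the_equality)
  have inj: "inj_on ((!) bs) {..<length bs}" using assms(1) by (simp add: inj_on_nth)
  have im: "(!) bs ` {..<length bs} = set bs" by (auto simp: set_conv_nth)
  have "(\<Sum>v\<in>set bs. (c (n v) - d (n v)) *\<^sub>R v) = (\<Sum>j<length bs. (c j - d j) *\<^sub>R bs ! j)"
    unfolding im[symmetric] by (subst sum.reindex[OF inj]) (simp add: n)
  also have "\<dots> = 0" using assms(3) by (simp add: scaleR_left_diff_distrib sum_subtractf)
  finally have "c (n (bs ! i)) - d (n (bs ! i)) = 0"
    using assms(2,4) independentD[OF assms(2) finite_set order_refl] by (metis nth_mem)
  then show ?thesis using n[OF assms(4)] by simp
qed

lemma independent_list_iff: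
  "distinct bs \<and> independent (set bs) \<longleftrightarrow>
   (\<forall>c. (\<Sum>j<length bs. c j *\<^sub>R bs ! j) = 0 \<longrightarrow> (\<forall>j<length bs. c j = 0))" (is "?L \<longleftrightarrow> ?R")
proof
  assume L: ?L
  show ?R
  proof (intro allI impI)
    fix c j assume "(\<Sum>j<length bs. c j *\<^sub>R bs ! j) = 0" "j < length bs"
    then show "c j = 0" using independent_list_coeffs[of bs c "\<lambda>_. 0" j] L by simp
  qed
next
  assume R: ?R
  have d: "distinct bs"
  proof (rule ccontr)
    assume "\<not> distinct bs"
    then obtain i k where ik: "i < length bs" "k < length bs" "i \<noteq> k" "bs ! i = bs ! k"
      by (auto simp: distinct_conv_nth)
    \<comment> \<open>A repeated entry yields the relation with coefficients 1 and -1.\<close>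
    have "(\<Sum>j<length bs. (if j = i then 1 else if j = k then -1 else 0) *\<^sub>R bs ! j) =
       (\<Sum>j<length bs. (if j = i then bs ! i else 0)) + (\<Sum>j<length bs. (if j = k then - bs ! k else 0))"
      using ik(3) by (subst sum.distrib[symmetric]) (auto intro!: sum.cong)
    also have "\<dots> = 0" using ik by simp
    finally show False using R ik(1) by fastforce
  qed
  have inj: "inj_on ((!) bs) {..<length bs}" using d by (simp add: inj_on_nth)
  have im: "(!) bs ` {..<length bs} = set bs" by (auto simp: set_conv_nth)
  have "independent (set bs)"
  proof
    assume "dependent (set bs)"
    then obtain u v where u: "(\<Sum>v\<in>set bs. u v *\<^sub>R v) = 0" "v \<in> set bs" "u v \<noteq> 0"
      by (auto simp: dependent_finite)
    have "(\<Sum>j<length bs. u (bs ! j) *\<^sub>R bs ! j) = 0"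
      using u(1) unfolding im[symmetric] by (subst (asm) sum.reindex[OF inj]) simp
    then show False using R u(2,3) by (metis in_set_conv_nth)
  qed
  then show ?L using d by blast
qed

lemma mat_act_inj:
  assumes "distinct bs" "independent (set bs)" "mat_act A bs = mat_act B bs"
    "A \<in> carrier_mat (length bs) (length bs)" "B \<in> carrier_mat (length bs) (length bs)"
  shows "A = B"
proof (rule eq_matI)
  fix i j assume "i < dim_row B" "j < dim_col B"
  then have ij: "i < length bs" "j < length bs" using assms by auto
  have "mat_act A bs ! i = mat_act B bs ! i" by (simp add: assms(3))
  then show "A $$ (i, j) = B $$ (i, j)"
    using independent_list_coeffs[OF assms(1,2), of "\<lambda>j. A $$ (i, j)" "\<lambda>j. B $$ (i, j)"] ij
    by (simp add: nth_mat_act)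
qed (use assms in auto)

lemma mat_act_exists:
  assumes "length cs = length bs" "set cs \<subseteq> span (set bs)"
  obtains A where "A \<in> carrier_mat (length bs) (length bs)" "cs = mat_act A bs"
proof -
  have "\<forall>i<length bs. cs ! i \<in> span (set bs)" using assms by auto
  then obtain A where "A \<in> carrier_mat (length bs) (length bs)"
      "\<And>i. i < length bs \<Longrightarrow> cs ! i = (\<Sum>j<length bs. A $$ (i, j) *\<^sub>R bs ! j)"
    by (rule span_list_mat) blast
  then show ?thesis using that[of A] assms(1) by (auto simp: list_eq_iff_nth_eq nth_mat_act)
qed

lemma basis_list_subset: "basis_list bs W \<Longrightarrow> set bs \<subseteq> W"
  by (auto simp: basis_list_def span_base)

lemma basis_list_length:
  assumes "basis_list bs W" "basis_list cs W"
  shows "length cs = length bs"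
proof -
  have "length xs = real_vector.dim W" if "basis_list xs W" for xs
    using that real_vector.dim_span_eq_card_independent[of "set xs"] distinct_card[of xs]
    unfolding basis_list_def by metis
  then show ?thesis using assms by metis
qed

lemma basis_list_length_dim: "basis_list xs W \<Longrightarrow> length xs = real_vector.dim W"
  using real_vector.dim_span_eq_card_independent[of "set xs"] distinct_card[of xs]
  unfolding basis_list_def by metis

text \<open>The matrices expressing each basis through the other multiply to the identity, because
  coefficients in a basis are unique; so neither determinant vanishes.\<close>

lemma basis_list_change:
  assumes "basis_list bs W" "basis_list cs W"
  obtains A where "A \<in> carrier_mat (length bs) (length bs)" "cs = mat_act A bs" "Determinant.det A \<noteq> 0"
proof -
  have l: "length cs = length bs" using basis_list_length[OF assms] .
  have s: "set cs \<subseteq> span (set bs)" "set bs \<subseteq> span (set cs)"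
    using assms basis_list_subset by (auto simp: basis_list_def)
  obtain A where A: "A \<in> carrier_mat (length bs) (length bs)" "cs = mat_act A bs"
    using mat_act_exists[OF l s(1)] .
  obtain B where B: "B \<in> carrier_mat (length cs) (length cs)" "bs = mat_act B cs"
    using mat_act_exists[OF l[symmetric] s(2)] .
  have B': "B \<in> carrier_mat (length bs) (length bs)" using B(1) l by simp
  have "mat_act (B * A) bs = mat_act B cs"
    unfolding A(2) by (rule mat_act_mult[OF B' A(1)])
  then have "mat_act (B * A) bs = mat_act (1\<^sub>m (length bs)) bs"
    unfolding B(2)[symmetric] mat_act_one .
  then have "B * A = 1\<^sub>m (length bs)"
    using mat_act_inj[of bs "B * A" "1\<^sub>m (length bs)"] assms(1) mult_carrier_mat[OF B' A(1)]
    by (simp add: basis_list_def)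
  then have "Determinant.det B * Determinant.det A = 1"
    using det_mult[OF B' A(1)] det_one by metis
  then have "Determinant.det A \<noteq> 0" by auto
  then show ?thesis using that A by blast
qed

text \<open>The inverse matrix shows that the spans agree. Independence comes from counting: a
  dependent list would leave a spanning set with fewer than \<open>dim W\<close> vectors.\<close>

lemma mat_act_basis_list:
  assumes "basis_list bs W" "A \<in> carrier_mat (length bs) (length bs)" "Determinant.det A \<noteq> 0"
  shows "basis_list (mat_act A bs) W"
proof -
  obtain B where B: "B \<in> carrier_mat (length bs) (length bs)" "B * A = 1\<^sub>m (length bs)" "A * B = 1\<^sub>m (length bs)"
    using real_mat_inverse[OF assms(2,3)] .
  have bs: "bs = mat_act B (mat_act A bs)" using assms B by (metis mat_act_mult mat_act_one)
  have s1: "set (mat_act A bs) \<subseteq> span (set bs)" by (auto simp: mat_act_def span_list_combination)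
  have "set (mat_act B (mat_act A bs)) \<subseteq> span (set (mat_act A bs))"
    using span_list_combination[of _ "mat_act A bs"] by (auto simp: mat_act_def[of B])
  then have s2: "set bs \<subseteq> span (set (mat_act A bs))" using bs by metis
  have sp: "span (set (mat_act A bs)) = W"
    using span_minimal[OF s1 subspace_span] span_minimal[OF s2 subspace_span] assms(1)
    by (auto simp: basis_list_def)
  have "card (set (mat_act A bs)) \<ge> real_vector.dim W"
    by (rule real_vector.span_card_ge_dim) (use sp in \<open>auto intro: span_base\<close>)
  then have c: "card (set (mat_act A bs)) \<ge> length bs" using basis_list_length_dim[OF assms(1)] by simp
  then have d: "distinct (mat_act A bs)"
    by (metis card_distinct card_length le_antisym length_mat_act)
  have "independent (set (mat_act A bs))"
  proof
    let ?S = "set (mat_act A bs)"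
    assume "dependent ?S"
    then obtain a where a: "a \<in> ?S" "a \<in> span (?S - {a})" by (auto simp: dependent_def)
    then have "?S \<subseteq> span (?S - {a})" by (auto intro: span_base)
    then have "W \<subseteq> span (?S - {a})" using span_minimal[OF _ subspace_span] sp by metis
    then have "real_vector.dim W \<le> card (?S - {a})" by (rule real_vector.dim_le_card) auto
    moreover have "card (?S - {a}) < card ?S" using a(1) by (intro psubset_card_mono) auto
    moreover have "card ?S \<le> length bs" by (metis card_length length_mat_act)
    ultimately show False using basis_list_length_dim[OF assms(1)] by simp
  qed
  then show ?thesis using d sp by (simp add: basis_list_def)
qed

lemma orient_class_basis_list: "basis_list bs W \<Longrightarrow> cs \<in> orient_class bs \<Longrightarrow> basis_list cs W"
  by (auto simp: orient_class_mat_act intro: mat_act_basis_list)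

section \<open>The two orientations of a vector space\<close>

definition flip_head :: "'v::real_vector list \<Rightarrow> 'v list" where
  "flip_head bs = (- hd bs) # tl bs"

text \<open>The matrix is diag(-1, 1, ..., 1).\<close>

lemma flip_head_mat_act:
  assumes "bs \<noteq> []"
  obtains F where "F \<in> carrier_mat (length bs) (length bs)" "Determinant.det F = -1"
    "\<And>xs::'v::real_vector list. length xs = length bs \<Longrightarrow> flip_head xs = mat_act F xs"
proof -
  define n where "n = length bs"
  define F :: "real mat" where "F = Matrix.mat n n (\<lambda>(i, j). if i = j then if i = 0 then -1 else 1 else 0)"
  have "upper_triangular F" by (auto simp: F_def)
  then have "Determinant.det F = prod_list (diag_mat F)"
    by (rule det_upper_triangular[of _ n]) (simp add: F_def)
  also have "diag_mat F = map (\<lambda>i. if i = 0 then -1 else 1) [0..<n]"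
    by (auto simp: diag_mat_def F_def)
  also have "\<dots> = -1 # map (\<lambda>i. 1) [1..<n]" using assms
    by (cases n) (auto simp: n_def upt_conv_Cons simp del: upt_Suc)
  also have "prod_list \<dots> = -1" by (simp add: prod_list_replicate map_replicate_const del: upt_Suc)
  finally have d: "Determinant.det F = -1" .
  have "flip_head xs = mat_act F xs" if l: "length xs = length bs" for xs :: "'v list"
  proof (rule nth_equalityI)
    show "length (flip_head xs) = length (mat_act F xs)" using l assms by (cases xs) (auto simp: flip_head_def)
    fix i assume "i < length (flip_head xs)"
    then have i: "i < length xs" "i < n" using l assms by (cases xs; auto simp: flip_head_def n_def)+
    have "mat_act F xs ! i = (\<Sum>j<length xs. if j = i then if i = 0 then - xs ! i else xs ! i else 0)"
      unfolding nth_mat_act[OF i(1)] using i l by (intro sum.cong) (auto simp: F_def n_def)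
    also have "\<dots> = flip_head xs ! i" using i by (cases xs) (auto simp: flip_head_def nth_Cons split: nat.split)
    finally show "flip_head xs ! i = mat_act F xs ! i" by simp
  qed
  with d show ?thesis using that[of F] by (simp add: F_def n_def)
qed

text \<open>The determinant of the change of basis is nonzero, and a negative one becomes positive
  after reversing the head.\<close>

lemma orient_class_dichotomy:
  assumes "basis_list bs W" "basis_list cs W" "bs \<noteq> []"
  shows "cs \<in> orient_class bs \<or> flip_head cs \<in> orient_class bs"
proof -
  obtain A where A: "A \<in> carrier_mat (length bs) (length bs)" "cs = mat_act A bs" "Determinant.det A \<noteq> 0"
    using basis_list_change[OF assms(1,2)] .
  obtain F where F: "F \<in> carrier_mat (length bs) (length bs)" "Determinant.det F = -1"
     "\<And>xs::'a list. length xs = length bs \<Longrightarrow> flip_head xs = mat_act F xs"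
    using flip_head_mat_act[OF assms(3)] by metis
  have "flip_head cs = mat_act (F * A) bs" using A F by (simp add: mat_act_mult)
  moreover have "Determinant.det (F * A) = - Determinant.det A" using A F by (simp add: det_mult)
  ultimately show ?thesis using A F orient_class_mat_actI[of cs A bs] orient_class_mat_actI[of "flip_head cs" "F * A" bs]
    by (cases "Determinant.det A > 0") auto
qed

text \<open>Coefficients in a basis are unique, so one list cannot come from matrices of both signs.
  Together with the dichotomy this allows orientations to be compared by contradiction.\<close>

lemma orient_class_exclusive:
  assumes "distinct bs" "independent (set bs)" "bs \<noteq> []" "cs \<in> orient_class bs"
  shows "flip_head cs \<notin> orient_class bs"
proof
  assume "flip_head cs \<in> orient_class bs"
  then obtain B where B: "B \<in> carrier_mat (length bs) (length bs)" "flip_head cs = mat_act B bs" "Determinant.det B > 0"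
    unfolding orient_class_mat_act by blast
  obtain A where A: "A \<in> carrier_mat (length bs) (length bs)" "cs = mat_act A bs" "Determinant.det A > 0"
    using assms(4) unfolding orient_class_mat_act by blast
  obtain F where F: "F \<in> carrier_mat (length bs) (length bs)" "Determinant.det F = -1"
     "\<And>xs::'a list. length xs = length bs \<Longrightarrow> flip_head xs = mat_act F xs"
    using flip_head_mat_act[OF assms(3)] by metis
  have "mat_act B bs = mat_act (F * A) bs" using A B F by (simp add: mat_act_mult)
  then have "B = F * A" using mat_act_inj[OF assms(1,2)] A B F by auto
  then have "Determinant.det B = - Determinant.det A" using A F by (simp add: det_mult)
  then show False using A B by simp
qed

lemma det_2x2: "Determinant.det (Matrix.mat 2 2 f) = f (0, 0) * f (1, 1) - f (0, 1) * f (1, 0 :: nat)"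
  for f :: "nat \<times> nat \<Rightarrow> real"
  by (subst laplace_expansion_row[of _ 2 0])
    (auto simp: cofactor_def mat_delete_def det_single numeral_2_eq_2 lessThan_Suc)

lemma orient_class_pair:
  "orient_class [u, v] = {[p *\<^sub>R u + q *\<^sub>R v, r *\<^sub>R u + s *\<^sub>R v] | p q r s. p * s - q * r > 0}" (is "_ = ?R")
proof (intro Set.set_eqI iffI)
  fix cs assume "cs \<in> orient_class [u, v]"
  then obtain A where A: "A \<in> carrier_mat 2 2" "Determinant.det A > 0" "cs = mat_act A [u, v]"
    by (auto simp: orient_class_mat_act numeral_2_eq_2)
  have "A = Matrix.mat 2 2 (\<lambda>ij. A $$ ij)" using A(1) by auto
  then have "Determinant.det A = A $$ (0, 0) * A $$ (1, 1) - A $$ (0, 1) * A $$ (1, 0)"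
    using det_2x2[of "\<lambda>ij. A $$ ij"] by metis
  then show "cs \<in> ?R" using A by (auto simp: mat_act_def lessThan_Suc numeral_2_eq_2 add.commute)
next
  fix cs assume "cs \<in> ?R"
  then obtain p q r s where c: "cs = [p *\<^sub>R u + q *\<^sub>R v, r *\<^sub>R u + s *\<^sub>R v]" "p * s - q * r > 0" by blast
  let ?A = "Matrix.mat 2 2 (\<lambda>(i, j). if i = 0 then if j = 0 then p else q else if j = (0::nat) then r else s)"
  have "Determinant.det ?A > 0" using c by (simp add: det_2x2)
  moreover have "cs = mat_act ?A [u, v]"
    using c by (simp add: mat_act_def lessThan_Suc numeral_2_eq_2 add.commute)
  ultimately show "cs \<in> orient_class [u, v]"
    unfolding orient_class_mat_act by (auto simp: numeral_2_eq_2 intro!: exI[of _ ?A])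
qed

lemma basis_list_pair:
  "basis_list [u, v] W \<longleftrightarrow> u \<noteq> v \<and> independent {u, v} \<and> span {u, v} = W"
  by (auto simp: basis_list_def)

lemma independent_pair:
  "u \<noteq> v \<and> independent {u, v} \<longleftrightarrow> (\<forall>a b. a *\<^sub>R u + b *\<^sub>R v = 0 \<longrightarrow> a = 0 \<and> b = 0)" (is "?L \<longleftrightarrow> ?R")
proof -
  have "?L \<longleftrightarrow> (\<forall>c. (\<Sum>j<2. c j *\<^sub>R [u, v] ! j) = 0 \<longrightarrow> (\<forall>j<2. c j = 0))"
    using independent_list_iff[of "[u, v]"] by (auto simp: numeral_2_eq_2)
  also have "\<dots> \<longleftrightarrow> (\<forall>c. c 0 *\<^sub>R u + c (1::nat) *\<^sub>R v = 0 \<longrightarrow> c 0 = 0 \<and> c 1 = 0)"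
    by (simp add: numeral_2_eq_2 lessThan_Suc less_Suc_eq all_conj_distrib imp_conjL add.commute)
  also have "\<dots> \<longleftrightarrow> ?R"
  proof
    assume *: "\<forall>c. c 0 *\<^sub>R u + c (1::nat) *\<^sub>R v = 0 \<longrightarrow> c 0 = 0 \<and> c 1 = 0"
    show ?R using *[rule_format, of "\<lambda>i. if i = 0 then _ else _"] by simp
  qed blast
  finally show ?thesis .
qed

lemma span_pair: "span {u, v} = {a *\<^sub>R u + b *\<^sub>R v | a b. True}"
  unfolding span_insert span_empty by (auto simp: algebra_simps)

text \<open>By counting, a complex basis consists of one vector, and passing from \<open>a\<close>
  to \<open>b\<close> has the matrix with rows (p, q), (-q, p) of determinant p^2 + q^2 > 0. Hence
  the union over all complex bases in \<open>complex_orientation\<close> is a single class, computed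
  from any one generator.\<close>

lemma complex_orientation_line:
  assumes "a \<in> S" "basis_list [e a, e (I a)] W"
    "\<And>b. b \<in> S \<Longrightarrow> \<exists>p q. e b = p *\<^sub>R e a + q *\<^sub>R e (I a) \<and> e (I b) = - q *\<^sub>R e a + p *\<^sub>R e (I a)"
  shows "complex_orientation I e S W = orient_class [e a, e (I a)]"
proof (intro Set.set_eqI iffI)
  fix bs assume "bs \<in> complex_orientation I e S W"
  then obtain as where as: "set as \<subseteq> S" "basis_list (concat (map (\<lambda>a. [e a, e (I a)]) as)) W"
      "bs \<in> orient_class (concat (map (\<lambda>a. [e a, e (I a)]) as))"
    unfolding complex_orientation_def by blast
  have "length (concat (map (\<lambda>a. [e a, e (I a)]) as)) = 2"
    using basis_list_length[OF assms(2) as(2)] by simp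
  moreover have "length (concat (map (\<lambda>a. [e a, e (I a)]) as)) = 2 * length as"
    by (induction as) auto
  ultimately have "length as = 1" by simp
  then obtain b where b: "as = [b]" by (cases as) auto
  then have bs: "basis_list [e b, e (I b)] W" "bs \<in> orient_class [e b, e (I b)]" "b \<in> S" using as by auto
  obtain p q where pq: "e b = p *\<^sub>R e a + q *\<^sub>R e (I a)" "e (I b) = - q *\<^sub>R e a + p *\<^sub>R e (I a)"
    using assms(3)[OF bs(3)] by blast
  have "e b \<noteq> 0" using bs(1) by (auto simp: basis_list_pair dependent_zero)
  then have "p \<noteq> 0 \<or> q \<noteq> 0" using pq by auto
  then have "p * p - q * - q > 0" using sum_power2_gt_zero_iff[of p q] by (simp add: power2_eq_square)
  then have "[e b, e (I b)] \<in> orient_class [e a, e (I a)]"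
    unfolding orient_class_pair pq by blast
  then show "bs \<in> orient_class [e a, e (I a)]" using bs(2) orient_class_trans by blast
next
  fix bs assume "bs \<in> orient_class [e a, e (I a)]"
  then show "bs \<in> complex_orientation I e S W"
    unfolding complex_orientation_def using assms by (auto intro!: exI[of _ "[a]"])
qed

section \<open>Determinants of quadruples in real 4-space\<close>

definition det4 :: "(real ^ 4) list \<Rightarrow> real" where
  "det4 ps = Determinant.det (Matrix.mat 4 4 (\<lambda>(i, j). ps ! i $ of_nat (Suc j)))"

lemma det4_mat_act:
  assumes "length ps = 4" "A \<in> carrier_mat 4 4"
  shows "det4 (mat_act A ps) = Determinant.det A * det4 ps"
proof -
  let ?P = "Matrix.mat 4 4 (\<lambda>(i, j). ps ! i $ of_nat (Suc j))"
  have "Matrix.mat 4 4 (\<lambda>(i, j). mat_act A ps ! i $ of_nat (Suc j)) = A * ?P"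
    using assms by (intro eq_matI) (auto simp: nth_mat_act scalar_prod_def lessThan_atLeast0)
  then show ?thesis using assms by (simp add: det4_def det_mult[of _ 4])
qed

lemma det_3x3: "Determinant.det (Matrix.mat 3 3 f) =
   f (0,0) * (f (1,1) * f (2,2) - f (1,2) * f (2,1)) - f (0,1) * (f (1,0) * f (2,2) - f (1,2) * f (2,0))
   + f (0,2) * (f (1,0) * f (2,1) - f (1,1) * f (2,0))"
  for f :: "nat \<times> nat \<Rightarrow> real"
  by (subst laplace_expansion_row[of _ 3 0])
    (auto simp: cofactor_def mat_delete_def det_2x2[unfolded numeral_2_eq_2] numeral_3_eq_3 numeral_2_eq_2 lessThan_Suc algebra_simps)

lemma det4_list: "det4 [a, b, c, d] =
    a$1 * (b$2 * (c$3 * d$4 - c$4 * d$3) - b$3 * (c$2 * d$4 - c$4 * d$2) + b$4 * (c$2 * d$3 - c$3 * d$2))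
  - a$2 * (b$1 * (c$3 * d$4 - c$4 * d$3) - b$3 * (c$1 * d$4 - c$4 * d$1) + b$4 * (c$1 * d$3 - c$3 * d$1))
  + a$3 * (b$1 * (c$2 * d$4 - c$4 * d$2) - b$2 * (c$1 * d$4 - c$4 * d$1) + b$4 * (c$1 * d$2 - c$2 * d$1))
  - a$4 * (b$1 * (c$2 * d$3 - c$3 * d$2) - b$2 * (c$1 * d$3 - c$3 * d$1) + b$3 * (c$1 * d$2 - c$2 * d$1))"
proof -
  have r: "{..<4::nat} = {0, 1, 2, 3}" by auto
  show ?thesis unfolding det4_def
    by (subst laplace_expansion_row[of _ 4 0])
      (auto simp: cofactor_def mat_delete_def r det_3x3 algebra_simps simp flip: numeral_3_eq_3)
qed

section \<open>Manifolds and their tangent vectors\<close>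

lemma chart_inv_left: "smooth_atlas N \<Longrightarrow> c \<in> N \<Longrightarrow> x \<in> fst c \<Longrightarrow> chart_inv c (snd c x) = x"
  by (simp add: chart_inv_def smooth_atlas_def)

lemma chart_inv_right: "z \<in> snd c ` fst c \<Longrightarrow> snd c (chart_inv c z) = z"
  by (simp add: chart_inv_def f_inv_into_f)

lemma chart_inv_in: "z \<in> snd c ` fst c \<Longrightarrow> chart_inv c z \<in> fst c"
  by (simp add: chart_inv_def inv_into_into)

lemma open_chart_image: "smooth_atlas N \<Longrightarrow> c \<in> N \<Longrightarrow> open (snd c ` fst c)"
  by (simp add: smooth_atlas_def)

lemma smooth_transition:
  "smooth_atlas N \<Longrightarrow> c \<in> N \<Longrightarrow> d \<in> N \<Longrightarrow> open (snd c ` (fst c \<inter> fst d)) \<and>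
     smooth_on (snd c ` (fst c \<inter> fst d)) (snd d \<circ> chart_inv c)"
  by (simp add: smooth_atlas_def)

lemma open_in_points: "open_in N W \<Longrightarrow> W \<subseteq> points N"
  by (simp add: open_in_def)

lemma open_in_image: "open_in N W \<Longrightarrow> c \<in> N \<Longrightarrow> open (snd c ` (fst c \<inter> W))"
  by (simp add: open_in_def Int_commute)

lemma in_points: "c \<in> N \<Longrightarrow> x \<in> fst c \<Longrightarrow> x \<in> points N"
  by (auto simp: points_def)

lemma pointsE:
  assumes "x \<in> points N" obtains c where "c \<in> N" "x \<in> fst c"
  using assms by (auto simp: points_def)

lemma open_in_Int:
  assumes "smooth_atlas N" "open_in N U" "open_in N W"
  shows "open_in N (U \<inter> W)"
proof -
  have "snd c ` (U \<inter> W \<inter> fst c) = snd c ` (U \<inter> fst c) \<inter> snd c ` (W \<inter> fst c)" if "c \<in> N" for c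
  proof -
    have "inj_on (snd c) (fst c)" using assms(1) that by (simp add: smooth_atlas_def)
    then have "snd c ` ((U \<inter> fst c) \<inter> (W \<inter> fst c)) = snd c ` (U \<inter> fst c) \<inter> snd c ` (W \<inter> fst c)"
      by (rule inj_on_image_Int) auto
    then show ?thesis by (simp add: Int_ac)
  qed
  then show ?thesis using assms by (auto simp: open_in_def)
qed

lemma open_in_Union:
  assumes "\<And>U. U \<in> \<U> \<Longrightarrow> open_in N U"
  shows "open_in N (\<Union>\<U>)"
proof -
  have "snd c ` (\<Union>\<U> \<inter> fst c) = (\<Union>U\<in>\<U>. snd c ` (U \<inter> fst c))" for c :: "('a, 'b) chart" by auto
  moreover have "\<Union>\<U> \<subseteq> points N" using assms by (blast dest: open_in_points)
  ultimately show ?thesis using assms by (simp add: open_in_def open_UN)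
qed

lemma istopology_open_in: "smooth_atlas N \<Longrightarrow> istopology (open_in N)"
  unfolding istopology_def using open_in_Int open_in_Union by blast

lemma openin_manifold_topology:
  "smooth_atlas N \<Longrightarrow> openin (manifold_topology N) U \<longleftrightarrow> open_in N U"
  by (simp add: manifold_topology_def topology_inverse' istopology_open_in)

lemma open_in_preimage:
  assumes "smooth_atlas N" "c \<in> N" "open U"
  shows "open_in N {x \<in> fst c. snd c x \<in> U}"
  unfolding open_in_def
proof (intro conjI ballI)
  fix d assume d: "d \<in> N"
  let ?O = "snd d ` (fst d \<inter> fst c)"
  have "open (?O \<inter> (snd c \<circ> chart_inv d) -` U)"
    using smooth_transition[OF assms(1) d assms(2)] assms(3)
    by (intro continuous_open_preimage) (blast intro: smooth_on_continuous_on)+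
  moreover have "snd d ` ({x \<in> fst c. snd c x \<in> U} \<inter> fst d) = ?O \<inter> (snd c \<circ> chart_inv d) -` U"
    using chart_inv_left[OF assms(1) d] by (auto simp: image_iff)
  ultimately show "open (snd d ` ({x \<in> fst c. snd c x \<in> U} \<inter> fst d))" by simp
qed (use assms(2) in \<open>auto simp: points_def\<close>)

lemma open_in_chart:
  assumes "smooth_atlas N" "c \<in> N" shows "open_in N (fst c)"
  using open_in_preimage[OF assms open_UNIV] by simp

lemma open_in_subsetI:
  assumes "\<And>x. x \<in> W \<Longrightarrow> \<exists>U. open_in N U \<and> x \<in> U \<and> U \<subseteq> W"
  shows "open_in N W"
proof -
  have "W = \<Union>{U. open_in N U \<and> U \<subseteq> W}" using assms by blast
  then show ?thesis using open_in_Union[of "{U. open_in N U \<and> U \<subseteq> W}" N] by auto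
qed

lemma open_in_points_self: "smooth_atlas N \<Longrightarrow> open_in N (points N)"
  by (rule open_in_subsetI) (meson open_in_chart open_in_points pointsE)

text \<open>The tangent vector at \<open>x\<close> whose component in the chart \<open>c\<close> is
  \<open>e\<close>; derivatives of the transition maps supply the components in the other charts. As
  a function of \<open>e\<close> it serves as the coordinate isomorphism onto the tangent
  space.\<close>

definition tvec :: "('a, 'e::euclidean_space) manifold \<Rightarrow> 'a \<Rightarrow> ('a, 'e) chart \<Rightarrow> 'e \<Rightarrow> ('a, 'e) tangent" where
  "tvec N x c e = (\<lambda>d. if d \<in> N \<and> x \<in> fst d
     then frechet_derivative (snd d \<circ> chart_inv c) (at (snd c x)) e else 0)"

lemma has_vector_derivative_chain:
  assumes "(f has_vector_derivative e) (at x)" "(g has_derivative D) (at (f x))"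
  shows "((\<lambda>t. g (f t)) has_vector_derivative D e) (at x)"
  using has_derivative_compose[of f "\<lambda>t. t *\<^sub>R e" x UNIV g D] assms
    linear_cmul[OF has_derivative_linear[OF assms(2)]]
  by (simp add: has_vector_derivative_def)

lemma has_derivative_imp_has_vector_derivative:
  assumes "(f has_derivative F) (at (x::real))"
  shows "(f has_vector_derivative F 1) (at x)"
proof -
  have "F t = t *\<^sub>R F 1" for t
    using linear_cmul[OF has_derivative_linear[OF assms], of t 1] by simp
  then show ?thesis
    unfolding has_vector_derivative_def by (intro has_derivative_eq_rhs[OF assms] ext)
qed

lemma eventually_at_0_interval: "\<epsilon> > 0 \<Longrightarrow> (\<And>t. t \<in> {-\<epsilon><..<\<epsilon>} \<Longrightarrow> P t) \<Longrightarrow> \<forall>\<^sub>F t in at (0::real). P t"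
  unfolding eventually_at by (rule exI[of _ \<epsilon>]) (auto simp: dist_real_def abs_less_iff)

lemma eventually_nhds_0_interval:
  assumes "\<forall>\<^sub>F t in nhds (0::real). P t"
  obtains \<epsilon> where "\<epsilon> > 0" "\<And>t. t \<in> {-\<epsilon><..<\<epsilon>} \<Longrightarrow> P t"
proof -
  obtain d where "d > 0" "\<And>t. dist t 0 < d \<Longrightarrow> P t"
    using assms unfolding eventually_nhds_metric by blast
  then show ?thesis using that[of d] by (auto simp: dist_real_def abs_less_iff)
qed

context
  fixes N :: "('a, 'e::euclidean_space) manifold"
  assumes N: "smooth_atlas N"
begin

lemma transition_derivative:
  assumes "c \<in> N" "d \<in> N" "x \<in> fst c" "x \<in> fst d"
  shows "((snd d \<circ> chart_inv c) has_derivative frechet_derivative (snd d \<circ> chart_inv c) (at (snd c x))) (at (snd c x))"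
  using smooth_on_has_derivative smooth_transition[OF N assms(1,2)] assms(3,4) by blast

lemma linear_tvec:
  assumes "c \<in> N" "x \<in> fst c"
  shows "linear (tvec N x c)"
proof (rule linearI)
  show "tvec N x c (u + v) = tvec N x c u + tvec N x c v" for u v
    using has_derivative_linear[OF transition_derivative[OF assms(1) _ assms(2)]]
    by (auto simp: tvec_def fun_eq_iff linear_add)
  show "tvec N x c (r *\<^sub>R v) = r *\<^sub>R tvec N x c v" for r v
    using has_derivative_linear[OF transition_derivative[OF assms(1) _ assms(2)]]
    by (auto simp: tvec_def fun_eq_iff scaleR_fun_def linear_cmul)
qed

lemma tvec_same:
  assumes "c \<in> N" "x \<in> fst c"
  shows "tvec N x c e c = e"
proof -
  have "((\<lambda>z. z) has_derivative (\<lambda>h. h)) (at (snd c x))" by (rule has_derivative_ident)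
  then have "((snd c \<circ> chart_inv c) has_derivative (\<lambda>h. h)) (at (snd c x))"
    by (rule has_derivative_transform_within_open[OF _ open_chart_image[OF N assms(1)]])
      (use assms(2) chart_inv_right in \<open>auto simp: chart_inv_left[OF N assms(1)]\<close>)
  from frechet_derivative_at[OF this] show ?thesis using assms by (simp add: tvec_def fun_eq_iff)
qed

lemma tvec_inj: "c \<in> N \<Longrightarrow> x \<in> fst c \<Longrightarrow> tvec N x c e = tvec N x c e' \<longleftrightarrow> e = e'"
  by (metis tvec_same)

text \<open>Differentiability at 0 in one chart and staying in that chart near 0 are enough; all
  other components follow by the chain rule.\<close>

lemma velocity_tvec:
  assumes "c \<in> N" "\<gamma> 0 \<in> fst c" "((\<lambda>t. snd c (\<gamma> t)) has_vector_derivative e) (at 0)"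
    and ev: "\<forall>\<^sub>F t in at 0. \<gamma> t \<in> fst c"
  shows "velocity N \<gamma> = tvec N (\<gamma> 0) c e"
proof
  fix d
  show "velocity N \<gamma> d = tvec N (\<gamma> 0) c e d"
  proof (cases "d \<in> N \<and> \<gamma> 0 \<in> fst d")
    case True
    let ?T = "frechet_derivative (snd d \<circ> chart_inv c) (at (snd c (\<gamma> 0)))"
    have "((\<lambda>t. (snd d \<circ> chart_inv c) (snd c (\<gamma> t))) has_vector_derivative ?T e) (at 0)"
      by (rule has_vector_derivative_chain[OF assms(3)]) (use transition_derivative[OF assms(1) _ assms(2)] True in blast)
    then have "((snd d \<circ> \<gamma>) has_vector_derivative ?T e) (at 0)"
      unfolding has_vector_derivative_def
    proof (rule has_derivative_transform_eventually)
      show "\<forall>\<^sub>F t in at 0. (snd d \<circ> chart_inv c) (snd c (\<gamma> t)) = (snd d \<circ> \<gamma>) t"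
        using ev by eventually_elim (simp add: chart_inv_left[OF N assms(1)])
      show "(snd d \<circ> chart_inv c) (snd c (\<gamma> 0)) = (snd d \<circ> \<gamma>) 0"
        by (simp add: chart_inv_left[OF N assms(1,2)])
    qed simp
    then show ?thesis using True by (simp add: velocity_def tvec_def vector_derivative_at)
  qed (auto simp: velocity_def tvec_def)
qed

text \<open>This is the cocycle identity for the derivatives of the transition maps.\<close>

lemma tvec_change:
  assumes "c \<in> N" "d \<in> N" "x \<in> fst c" "x \<in> fst d"
  shows "tvec N x c e = tvec N x d (tvec N x c e d)"
proof
  fix c'
  show "tvec N x c e c' = tvec N x d (tvec N x c e d) c'"
  proof (cases "c' \<in> N \<and> x \<in> fst c'")
    case True
    have "((snd d \<circ> chart_inv c) has_derivative frechet_derivative (snd d \<circ> chart_inv c) (at (snd c x))) (at (snd c x))"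
      using transition_derivative assms by blast
    moreover have "((snd c' \<circ> chart_inv d) has_derivative frechet_derivative (snd c' \<circ> chart_inv d) (at (snd d x)))
        (at ((snd d \<circ> chart_inv c) (snd c x)))"
      using transition_derivative[of d c' x] assms True by (simp add: chart_inv_left[OF N])
    ultimately have "((\<lambda>z. (snd c' \<circ> chart_inv d) ((snd d \<circ> chart_inv c) z)) has_derivative
      (\<lambda>v. frechet_derivative (snd c' \<circ> chart_inv d) (at (snd d x)) (frechet_derivative (snd d \<circ> chart_inv c) (at (snd c x)) v))) (at (snd c x))"
      by (rule has_derivative_compose)
    then have "((snd c' \<circ> chart_inv c) has_derivative
      (\<lambda>v. frechet_derivative (snd c' \<circ> chart_inv d) (at (snd d x)) (frechet_derivative (snd d \<circ> chart_inv c) (at (snd c x)) v))) (at (snd c x))"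
      by (rule has_derivative_transform_within_open[where s="snd c ` (fst c \<inter> fst d)"])
        (use smooth_transition[OF N assms(1,2)] assms in \<open>auto simp: chart_inv_left[OF N]\<close>)
    from frechet_derivative_at[OF this] show ?thesis using True assms by (simp add: tvec_def fun_eq_iff)
  qed (auto simp: tvec_def)
qed

lemma chart_curve:
  fixes e :: 'e
  assumes "c \<in> N" "x \<in> fst c"
    and \<gamma>_def: "\<And>t. \<gamma> t = chart_inv c (snd c x + t *\<^sub>R e)"
  shows "\<gamma> 0 = x" "((\<lambda>t. snd c (\<gamma> t)) has_vector_derivative e) (at 0)"
    "\<exists>\<epsilon>>0. \<gamma> ` {-\<epsilon><..<\<epsilon>} \<subseteq> fst c \<and> (\<forall>t\<in>{-\<epsilon><..<\<epsilon>}. snd c (\<gamma> t) = snd c x + t *\<^sub>R e)"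
proof -
  show "\<gamma> 0 = x" using assms(1,2) by (simp add: \<gamma>_def chart_inv_left[OF N])
  have "((\<lambda>t. snd c x + t *\<^sub>R e) \<longlongrightarrow> snd c x + 0 *\<^sub>R e) (nhds 0)"
    by (intro tendsto_intros filterlim_ident)
  then have "\<forall>\<^sub>F t in nhds 0. snd c x + t *\<^sub>R e \<in> snd c ` fst c"
    by (rule topological_tendstoD) (use assms(1,2) open_chart_image[OF N] in auto)
  then obtain \<epsilon> where e: "\<epsilon> > 0" "\<And>t. t \<in> {-\<epsilon><..<\<epsilon>} \<Longrightarrow> snd c x + t *\<^sub>R e \<in> snd c ` fst c"
    by (rule eventually_nhds_0_interval) blast
  then show ex: "\<exists>\<epsilon>>0. \<gamma> ` {-\<epsilon><..<\<epsilon>} \<subseteq> fst c \<and> (\<forall>t\<in>{-\<epsilon><..<\<epsilon>}. snd c (\<gamma> t) = snd c x + t *\<^sub>R e)"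
    unfolding \<gamma>_def using chart_inv_in[OF e(2)] chart_inv_right[OF e(2)] e(1)
    by (intro exI[of _ \<epsilon>] conjI ballI subsetI) auto
  have "((\<lambda>t. snd c x + t *\<^sub>R e) has_vector_derivative e) (at 0)"
    by (auto intro!: derivative_eq_intros)
  then show "((\<lambda>t. snd c (\<gamma> t)) has_vector_derivative e) (at 0)"
    by (rule has_vector_derivative_transform_within_open[of _ _ _ "{-\<epsilon><..<\<epsilon>}"])
      (use e(1) chart_inv_right[OF e(2)] in \<open>auto simp: \<gamma>_def\<close>)
qed

lemma tangent_space_ofI:
  assumes "c \<in> N" "\<epsilon> > 0" "\<gamma> ` {-\<epsilon><..<\<epsilon>} \<subseteq> fst c \<inter> K" "smooth_on {-\<epsilon><..<\<epsilon>} (\<lambda>t. snd c (\<gamma> t))"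
    "((\<lambda>t. snd c (\<gamma> t)) has_vector_derivative e) (at 0)" "\<gamma> 0 = x"
  shows "tvec N x c e \<in> tangent_space_of N K x"
proof -
  have "\<gamma> 0 \<in> fst c" using assms(2,3) by auto
  moreover have "\<forall>\<^sub>F t in at 0. \<gamma> t \<in> fst c"
    using assms(2,3) by (intro eventually_at_0_interval) auto
  ultimately have "velocity N \<gamma> = tvec N x c e" using velocity_tvec assms by metis
  moreover have "smooth_curve_at N x \<gamma>"
    using assms unfolding smooth_curve_at_def comp_def by blast
  moreover have "\<exists>\<epsilon>>0. \<gamma> ` {-\<epsilon><..<\<epsilon>} \<subseteq> K" using assms by blast
  ultimately show ?thesis unfolding tangent_space_of_def by force
qed

text \<open>Smoothness of a curve is witnessed in some chart \<open>d\<close>. Continuity keeps the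
  curve in the overlap with the prescribed chart \<open>c\<close> near 0, where the transition map
  transfers the derivative.\<close>

lemma smooth_curve_velocity:
  assumes "smooth_curve_at N x \<gamma>" "c \<in> N" "x \<in> fst c"
  obtains e where "velocity N \<gamma> = tvec N x c e" "((\<lambda>t. snd c (\<gamma> t)) has_vector_derivative e) (at 0)"
    "\<forall>\<^sub>F t in at 0. \<gamma> t \<in> fst c"
proof -
  obtain d \<epsilon> where d: "d \<in> N" "\<epsilon> > 0" "\<gamma> ` {-\<epsilon><..<\<epsilon>} \<subseteq> fst d" "smooth_on {-\<epsilon><..<\<epsilon>} (snd d \<circ> \<gamma>)" "\<gamma> 0 = x"
    using assms(1) unfolding smooth_curve_at_def by blast
  have xd: "x \<in> fst d" using d by auto
  have "((snd d \<circ> \<gamma>) has_derivative frechet_derivative (snd d \<circ> \<gamma>) (at 0)) (at 0)"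
    by (rule smooth_on_has_derivative[OF d(4)]) (use d(2) in auto)
  then have D: "((\<lambda>t. snd d (\<gamma> t)) has_vector_derivative frechet_derivative (snd d \<circ> \<gamma>) (at 0) 1) (at 0)"
    (is "(_ has_vector_derivative ?e) _")
    unfolding comp_def by (rule has_derivative_imp_has_vector_derivative)
  let ?O = "snd d ` (fst d \<inter> fst c)"
  have "((\<lambda>t. snd d (\<gamma> t)) \<longlongrightarrow> snd d (\<gamma> 0)) (at 0)"
    using has_vector_derivative_continuous[OF D] by (simp add: continuous_within)
  then have "\<forall>\<^sub>F t in at 0. snd d (\<gamma> t) \<in> ?O"
    by (rule topological_tendstoD) (use smooth_transition[OF N d(1) assms(2)] xd assms d in auto)
  moreover have evd: "\<forall>\<^sub>F t in at 0. \<gamma> t \<in> fst d"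
    using d by (intro eventually_at_0_interval) auto
  ultimately have ev: "\<forall>\<^sub>F t in at 0. \<gamma> t \<in> fst c"
  proof eventually_elim
    case (elim t)
    then obtain y where "y \<in> fst d \<inter> fst c" "snd d (\<gamma> t) = snd d y" by auto
    then show ?case using chart_inv_left[OF N d(1)] elim by (metis IntE)
  qed
  let ?T = "frechet_derivative (snd c \<circ> chart_inv d) (at (snd d x))"
  have "((\<lambda>t. (snd c \<circ> chart_inv d) (snd d (\<gamma> t))) has_vector_derivative ?T ?e) (at 0)"
    by (rule has_vector_derivative_chain[OF D]) (simp only: d(5) transition_derivative[OF d(1) assms(2) xd assms(3)])
  then have C: "((\<lambda>t. snd c (\<gamma> t)) has_vector_derivative ?T ?e) (at 0)"
    unfolding has_vector_derivative_def
  proof (rule has_derivative_transform_eventually)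
    show "\<forall>\<^sub>F t in at 0. (snd c \<circ> chart_inv d) (snd d (\<gamma> t)) = snd c (\<gamma> t)"
      using evd by eventually_elim (simp add: chart_inv_left[OF N d(1)])
    show "(snd c \<circ> chart_inv d) (snd d (\<gamma> 0)) = snd c (\<gamma> 0)"
      using xd d by (simp add: chart_inv_left[OF N d(1)])
  qed simp
  have "velocity N \<gamma> = tvec N x c (?T ?e)"
    using velocity_tvec[OF assms(2) _ C ev] assms(3) d(5) by simp
  then show ?thesis using that C ev by blast
qed

lemma tangent_space_of_subset:
  assumes "c \<in> N" "x \<in> fst c"
  shows "tangent_space_of N K x \<subseteq> range (tvec N x c)"
proof
  fix v assume "v \<in> tangent_space_of N K x"
  then obtain \<gamma> where g: "v = velocity N \<gamma>" "smooth_curve_at N x \<gamma>" unfolding tangent_space_of_def by blast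
  show "v \<in> range (tvec N x c)"
    by (rule smooth_curve_velocity[OF g(2) assms]) (simp add: g(1))
qed

text \<open>Every \<open>e\<close> is the velocity of a straight line in the coordinates of the
  chart.\<close>

lemma tangent_space_eq:
  assumes "c \<in> N" "x \<in> fst c"
  shows "tangent_space N x = range (tvec N x c)"
proof
  show "range (tvec N x c) \<subseteq> tangent_space N x"
  proof
    fix v assume "v \<in> range (tvec N x c)"
    then obtain e where e: "v = tvec N x c e" by blast
    define \<gamma> where "\<gamma> = (\<lambda>t. chart_inv c (snd c x + t *\<^sub>R e))"
    have cc: "\<gamma> 0 = x" "((\<lambda>t. snd c (\<gamma> t)) has_vector_derivative e) (at 0)"
      "\<exists>\<epsilon>>0. \<gamma> ` {-\<epsilon><..<\<epsilon>} \<subseteq> fst c \<and> (\<forall>t\<in>{-\<epsilon><..<\<epsilon>}. snd c (\<gamma> t) = snd c x + t *\<^sub>R e)"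
      by (rule chart_curve[OF assms], simp add: \<gamma>_def)+
    obtain \<epsilon> where eps: "\<epsilon> > 0" "\<gamma> ` {-\<epsilon><..<\<epsilon>} \<subseteq> fst c" "\<forall>t\<in>{-\<epsilon><..<\<epsilon>}. snd c (\<gamma> t) = snd c x + t *\<^sub>R e"
      using cc(3) by blast
    have "smooth_on {-\<epsilon><..<\<epsilon>} (\<lambda>t. snd c x + t *\<^sub>R e)"
      by (intro smooth_on_intros) auto
    then have sm: "smooth_on {-\<epsilon><..<\<epsilon>} (\<lambda>t. snd c (\<gamma> t))"
      by (rule smooth_on_cong) (use eps in auto)
    show "v \<in> tangent_space N x" unfolding e
      using eps(2) in_points[OF assms(1)] by (intro tangent_space_ofI[OF assms(1) eps(1) _ sm cc(2,1)]) blast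
  qed
qed (rule tangent_space_of_subset[OF assms])

lemma subspace_tangent_space:
  assumes "x \<in> points N" shows "subspace (tangent_space N x)"
proof -
  obtain c where "c \<in> N" "x \<in> fst c" using assms by (rule pointsE)
  then show ?thesis using tangent_space_eq linear_tvec linear_subspace_image[OF _ subspace_UNIV] by metis
qed

lemma tvec_in_tangent_space: "c \<in> N \<Longrightarrow> x \<in> fst c \<Longrightarrow> tvec N x c e \<in> tangent_space N x"
  by (simp add: tangent_space_eq)

lemma tangent_vector_tvec: "c \<in> N \<Longrightarrow> x \<in> fst c \<Longrightarrow> v \<in> tangent_space N x \<Longrightarrow> v = tvec N x c (v c)"
  by (auto simp: tangent_space_eq tvec_same)

text \<open>\<open>deriv_along\<close> selects its chart by choice; the chain rule through the
  transition map makes the value computable in any chart around \<open>x\<close>.\<close>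

lemma deriv_along_tvec:
  assumes "c \<in> N" "x \<in> fst c" "((h \<circ> chart_inv c) has_derivative D) (at (snd c x))"
  shows "deriv_along N h x (tvec N x c e) = D e"
proof -
  define d where "d = (SOME c. c \<in> N \<and> x \<in> fst c)"
  have d: "d \<in> N" "x \<in> fst d" using someI[of "\<lambda>c. c \<in> N \<and> x \<in> fst c"] assms unfolding d_def by blast+
  let ?T = "frechet_derivative (snd c \<circ> chart_inv d) (at (snd d x))"
  have "((\<lambda>z. (h \<circ> chart_inv c) ((snd c \<circ> chart_inv d) z)) has_derivative (\<lambda>v. D (?T v))) (at (snd d x))"
    by (rule has_derivative_compose[OF transition_derivative[OF d(1) assms(1) d(2) assms(2)]])
      (simp only: comp_def chart_inv_left[OF N d(1,2)] assms(3)[unfolded comp_def])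
  then have "((h \<circ> chart_inv d) has_derivative (\<lambda>v. D (?T v))) (at (snd d x))"
    by (rule has_derivative_transform_within_open[where s="snd d ` (fst d \<inter> fst c)"])
      (use smooth_transition[OF N d(1) assms(1)] assms d in \<open>auto simp: chart_inv_left[OF N]\<close>)
  then have "frechet_derivative (h \<circ> chart_inv d) (at (snd d x)) = (\<lambda>v. D (?T v))"
    using frechet_derivative_at by metis
  then have "deriv_along N h x (tvec N x c e) = D (?T (tvec N x c e d))"
    unfolding deriv_along_def d_def[symmetric] by simp
  also have "?T (tvec N x c e d) = tvec N x d (tvec N x c e d) c"
    using d assms by (simp add: tvec_def)
  also have "\<dots> = e" using tvec_change[OF assms(1) d(1) assms(2) d(2)] tvec_same[OF assms(1,2)] by metis
  finally show ?thesis .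
qed

lemma smooth_fun_local:
  assumes "\<And>x. x \<in> W \<Longrightarrow> \<exists>U. open_in N U \<and> x \<in> U \<and> smooth_fun N U h"
  shows "smooth_fun N W h"
  unfolding smooth_fun_def
proof
  fix c assume c: "c \<in> N"
  show "smooth_on (snd c ` (fst c \<inter> W)) (h \<circ> chart_inv c)"
  proof (rule smooth_on_local)
    fix z assume "z \<in> snd c ` (fst c \<inter> W)"
    then obtain x where x: "z = snd c x" "x \<in> fst c" "x \<in> W" by blast
    obtain U where "open_in N U" "x \<in> U" "smooth_fun N U h" using assms[OF x(3)] by blast
    then show "\<exists>U. open U \<and> z \<in> U \<and> smooth_on U (h \<circ> chart_inv c)"
      using x c open_in_image[of N U c] by (intro exI[of _ "snd c ` (fst c \<inter> U)"]) (auto simp: smooth_fun_def)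
  qed
qed

lemma smooth_fun_cong:
  assumes "smooth_fun N W h" "open_in N W" "\<And>x. x \<in> W \<Longrightarrow> h x = k x"
  shows "smooth_fun N W k"
  unfolding smooth_fun_def
proof
  fix c assume c: "c \<in> N"
  have "smooth_on (snd c ` (fst c \<inter> W)) (h \<circ> chart_inv c)" using assms(1) c by (simp add: smooth_fun_def)
  then show "smooth_on (snd c ` (fst c \<inter> W)) (k \<circ> chart_inv c)"
    by (rule smooth_on_cong[OF _ open_in_image[OF assms(2) c]]) (use assms(3) in \<open>auto simp: chart_inv_left[OF N c]\<close>)
qed

text \<open>The coordinate fields of a chart. The smoothness of g, J and Clifford multiplication is
  assumed in the form of tests on smooth fields, and these are the fields to be inserted.\<close>

lemma smooth_field_tvec:
  assumes "c \<in> N"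
  shows "smooth_field N (fst c) (\<lambda>x. tvec N x c e)"
  unfolding smooth_field_def
proof (intro conjI ballI)
  fix d assume d: "d \<in> N"
  let ?O = "snd d ` (fst d \<inter> fst c)" and ?O' = "snd c ` (fst c \<inter> fst d)"
  have o: "open ?O" "open ?O'" using smooth_transition[OF N d assms] smooth_transition[OF N assms d] by auto
  have "smooth_on ?O' (\<lambda>w. frechet_derivative (snd d \<circ> chart_inv c) (at w) e)"
    using smooth_transition[OF N assms d] smooth_on_frechet_derivative by blast
  moreover have "smooth_on ?O (snd c \<circ> chart_inv d)" using smooth_transition[OF N d assms] by blast
  moreover have "(snd c \<circ> chart_inv d) ` ?O \<subseteq> ?O'" by (auto simp: chart_inv_left[OF N d])
  ultimately have "smooth_on ?O (\<lambda>z. frechet_derivative (snd d \<circ> chart_inv c) (at ((snd c \<circ> chart_inv d) z)) e)"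
    by (rule smooth_on_compose[OF o])
  then show "smooth_on ?O (\<lambda>z. tvec N (chart_inv d z) c e d)"
    by (rule smooth_on_cong[OF _ o(1)]) (auto simp: tvec_def d chart_inv_left[OF N d])
qed (use tvec_in_tangent_space assms in blast)

end

lemma smooth_fun_subset: "smooth_fun N W h \<Longrightarrow> U \<subseteq> W \<Longrightarrow> smooth_fun N U h"
  unfolding smooth_fun_def by (blast intro: smooth_on_subset)

section \<open>Charts of the bundle of oriented planes\<close>

definition vec4 :: "real \<Rightarrow> real \<Rightarrow> real \<Rightarrow> real \<Rightarrow> real ^ 4" where
  "vec4 a b c d = (\<chi> i. if i = 1 then a else if i = 2 then b else if i = 3 then c else d)"

lemma vec4_nth [simp]: "vec4 a b c d $ 1 = a" "vec4 a b c d $ 2 = b" "vec4 a b c d $ 3 = c" "vec4 a b c d $ 4 = d"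
  by (simp_all add: vec4_def)

lemma vec4_eq_iff: "x = y \<longleftrightarrow> x $ 1 = y $ 1 \<and> x $ 2 = y $ 2 \<and> x $ 3 = y $ 3 \<and> x $ 4 = y $ 4" for x y :: "real ^ 4"
  by (simp add: vec_eq_iff forall_4)

lemma smooth_on_vec4:
  assumes "open S" "smooth_on S a" "smooth_on S b" "smooth_on S c" "smooth_on S d"
  shows "smooth_on S (\<lambda>x. vec4 (a x) (b x) (c x) (d x))"
proof (rule smooth_on_vec[OF assms(1)])
  fix i :: 4
  show "smooth_on S (\<lambda>x. vec4 (a x) (b x) (c x) (d x) $ i)"
    using exhaust_4[of i] assms(2-) by auto
qed

lemma has_vector_derivative_vec4:
  assumes "(a has_real_derivative a') (at x)" "(b has_real_derivative b') (at x)"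
    "(c has_real_derivative c') (at x)" "(d has_real_derivative d') (at x)"
  shows "((\<lambda>t. vec4 (a t) (b t) (c t) (d t)) has_vector_derivative vec4 a' b' c' d') (at x)"
proof -
  have v: "vec4 a b c d = a *\<^sub>R axis 1 1 + b *\<^sub>R axis 2 1 + c *\<^sub>R axis 3 1 + d *\<^sub>R axis 4 1" for a b c d
    by (simp add: vec4_eq_iff axis_def)
  show ?thesis unfolding v using assms by (auto intro!: derivative_eq_intros)
qed

definition bcomb :: "(real ^ 4) list \<Rightarrow> real ^ 4 \<Rightarrow> real ^ 4" where
  "bcomb B a = (a $ 1) *\<^sub>R (B ! 0) + (a $ 2) *\<^sub>R (B ! 1) + (a $ 3) *\<^sub>R (B ! 2) + (a $ 4) *\<^sub>R (B ! 3)"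

definition bcoord :: "(real ^ 4) list \<Rightarrow> real ^ 4 \<Rightarrow> real ^ 4" where
  "bcoord B = inv_into UNIV (bcomb B)"

lemma linear_bcomb: "linear (bcomb B)"
  by (rule linearI) (simp_all add: bcomb_def algebra_simps)

lemma basis_list_UNIV_length: "basis_list B (UNIV :: (real ^ 4) set) \<Longrightarrow> length B = 4"
  using basis_list_length_dim[of B UNIV] by simp

lemma bij_bcomb:
  assumes "basis_list B UNIV" shows "bij (bcomb B)"
proof -
  have l: "length B = 4" using basis_list_UNIV_length[OF assms] .
  have r: "{..<4::nat} = {0, 1, 2, 3}" by auto
  have "inj (bcomb B)"
    unfolding linear_injective_0[OF linear_bcomb]
  proof (intro allI impI)
    fix a assume "bcomb B a = 0"
    define C where "C j = (if j = 0 then a $ 1 else if j = 1 then a $ 2 else if j = 2 then a $ 3 else a $ 4)" for j :: nat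
    have "(\<Sum>j<length B. C j *\<^sub>R B ! j) = 0"
      using \<open>bcomb B a = 0\<close> by (simp add: C_def l r bcomb_def add.assoc)
    moreover have "\<forall>c. (\<Sum>j<length B. c j *\<^sub>R B ! j) = 0 \<longrightarrow> (\<forall>j<length B. c j = 0)"
      using independent_list_iff[of B] assms by (simp only: basis_list_def simp_thms)
    ultimately have "\<forall>j<length B. C j = 0" by blast
    from this[rule_format, of 0] this[rule_format, of 1] this[rule_format, of 2] this[rule_format, of 3]
    show "a = 0" by (simp add: C_def l vec4_eq_iff)
  qed
  then show ?thesis using linear_inj_imp_surj[OF linear_bcomb] by (simp add: bij_def)
qed

lemma bcoord_bcomb: "basis_list B UNIV \<Longrightarrow> bcoord B (bcomb B a) = a"
  by (simp add: bcoord_def bij_bcomb bij_is_inj)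

lemma bcomb_bcoord: "basis_list B UNIV \<Longrightarrow> bcomb B (bcoord B v) = v"
  by (simp add: bcoord_def bij_bcomb bij_is_surj surj_f_inv_f)

lemma linear_bcoord:
  assumes "basis_list B UNIV" shows "linear (bcoord B)"
proof (rule linearI)
  show "bcoord B (u + v) = bcoord B u + bcoord B v" for u v
    by (rule injD[OF bij_is_inj[OF bij_bcomb[OF assms]]])
      (simp add: bcomb_bcoord[OF assms] linear_add[OF linear_bcomb])
  show "bcoord B (r *\<^sub>R v) = r *\<^sub>R bcoord B v" for r v
    by (rule injD[OF bij_is_inj[OF bij_bcomb[OF assms]]])
      (simp add: bcomb_bcoord[OF assms] linear_cmul[OF linear_bcomb])
qed

lemma bcoord_basis:
  assumes "basis_list B UNIV"
  shows "bcoord B (B ! 0) = vec4 1 0 0 0" "bcoord B (B ! 1) = vec4 0 1 0 0"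
    "bcoord B (B ! 2) = vec4 0 0 1 0" "bcoord B (B ! 3) = vec4 0 0 0 1"
proof -
  have "bcomb B (vec4 1 0 0 0) = B ! 0" "bcomb B (vec4 0 1 0 0) = B ! 1"
    "bcomb B (vec4 0 0 1 0) = B ! 2" "bcomb B (vec4 0 0 0 1) = B ! 3" by (simp_all add: bcomb_def)
  then show "bcoord B (B ! 0) = vec4 1 0 0 0" "bcoord B (B ! 1) = vec4 0 1 0 0"
    "bcoord B (B ! 2) = vec4 0 0 1 0" "bcoord B (B ! 3) = vec4 0 0 0 1"
    by (metis bcoord_bcomb[OF assms])+
qed

section \<open>Slopes of oriented planes\<close>

definition plane_minor :: "real ^ 4 \<Rightarrow> real ^ 4 \<Rightarrow> real" where
  "plane_minor a b = a $ 1 * b $ 2 - a $ 2 * b $ 1"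

text \<open>Cramer's rule: the plane spanned by \<open>a\<close>, \<open>b\<close> is a graph over
  the first two coordinates with these slopes. The denominator is its Pluecker coordinate for that
  projection.\<close>

definition plane_coords :: "real ^ 4 \<Rightarrow> real ^ 4 \<Rightarrow> real ^ 4" where
  "plane_coords a b = vec4
     ((b $ 2 * a $ 3 - a $ 2 * b $ 3) / plane_minor a b) ((b $ 2 * a $ 4 - a $ 2 * b $ 4) / plane_minor a b)
     ((a $ 1 * b $ 3 - b $ 1 * a $ 3) / plane_minor a b) ((a $ 1 * b $ 4 - b $ 1 * a $ 4) / plane_minor a b)"

definition graph_fst :: "real ^ 4 \<Rightarrow> real ^ 4" where "graph_fst q = vec4 1 0 (q $ 1) (q $ 2)"
definition graph_snd :: "real ^ 4 \<Rightarrow> real ^ 4" where "graph_snd q = vec4 0 1 (q $ 3) (q $ 4)"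

lemma graph_plane_bcomb: "graph_plane B q = orient_class [bcomb B (graph_fst q), bcomb B (graph_snd q)]"
  by (simp add: graph_plane_def bcomb_def graph_fst_def graph_snd_def)

text \<open>The graph vectors have first two coordinates (1, 0) and (0, 1), so the base change from
  them to \<open>u\<close>, \<open>v\<close> can be read off from the first two coordinates of the
  latter, and its determinant is \<open>plane_minor\<close>.\<close>

lemma orient_class_eq_graph_plane:
  assumes "basis_list B UNIV"
  shows "orient_class [u, v] = graph_plane B q \<longleftrightarrow>
    plane_minor (bcoord B u) (bcoord B v) > 0 \<and> q = plane_coords (bcoord B u) (bcoord B v)" (is "?L \<longleftrightarrow> ?R")
proof -
  define a b where "a = bcoord B u" and "b = bcoord B v"
  have uv: "u = bcomb B a" "v = bcomb B b" by (simp_all add: a_def b_def bcomb_bcoord assms)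
  have inj: "bcomb B x = bcomb B y \<longleftrightarrow> x = y" for x y
    using bij_bcomb[OF assms] by (simp add: bij_def inj_eq)
  have "?L \<longleftrightarrow> [u, v] \<in> orient_class [bcomb B (graph_fst q), bcomb B (graph_snd q)]"
    by (simp add: graph_plane_bcomb orient_class_eq_iff)
  also have "\<dots> \<longleftrightarrow> (\<exists>p r s t. u = p *\<^sub>R bcomb B (graph_fst q) + r *\<^sub>R bcomb B (graph_snd q) \<and>
      v = s *\<^sub>R bcomb B (graph_fst q) + t *\<^sub>R bcomb B (graph_snd q) \<and> p * t - r * s > 0)"
    unfolding orient_class_pair by auto
  also have "\<dots> \<longleftrightarrow> (\<exists>p r s t. a = p *\<^sub>R graph_fst q + r *\<^sub>R graph_snd q \<and>
      b = s *\<^sub>R graph_fst q + t *\<^sub>R graph_snd q \<and> p * t - r * s > 0)"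
    unfolding uv linear_cmul[OF linear_bcomb, symmetric] linear_add[OF linear_bcomb, symmetric] inj ..
  also have "\<dots> \<longleftrightarrow> plane_minor a b > 0 \<and> q = plane_coords a b"
  proof
    assume "\<exists>p r s t. a = p *\<^sub>R graph_fst q + r *\<^sub>R graph_snd q \<and>
      b = s *\<^sub>R graph_fst q + t *\<^sub>R graph_snd q \<and> p * t - r * s > 0"
    then obtain p r s t where *: "a = p *\<^sub>R graph_fst q + r *\<^sub>R graph_snd q"
      "b = s *\<^sub>R graph_fst q + t *\<^sub>R graph_snd q" "p * t - r * s > 0" by blast
    then have "plane_minor a b = p * t - r * s" by (simp add: plane_minor_def graph_fst_def graph_snd_def)
    moreover from this have "q = plane_coords a b"
      unfolding vec4_eq_iff plane_coords_def vec4_nth using *(3)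
      by (simp add: nonzero_eq_divide_eq) (simp add: *(1,2) graph_fst_def graph_snd_def algebra_simps)
    ultimately show "plane_minor a b > 0 \<and> q = plane_coords a b" using *(3) by simp
  next
    assume *: "plane_minor a b > 0 \<and> q = plane_coords a b"
    have "a = a $ 1 *\<^sub>R graph_fst q + a $ 2 *\<^sub>R graph_snd q \<and>
      b = b $ 1 *\<^sub>R graph_fst q + b $ 2 *\<^sub>R graph_snd q"
      using * unfolding vec4_eq_iff by (simp add: graph_fst_def graph_snd_def plane_coords_def)
        (simp add: field_simps, simp add: plane_minor_def algebra_simps)
    then show "\<exists>p r s t. a = p *\<^sub>R graph_fst q + r *\<^sub>R graph_snd q \<and>
      b = s *\<^sub>R graph_fst q + t *\<^sub>R graph_snd q \<and> p * t - r * s > 0"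
      using * unfolding plane_minor_def by blast
  qed
  finally show ?thesis by (simp add: a_def b_def)
qed

lemma smooth_plane_coords:
  assumes "open S" "smooth_on S a" "smooth_on S b" "\<And>x. x \<in> S \<Longrightarrow> plane_minor (a x) (b x) > 0"
  shows "smooth_on S (\<lambda>x. plane_coords (a x) (b x))"
  unfolding plane_coords_def
proof -
  have n: "plane_minor (a x) (b x) \<noteq> 0" if "x \<in> S" for x using assms(4)[OF that] by simp
  have m: "smooth_on S (\<lambda>x. plane_minor (a x) (b x))"
    unfolding plane_minor_def by (intro smooth_on_intros assms)
  show "smooth_on S (\<lambda>x. vec4
     ((b x $ 2 * a x $ 3 - a x $ 2 * b x $ 3) / plane_minor (a x) (b x)) ((b x $ 2 * a x $ 4 - a x $ 2 * b x $ 4) / plane_minor (a x) (b x))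
     ((a x $ 1 * b x $ 3 - b x $ 1 * a x $ 3) / plane_minor (a x) (b x)) ((a x $ 1 * b x $ 4 - b x $ 1 * a x $ 4) / plane_minor (a x) (b x)))"
    by (intro smooth_on_vec4 smooth_on_divide[OF _ _ m] smooth_on_diff smooth_on_mult smooth_on_nth assms(1-3) n)
qed

text \<open>At the standard plane the minor is 1, and only the last two coordinates of
  \<open>a'\<close>, \<open>b'\<close> survive: a velocity of planes is a homomorphism modulo the
  plane itself.\<close>

lemma plane_coords_derivative:
  assumes "(a has_vector_derivative a') (at t)" "(b has_vector_derivative b') (at t)"
    "a t = vec4 1 0 0 0" "b t = vec4 0 1 0 0"
  shows "((\<lambda>t. plane_coords (a t) (b t)) has_vector_derivative vec4 (a' $ 3) (a' $ 4) (b' $ 3) (b' $ 4)) (at t)"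
proof -
  have a: "((\<lambda>t. a t $ i) has_real_derivative a' $ i) (at t)" and b: "((\<lambda>t. b t $ i) has_real_derivative b' $ i) (at t)" for i
    using bounded_linear.has_vector_derivative[OF bounded_linear_vec_nth assms(1)]
      bounded_linear.has_vector_derivative[OF bounded_linear_vec_nth assms(2)]
    by (simp_all add: has_real_derivative_iff_has_vector_derivative)
  show ?thesis unfolding plane_coords_def plane_minor_def
    by (intro has_vector_derivative_vec4) (auto intro!: derivative_eq_intros a b simp: assms(3,4))
qed

lemma plane_coords_graph: "plane_coords (graph_fst q) (graph_snd q) = q" "plane_minor (graph_fst q) (graph_snd q) = 1"
  by (simp_all add: plane_coords_def plane_minor_def graph_fst_def graph_snd_def vec4_eq_iff)

text \<open>Multiplying a relation by the minor isolates each coefficient, again as in Cramer's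
  rule.\<close>

lemma plane_minor_independent:
  assumes "plane_minor (bcoord B u) (bcoord B v) \<noteq> 0" "basis_list B UNIV"
  shows "u \<noteq> v \<and> independent {u, v}"
  unfolding independent_pair
proof (intro allI impI)
  fix x y assume "x *\<^sub>R u + y *\<^sub>R v = 0"
  then have "bcoord B (x *\<^sub>R u + y *\<^sub>R v) = 0" by (simp add: linear_0[OF linear_bcoord[OF assms(2)]])
  then have "x *\<^sub>R bcoord B u + y *\<^sub>R bcoord B v = 0"
    by (simp add: linear_add[OF linear_bcoord[OF assms(2)]] linear_cmul[OF linear_bcoord[OF assms(2)]])
  then have e: "x * bcoord B u $ 1 + y * bcoord B v $ 1 = 0" "x * bcoord B u $ 2 + y * bcoord B v $ 2 = 0"
    by (simp_all add: vec4_eq_iff)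
  have "x * plane_minor (bcoord B u) (bcoord B v) = bcoord B v $ 2 * (x * bcoord B u $ 1 + y * bcoord B v $ 1)
      - bcoord B v $ 1 * (x * bcoord B u $ 2 + y * bcoord B v $ 2)"
    "y * plane_minor (bcoord B u) (bcoord B v) = bcoord B u $ 1 * (x * bcoord B u $ 2 + y * bcoord B v $ 2)
      - bcoord B u $ 2 * (x * bcoord B u $ 1 + y * bcoord B v $ 1)"
    by (simp_all add: plane_minor_def algebra_simps)
  then have "x * plane_minor (bcoord B u) (bcoord B v) = 0" "y * plane_minor (bcoord B u) (bcoord B v) = 0"
    unfolding e by simp_all
  then show "x = 0 \<and> y = 0" using assms(1) by simp
qed

lemma basis_list4I:
  fixes a b c d :: "real ^ 4"
  assumes "a \<noteq> b" "independent {a, b}" "c \<notin> span {a, b}" "d \<notin> span {a, b, c}"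
  shows "basis_list [a, b, c, d] UNIV"
proof -
  have s: "{a, b} \<subseteq> span {a, b}" "{a, b, c} \<subseteq> span {a, b, c}" by (simp_all add: span_superset)
  have dist: "distinct [a, b, c, d]" using assms s by auto
  have "independent {c, a, b}" by (rule independent_insertI[OF assms(3,2)])
  then have "independent {a, b, c}" by (simp add: insert_commute)
  then have i: "independent {d, a, b, c}" by (rule independent_insertI[OF assms(4)])
  have "card {d, a, b, c} = 4" using dist by auto
  then have "UNIV \<subseteq> span {d, a, b, c}" by (intro card_ge_dim_independent i) auto
  then show ?thesis using dist i by (auto simp: basis_list_def insert_commute)
qed

lemma extend_basis4:
  fixes a b :: "real ^ 4"
  assumes "a \<noteq> b" "independent {a, b}"
  obtains c d where "basis_list [a, b, c, d] UNIV"
proof -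
  have "dim {a, b} \<le> card {a, b}" by (rule dim_le_card') simp
  then have "dim (span {a, b}) < dim (UNIV :: (real ^ 4) set)" using card_2_iff[of "{a,b}"] by (simp add: card_insert_if split: if_splits)
  then obtain c where c: "c \<notin> span {a, b}" by (metis UNIV_eq_I less_irrefl)
  have "dim {a, b, c} \<le> card {a, b, c}" by (rule dim_le_card') simp
  moreover have "card {a, b, c} \<le> 3" by (simp add: card_insert_if)
  ultimately have "dim (span {a, b, c}) < dim (UNIV :: (real ^ 4) set)" by simp
  then obtain d where "d \<notin> span {a, b, c}" by (metis UNIV_eq_I less_irrefl)
  then show ?thesis using that basis_list4I[OF assms c] by blast
qed

lemma plane_components_pair: "plane_components c (orient_class [u, v]) = orient_class [u c, v c]"
proof -
  have "linear (\<lambda>v::('a, real ^ 4) tangent. v c)" by (rule linearI) (auto simp: scaleR_fun_def)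
  from orient_class_map_linear[OF this, of "[u, v]"] show ?thesis
    by (simp add: plane_components_def)
qed

definition frame_point :: "('a, real ^ 4) manifold \<Rightarrow> 'a \<Rightarrow> ('a, real ^ 4) chart \<Rightarrow> real ^ 4 \<Rightarrow> real ^ 4 \<Rightarrow> 'a plane_point" where
  "frame_point M y c a b = (y, orient_class [tvec M y c a, tvec M y c b])"

lemma fst_frame_point [simp]: "fst (frame_point M y c a b) = y" by (simp add: frame_point_def)

definition pchart_inv :: "('a, real ^ 4) manifold \<Rightarrow> ('a, real ^ 4) chart \<Rightarrow> (real ^ 4) list \<Rightarrow> (real ^ 4) \<times> (real ^ 4) \<Rightarrow> 'a plane_point" where
  "pchart_inv M c B = (\<lambda>(z, q). frame_point M (chart_inv c z) c (bcomb B (graph_fst q)) (bcomb B (graph_snd q)))"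

lemma linear_inj_independent_pair:
  assumes "linear f" "inj f"
  shows "(f u \<noteq> f v \<and> independent {f u, f v}) \<longleftrightarrow> (u \<noteq> v \<and> independent {u, v})"
proof -
  have "p *\<^sub>R f u + q *\<^sub>R f v = 0 \<longleftrightarrow> p *\<^sub>R u + q *\<^sub>R v = 0" for p q
  proof -
    have "p *\<^sub>R f u + q *\<^sub>R f v = f (p *\<^sub>R u + q *\<^sub>R v)"
      by (simp add: linear_add[OF assms(1)] linear_cmul[OF assms(1)])
    then show ?thesis using assms(2) linear_0[OF assms(1)] by (metis injD)
  qed
  then show ?thesis unfolding independent_pair by simp
qed

lemma linear_graph_affine:
  assumes "open S" "smooth_on S q"
  shows "smooth_on S (\<lambda>x. graph_fst (q x))" "smooth_on S (\<lambda>x. graph_snd (q x))"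
  unfolding graph_fst_def graph_snd_def by (intro smooth_on_vec4 smooth_on_const smooth_on_nth assms)+

text \<open>Expansion in the basis reduces a varying argument to fixed ones. The index passes
  through \<open>p\<close>, so that \<open>F\<close> may be parametrized by points of a manifold and
  not only by coordinates.\<close>

lemma smooth_on_linear_family:
  fixes F :: "'x \<Rightarrow> 'f::euclidean_space \<Rightarrow> 'g::euclidean_space" and p :: "'d::euclidean_space \<Rightarrow> 'x"
  assumes "open S" "\<And>s. s \<in> S \<Longrightarrow> linear (F (p s))" "\<And>b. b \<in> Basis \<Longrightarrow> smooth_on S (\<lambda>s. F (p s) b)"
    "smooth_on S w"
  shows "smooth_on S (\<lambda>s. F (p s) (w s))"
proof -
  have "smooth_on S (\<lambda>s. \<Sum>b\<in>Basis. (w s \<bullet> b) *\<^sub>R F (p s) b)"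
    by (intro smooth_on_sum smooth_on_scaleR assms(1,3) smooth_on_linear[OF assms(1) _ assms(4), where L="\<lambda>v. v \<bullet> _"])
      (auto intro!: linearI simp: inner_left_distrib)
  then show ?thesis
  proof (rule smooth_on_cong[OF _ assms(1)])
    fix s assume "s \<in> S"
    then have l: "linear (F (p s))" by (rule assms(2))
    have "F (p s) (w s) = F (p s) (\<Sum>b\<in>Basis. (w s \<bullet> b) *\<^sub>R b)" by (simp add: euclidean_representation)
    then show "(\<Sum>b\<in>Basis. (w s \<bullet> b) *\<^sub>R F (p s) b) = F (p s) (w s)"
      by (simp add: linear_sum[OF l] linear_cmul[OF l])
  qed
qed

context
  fixes M :: "('a, real ^ 4) manifold"
  assumes M: "smooth_atlas M"
begin

lemma inj_tvec: "c \<in> M \<Longrightarrow> y \<in> fst c \<Longrightarrow> inj (tvec M y c)"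
  by (rule injI) (simp add: tvec_inj[OF M])

lemma oriented_planes_tangent:
  assumes "c \<in> M" "y \<in> fst c"
  shows "T \<in> oriented_planes (tangent_space M y) \<longleftrightarrow>
    (\<exists>a b. T = orient_class [tvec M y c a, tvec M y c b] \<and> a \<noteq> b \<and> independent {a, b})"
proof -
  have "T \<in> oriented_planes (tangent_space M y) \<longleftrightarrow> (\<exists>u v. T = orient_class [u, v] \<and>
      u \<in> range (tvec M y c) \<and> v \<in> range (tvec M y c) \<and> u \<noteq> v \<and> independent {u, v})"
    unfolding oriented_planes_def tangent_space_eq[OF M assms] by blast
  also have "\<dots> \<longleftrightarrow> (\<exists>a b. T = orient_class [tvec M y c a, tvec M y c b] \<and> tvec M y c a \<noteq> tvec M y c b \<and> independent {tvec M y c a, tvec M y c b})"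
    by blast
  also have "\<dots> \<longleftrightarrow> (\<exists>a b. T = orient_class [tvec M y c a, tvec M y c b] \<and> a \<noteq> b \<and> independent {a, b})"
    unfolding linear_inj_independent_pair[OF linear_tvec[OF M assms] inj_tvec[OF assms]] ..
  finally show ?thesis .
qed

lemma plane_components_frame:
  assumes "c \<in> M" "y \<in> fst c"
  shows "plane_components c (orient_class [tvec M y c a, tvec M y c b]) = orient_class [a, b]"
  by (simp add: plane_components_pair tvec_same[OF M assms])

lemma frame_point_in_chart:
  assumes "c \<in> M" "y \<in> fst c" "basis_list B UNIV"
  shows "frame_point M y c a b \<in> fst (plane_chart M c B) \<longleftrightarrow> plane_minor (bcoord B a) (bcoord B b) > 0"
  using plane_minor_independent[OF _ assms(3), of a b] assms
  by (auto simp: frame_point_def plane_chart_def plane_components_frame orient_class_eq_graph_plane oriented_planes_tangent) blast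

lemma frame_point_coords:
  assumes "c \<in> M" "y \<in> fst c" "basis_list B UNIV" "plane_minor (bcoord B a) (bcoord B b) > 0"
  shows "snd (plane_chart M c B) (frame_point M y c a b) = (snd c y, plane_coords (bcoord B a) (bcoord B b))"
  using assms by (simp add: frame_point_def plane_chart_def plane_components_frame orient_class_eq_graph_plane)

lemma frame_point_eq:
  assumes "c \<in> M" "y \<in> fst c" "orient_class [a, b] = orient_class [a', b']"
  shows "frame_point M y c a b = frame_point M y c a' b'"
proof -
  have "orient_class [tvec M y c a, tvec M y c b] = map (tvec M y c) ` orient_class [a, b]" for a b
    using orient_class_map_linear[OF linear_tvec[OF M assms(1,2)], of "[a, b]"] by simp
  then show ?thesis using assms(3) by (simp add: frame_point_def)
qed

lemma plane_chart_point:
  assumes "c \<in> M" "basis_list B UNIV" "x \<in> fst (plane_chart M c B)"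
  obtains q where "fst x \<in> fst c" "x = pchart_inv M c B (snd c (fst x), q)"
    "snd (plane_chart M c B) x = (snd c (fst x), q)"
    "x = frame_point M (fst x) c (bcomb B (graph_fst q)) (bcomb B (graph_snd q))"
proof -
  obtain y T where x: "x = (y, T)" by (cases x)
  have y: "y \<in> fst c" "T \<in> oriented_planes (tangent_space M y)" and "\<exists>q. plane_components c T = graph_plane B q"
    using assms(3) by (auto simp: plane_chart_def x)
  then obtain q a b where T: "T = orient_class [tvec M y c a, tvec M y c b]" "orient_class [a, b] = graph_plane B q"
    using oriented_planes_tangent[OF assms(1) y(1)] plane_components_frame[OF assms(1) y(1)] by metis
  let ?u = "bcomb B (graph_fst q)" and ?v = "bcomb B (graph_snd q)"
  have *: "x = frame_point M y c ?u ?v"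
    using frame_point_eq[OF assms(1) y(1) T(2)[unfolded graph_plane_bcomb]] by (simp add: x T frame_point_def)
  have "snd (plane_chart M c B) x = (snd c y, q)"
    unfolding * using frame_point_coords[OF assms(1) y(1) assms(2), of ?u ?v]
    by (simp add: bcoord_bcomb[OF assms(2)] plane_coords_graph)
  then show ?thesis using that[of q] * y(1) by (simp add: x pchart_inv_def chart_inv_left[OF M assms(1)])
qed

lemma pchart_inv_in:
  assumes "c \<in> M" "basis_list B UNIV" "z \<in> snd c ` fst c"
  shows "pchart_inv M c B (z, q) \<in> fst (plane_chart M c B)" "snd (plane_chart M c B) (pchart_inv M c B (z, q)) = (z, q)"
  using frame_point_in_chart[OF assms(1) chart_inv_in[OF assms(3)] assms(2), of "bcomb B (graph_fst q)" "bcomb B (graph_snd q)"]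
    frame_point_coords[OF assms(1) chart_inv_in[OF assms(3)] assms(2), of "bcomb B (graph_fst q)" "bcomb B (graph_snd q)"]
  by (simp_all add: pchart_inv_def bcoord_bcomb[OF assms(2)] plane_coords_graph chart_inv_right[OF assms(3)])

lemma plane_chart_image:
  assumes "c \<in> M" "basis_list B UNIV"
  shows "snd (plane_chart M c B) ` fst (plane_chart M c B) = snd c ` fst c \<times> UNIV"
proof (intro equalityI subsetI)
  fix p assume "p \<in> snd (plane_chart M c B) ` fst (plane_chart M c B)"
  then obtain x where x: "x \<in> fst (plane_chart M c B)" "p = snd (plane_chart M c B) x" by blast
  show "p \<in> snd c ` fst c \<times> UNIV" by (rule plane_chart_point[OF assms x(1)]) (simp add: x(2))
next
  fix p assume "p \<in> snd c ` fst c \<times> (UNIV :: (real ^ 4) set)"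
  then show "p \<in> snd (plane_chart M c B) ` fst (plane_chart M c B)"
    using pchart_inv_in[OF assms, of "fst p" "snd p"] by (metis imageI mem_Times_iff prod.collapse)
qed

lemma inj_plane_chart:
  assumes "c \<in> M" "basis_list B UNIV"
  shows "inj_on (snd (plane_chart M c B)) (fst (plane_chart M c B))"
proof (rule inj_on_inverseI[where g = "pchart_inv M c B"])
  fix x assume x: "x \<in> fst (plane_chart M c B)"
  show "pchart_inv M c B (snd (plane_chart M c B) x) = x"
    by (rule plane_chart_point[OF assms x]) simp
qed

lemma chart_inv_plane_chart:
  assumes "c \<in> M" "basis_list B UNIV" "z \<in> snd c ` fst c"
  shows "chart_inv (plane_chart M c B) (z, q) = pchart_inv M c B (z, q)"
  using inv_into_f_f[OF inj_plane_chart[OF assms(1,2)] pchart_inv_in(1)[OF assms]] pchart_inv_in(2)[OF assms]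
  by (simp add: chart_inv_def)

lemma tvec_transition:
  assumes "c \<in> M" "d \<in> M" "y \<in> fst c" "y \<in> fst d"
  shows "frame_point M y c a b = frame_point M y d (tvec M y c a d) (tvec M y c b d)"
  unfolding frame_point_def using tvec_change[OF M assms] by metis

text \<open>\<open>P\<close> carries a graph vector through the derivative of the transition map of
  M and reads it relative to \<open>B'\<close>. The plane lies in the second chart exactly where the
  minor of the two carried vectors is positive, and its new coordinates are their slopes.\<close>

lemma plane_chart_overlap:
  assumes "c \<in> M" "d \<in> M" "basis_list B UNIV" "basis_list B' UNIV"
  defines "P \<equiv> \<lambda>w p. bcoord B' (frechet_derivative (snd d \<circ> chart_inv c) (at (fst p)) (bcomb B (w (snd p))))"
  shows "snd (plane_chart M c B) ` (fst (plane_chart M c B) \<inter> fst (plane_chart M d B')) =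
     {p \<in> snd c ` (fst c \<inter> fst d) \<times> UNIV. plane_minor (P graph_fst p) (P graph_snd p) > 0}" (is ?A)
    and "p \<in> snd c ` (fst c \<inter> fst d) \<times> UNIV \<Longrightarrow> plane_minor (P graph_fst p) (P graph_snd p) > 0 \<Longrightarrow> snd (plane_chart M d B') (chart_inv (plane_chart M c B) p) =
       (snd d (chart_inv c (fst p)), plane_coords (P graph_fst p) (P graph_snd p))"
proof -
  have key: "pchart_inv M c B p \<in> fst (plane_chart M d B') \<longleftrightarrow> plane_minor (P graph_fst p) (P graph_snd p) > 0"
    "plane_minor (P graph_fst p) (P graph_snd p) > 0 \<Longrightarrow>
     snd (plane_chart M d B') (pchart_inv M c B p) = (snd d (chart_inv c (fst p)), plane_coords (P graph_fst p) (P graph_snd p))"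
    if p: "p \<in> snd c ` (fst c \<inter> fst d) \<times> UNIV" for p
  proof -
    obtain y where y: "y \<in> fst c" "y \<in> fst d" "fst p = snd c y" using p by auto
    have ci: "chart_inv c (fst p) = y" using y by (simp add: chart_inv_left[OF M assms(1)])
    have P: "P w p = bcoord B' (tvec M y c (bcomb B (w (snd p))) d)" for w
      using y assms(2) by (simp add: P_def tvec_def)
    have "pchart_inv M c B p = frame_point M y c (bcomb B (graph_fst (snd p))) (bcomb B (graph_snd (snd p)))"
      by (simp add: pchart_inv_def ci case_prod_beta)
    then have f: "pchart_inv M c B p = frame_point M y d (tvec M y c (bcomb B (graph_fst (snd p))) d) (tvec M y c (bcomb B (graph_snd (snd p))) d)"
      using tvec_transition[OF assms(1,2) y(1,2)] by simp
    show "pchart_inv M c B p \<in> fst (plane_chart M d B') \<longleftrightarrow> plane_minor (P graph_fst p) (P graph_snd p) > 0"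
      unfolding f P using frame_point_in_chart[OF assms(2) y(2) assms(4)] .
    assume "plane_minor (P graph_fst p) (P graph_snd p) > 0"
    then show "snd (plane_chart M d B') (pchart_inv M c B p) = (snd d (chart_inv c (fst p)), plane_coords (P graph_fst p) (P graph_snd p))"
      unfolding f P ci using frame_point_coords[OF assms(2) y(2) assms(4)] by blast
  qed
  let ?L = "snd (plane_chart M c B) ` (fst (plane_chart M c B) \<inter> fst (plane_chart M d B'))"
  let ?R = "{p \<in> snd c ` (fst c \<inter> fst d) \<times> UNIV. plane_minor (P graph_fst p) (P graph_snd p) > 0}"
  show "?L = ?R"
  proof (intro equalityI subsetI)
    fix p assume "p \<in> ?L"
    then obtain x where x: "x \<in> fst (plane_chart M c B)" "x \<in> fst (plane_chart M d B')" "p = snd (plane_chart M c B) x" by blast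
    obtain q where q: "fst x \<in> fst c" "x = pchart_inv M c B (snd c (fst x), q)"
      "snd (plane_chart M c B) x = (snd c (fst x), q)"
      by (rule plane_chart_point[OF assms(1,3) x(1)]) blast
    have xd: "fst x \<in> fst d" using x(2) by (auto simp: plane_chart_def)
    have p: "p = (snd c (fst x), q)" using x(3) q(3) by simp
    then have pp: "p \<in> snd c ` (fst c \<inter> fst d) \<times> UNIV" using q(1) xd by auto
    moreover have "pchart_inv M c B p \<in> fst (plane_chart M d B')" using p q(2) x(2) by simp
    ultimately show "p \<in> ?R" using key(1) by blast
  next
    fix p assume p: "p \<in> ?R"
    have z: "fst p \<in> snd c ` fst c" using p by auto
    show "p \<in> ?L"
      using pchart_inv_in[OF assms(1,3) z, of "snd p"] key(1)[of p] p by (auto intro!: image_eqI[of _ _ "pchart_inv M c B p"])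
  qed
  show "p \<in> snd c ` (fst c \<inter> fst d) \<times> UNIV \<Longrightarrow> plane_minor (P graph_fst p) (P graph_snd p) > 0 \<Longrightarrow> snd (plane_chart M d B') (chart_inv (plane_chart M c B) p) =
       (snd d (chart_inv c (fst p)), plane_coords (P graph_fst p) (P graph_snd p))"
    using key(2)[of p] chart_inv_plane_chart[OF assms(1,3), of "fst p" "snd p"] by auto
qed

text \<open>A transition map pairs one of M with slopes that are rational in the entries of its
  derivative; positivity of the minor makes the overlap open and the denominators nonzero.\<close>

lemma smooth_atlas_plane_bundle: "smooth_atlas (plane_bundle M)"
  unfolding smooth_atlas_def
proof (intro conjI ballI)
  fix c' assume "c' \<in> plane_bundle M"
  then obtain c B where c: "c' = plane_chart M c B" "c \<in> M" "basis_list B UNIV" by (auto simp: plane_bundle_def)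
  show "inj_on (snd c') (fst c')" unfolding c(1) using inj_plane_chart c by blast
  show "open (snd c' ` fst c')" unfolding c(1)
    using plane_chart_image c open_chart_image[OF M] by (simp add: open_Times)
  fix d' assume "d' \<in> plane_bundle M"
  then obtain d B' where d: "d' = plane_chart M d B'" "d \<in> M" "basis_list B' UNIV" by (auto simp: plane_bundle_def)
  define P where "P w p = bcoord B' (frechet_derivative (snd d \<circ> chart_inv c) (at (fst p)) (bcomb B (w (snd p))))"
    for w and p :: "(real ^ 4) \<times> (real ^ 4)"
  let ?O = "snd c ` (fst c \<inter> fst d)"
  let ?S = "?O \<times> (UNIV :: (real ^ 4) set)" let ?R = "{p \<in> ?S. plane_minor (P graph_fst p) (P graph_snd p) > 0}"
  have O: "open ?O" "smooth_on ?O (snd d \<circ> chart_inv c)" using smooth_transition[OF M c(2) d(2)] by auto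
  have S: "open ?S" using O(1) by (simp add: open_Times)
  have fs: "smooth_on ?S fst" "smooth_on ?S snd" by (intro smooth_on_linear' S linear_fst linear_snd)+
  have P: "smooth_on ?S (P w)" if w: "smooth_on ?S (\<lambda>p. w (snd p))" for w
  proof -
    have "smooth_on ?S (\<lambda>p. frechet_derivative (snd d \<circ> chart_inv c) (at (fst p)) (bcomb B (w (snd p))))"
    proof (rule smooth_on_linear_family[where F="\<lambda>z. frechet_derivative (snd d \<circ> chart_inv c) (at z)" and p=fst, OF S])
      show "linear (frechet_derivative (snd d \<circ> chart_inv c) (at (fst p)))" if "p \<in> ?S" for p
        using smooth_on_differentiable[OF O(2)] that by (intro linear_frechet_derivative) auto
      show "smooth_on ?S (\<lambda>p. frechet_derivative (snd d \<circ> chart_inv c) (at (fst p)) b)" for b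
        by (rule smooth_on_compose[OF S O(1) smooth_on_frechet_derivative[OF O(2)] fs(1)]) auto
      show "smooth_on ?S (\<lambda>p. bcomb B (w (snd p)))" by (rule smooth_on_linear[OF S linear_bcomb w])
    qed
    then show ?thesis unfolding P_def by (rule smooth_on_linear[OF S linear_bcoord[OF d(3)]])
  qed
  note PP = P[OF linear_graph_affine(1)[OF S fs(2)]] P[OF linear_graph_affine(2)[OF S fs(2)]]
  have "continuous_on ?S (\<lambda>p. plane_minor (P graph_fst p) (P graph_snd p))"
    unfolding plane_minor_def by (intro smooth_on_continuous_on smooth_on_intros S PP)
  then have "open (?S \<inter> (\<lambda>p. plane_minor (P graph_fst p) (P graph_snd p)) -` {0<..})"
    by (rule continuous_open_preimage[OF _ S]) simp
  also have "?S \<inter> (\<lambda>p. plane_minor (P graph_fst p) (P graph_snd p)) -` {0<..} = ?R" by auto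
  finally have R: "open ?R" .
  note ov = plane_chart_overlap[OF c(2) d(2) c(3) d(3), folded P_def]
  show "open (snd c' ` (fst c' \<inter> fst d'))" unfolding c(1) d(1) ov(1) by (rule R)
  have "smooth_on ?R (\<lambda>p. ((snd d \<circ> chart_inv c) (fst p), plane_coords (P graph_fst p) (P graph_snd p)))"
    by (intro smooth_on_Pair R smooth_plane_coords smooth_on_compose[OF R O] smooth_on_subset[OF PP(1)]
        smooth_on_subset[OF PP(2)] smooth_on_subset[OF fs(1)]) auto
  then show "smooth_on (snd c' ` (fst c' \<inter> fst d')) (snd d' \<circ> chart_inv c')"
    unfolding c(1) d(1) ov(1)
  proof (rule smooth_on_cong[OF _ R])
    fix p assume "p \<in> ?R"
    then show "((snd d \<circ> chart_inv c) (fst p), plane_coords (P graph_fst p) (P graph_snd p)) =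
        (snd (plane_chart M d B') \<circ> chart_inv (plane_chart M c B)) p" using ov(2)[of p] by simp
  qed
qed

end

section \<open>Hermitian planes\<close>

interpretation cvec: vector_space "scaleC :: complex \<Rightarrow> 'a \<Rightarrow> 'a::complex_vector"
  by (rule vector_space_scaleC)

lemmas cvec_algebra = scaleC_right_distrib scaleC_left_distrib scaleC_scaleC scaleC_one
  cvec.scale_minus_left cvec.scale_minus_right cvec.scale_right_diff_distrib cvec.scale_left_diff_distrib

lemma complex_lines_iff:
  "L \<in> complex_lines S \<longleftrightarrow> (\<exists>p. p \<noteq> 0 \<and> p \<in> S \<and> L \<subseteq> S \<and> L = {c *\<^sub>C p | c. True})" (is "?L \<longleftrightarrow> ?R")
proof
  assume L: ?L
  then have s: "L \<subseteq> S" "csubspace L" "cdim L = 1" by (auto simp: complex_lines_def)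
  obtain B where B: "B \<subseteq> L" "\<not> cvec.dependent B" "L \<subseteq> cvec.span B" "card B = 1"
    using cvec.basis_exists[of L] s(3) by metis
  then obtain p where p: "B = {p}" using card_1_singletonE by metis
  have "p \<noteq> 0" using B(2) p cvec.dependent_zero by auto
  moreover have "L = cvec.span {p}" using B p s(2) cvec.span_subspace by blast
  ultimately show ?R using s(1) B(1) p by (auto simp: cvec.span_singleton)
next
  assume ?R
  then obtain p where p: "p \<noteq> 0" "L \<subseteq> S" "L = {c *\<^sub>C p | c. True}" by blast
  then have L: "L = cvec.span {p}" by (auto simp: cvec.span_singleton)
  have "\<not> cvec.dependent {p}" using p(1) by (simp add: cvec.dependent_single)
  from cvec.dim_span_eq_card_independent[OF this] have "cdim L = 1" unfolding L by simp
  then show ?L using p(2) L by (simp add: complex_lines_def)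
qed

lemma hermitian_spaceD:
  assumes "hermitian_space n S h" "u \<in> S" "v \<in> S"
  shows "h u v = cnj (h v u)" "w \<in> S \<Longrightarrow> h (a *\<^sub>C u + b *\<^sub>C v) w = a * h u w + b * h v w"
    "u \<noteq> 0 \<Longrightarrow> Re (h u u) > 0"
proof -
  have 1: "\<forall>u\<in>S. \<forall>v\<in>S. h u v = cnj (h v u)"
    using assms(1) unfolding hermitian_space_def by (elim conjE)
  have 2: "\<forall>u\<in>S. \<forall>v\<in>S. \<forall>w\<in>S. \<forall>a b. h (a *\<^sub>C u + b *\<^sub>C v) w = a * h u w + b * h v w"
    using assms(1) unfolding hermitian_space_def by (elim conjE)
  have 3: "\<forall>u\<in>S. u \<noteq> 0 \<longrightarrow> Re (h u u) > 0"
    using assms(1) unfolding hermitian_space_def by (elim conjE)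
  show "h u v = cnj (h v u)" by (rule 1[rule_format, OF assms(2,3)])
  show "w \<in> S \<Longrightarrow> h (a *\<^sub>C u + b *\<^sub>C v) w = a * h u w + b * h v w" by (rule 2[rule_format, OF assms(2,3)])
  show "u \<noteq> 0 \<Longrightarrow> Re (h u u) > 0" by (rule 3[rule_format, OF assms(2)])
qed

lemma hermitian_right:
  assumes "hermitian_space n S h" "u \<in> S" "v \<in> S" "w \<in> S"
  shows "h w (a *\<^sub>C u + b *\<^sub>C v) = cnj a * h w u + cnj b * h w v"
proof -
  have cs: "csubspace S" using assms(1) by (simp add: hermitian_space_def)
  have m: "a *\<^sub>C u + b *\<^sub>C v \<in> S"
    using assms(2,3) cvec.subspace_add[OF cs] cvec.subspace_scale[OF cs] by blast
  have "h w (a *\<^sub>C u + b *\<^sub>C v) = cnj (h (a *\<^sub>C u + b *\<^sub>C v) w)"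
    by (rule hermitian_spaceD(1)[OF assms(1,4) m])
  also have "h (a *\<^sub>C u + b *\<^sub>C v) w = a * h u w + b * h v w"
    by (rule hermitian_spaceD(2)[OF assms(1-4)])
  also have "cnj \<dots> = cnj a * cnj (h u w) + cnj b * cnj (h v w)" by simp
  finally show ?thesis
    unfolding hermitian_spaceD(1)[OF assms(1,4,2), symmetric] hermitian_spaceD(1)[OF assms(1,4,3), symmetric] .
qed

context
  fixes n and S :: "'s::complex_vector set" and h
  assumes H: "hermitian_space n S h"
begin

lemma herm_csubspace: "csubspace S" using H by (simp add: hermitian_space_def)

lemma herm_mem: "u \<in> S \<Longrightarrow> v \<in> S \<Longrightarrow> u + v \<in> S" "u \<in> S \<Longrightarrow> c *\<^sub>C u \<in> S" "0 \<in> S"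
  "u \<in> S \<Longrightarrow> v \<in> S \<Longrightarrow> u - v \<in> S" "u \<in> S \<Longrightarrow> r *\<^sub>R u \<in> S" "u \<in> S \<Longrightarrow> - u \<in> S"
  using cvec.subspace_add[OF herm_csubspace] cvec.subspace_scale[OF herm_csubspace]
    cvec.subspace_0[OF herm_csubspace] cvec.subspace_diff[OF herm_csubspace] cvec.subspace_neg[OF herm_csubspace]
  by (auto simp: scaleR_scaleC)

lemma herm_cnj: "u \<in> S \<Longrightarrow> v \<in> S \<Longrightarrow> cnj (h u v) = h v u"
  by (rule hermitian_spaceD(1)[OF H, symmetric])

lemma herm_lin_aux:
  assumes "u \<in> S" "v \<in> S" "w \<in> S"
  shows "h (u + v) w = h u w + h v w" "h (c *\<^sub>C u) w = c * h u w" "h (r *\<^sub>R u) w = r * h u w"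
    "h w (u + v) = h w u + h w v" "h w (c *\<^sub>C u) = cnj c * h w u" "h w (r *\<^sub>R u) = r * h w u"
    "h 0 w = 0" "h w 0 = 0" "h (u - v) w = h u w - h v w" "h w (u - v) = h w u - h w v"
    "h (- u) w = - h u w" "h w (- u) = - h w u"
proof -
  have l: "h (a *\<^sub>C u + b *\<^sub>C v) w = a * h u w + b * h v w" for a b
    by (rule hermitian_spaceD(2)[OF H assms])
  have r: "h w (a *\<^sub>C u + b *\<^sub>C v) = cnj a * h w u + cnj b * h w v" for a b
    using hermitian_right[OF H assms] .
  show "h (u + v) w = h u w + h v w" "h (c *\<^sub>C u) w = c * h u w" "h (r *\<^sub>R u) w = r * h u w"
    "h w (u + v) = h w u + h w v" "h w (c *\<^sub>C u) = cnj c * h w u" "h w (r *\<^sub>R u) = r * h w u"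
    "h 0 w = 0" "h w 0 = 0" "h (u - v) w = h u w - h v w" "h w (u - v) = h w u - h w v"
    "h (- u) w = - h u w" "h w (- u) = - h w u"
    using l[of 1 1] l[of c 0] l[of r 0] l[of 0 0] l[of 1 "-1"] l[of "-1" 0]
      r[of 1 1] r[of c 0] r[of r 0] r[of 0 0] r[of 1 "-1"] r[of "-1" 0]
    by (simp_all add: scaleC_one scaleR_scaleC)
qed

lemma herm_lin:
  "u \<in> S \<Longrightarrow> v \<in> S \<Longrightarrow> w \<in> S \<Longrightarrow> h (u + v) w = h u w + h v w"
  "u \<in> S \<Longrightarrow> w \<in> S \<Longrightarrow> h (c *\<^sub>C u) w = c * h u w" "u \<in> S \<Longrightarrow> w \<in> S \<Longrightarrow> h (r *\<^sub>R u) w = r * h u w"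
  "u \<in> S \<Longrightarrow> v \<in> S \<Longrightarrow> w \<in> S \<Longrightarrow> h w (u + v) = h w u + h w v"
  "u \<in> S \<Longrightarrow> w \<in> S \<Longrightarrow> h w (c *\<^sub>C u) = cnj c * h w u" "u \<in> S \<Longrightarrow> w \<in> S \<Longrightarrow> h w (r *\<^sub>R u) = r * h w u"
  "w \<in> S \<Longrightarrow> h 0 w = 0" "w \<in> S \<Longrightarrow> h w 0 = 0"
  "u \<in> S \<Longrightarrow> v \<in> S \<Longrightarrow> w \<in> S \<Longrightarrow> h (u - v) w = h u w - h v w"
  "u \<in> S \<Longrightarrow> v \<in> S \<Longrightarrow> w \<in> S \<Longrightarrow> h w (u - v) = h w u - h w v"
  "u \<in> S \<Longrightarrow> w \<in> S \<Longrightarrow> h (- u) w = - h u w" "u \<in> S \<Longrightarrow> w \<in> S \<Longrightarrow> h w (- u) = - h w u"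
  using herm_lin_aux(1,4,9,10)[of u v w] herm_lin_aux(2,3,5,6,7,8,11,12)[of u u w] herm_lin_aux(7,8)[of w w w] by blast+

lemma herm_self: "u \<in> S \<Longrightarrow> Im (h u u) = 0"
  using arg_cong[OF herm_cnj[of u u], of Im] by simp

lemma herm_pos: "u \<in> S \<Longrightarrow> Re (h u u) \<ge> 0" "u \<in> S \<Longrightarrow> Re (h u u) = 0 \<Longrightarrow> u = 0"
  using hermitian_spaceD(3)[OF H, of u u] herm_lin(7)[of u] by (cases "u = 0"; simp)+

lemma herm_hnorm: "u \<in> S \<Longrightarrow> (hnorm h u)\<^sup>2 = Re (h u u)"
  using herm_pos by (simp add: hnorm_def)

lemma herm_eq: "u \<in> S \<Longrightarrow> h u u = complex_of_real (Re (h u u))"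
  using herm_self by (simp add: complex_eq_iff)

end

text \<open>The two vectors share a squared norm \<open>N\<close> instead of being unit vectors,
  since multiplication by a nonzero tangent vector u takes an orthonormal frame to such a pair with
  N = g(u, u). Dimension two forces \<open>x\<close> into their span.\<close>

lemma hermitian_plane_expand:
  assumes H: "hermitian_space 2 S h" and e: "e1 \<in> S" "e2 \<in> S" "h e1 e1 = N" "h e2 e2 = N" "h e1 e2 = 0" "N \<noteq> 0"
    and "x \<in> S"
  shows "N *\<^sub>C x = h x e1 *\<^sub>C e1 + h x e2 *\<^sub>C e2"
proof -
  note lin = herm_lin[OF H] and mem = herm_mem[OF H]
  have e21: "h e2 e1 = 0" using herm_cnj[OF H e(1,2)] e(5) by simp
  have z: "a = 0 \<and> b = 0" if "a *\<^sub>C e1 + b *\<^sub>C e2 = 0" for a b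
  proof -
    have "h (a *\<^sub>C e1 + b *\<^sub>C e2) e1 = a * N" "h (a *\<^sub>C e1 + b *\<^sub>C e2) e2 = b * N"
      using e e21 by (simp_all add: lin mem)
    then have "a * N = 0" "b * N = 0"
      unfolding that by (simp_all add: lin(7)[OF e(1)] lin(7)[OF e(2)])
    then show ?thesis using e(6) by simp
  qed
  have "x \<in> cvec.span {e1, e2}"
  proof (rule ccontr)
    assume x: "x \<notin> cvec.span {e1, e2}"
    have "e1 \<noteq> 0" using z[of 1 0] by (auto simp: scaleC_one)
    moreover have "e2 \<notin> cvec.span {e1}"
    proof
      assume "e2 \<in> cvec.span {e1}"
      then obtain k where "e2 = k *\<^sub>C e1" by (auto simp: cvec.span_singleton)
      then have "k *\<^sub>C e1 + (-1) *\<^sub>C e2 = 0" by (simp add: cvec_algebra)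
      then show False using z by (metis neg_eq_iff_add_eq_0 zero_neq_one add.inverse_inverse add.inverse_neutral)
    qed
    ultimately have "\<not> cvec.dependent {e2, e1}"
      by (intro cvec.independent_insertI cvec.independent_empty) (auto simp: cvec.span_singleton)
    then have "\<not> cvec.dependent {e1, e2}" by (simp add: insert_commute)
    then have i: "\<not> cvec.dependent {x, e1, e2}" by (rule cvec.independent_insertI[OF x])
    have "x \<noteq> e1" "x \<noteq> e2" using x cvec.span_base[of e1 "{e1, e2}"] cvec.span_base[of e2 "{e1, e2}"] by auto
    moreover have "e1 \<noteq> e2" using e e21 by auto
    ultimately have c: "card {x, e1, e2} = 3" by simp
    obtain B where B: "B \<subseteq> S" "\<not> cvec.dependent B" "S \<subseteq> cvec.span B" "card B = 2"
      using cvec.basis_exists[of S] H unfolding hermitian_space_def by metis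
    have "finite B" using B(4) by (metis card.infinite zero_neq_numeral)
    then have "card {x, e1, e2} \<le> card B"
      using cvec.independent_span_bound[OF _ i] B(3) e(1,2) \<open>x \<in> S\<close> by blast
    then show False using c B(4) by simp
  qed
  then obtain a b where ab: "x = a *\<^sub>C e1 + b *\<^sub>C e2"
    unfolding cvec.span_insert cvec.span_empty by (auto simp: algebra_simps)
  have "h x e1 = a * N" "h x e2 = b * N" using e e21 unfolding ab by (simp_all add: lin mem)
  then show ?thesis unfolding ab by (simp add: cvec_algebra mult.commute)
qed

section \<open>The spinor planes at a point\<close>

locale spinor_fibre =
  fixes G :: "('s::complex_vector, 't::complex_vector, 'k::complex_vector) spinc4"
    and TT :: "'v::real_vector set" and cl :: "'v \<Rightarrow> 's \<Rightarrow> 't" and J :: "'v \<Rightarrow> 'v"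
    and g :: "'v \<Rightarrow> 'v \<Rightarrow> real" and \<psi> :: 's
  assumes geom: "spinc4_geometry G"
    and bij: "bij_betw cl TT (spinc4_space G)"
    and clhom: "cl \<in> real_hom TT (spinc4_space G)"
    and subTT: "subspace TT" and dimTT: "real_vector.dim TT = 4"
    and Jhom: "J \<in> real_hom TT TT" and JJ: "v \<in> TT \<Longrightarrow> J (J v) = - v"
    and gbil: "u \<in> TT \<Longrightarrow> v \<in> TT \<Longrightarrow> w \<in> TT \<Longrightarrow> g (a *\<^sub>R u + b *\<^sub>R v) w = a * g u w + b * g v w"
    and gsym: "u \<in> TT \<Longrightarrow> v \<in> TT \<Longrightarrow> g u v = g v u"
    and gJ: "u \<in> TT \<Longrightarrow> v \<in> TT \<Longrightarrow> g (J u) (J v) = g u v"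
    and gpos: "u \<in> TT \<Longrightarrow> u \<noteq> 0 \<Longrightarrow> g u u > 0"
    and psi: "\<psi> \<in> plane_plus G" "hnorm (metric_plus G) \<psi> = 1"
    and clJ: "v \<in> TT \<Longrightarrow> cl (J v) \<psi> = \<i> *\<^sub>C cl v \<psi>"
    and gcl: "v \<in> TT \<Longrightarrow> g v v = (homothety_norm G (cl v))\<^sup>2"
begin

abbreviation "Sp \<equiv> plane_plus G"
abbreviation "Sm \<equiv> plane_minus G"
abbreviation "hp \<equiv> metric_plus G"
abbreviation "hm \<equiv> metric_minus G"

lemma Hp: "hermitian_space 2 Sp hp" and Hm: "hermitian_space 2 Sm hm"
  using geom by (auto simp: spinc4_geometry_def)

lemmas plin = herm_lin[OF Hp] and pmem = herm_mem[OF Hp] and mlin = herm_lin[OF Hm] and mmem = herm_mem[OF Hm]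

lemma Tmem: "u \<in> TT \<Longrightarrow> v \<in> TT \<Longrightarrow> u + v \<in> TT" "u \<in> TT \<Longrightarrow> r *\<^sub>R u \<in> TT" "0 \<in> TT"
  "u \<in> TT \<Longrightarrow> v \<in> TT \<Longrightarrow> u - v \<in> TT" "u \<in> TT \<Longrightarrow> - u \<in> TT" "u \<in> TT \<Longrightarrow> J u \<in> TT"
  using subspace_add[OF subTT] subspace_scale[OF subTT] subspace_0[OF subTT] subspace_diff[OF subTT]
    subspace_neg[OF subTT] Jhom by (auto simp: real_hom_def)

lemma cl_space: "v \<in> TT \<Longrightarrow> cl v \<in> spinc4_space G"
  using bij by (auto simp: bij_betw_def)

lemma cl_mem: "v \<in> TT \<Longrightarrow> \<phi> \<in> Sp \<Longrightarrow> cl v \<phi> \<in> Sm"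
  using cl_space by (auto simp: spinc4_space_def complex_hom_def)

lemma cl_clin:
  assumes "v \<in> TT" "\<phi> \<in> Sp" "\<phi>' \<in> Sp"
  shows "cl v (a *\<^sub>C \<phi> + b *\<^sub>C \<phi>') = a *\<^sub>C cl v \<phi> + b *\<^sub>C cl v \<phi>'"
  using cl_space[OF assms(1)] assms(2,3) unfolding spinc4_space_def complex_hom_def by blast

lemma cl_scale: "v \<in> TT \<Longrightarrow> \<phi> \<in> Sp \<Longrightarrow> cl v (a *\<^sub>C \<phi>) = a *\<^sub>C cl v \<phi>"
  using cl_clin[of v \<phi> \<phi> a 0] by simp

lemma cl_rlin:
  assumes "u \<in> TT" "v \<in> TT"
  shows "cl (a *\<^sub>R u + b *\<^sub>R v) = a *\<^sub>R cl u + b *\<^sub>R cl v"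
  using clhom assms unfolding real_hom_def by blast

lemma cl_rlin_at:
  assumes "u \<in> TT" "v \<in> TT"
  shows "cl (a *\<^sub>R u + b *\<^sub>R v) \<phi> = a *\<^sub>R cl u \<phi> + b *\<^sub>R cl v \<phi>"
  using cl_rlin[OF assms] by (simp add: scaleR_fun_def)

lemma g_lin_aux:
  assumes "u \<in> TT" "v \<in> TT" "w \<in> TT"
  shows "g (u + v) w = g u w + g v w" "g (r *\<^sub>R u) w = r * g u w" "g w (u + v) = g w u + g w v"
    "g w (r *\<^sub>R u) = r * g w u" "g (u - v) w = g u w - g v w" "g w (u - v) = g w u - g w v"
    "g (- u) w = - g u w" "g w (- u) = - g w u" "g 0 w = 0"
proof -
  have l: "g (a *\<^sub>R u + b *\<^sub>R v) w = a * g u w + b * g v w" for a b using gbil assms .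
  have r: "g w (a *\<^sub>R u + b *\<^sub>R v) = a * g w u + b * g w v" for a b
    using l[of a b] gsym assms Tmem by metis
  show "g (u + v) w = g u w + g v w" "g (r *\<^sub>R u) w = r * g u w" "g w (u + v) = g w u + g w v"
    "g w (r *\<^sub>R u) = r * g w u" "g (u - v) w = g u w - g v w" "g w (u - v) = g w u - g w v"
    "g (- u) w = - g u w" "g w (- u) = - g w u" "g 0 w = 0"
    using l[of 1 1] r[of 1 1] l[of r 0] r[of r 0] l[of 1 "-1"] r[of 1 "-1"] l[of "-1" 0] r[of "-1" 0] l[of 0 0]
    by simp_all
qed

lemma g_lin:
  "u \<in> TT \<Longrightarrow> v \<in> TT \<Longrightarrow> w \<in> TT \<Longrightarrow> g (u + v) w = g u w + g v w"
  "u \<in> TT \<Longrightarrow> w \<in> TT \<Longrightarrow> g (r *\<^sub>R u) w = r * g u w"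
  "u \<in> TT \<Longrightarrow> v \<in> TT \<Longrightarrow> w \<in> TT \<Longrightarrow> g w (u + v) = g w u + g w v"
  "u \<in> TT \<Longrightarrow> w \<in> TT \<Longrightarrow> g w (r *\<^sub>R u) = r * g w u"
  "u \<in> TT \<Longrightarrow> v \<in> TT \<Longrightarrow> w \<in> TT \<Longrightarrow> g (u - v) w = g u w - g v w"
  "u \<in> TT \<Longrightarrow> v \<in> TT \<Longrightarrow> w \<in> TT \<Longrightarrow> g w (u - v) = g w u - g w v"
  "u \<in> TT \<Longrightarrow> w \<in> TT \<Longrightarrow> g (- u) w = - g u w" "u \<in> TT \<Longrightarrow> w \<in> TT \<Longrightarrow> g w (- u) = - g w u"
  "w \<in> TT \<Longrightarrow> g 0 w = 0"
  using g_lin_aux(1,3,5,6)[of u v w] g_lin_aux(2,4,7,8)[of u u w] g_lin_aux(9)[of w w w] by blast+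

lemma J_lin_aux:
  assumes "u \<in> TT" "v \<in> TT"
  shows "J (a *\<^sub>R u + b *\<^sub>R v) = a *\<^sub>R J u + b *\<^sub>R J v" "J (u + v) = J u + J v" "J (r *\<^sub>R u) = r *\<^sub>R J u" "J (- u) = - J u"
proof -
  have l: "J (a *\<^sub>R u + b *\<^sub>R v) = a *\<^sub>R J u + b *\<^sub>R J v" for a b
    using Jhom assms unfolding real_hom_def by blast
  show "J (a *\<^sub>R u + b *\<^sub>R v) = a *\<^sub>R J u + b *\<^sub>R J v" "J (u + v) = J u + J v" "J (r *\<^sub>R u) = r *\<^sub>R J u" "J (- u) = - J u"
    using l[of a b] l[of 1 1] l[of r 0] l[of "-1" 0] by simp_all
qed

lemma J_lin:
  "u \<in> TT \<Longrightarrow> v \<in> TT \<Longrightarrow> J (a *\<^sub>R u + b *\<^sub>R v) = a *\<^sub>R J u + b *\<^sub>R J v"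
  "u \<in> TT \<Longrightarrow> v \<in> TT \<Longrightarrow> J (u + v) = J u + J v" "u \<in> TT \<Longrightarrow> J (r *\<^sub>R u) = r *\<^sub>R J u"
  "u \<in> TT \<Longrightarrow> J (- u) = - J u"
  using J_lin_aux(1,2)[of u v] J_lin_aux(3,4)[of u u] by blast+

lemma g_zero_iff: "u \<in> TT \<Longrightarrow> g u u = 0 \<longleftrightarrow> u = 0"
  using gpos[of u] g_lin(9)[of u] by fastforce

lemma hp_psi: "hp \<psi> \<psi> = 1"
  using herm_eq[OF Hp psi(1)] herm_hnorm[OF Hp psi(1)] psi(2) by simp

text \<open>The unit spinor \<psi> shows that the homothety factor is unique, so the description
  \<open>homothety_norm\<close> really yields it, and g(v, v) is its square by assumption.\<close>

lemma cl_norm: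
  assumes "v \<in> TT" "\<phi> \<in> Sp"
  shows "hm (cl v \<phi>) (cl v \<phi>) = complex_of_real (g v v) * hp \<phi> \<phi>"
proof -
  obtain r where r: "homothety G (cl v) r" using cl_space[OF assms(1)] by (auto simp: spinc4_space_def)
  have "homothety_norm G (cl v) = r"
    unfolding homothety_norm_def
  proof (rule the_equality[of _ r])
    fix r' assume "homothety G (cl v) r'"
    then have "hnorm hm (cl v \<psi>) = r' * hnorm hp \<psi>" "hnorm hm (cl v \<psi>) = r * hnorm hp \<psi>"
      using r psi(1) unfolding homothety_def by blast+
    then show "r' = r" using psi(2) by simp
  qed (rule r)
  then have "hnorm hm (cl v \<phi>) = homothety_norm G (cl v) * hnorm hp \<phi>"
    using r assms(2) by (simp add: homothety_def)
  then have "Re (hm (cl v \<phi>) (cl v \<phi>)) = g v v * Re (hp \<phi> \<phi>)"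
    using herm_hnorm[OF Hm cl_mem[OF assms]] herm_hnorm[OF Hp assms(2)] gcl[OF assms(1)]
    by (simp add: power_mult_distrib)
  then show ?thesis
    using herm_eq[OF Hm cl_mem[OF assms]] herm_eq[OF Hp assms(2)] by (metis of_real_mult)
qed

lemma cl_polar:
  assumes "u \<in> TT" "v \<in> TT" "\<phi> \<in> Sp"
  shows "hm (cl u \<phi>) (cl v \<phi>) + hm (cl v \<phi>) (cl u \<phi>) = complex_of_real (2 * g u v) * hp \<phi> \<phi>"
proof -
  have c: "cl (u + v) \<phi> = cl u \<phi> + cl v \<phi>" using cl_rlin_at[OF assms(1,2), of 1 1] by simp
  have "hm (cl (u + v) \<phi>) (cl (u + v) \<phi>) = complex_of_real (g (u + v) (u + v)) * hp \<phi> \<phi>"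
    by (rule cl_norm[OF Tmem(1)[OF assms(1,2)] assms(3)])
  moreover have "g (u + v) (u + v) = g u u + 2 * g u v + g v v"
    using assms gsym[OF assms(1,2)] by (simp add: g_lin Tmem)
  ultimately show ?thesis
    using cl_norm[OF assms(1,3)] cl_norm[OF assms(2,3)] cl_mem[OF assms(1,3)] cl_mem[OF assms(2,3)]
    unfolding c by (simp add: mlin mmem algebra_simps)
qed

text \<open>For equal spinors this is \<open>cl_polar\<close>, and a form that is sesquilinear in
  the spinors and vanishes on the diagonal is zero.\<close>

lemma clifford_relation:
  assumes "u \<in> TT" "v \<in> TT" "\<phi> \<in> Sp" "\<phi>' \<in> Sp"
  shows "hm (cl u \<phi>) (cl v \<phi>') + hm (cl v \<phi>) (cl u \<phi>') = complex_of_real (2 * g u v) * hp \<phi> \<phi>'"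
proof -
  define Q where "Q x y = hm (cl u x) (cl v y) + hm (cl v x) (cl u y) - complex_of_real (2 * g u v) * hp x y" for x y
  have Q0: "Q x x = 0" if "x \<in> Sp" for x using cl_polar[OF assms(1,2) that] by (simp add: Q_def)
  have Qe: "Q (\<phi> + c *\<^sub>C \<phi>') (\<phi> + c *\<^sub>C \<phi>') = Q \<phi> \<phi> + cnj c * Q \<phi> \<phi>' + c * Q \<phi>' \<phi> + c * cnj c * Q \<phi>' \<phi>'" for c
  proof -
    have "cl w (\<phi> + c *\<^sub>C \<phi>') = cl w \<phi> + c *\<^sub>C cl w \<phi>'" if "w \<in> TT" for w
      using cl_clin[OF that assms(3,4), of 1 c] by (simp add: scaleC_one)
    then show ?thesis
      using assms unfolding Q_def by (simp add: cl_mem mlin mmem plin pmem algebra_simps)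
  qed
  \<comment> \<open>The expansion at c = 1 and at c = \<i> gives two relations that admit only the
    zero solution.\<close>
  have "Q \<phi> \<phi>' + Q \<phi>' \<phi> = 0" "- \<i> * Q \<phi> \<phi>' + \<i> * Q \<phi>' \<phi> = 0"
    using Qe[of 1] Qe[of \<i>] Q0 assms(3,4) pmem by (simp_all add: algebra_simps)
  then have "Q \<phi> \<phi>' = 0" by (simp add: complex_eq_iff)
  then show ?thesis by (simp only: Q_def eq_iff_diff_eq_0[symmetric])
qed

lemma cl_zero:
  assumes "v \<in> TT" "\<phi> \<in> Sp" "\<phi> \<noteq> 0" "cl v \<phi> = 0"
  shows "v = 0"
proof -
  have "complex_of_real (g v v) * hp \<phi> \<phi> = 0"
    using cl_norm[OF assms(1,2)] mlin(7)[OF mmem(3)] by (simp add: assms(4))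
  moreover have "hp \<phi> \<phi> \<noteq> 0" using herm_pos(2)[OF Hp assms(2)] assms(3) by auto
  ultimately show ?thesis using g_zero_iff[OF assms(1)] by simp
qed

lemma cl_eq:
  assumes "u \<in> TT" "v \<in> TT" "\<phi> \<in> Sp" "\<phi> \<noteq> 0" "cl u \<phi> = cl v \<phi>"
  shows "u = v"
proof -
  have "cl (u - v) \<phi> = 0" using cl_rlin_at[OF assms(1,2), of 1 "-1"] assms(5) by simp
  then show ?thesis using cl_zero[OF Tmem(4)[OF assms(1,2)] assms(3,4)] by simp
qed

lemma psi_nonzero: "\<psi> \<noteq> 0"
  using hp_psi plin(7)[OF psi(1)] by auto

text \<open>Four dimensions are not spanned by two vectors. For nonzero \<open>u\<close> the vector
  obtained completes \<open>u\<close> to a complex basis.\<close>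

lemma span_J_proper:
  obtains w where "w \<in> TT" "w \<notin> span {u, J u}"
proof -
  have "real_vector.dim {u, J u} \<le> card {u, J u}" by (rule real_vector.dim_le_card) (simp_all add: span_superset)
  moreover have "card {u, J u} \<le> 2" by (simp add: card_insert_if)
  ultimately have "real_vector.dim (span {u, J u}) < real_vector.dim TT" using dimTT by (simp add: real_vector.dim_span)
  moreover have "real_vector.dim TT \<le> real_vector.dim (span {u, J u})" if "TT \<subseteq> span {u, J u}"
    using real_vector.dim_le_card[of TT "{u, J u}"] that \<open>card {u, J u} \<le> 2\<close> dimTT by simp
  ultimately show ?thesis using that by (metis not_le subsetI)
qed

lemma complex_scale_T:
  assumes "v \<in> TT"
  shows "cl (a *\<^sub>R v + b *\<^sub>R J v) \<psi> = Complex a b *\<^sub>C cl v \<psi>"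
proof -
  have "Complex a b = complex_of_real a + complex_of_real b * \<i>" by (simp add: complex_eq_iff)
  then show ?thesis
    using cl_rlin_at[OF assms Tmem(6)[OF assms], of a b \<psi>] clJ[OF assms]
    by (simp add: scaleR_scaleC cvec_algebra)
qed

text \<open>Multiplication onto \<psi> is complex linear and preserves norms, so Gram-Schmidt on two
  tangent vectors gives an orthogonal pair in the two-dimensional \<open>Sm\<close>, and the
  expansion of \<eta> in that pair exhibits a preimage.\<close>

lemma cl_psi_surj:
  assumes "\<eta> \<in> Sm"
  obtains v where "v \<in> TT" "cl v \<psi> = \<eta>"
proof -
  \<comment> \<open>Only a nonzero vector is wanted here.\<close>
  obtain u0 where u0: "u0 \<in> TT" "u0 \<notin> span {0, J 0}" by (rule span_J_proper)
  have n0: "u0 \<noteq> 0" using u0(2) span_0 by metis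
  obtain w where w: "w \<in> TT" "w \<notin> span {u0, J u0}" by (rule span_J_proper)
  define e1 where "e1 = cl u0 \<psi>"
  define z where "z = hm (cl w \<psi>) e1 / complex_of_real (g u0 u0)"
  define w' where "w' = w - (Re z *\<^sub>R u0 + Im z *\<^sub>R J u0)"
  have w'T: "w' \<in> TT" using w u0 Tmem by (simp add: w'_def)
  have "w' \<noteq> 0" using w(2) by (auto simp: w'_def span_pair)
  have g0: "g u0 u0 > 0" "g w' w' > 0" using gpos u0(1) n0 w'T \<open>w' \<noteq> 0\<close> by auto
  have e1: "e1 \<in> Sm" "hm e1 e1 = complex_of_real (g u0 u0)"
    using cl_mem cl_norm u0(1) psi(1) hp_psi by (simp_all add: e1_def)
  have cw: "cl w' \<psi> = cl w \<psi> - z *\<^sub>C e1"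
    using cl_rlin_at[of w "Re z *\<^sub>R u0 + Im z *\<^sub>R J u0" 1 "-1" \<psi>] complex_scale_T[OF u0(1), of "Re z" "Im z"] w(1) u0(1)
    by (simp add: w'_def e1_def Tmem diff_conv_add_uminus del: minus_add_distrib add_uminus_conv_diff)
  have o: "hm (cl w' \<psi>) e1 = 0"
    unfolding cw using e1 cl_mem[OF w(1) psi(1)] g0 by (simp add: mlin mmem z_def)
  \<comment> \<open>This factor equalizes the two lengths, as the expansion in an orthogonal pair
    asks for a common \<open>N\<close>.\<close>
  define s where "s = sqrt (g u0 u0 / g w' w')"
  have s: "s * s * g w' w' = g u0 u0" using g0 by (simp add: s_def)
  define e2 where "e2 = cl (s *\<^sub>R w') \<psi>"
  have e2c: "e2 = s *\<^sub>R cl w' \<psi>" using cl_rlin_at[OF w'T w'T, of s 0 \<psi>] by (simp add: e2_def)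
  have cw'm: "cl w' \<psi> \<in> Sm" using cl_mem w'T psi(1) by blast
  have e2: "e2 \<in> Sm" "hm e2 e2 = complex_of_real (g u0 u0)" "hm e1 e2 = 0"
    using cw'm s o e1(1) cl_norm[OF w'T psi(1)] hp_psi herm_cnj[OF Hm cw'm e1(1)]
    by (simp_all add: e2c mlin mmem flip: of_real_mult mult.assoc)
  let ?N = "complex_of_real (g u0 u0)"
  have N: "?N \<noteq> 0" using g0 by simp
  have "\<eta> = (1 / ?N) *\<^sub>C (?N *\<^sub>C \<eta>)" using N by (simp add: scaleC_scaleC scaleC_one)
  also have "?N *\<^sub>C \<eta> = hm \<eta> e1 *\<^sub>C e1 + hm \<eta> e2 *\<^sub>C e2"
    by (rule hermitian_plane_expand[OF Hm e1(1) e2(1) e1(2) e2(2) e2(3) N assms])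
  finally have eta: "\<eta> = (hm \<eta> e1 / ?N) *\<^sub>C e1 + (hm \<eta> e2 / ?N) *\<^sub>C e2" by (simp add: cvec_algebra)
  define a b where "a = hm \<eta> e1 / ?N" and "b = hm \<eta> e2 / ?N"
  let ?v = "(Re a *\<^sub>R u0 + Im a *\<^sub>R J u0) + (Re b *\<^sub>R (s *\<^sub>R w') + Im b *\<^sub>R J (s *\<^sub>R w'))"
  have "cl ?v \<psi> = a *\<^sub>C e1 + b *\<^sub>C e2"
    using cl_rlin_at[of "Re a *\<^sub>R u0 + Im a *\<^sub>R J u0" "Re b *\<^sub>R (s *\<^sub>R w') + Im b *\<^sub>R J (s *\<^sub>R w')" 1 1 \<psi>]
      complex_scale_T[OF u0(1), of "Re a" "Im a"] complex_scale_T[of "s *\<^sub>R w'" "Re b" "Im b"] w'T u0(1) Tmem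
    by (simp add: e1_def e2_def)
  moreover have "?v \<in> TT" using w'T u0(1) Tmem by simp
  ultimately show ?thesis using that eta unfolding a_def b_def by metis
qed

end

locale spinor_frame = spinor_fibre G TT cl J g \<psi>
  for G :: "('s::complex_vector, 't::complex_vector, 'k::complex_vector) spinc4"
    and TT :: "'v::real_vector set" and cl J g \<psi> +
  fixes \<xi> :: 's
  assumes chi: "\<xi> \<in> plane_plus G" "metric_plus G \<xi> \<psi> = 0" "metric_plus G \<xi> \<xi> = 1"
begin

definition om where "om u v = g (J u) v"
definition be where "be u v = hm (cl v \<psi>) (cl u \<xi>)"

lemma hp_psi_chi: "hp \<psi> \<xi> = 0"
  using herm_cnj[OF Hp chi(1) psi(1)] chi(2) by simp

lemma chi_nonzero: "\<xi> \<noteq> 0"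
  using chi(3) plin(7)[OF chi(1)] by auto

lemma Sp_expand: "\<phi> \<in> Sp \<Longrightarrow> \<phi> = hp \<phi> \<psi> *\<^sub>C \<psi> + hp \<phi> \<xi> *\<^sub>C \<xi>"
  using hermitian_plane_expand[OF Hp psi(1) chi(1) hp_psi chi(3) hp_psi_chi] by (simp add: scaleC_one)

lemma hp_frame:
  "hp (a *\<^sub>C \<psi> + b *\<^sub>C \<xi>) \<psi> = a" "hp (a *\<^sub>C \<psi> + b *\<^sub>C \<xi>) \<xi> = b"
  "hp (a *\<^sub>C \<psi> + b *\<^sub>C \<xi>) (c *\<^sub>C \<psi> + d *\<^sub>C \<xi>) = a * cnj c + b * cnj d"
  using psi(1) chi hp_psi hp_psi_chi by (simp_all add: plin pmem)

lemma frame_mem: "a *\<^sub>C \<psi> + b *\<^sub>C \<xi> \<in> Sp" using psi(1) chi(1) pmem by simp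

lemma frame_inj: "a *\<^sub>C \<psi> + b *\<^sub>C \<xi> = c *\<^sub>C \<psi> + d *\<^sub>C \<xi> \<longleftrightarrow> a = c \<and> b = d"
  by (metis hp_frame(1,2))

lemma cl_orth:
  assumes "u \<in> TT" shows "hm (cl u \<psi>) (cl u \<xi>) = 0"
  using clifford_relation[OF assms assms psi(1) chi(1)] hp_psi_chi by simp

text \<open>The Clifford relation between \<psi> and \<xi>, whose metric term vanishes by
  orthogonality.\<close>

lemma be_alt:
  assumes "u \<in> TT" "v \<in> TT" shows "be v u = - be u v"
  using clifford_relation[OF assms psi(1) chi(1)] hp_psi_chi unfolding be_def
  by (simp add: eq_neg_iff_add_eq_0)

text \<open>Writing u \<xi> as v \<psi> makes J accessible, which is known only on \<psi>: the
  Clifford relation of v with J u gives the inner product of u \<xi> and (J u) \<xi>, whence (J u)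
  \<xi> + \<i> u \<xi> has norm zero. The sign, opposite to that on \<psi>, compensates the
  antilinear slot of the metric and makes \<beta> complex bilinear.\<close>

lemma cl_J_chi:
  assumes u: "u \<in> TT" shows "cl (J u) \<xi> = - \<i> *\<^sub>C cl u \<xi>"
proof -
  obtain v where v: "v \<in> TT" "cl v \<psi> = cl u \<xi>" using cl_psi_surj[OF cl_mem[OF u chi(1)]] .
  note m = cl_mem[OF u psi(1)] cl_mem[OF u chi(1)] cl_mem[OF Tmem(6)[OF u] chi(1)]
  have n: "hm (cl u \<xi>) (cl u \<xi>) = complex_of_real (g u u)" using cl_norm[OF u chi(1)] chi(3) by simp
  have nJ: "hm (cl (J u) \<xi>) (cl (J u) \<xi>) = complex_of_real (g u u)"
    using cl_norm[OF Tmem(6)[OF u] chi(1)] chi(3) gJ[OF u u] by simp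
  have uv: "hm (cl u \<psi>) (cl v \<xi>) = - complex_of_real (g u u)"
    using clifford_relation[OF u v(1) psi(1) chi(1)] n v(2) hp_psi_chi by (simp add: eq_neg_iff_add_eq_0)
  have "hm (cl v \<psi>) (cl (J u) \<xi>) + hm (cl (J u) \<psi>) (cl v \<xi>) = 0"
    using clifford_relation[OF v(1) Tmem(6)[OF u] psi(1) chi(1)] hp_psi_chi by simp
  then have "hm (cl u \<xi>) (cl (J u) \<xi>) = \<i> * complex_of_real (g u u)"
    using uv m cl_mem[OF v(1) chi(1)] unfolding v(2) clJ[OF u] by (simp add: mlin eq_neg_iff_add_eq_0)
  moreover from this have "hm (cl (J u) \<xi>) (cl u \<xi>) = - \<i> * complex_of_real (g u u)"
    using herm_cnj[OF Hm m(2) m(3)] by simp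
  ultimately have "hm (cl (J u) \<xi> + \<i> *\<^sub>C cl u \<xi>) (cl (J u) \<xi> + \<i> *\<^sub>C cl u \<xi>) = 0"
    using n nJ m by (simp add: mlin mmem algebra_simps)
  then have "cl (J u) \<xi> + \<i> *\<^sub>C cl u \<xi> = 0"
    using herm_pos(2)[OF Hm] mmem m by simp
  then show ?thesis by (simp add: cvec_algebra eq_neg_iff_add_eq_0)
qed

lemma be_lin:
  assumes "u \<in> TT" "v \<in> TT" "w \<in> TT"
  shows "be w (a *\<^sub>R u + b *\<^sub>R v) = a * be w u + b * be w v" "be (a *\<^sub>R u + b *\<^sub>R v) w = a * be u w + b * be v w"
  using assms psi(1) chi(1) unfolding be_def by (simp_all add: cl_rlin_at cl_mem mlin mmem)

lemma be_J:
  assumes "u \<in> TT" "v \<in> TT"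
  shows "be u (J v) = \<i> * be u v" "be (J u) v = \<i> * be u v"
  using assms psi(1) chi(1) unfolding be_def by (simp_all add: clJ cl_J_chi Tmem cl_mem mlin mmem)

lemma be_self: "u \<in> TT \<Longrightarrow> be u u = 0"
  using cl_orth by (simp add: be_def)

lemma om_lin:
  assumes "u \<in> TT" "v \<in> TT" "w \<in> TT"
  shows "om w (a *\<^sub>R u + b *\<^sub>R v) = a * om w u + b * om w v" "om (a *\<^sub>R u + b *\<^sub>R v) w = a * om u w + b * om v w"
  using assms unfolding om_def by (simp_all add: J_lin g_lin Tmem)

lemma om_J: "u \<in> TT \<Longrightarrow> om u (J u) = g u u" using gJ by (simp add: om_def)

lemma om_self: "u \<in> TT \<Longrightarrow> om u u = 0"
proof -
  assume u: "u \<in> TT"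
  have "g (J (J u)) (J u) = g (J u) u" by (rule gJ[OF Tmem(6)[OF u] u])
  then have "- g u (J u) = g (J u) u" using JJ[OF u] g_lin(7)[OF u Tmem(6)[OF u]] by simp
  then show "om u u = 0" unfolding gsym[OF u Tmem(6)[OF u]] by (simp add: om_def)
qed

text \<open>Polarization gives the real part. Replacing u by J u multiplies the product by -\<i>,
  which turns its imaginary part into a real part already known.\<close>

lemma cl_psi_psi:
  assumes "u \<in> TT" "v \<in> TT"
  shows "hm (cl v \<psi>) (cl u \<psi>) = Complex (g u v) (om u v)"
proof -
  note m = cl_mem[OF assms(1) psi(1)] cl_mem[OF assms(2) psi(1)]
  have 1: "Re (hm (cl v \<psi>) (cl w \<psi>)) = g w v" if "w \<in> TT" for w
    using clifford_relation[OF that assms(2) psi(1) psi(1)] hp_psi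
      herm_cnj[OF Hm cl_mem[OF that psi(1)] m(2)] by (auto simp: complex_eq_iff)
  have "hm (cl v \<psi>) (cl (J u) \<psi>) = - \<i> * hm (cl v \<psi>) (cl u \<psi>)"
    unfolding clJ[OF assms(1)] using m by (simp add: mlin)
  then have "Re (- \<i> * hm (cl v \<psi>) (cl u \<psi>)) = om u v" using 1[OF Tmem(6)[OF assms(1)]] by (simp add: om_def)
  then show ?thesis using 1[OF assms(1)] by (simp add: complex_eq_iff)
qed

lemma cl_chi_chi:
  assumes "u \<in> TT" "v \<in> TT"
  shows "hm (cl v \<xi>) (cl u \<xi>) = Complex (g u v) (- om u v)"
proof -
  note m = cl_mem[OF assms(1) chi(1)] cl_mem[OF assms(2) chi(1)]
  have 1: "Re (hm (cl v \<xi>) (cl w \<xi>)) = g w v" if "w \<in> TT" for w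
    using clifford_relation[OF that assms(2) chi(1) chi(1)] chi(3)
      herm_cnj[OF Hm cl_mem[OF that chi(1)] m(2)] by (auto simp: complex_eq_iff)
  have "hm (cl v \<xi>) (cl (J u) \<xi>) = \<i> * hm (cl v \<xi>) (cl u \<xi>)"
    unfolding cl_J_chi[OF assms(1)] using m by (simp add: mlin mmem)
  then have "Re (\<i> * hm (cl v \<xi>) (cl u \<xi>)) = om u v" using 1[OF Tmem(6)[OF assms(1)]] by (simp add: om_def)
  then show ?thesis using 1[OF assms(1)] by (simp add: complex_eq_iff)
qed

lemma cl_chi_psi:
  assumes "u \<in> TT" "v \<in> TT"
  shows "hm (cl v \<xi>) (cl u \<psi>) = - cnj (be u v)"
proof -
  have "hm (cl v \<xi>) (cl u \<psi>) = cnj (hm (cl u \<psi>) (cl v \<xi>))"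
    using herm_cnj[OF Hm cl_mem[OF assms(1) psi(1)] cl_mem[OF assms(2) chi(1)]] by simp
  also have "hm (cl u \<psi>) (cl v \<xi>) = - be u v"
    using be_alt[OF assms] unfolding be_def[of v u] .
  finally show ?thesis by simp
qed

text \<open>The coefficients are the matrix of the adjoint of \<open>u\<close> composed with
  \<open>v\<close> in the frame (\<psi>, \<xi>): the scalar g(u, v) plus the trace-free matrix X
  with rows (\<i> \<omega>, - cnj \<beta>) and (\<beta>, - \<i> \<omega>).\<close>

lemma cl_expand:
  assumes "u \<in> TT" "v \<in> TT" "u \<noteq> 0"
  shows "complex_of_real (g u u) *\<^sub>C cl v \<psi> = Complex (g u v) (om u v) *\<^sub>C cl u \<psi> + be u v *\<^sub>C cl u \<xi>"
    "complex_of_real (g u u) *\<^sub>C cl v \<xi> = - cnj (be u v) *\<^sub>C cl u \<psi> + Complex (g u v) (- om u v) *\<^sub>C cl u \<xi>"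
proof -
  let ?N = "complex_of_real (g u u)"
  have N: "?N \<noteq> 0" using gpos[OF assms(1,3)] by simp
  have n: "hm (cl u \<psi>) (cl u \<psi>) = ?N" "hm (cl u \<xi>) (cl u \<xi>) = ?N"
    using cl_norm[OF assms(1) psi(1)] cl_norm[OF assms(1) chi(1)] hp_psi chi(3) by simp_all
  note ex = hermitian_plane_expand[OF Hm cl_mem[OF assms(1) psi(1)] cl_mem[OF assms(1) chi(1)] n cl_orth[OF assms(1)] N]
  show "?N *\<^sub>C cl v \<psi> = Complex (g u v) (om u v) *\<^sub>C cl u \<psi> + be u v *\<^sub>C cl u \<xi>"
    using ex[OF cl_mem[OF assms(2) psi(1)]] cl_psi_psi[OF assms(1,2)] by (simp add: be_def)
  show "?N *\<^sub>C cl v \<xi> = - cnj (be u v) *\<^sub>C cl u \<psi> + Complex (g u v) (- om u v) *\<^sub>C cl u \<xi>"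
    using ex[OF cl_mem[OF assms(2) chi(1)]] cl_chi_chi[OF assms(1,2)] cl_chi_psi[OF assms(1,2)] by simp
qed

definition gram where "gram u v = (om u v)\<^sup>2 + (cmod (be u v))\<^sup>2"

text \<open>Comparison of the squared norms of both sides in the expansion of v \<psi>. Thus
  \<open>gram\<close>, which is the determinant of X, is also the Gram determinant of the two
  vectors and detects their independence.\<close>

lemma gram_eq:
  assumes "u \<in> TT" "v \<in> TT"
  shows "g u u * g v v = (g u v)\<^sup>2 + gram u v"
proof (cases "u = 0")
  case True
  have "be 0 v = 0" using be_lin(2)[OF assms(1,1,2), of 0 0] by simp
  moreover have "om 0 v = 0" using om_lin(2)[OF assms(1,1,2), of 0 0] by simp
  ultimately show ?thesis using True assms by (simp add: gram_def g_lin)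
next
  case False
  let ?N = "complex_of_real (g u u)"
  note m = cl_mem[OF assms(1) psi(1)] cl_mem[OF assms(1) chi(1)] cl_mem[OF assms(2) psi(1)]
  have n: "hm (cl u \<psi>) (cl u \<psi>) = ?N" "hm (cl u \<xi>) (cl u \<xi>) = ?N" "hm (cl v \<psi>) (cl v \<psi>) = complex_of_real (g v v)"
    using cl_norm[OF assms(1) psi(1)] cl_norm[OF assms(1) chi(1)] cl_norm[OF assms(2) psi(1)] hp_psi chi(3) by simp_all
  have o: "hm (cl u \<xi>) (cl u \<psi>) = 0" using herm_cnj[OF Hm m(1,2)] cl_orth[OF assms(1)] by simp
  let ?a = "Complex (g u v) (om u v)"
  have "?N * ?N * complex_of_real (g v v) = hm (?N *\<^sub>C cl v \<psi>) (?N *\<^sub>C cl v \<psi>)"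
    using m n by (simp add: mlin mmem)
  also have "\<dots> = ?a * cnj ?a * ?N + be u v * cnj (be u v) * ?N"
    unfolding cl_expand(1)[OF assms False] using m n o cl_orth[OF assms(1)] by (simp add: mlin mmem)
  also have "\<dots> = complex_of_real (((g u v)\<^sup>2 + gram u v) * g u u)"
    by (simp add: gram_def complex_mult_cnj complex_norm_square[symmetric] cmod_power2 distrib_right flip: of_real_add of_real_mult of_real_power)
  finally have "complex_of_real (g u u * g u u * g v v) = complex_of_real (((g u v)\<^sup>2 + gram u v) * g u u)"
    by simp
  then have "(g u u * g v v) * g u u = ((g u v)\<^sup>2 + gram u v) * g u u"
    unfolding of_real_eq_iff by (simp add: mult_ac)
  then show ?thesis using gpos[OF assms(1) False] by simp
qed

lemma gram_pos:
  assumes "u \<in> TT" "v \<in> TT" "u \<noteq> v" "independent {u, v}"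
  shows "gram u v > 0"
proof -
  have i: "\<And>a b. a *\<^sub>R u + b *\<^sub>R v = 0 \<Longrightarrow> a = 0 \<and> b = 0" using assms(3,4) independent_pair by blast
  have u0: "u \<noteq> 0" using i[of 1 0] by auto
  let ?w = "(- g u v) *\<^sub>R u + g u u *\<^sub>R v"
  have "?w \<noteq> 0" using i[of "- g u v" "g u u"] gpos[OF assms(1) u0] by auto
  then have "g ?w ?w > 0" using gpos Tmem assms(1,2) by simp
  also have "g ?w ?w = g u u * (g u u * g v v - (g u v)\<^sup>2)"
    using assms(1,2) gsym[OF assms(1,2)] by (simp add: g_lin Tmem power2_eq_square algebra_simps)
  finally show ?thesis using gram_eq[OF assms(1,2)] gpos[OF assms(1) u0] by (simp add: zero_less_mult_iff)
qed

end

section \<open>Eigenlines and spectral projections\<close>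

context spinor_frame
begin

text \<open>The eigenspace of the trace-free matrix X for the eigenvalue \<i> \<eta> r, where r is
  the root of \<open>gram\<close>; X is skew-Hermitian with X^2 = - r^2. Both equations are kept
  because either may become trivial when \<beta> vanishes.\<close>

definition eline :: "real \<Rightarrow> 'v \<Rightarrow> 'v \<Rightarrow> 's set" where
  "eline \<eta> u v = {a *\<^sub>C \<psi> + b *\<^sub>C \<xi> | a b.
     \<i> * om u v * a - cnj (be u v) * b = \<i> * \<eta> * sqrt (gram u v) * a \<and>
     be u v * a - \<i> * om u v * b = \<i> * \<eta> * sqrt (gram u v) * b}"

text \<open>With \<open>sigma2\<close>, the coefficients of the spectral projection (1 + X / (\<i>
  \<eta> r)) / 2 applied to \<psi>; note that 1 / \<eta> = \<eta>.\<close>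

definition sigma1 :: "real \<Rightarrow> 'v \<Rightarrow> 'v \<Rightarrow> complex" where
  "sigma1 \<eta> u v = complex_of_real ((1 + \<eta> * om u v / sqrt (gram u v)) / 2)"
definition sigma2 :: "real \<Rightarrow> 'v \<Rightarrow> 'v \<Rightarrow> complex" where
  "sigma2 \<eta> u v = - \<i> * \<eta> * be u v / (2 * sqrt (gram u v))"

lemma eline_csubspace: "csubspace (eline \<eta> u v)"
proof (rule cvec.subspaceI)
  show "0 \<in> eline \<eta> u v" unfolding eline_def by (intro CollectI exI[of _ 0]) simp
next
  fix x y assume "x \<in> eline \<eta> u v" "y \<in> eline \<eta> u v"
  then obtain a b c d where *: "x = a *\<^sub>C \<psi> + b *\<^sub>C \<xi>" "y = c *\<^sub>C \<psi> + d *\<^sub>C \<xi>"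
    "\<i> * om u v * a - cnj (be u v) * b = \<i> * \<eta> * sqrt (gram u v) * a" "be u v * a - \<i> * om u v * b = \<i> * \<eta> * sqrt (gram u v) * b"
    "\<i> * om u v * c - cnj (be u v) * d = \<i> * \<eta> * sqrt (gram u v) * c" "be u v * c - \<i> * om u v * d = \<i> * \<eta> * sqrt (gram u v) * d"
    unfolding eline_def by blast
  have "x + y = (a + c) *\<^sub>C \<psi> + (b + d) *\<^sub>C \<xi>" by (simp add: *(1,2) cvec_algebra)
  moreover have "\<i> * om u v * (a + c) - cnj (be u v) * (b + d) = \<i> * \<eta> * sqrt (gram u v) * (a + c)"
    using arg_cong2[OF *(3) *(5), of "(+)"] by (simp add: algebra_simps)
  moreover have "be u v * (a + c) - \<i> * om u v * (b + d) = \<i> * \<eta> * sqrt (gram u v) * (b + d)"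
    using arg_cong2[OF *(4) *(6), of "(+)"] by (simp add: algebra_simps)
  ultimately show "x + y \<in> eline \<eta> u v" unfolding eline_def by blast
next
  fix k x assume "x \<in> eline \<eta> u v"
  then obtain a b where *: "x = a *\<^sub>C \<psi> + b *\<^sub>C \<xi>"
    "\<i> * om u v * a - cnj (be u v) * b = \<i> * \<eta> * sqrt (gram u v) * a" "be u v * a - \<i> * om u v * b = \<i> * \<eta> * sqrt (gram u v) * b"
    unfolding eline_def by blast
  have "k *\<^sub>C x = (k * a) *\<^sub>C \<psi> + (k * b) *\<^sub>C \<xi>" by (simp add: *(1) cvec_algebra)
  moreover have "\<i> * om u v * (k * a) - cnj (be u v) * (k * b) = \<i> * \<eta> * sqrt (gram u v) * (k * a)"
    using arg_cong[OF *(2), of "(*) k"] by (simp add: algebra_simps)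
  moreover have "be u v * (k * a) - \<i> * om u v * (k * b) = \<i> * \<eta> * sqrt (gram u v) * (k * b)"
    using arg_cong[OF *(3), of "(*) k"] by (simp add: algebra_simps)
  ultimately show "k *\<^sub>C x \<in> eline \<eta> u v" unfolding eline_def by blast
qed

lemma eline_subset: "eline \<eta> u v \<subseteq> Sp"
  unfolding eline_def using frame_mem by blast

context
  fixes u v
  assumes uv: "u \<in> TT" "v \<in> TT" "u \<noteq> v" "independent {u, v}"
begin

lemma sqrt_gram: "sqrt (gram u v) > 0" "(sqrt (gram u v))\<^sup>2 = gram u v"
  using gram_pos[OF uv] by auto

lemma gram_complex: "complex_of_real (sqrt (gram u v)) * complex_of_real (sqrt (gram u v)) =
    complex_of_real (om u v) * complex_of_real (om u v) + be u v * cnj (be u v)"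
proof -
  have "complex_of_real (sqrt (gram u v)) * complex_of_real (sqrt (gram u v)) = complex_of_real (gram u v)"
    using sqrt_gram(2) by (metis of_real_mult power2_eq_square)
  also have "\<dots> = complex_of_real (om u v) * complex_of_real (om u v) + be u v * cnj (be u v)"
    by (simp only: gram_def of_real_add complex_norm_square) (simp add: power2_eq_square)
  finally show ?thesis .
qed

text \<open>The second vector is the same projection applied to \<xi>. After clearing the
  denominator 2 r, all four equations reduce to r^2 = \<omega>^2 + |\<beta>|^2.\<close>

lemma sigma_in_eline:
  assumes "\<eta> = 1 \<or> \<eta> = -1"
  shows "sigma1 \<eta> u v *\<^sub>C \<psi> + sigma2 \<eta> u v *\<^sub>C \<xi> \<in> eline \<eta> u v"
    "- cnj (sigma2 (- \<eta>) u v) *\<^sub>C \<psi> + sigma1 (- \<eta>) u v *\<^sub>C \<xi> \<in> eline \<eta> u v"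
proof -
  define r where "r = complex_of_real (sqrt (gram u v))"
  define w where "w = complex_of_real (om u v)"
  define b where "b = be u v"
  have r: "r \<noteq> 0" using sqrt_gram(1) by (simp add: r_def)
  have rr: "r * r = w * w + b * cnj b" using gram_complex by (simp add: r_def w_def b_def)
  have e: "complex_of_real \<eta> * complex_of_real \<eta> = 1" using assms by auto
  have s1: "sigma1 \<eta> u v = (r + \<eta> * w) / (2 * r)" and s2: "sigma2 \<eta> u v = - \<i> * \<eta> * b / (2 * r)"
    and s1': "sigma1 (- \<eta>) u v = (r - \<eta> * w) / (2 * r)" and s2': "- cnj (sigma2 (- \<eta>) u v) = \<i> * \<eta> * cnj b / (2 * r)"
    using r unfolding sigma1_def sigma2_def r_def w_def b_def by (simp_all add: field_simps)
  have "\<i> * w * (r + \<eta> * w) - cnj b * (- \<i> * \<eta> * b) = \<i> * \<eta> * r * (r + \<eta> * w)"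
    "b * (r + \<eta> * w) - \<i> * w * (- \<i> * \<eta> * b) = \<i> * \<eta> * r * (- \<i> * \<eta> * b)"
    "\<i> * w * (\<i> * \<eta> * cnj b) - cnj b * (r - \<eta> * w) = \<i> * \<eta> * r * (\<i> * \<eta> * cnj b)"
    "b * (\<i> * \<eta> * cnj b) - \<i> * w * (r - \<eta> * w) = \<i> * \<eta> * r * (r - \<eta> * w)"
    using rr assms by (auto simp: algebra_simps)
  then have "\<i> * w * sigma1 \<eta> u v - cnj b * sigma2 \<eta> u v = \<i> * \<eta> * r * sigma1 \<eta> u v"
    "b * sigma1 \<eta> u v - \<i> * w * sigma2 \<eta> u v = \<i> * \<eta> * r * sigma2 \<eta> u v"
    "\<i> * w * (- cnj (sigma2 (- \<eta>) u v)) - cnj b * sigma1 (- \<eta>) u v = \<i> * \<eta> * r * (- cnj (sigma2 (- \<eta>) u v))"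
    "b * (- cnj (sigma2 (- \<eta>) u v)) - \<i> * w * sigma1 (- \<eta>) u v = \<i> * \<eta> * r * sigma1 (- \<eta>) u v"
    unfolding s1 s2 s1' s2' times_divide_eq_right diff_divide_distrib[symmetric] by simp_all
  then show "sigma1 \<eta> u v *\<^sub>C \<psi> + sigma2 \<eta> u v *\<^sub>C \<xi> \<in> eline \<eta> u v"
    "- cnj (sigma2 (- \<eta>) u v) *\<^sub>C \<psi> + sigma1 (- \<eta>) u v *\<^sub>C \<xi> \<in> eline \<eta> u v"
    unfolding eline_def r_def w_def b_def by blast+
qed

lemma sigma_sum: "sigma1 \<eta> u v + sigma1 (- \<eta>) u v = 1" "sigma2 (- \<eta>) u v = - sigma2 \<eta> u v"
  unfolding sigma1_def sigma2_def of_real_add[symmetric] by (simp_all add: field_simps)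

text \<open>The projection of \<psi> generates the line as long as its \<psi>-coefficient is
  nonzero; the degenerate case is handled by \<xi>.\<close>

lemma eline_complex_line:
  assumes "\<eta> = 1 \<or> \<eta> = -1"
  shows "eline \<eta> u v \<in> complex_lines Sp"
proof -
  define r where "r = complex_of_real (sqrt (gram u v))"
  define w where "w = complex_of_real (om u v)"
  define b where "b = be u v"
  have r: "r \<noteq> 0" using sqrt_gram(1) by (simp add: r_def)
  have rr: "r * r = w * w + b * cnj b" using gram_complex by (simp add: r_def w_def b_def)
  have s1: "sigma1 \<eta> u v = (r + \<eta> * w) / (2 * r)" and s2: "sigma2 \<eta> u v = - \<i> * \<eta> * b / (2 * r)"
    and s1': "sigma1 (- \<eta>) u v = (r - \<eta> * w) / (2 * r)" and s2': "- cnj (sigma2 (- \<eta>) u v) = \<i> * \<eta> * cnj b / (2 * r)"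
    using r unfolding sigma1_def sigma2_def r_def w_def b_def by (simp_all add: field_simps)
  have "\<exists>p. p \<noteq> 0 \<and> p \<in> eline \<eta> u v \<and> (\<forall>x\<in>eline \<eta> u v. \<exists>c. x = c *\<^sub>C p)"
  proof (cases "r + \<eta> * w = 0")
    case False
    let ?p = "sigma1 \<eta> u v *\<^sub>C \<psi> + sigma2 \<eta> u v *\<^sub>C \<xi>"
    have n: "sigma1 \<eta> u v \<noteq> 0" using False r by (simp add: s1)
    have "?p \<noteq> 0" using n frame_inj[of "sigma1 \<eta> u v" "sigma2 \<eta> u v" 0 0] by auto
    moreover have "\<exists>c. x = c *\<^sub>C ?p" if "x \<in> eline \<eta> u v" for x
    proof -
      obtain a c where x: "x = a *\<^sub>C \<psi> + c *\<^sub>C \<xi>" "b * a - \<i> * w * c = \<i> * \<eta> * r * c"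
        using \<open>x \<in> eline \<eta> u v\<close> unfolding eline_def r_def w_def b_def by blast
      have "c * (r + \<eta> * w) = - \<i> * \<eta> * b * a"
      proof -
        have "b * a = \<i> * (\<eta> * r + w) * c" using x(2) by (simp add: algebra_simps)
        then have "- \<i> * \<eta> * (b * a) = - \<i> * \<eta> * (\<i> * (\<eta> * r + w) * c)" by simp
        then show ?thesis using assms by (auto simp: algebra_simps)
      qed
      then have "c * sigma1 \<eta> u v = a * sigma2 \<eta> u v" unfolding s1 s2 times_divide_eq_right by (simp add: mult_ac)
      then have "x = (a / sigma1 \<eta> u v) *\<^sub>C ?p"
        using n by (simp add: x(1) cvec_algebra frame_inj field_simps)
      then show ?thesis by blast
    qed
    ultimately show ?thesis using sigma_in_eline(1)[OF assms] by blast
  next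
    case True
    \<comment> \<open>Here \<omega> = - \<eta> r, so r^2 = \<omega>^2 + |\<beta>|^2 forces \<beta> =
      0, and \<xi> is its own projection and spans the eigenline.\<close>
    let ?p = "- cnj (sigma2 (- \<eta>) u v) *\<^sub>C \<psi> + sigma1 (- \<eta>) u v *\<^sub>C \<xi>"
    have w: "w = - \<eta> * r"
      using True assms by (auto simp: add_eq_0_iff)
    then have "b * cnj b = 0" using rr assms by auto
    then have b0: "b = 0" by simp
    have p: "?p = \<xi>" using r assms unfolding s1' s2' w b0 by (auto simp: scaleC_one)
    have "\<exists>c. x = c *\<^sub>C \<xi>" if "x \<in> eline \<eta> u v" for x
    proof -
      obtain a c where x: "x = a *\<^sub>C \<psi> + c *\<^sub>C \<xi>" "\<i> * w * a - cnj b * c = \<i> * \<eta> * r * a"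
        using \<open>x \<in> eline \<eta> u v\<close> unfolding eline_def r_def w_def b_def by blast
      then have "2 * (\<i> * \<eta> * r * a) = 0" unfolding w b0 by (simp add: algebra_simps)
      then have "a = 0" using r assms by auto
      then show ?thesis using x(1) by auto
    qed
    moreover have "\<xi> \<in> eline \<eta> u v" using sigma_in_eline(2)[OF assms] unfolding p .
    ultimately show ?thesis using chi_nonzero by blast
  qed
  then obtain p where p: "p \<noteq> 0" "p \<in> eline \<eta> u v" "\<forall>x\<in>eline \<eta> u v. \<exists>c. x = c *\<^sub>C p" by blast
  have "eline \<eta> u v = {c *\<^sub>C p | c. True}"
    using p(3) cvec.subspace_scale[OF eline_csubspace p(2)] by blast
  then show ?thesis unfolding complex_lines_iff using p(1,2) eline_subset by blast
qed

text \<open>Eigenvectors of a skew-Hermitian matrix for distinct eigenvalues are orthogonal.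
  Conversely, orthogonality to the projections of \<psi> and of \<xi> already amounts to the two
  eigenvalue equations. This identifies \<mu> once \<lambda> is known.\<close>

lemma eline_orth:
  "{x \<in> Sp. \<forall>y\<in>eline 1 u v. hp x y = 0} = eline (- 1) u v"
proof (intro equalityI subsetI)
  define r where "r = complex_of_real (sqrt (gram u v))"
  define w where "w = complex_of_real (om u v)"
  define b where "b = be u v"
  have r: "r \<noteq> 0" using sqrt_gram(1) by (simp add: r_def)
  have cr: "cnj r = r" "cnj w = w" by (simp_all add: r_def w_def)
  have s: "sigma1 1 u v = (r + w) / (2 * r)" "sigma2 1 u v = - \<i> * b / (2 * r)"
    "sigma1 (- 1) u v = (r - w) / (2 * r)" "sigma2 (- 1) u v = \<i> * b / (2 * r)"
    using r unfolding sigma1_def sigma2_def r_def w_def b_def by (simp_all add: field_simps)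
  fix x assume x: "x \<in> {x \<in> Sp. \<forall>y\<in>eline 1 u v. hp x y = 0}"
  define a c where "a = hp x \<psi>" and "c = hp x \<xi>"
  have xe: "x = a *\<^sub>C \<psi> + c *\<^sub>C \<xi>" using x Sp_expand by (simp add: a_def c_def)
  have "hp x (sigma1 1 u v *\<^sub>C \<psi> + sigma2 1 u v *\<^sub>C \<xi>) = 0"
    "hp x (- cnj (sigma2 (- 1) u v) *\<^sub>C \<psi> + sigma1 (- 1) u v *\<^sub>C \<xi>) = 0"
    using x sigma_in_eline[of 1] by auto
  then have "a * cnj (sigma1 1 u v) + c * cnj (sigma2 1 u v) = 0" "a * - sigma2 (- 1) u v + c * cnj (sigma1 (- 1) u v) = 0"
    unfolding xe hp_frame(3) by simp_all
  moreover have "cnj (sigma1 1 u v) = (r + w) / (2 * r)" "cnj (sigma2 1 u v) = (\<i> * cnj b) / (2 * r)"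
    "cnj (sigma1 (- 1) u v) = (r - w) / (2 * r)" "- sigma2 (- 1) u v = (- \<i> * b) / (2 * r)"
    unfolding s complex_cnj_divide complex_cnj_mult complex_cnj_add complex_cnj_diff cr by simp_all
  ultimately have "(a * (r + w) + c * (\<i> * cnj b)) / (2 * r) = 0" "(a * (- \<i> * b) + c * (r - w)) / (2 * r) = 0"
    by (simp_all only: add_divide_distrib[symmetric] times_divide_eq_right)
  then have "a * (r + w) + c * (\<i> * cnj b) = 0" "a * (- \<i> * b) + c * (r - w) = 0"
    using r by simp_all
  then have "\<i> * (a * (r + w) + c * (\<i> * cnj b)) = 0" "\<i> * (a * (- \<i> * b) + c * (r - w)) = 0" by simp_all
  then have "\<i> * w * a - cnj b * c = \<i> * (- 1) * r * a" "b * a - \<i> * w * c = \<i> * (- 1) * r * c"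
    by (simp_all add: algebra_simps eq_neg_iff_add_eq_0)
  then show "x \<in> eline (- 1) u v" unfolding eline_def xe r_def w_def b_def by auto
next
  fix x assume "x \<in> eline (- 1) u v"
  then obtain a c where x: "x = a *\<^sub>C \<psi> + c *\<^sub>C \<xi>"
    "\<i> * om u v * a - cnj (be u v) * c = - \<i> * sqrt (gram u v) * a" "be u v * a - \<i> * om u v * c = - \<i> * sqrt (gram u v) * c"
    unfolding eline_def by auto
  have "hp x y = 0" if "y \<in> eline 1 u v" for y
  proof -
    obtain a' c' where y: "y = a' *\<^sub>C \<psi> + c' *\<^sub>C \<xi>"
      "\<i> * om u v * a' - cnj (be u v) * c' = \<i> * sqrt (gram u v) * a'" "be u v * a' - \<i> * om u v * c' = \<i> * sqrt (gram u v) * c'"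
      using \<open>y \<in> eline 1 u v\<close> unfolding eline_def by auto
    have y': "- \<i> * om u v * cnj a' - be u v * cnj c' = - \<i> * sqrt (gram u v) * cnj a'"
      "cnj (be u v) * cnj a' + \<i> * om u v * cnj c' = - \<i> * sqrt (gram u v) * cnj c'"
      using arg_cong[OF y(2), of cnj] arg_cong[OF y(3), of cnj] by simp_all
    have "(- \<i> * sqrt (gram u v) * a) * cnj a' + (- \<i> * sqrt (gram u v) * c) * cnj c' =
      (\<i> * om u v * a - cnj (be u v) * c) * cnj a' + (be u v * a - \<i> * om u v * c) * cnj c'" using x by simp
    also have "\<dots> = - a * (- \<i> * om u v * cnj a' - be u v * cnj c') - c * (cnj (be u v) * cnj a' + \<i> * om u v * cnj c')"
      by (simp add: algebra_simps)
    also have "\<dots> = - a * (- \<i> * sqrt (gram u v) * cnj a') - c * (- \<i> * sqrt (gram u v) * cnj c')" unfolding y' by simp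
    finally have "2 * (\<i> * sqrt (gram u v) * (a * cnj a' + c * cnj c')) = 0" by (simp add: algebra_simps)
    then have "a * cnj a' + c * cnj c' = 0" using sqrt_gram(1) by simp
    then show ?thesis unfolding x(1) y(1) hp_frame(3) .
  qed
  then show "x \<in> {x \<in> Sp. \<forall>y\<in>eline 1 u v. hp x y = 0}" using x(1) frame_mem by simp
qed

lemma eline_inter:
  assumes "x \<in> eline 1 u v" "x \<in> eline (- 1) u v" shows "x = 0"
  using assms herm_pos(2)[OF Hp, of x] eline_subset unfolding eline_orth[symmetric] by auto

text \<open>The two eigenlines meet only in 0, so the description \<open>component\<close> has a
  unique solution, namely the spectral projection; its complement is the projection for the other
  sign.\<close>

lemma component_eline:
  assumes "\<eta> = 1 \<or> \<eta> = -1"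
  shows "component (eline \<eta> u v) (eline (- \<eta>) u v) \<psi> = sigma1 \<eta> u v *\<^sub>C \<psi> + sigma2 \<eta> u v *\<^sub>C \<xi>"
    "component (eline \<eta> u v) (eline (- \<eta>) u v) \<xi> = - cnj (sigma2 (- \<eta>) u v) *\<^sub>C \<psi> + sigma1 (- \<eta>) u v *\<^sub>C \<xi>"
proof -
  have uniq: "component (eline \<eta> u v) (eline (- \<eta>) u v) x = y"
    if "y \<in> eline \<eta> u v" "x - y \<in> eline (- \<eta>) u v" for x y
    unfolding component_def
  proof (rule the_equality)
    show "y \<in> eline \<eta> u v \<and> x - y \<in> eline (- \<eta>) u v" using that by blast
    fix y' assume y': "y' \<in> eline \<eta> u v \<and> x - y' \<in> eline (- \<eta>) u v"
    have "y - y' \<in> eline \<eta> u v" using cvec.subspace_diff[OF eline_csubspace] that y' by blast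
    moreover have "(x - y') - (x - y) \<in> eline (- \<eta>) u v" using cvec.subspace_diff[OF eline_csubspace] that y' by blast
    ultimately show "y' = y" using eline_inter[of "y - y'"] assms by auto
  qed
  have m: "- \<eta> = 1 \<or> - \<eta> = - 1" using assms by auto
  have s: "1 - sigma1 \<eta> u v = sigma1 (- \<eta>) u v" "- sigma2 \<eta> u v = sigma2 (- \<eta>) u v"
    "1 - sigma1 (- \<eta>) u v = sigma1 (- (- \<eta>)) u v"
    using sigma_sum[of \<eta>] sigma_sum[of "- \<eta>"] by (simp_all only: diff_eq_eq add.commute)
  show "component (eline \<eta> u v) (eline (- \<eta>) u v) \<psi> = sigma1 \<eta> u v *\<^sub>C \<psi> + sigma2 \<eta> u v *\<^sub>C \<xi>"
  proof (rule uniq[OF sigma_in_eline(1)[OF assms]])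
    have "\<psi> - (sigma1 \<eta> u v *\<^sub>C \<psi> + sigma2 \<eta> u v *\<^sub>C \<xi>) = (1 - sigma1 \<eta> u v) *\<^sub>C \<psi> + (- sigma2 \<eta> u v) *\<^sub>C \<xi>"
      by (simp add: cvec_algebra)
    also have "\<dots> = sigma1 (- \<eta>) u v *\<^sub>C \<psi> + sigma2 (- \<eta>) u v *\<^sub>C \<xi>"
      by (simp only: s)
    finally show "\<psi> - (sigma1 \<eta> u v *\<^sub>C \<psi> + sigma2 \<eta> u v *\<^sub>C \<xi>) \<in> eline (- \<eta>) u v" using sigma_in_eline(1)[OF m] by simp
  qed
  show "component (eline \<eta> u v) (eline (- \<eta>) u v) \<xi> = - cnj (sigma2 (- \<eta>) u v) *\<^sub>C \<psi> + sigma1 (- \<eta>) u v *\<^sub>C \<xi>"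
  proof (rule uniq[OF sigma_in_eline(2)[OF assms]])
    have "\<xi> - (- cnj (sigma2 (- \<eta>) u v) *\<^sub>C \<psi> + sigma1 (- \<eta>) u v *\<^sub>C \<xi>) = cnj (sigma2 (- \<eta>) u v) *\<^sub>C \<psi> + (1 - sigma1 (- \<eta>) u v) *\<^sub>C \<xi>"
      by (simp add: cvec_algebra)
    also have "\<dots> = - cnj (sigma2 (- (- \<eta>)) u v) *\<^sub>C \<psi> + sigma1 (- (- \<eta>)) u v *\<^sub>C \<xi>"
      by (simp only: s(3) sigma_sum(2)[of \<eta>] complex_cnj_minus minus_minus)
    finally show "\<xi> - (- cnj (sigma2 (- \<eta>) u v) *\<^sub>C \<psi> + sigma1 (- \<eta>) u v *\<^sub>C \<xi>) \<in> eline (- \<eta>) u v"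
      using sigma_in_eline(2)[OF m] by simp
  qed
qed

text \<open>The eigenvalue g(u, v) + \<i> r of the full product for \<eta> = 1, divided by g(u, u):
  the factor by which \<open>v\<close> differs from \<open>u\<close> on that eigenline.\<close>

definition "zeta = Complex (g u v) (sqrt (gram u v)) / complex_of_real (g u u)"

lemma u_nonzero: "u \<noteq> 0"
  using uv(3,4) independent_pair[of u v] by (metis scaleR_one scale_zero_right add.right_neutral scaleR_zero_left zero_neq_one scaleR_zero_right)

lemma guu: "g u u > 0" using gpos[OF uv(1) u_nonzero] .

lemma zeta_Im: "Im zeta > 0" using guu sqrt_gram(1) by (simp add: zeta_def)

lemma eline_iff_zeta:
  assumes "x \<in> Sp"
  shows "cl v x = zeta *\<^sub>C cl u x \<longleftrightarrow> x \<in> eline 1 u v"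
proof -
  define r where "r = complex_of_real (sqrt (gram u v))"
  define w where "w = complex_of_real (om u v)"
  define b where "b = be u v"
  define G where "G = complex_of_real (g u v)"
  let ?N = "complex_of_real (g u u)"
  have N: "?N \<noteq> 0" using guu by simp
  define a c where "a = hp x \<psi>" and "c = hp x \<xi>"
  have xe: "x = a *\<^sub>C \<psi> + c *\<^sub>C \<xi>" using Sp_expand[OF assms] by (simp add: a_def c_def)
  have Cx: "Complex (g u v) (om u v) = G + \<i> * w" "Complex (g u v) (- om u v) = G - \<i> * w"
    "Complex (g u v) (sqrt (gram u v)) = G + \<i> * r"
    by (simp_all add: G_def w_def r_def complex_eq_iff)
  have cu: "cl u x = a *\<^sub>C cl u \<psi> + c *\<^sub>C cl u \<xi>" and cv: "cl v x = a *\<^sub>C cl v \<psi> + c *\<^sub>C cl v \<xi>"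
    unfolding xe using cl_clin[OF uv(1) psi(1) chi(1)] cl_clin[OF uv(2) psi(1) chi(1)] by auto
  have inj: "p *\<^sub>C cl u \<psi> + q *\<^sub>C cl u \<xi> = p' *\<^sub>C cl u \<psi> + q' *\<^sub>C cl u \<xi> \<longleftrightarrow> p = p' \<and> q = q'" for p q p' q'
  proof
    assume "p *\<^sub>C cl u \<psi> + q *\<^sub>C cl u \<xi> = p' *\<^sub>C cl u \<psi> + q' *\<^sub>C cl u \<xi>"
    then have "(p - p') *\<^sub>C cl u \<psi> + (q - q') *\<^sub>C cl u \<xi> = 0" by (simp add: cvec_algebra algebra_simps)
    then have "cl u ((p - p') *\<^sub>C \<psi> + (q - q') *\<^sub>C \<xi>) = 0" using cl_clin[OF uv(1) psi(1) chi(1)] by simp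
    then have "(p - p') *\<^sub>C \<psi> + (q - q') *\<^sub>C \<xi> = 0"
      using cl_zero[OF uv(1) frame_mem] u_nonzero by blast
    then show "p = p' \<and> q = q'" using frame_inj[of "p - p'" "q - q'" 0 0] by simp
  qed simp
  have "?N *\<^sub>C cl v x = a *\<^sub>C (?N *\<^sub>C cl v \<psi>) + c *\<^sub>C (?N *\<^sub>C cl v \<xi>)" unfolding cv by (simp add: cvec_algebra mult.commute)
  also have "\<dots> = (a * (G + \<i> * w) - c * cnj b) *\<^sub>C cl u \<psi> + (a * b + c * (G - \<i> * w)) *\<^sub>C cl u \<xi>"
    unfolding cl_expand[OF uv(1,2) u_nonzero] Cx b_def by (simp add: cvec_algebra algebra_simps)
  finally have 1: "?N *\<^sub>C cl v x = (a * (G + \<i> * w) - c * cnj b) *\<^sub>C cl u \<psi> + (a * b + c * (G - \<i> * w)) *\<^sub>C cl u \<xi>" .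
  have 2: "?N *\<^sub>C (zeta *\<^sub>C cl u x) = ((G + \<i> * r) * a) *\<^sub>C cl u \<psi> + ((G + \<i> * r) * c) *\<^sub>C cl u \<xi>"
    unfolding cu zeta_def Cx using N by (simp add: cvec_algebra)
  have "cl v x = zeta *\<^sub>C cl u x \<longleftrightarrow> ?N *\<^sub>C cl v x = ?N *\<^sub>C (zeta *\<^sub>C cl u x)"
    using N by (metis cvec.scale_left_imp_eq)
  also have "\<dots> \<longleftrightarrow> a * (G + \<i> * w) - c * cnj b = (G + \<i> * r) * a \<and> a * b + c * (G - \<i> * w) = (G + \<i> * r) * c"
    unfolding 1 2 inj ..
  \<comment> \<open>The scalar part g(u, v) cancels and leaves the eigenvalue equations of
    X.\<close>
  also have "\<dots> \<longleftrightarrow> \<i> * w * a - cnj b * c = \<i> * r * a \<and> b * a - \<i> * w * c = \<i> * r * c"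
    by (simp add: algebra_simps)
  also have "\<dots> \<longleftrightarrow> x \<in> eline 1 u v"
    unfolding eline_def xe r_def w_def b_def by (auto simp: frame_inj)
  finally show ?thesis .
qed

text \<open>Polarization fixes Re z and the norms fix |z|^2, both through g alone, so Im z is known
  up to sign and its positivity leaves z = \<open>zeta\<close>. Hence no other spinor line can carry
  the plane with the given orientation.\<close>

lemma eline_unique:
  assumes "x \<in> Sp" "x \<noteq> 0" "cl v x = z *\<^sub>C cl u x" "Im z > 0"
  shows "x \<in> eline 1 u v"
proof -
  define n where "n = Re (hp x x)"
  have n: "n > 0" "hp x x = complex_of_real n"
    using herm_pos[OF Hp assms(1)] assms(2) herm_eq[OF Hp assms(1)] by (auto simp: n_def less_le)
  note m = cl_mem[OF uv(1) assms(1)] cl_mem[OF uv(2) assms(1)]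
  have uu: "hm (cl u x) (cl u x) = complex_of_real (g u u * n)" using cl_norm[OF uv(1) assms(1)] n(2) by simp
  have vv: "hm (cl v x) (cl v x) = complex_of_real (g v v * n)" using cl_norm[OF uv(2) assms(1)] n(2) by simp
  have "hm (cl u x) (cl v x) + hm (cl v x) (cl u x) = complex_of_real (2 * g u v) * hp x x"
    using cl_polar[OF uv(1,2) assms(1)] .
  then have "cnj z * complex_of_real (g u u * n) + z * complex_of_real (g u u * n) = complex_of_real (2 * g u v * n)"
    unfolding assms(3) using m uu n(2) by (simp add: mlin mmem)
  then have "Re z * (g u u * n) * 2 = g u v * n * 2" by (simp add: complex_eq_iff)
  then have re: "Re z = g u v / g u u" using n(1) guu by (simp add: field_simps)
  have "z * cnj z * complex_of_real (g u u * n) = complex_of_real (g v v * n)"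
    using vv m uu unfolding assms(3) by (simp add: mlin mmem mult_ac)
  then have "((Re z)\<^sup>2 + (Im z)\<^sup>2) * (g u u * n) = g v v * n"
    by (simp add: complex_mult_cnj flip: of_real_mult of_real_add of_real_power)
  then have "((Re z)\<^sup>2 + (Im z)\<^sup>2) * g u u = g v v" using n(1) by simp
  moreover have "(Re z * g u u)\<^sup>2 + (Im z * g u u)\<^sup>2 = g u u * (((Re z)\<^sup>2 + (Im z)\<^sup>2) * g u u)"
    by (simp add: power2_eq_square algebra_simps)
  moreover have "Re z * g u u = g u v" using re guu by simp
  ultimately have "(g u v)\<^sup>2 + (Im z * g u u)\<^sup>2 = g u u * g v v" by simp
  then have "(Im z * g u u)\<^sup>2 = gram u v" using gram_eq[OF uv(1,2)] by simp
  then have "Im z * g u u = sqrt (gram u v)" using assms(4) guu by (metis real_sqrt_unique mult_nonneg_nonneg less_imp_le)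
  then have "z = zeta" using re guu by (simp add: zeta_def complex_eq_iff field_simps)
  then show ?thesis using assms(1,3) eline_iff_zeta by simp
qed

lemma be_zero_imp:
  assumes "be u v = 0"
  shows "g u u *\<^sub>R v = g u v *\<^sub>R u + om u v *\<^sub>R J u"
proof -
  have "cl (g u u *\<^sub>R v) \<psi> = complex_of_real (g u u) *\<^sub>C cl v \<psi>"
    using cl_rlin_at[OF uv(2,2), of "g u u" 0 \<psi>] by (simp add: scaleR_scaleC)
  also have "\<dots> = Complex (g u v) (om u v) *\<^sub>C cl u \<psi>"
    unfolding cl_expand(1)[OF uv(1,2) u_nonzero] assms by simp
  also have "\<dots> = cl (g u v *\<^sub>R u + om u v *\<^sub>R J u) \<psi>" using complex_scale_T[OF uv(1)] by simp
  finally show ?thesis by (rule cl_eq[rotated -1]) (use uv psi(1) psi_nonzero in \<open>simp_all add: Tmem\<close>)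
qed

text \<open>Vanishing means \<beta> = 0 together with \<eta> \<omega> = - r. By
  \<open>be_zero_imp\<close> the former puts \<open>v\<close> into the complex line of
  \<open>u\<close>; the latter fixes the sign of its J u coefficient.\<close>

lemma sigma_zero_iff:
  assumes "\<eta> = 1 \<or> \<eta> = -1"
  shows "sigma1 \<eta> u v *\<^sub>C \<psi> + sigma2 \<eta> u v *\<^sub>C \<xi> = 0 \<longleftrightarrow> (\<exists>p q. v = p *\<^sub>R u + q *\<^sub>R J u \<and> \<eta> * q < 0)" (is "?L \<longleftrightarrow> ?R")
proof
  assume ?L
  then have "sigma1 \<eta> u v = 0" "sigma2 \<eta> u v = 0"
    using frame_inj[of "sigma1 \<eta> u v" "sigma2 \<eta> u v" 0 0] by simp_all
  then have b: "be u v = 0" and o: "1 + \<eta> * om u v / sqrt (gram u v) = 0"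
    using sqrt_gram(1) assms unfolding sigma1_def sigma2_def of_real_eq_0_iff by auto
  have o: "\<eta> * om u v = - sqrt (gram u v)" using o sqrt_gram(1) by (simp add: field_simps)
  have "v = (1 / g u u) *\<^sub>R (g u u *\<^sub>R v)" using guu by simp
  also have "\<dots> = (g u v / g u u) *\<^sub>R u + (om u v / g u u) *\<^sub>R J u"
    unfolding be_zero_imp[OF b] by (simp add: scaleR_right_distrib)
  finally have "v = (g u v / g u u) *\<^sub>R u + (om u v / g u u) *\<^sub>R J u" .
  moreover have "\<eta> * (om u v / g u u) < 0"
    unfolding times_divide_eq_right o using guu sqrt_gram(1) by (simp add: divide_neg_pos)
  ultimately show ?R by blast
next
  assume ?R
  then obtain p q where v: "v = p *\<^sub>R u + q *\<^sub>R J u" "\<eta> * q < 0" by blast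
  have b: "be u v = 0" unfolding v(1) be_lin(1)[OF uv(1) Tmem(6)[OF uv(1)] uv(1)] using uv(1) by (simp add: be_J be_self)
  have o: "om u v = q * g u u" unfolding v(1) om_lin(1)[OF uv(1) Tmem(6)[OF uv(1)] uv(1)] using uv(1) by (simp add: om_J om_self)
  have "sqrt (gram u v) = \<bar>q\<bar> * g u u" unfolding gram_def b o using guu by (simp add: real_sqrt_mult power_mult_distrib)
  also have "\<bar>q\<bar> = - \<eta> * q" using v(2) assms by auto
  finally have "\<eta> * om u v / sqrt (gram u v) = -1" using o guu v(2) assms by auto
  then show ?L unfolding sigma1_def sigma2_def b by simp
qed

lemma orient_class_J_plane:
  assumes "v = p *\<^sub>R u + q *\<^sub>R J u" "\<eta> * q < 0" "\<eta> = 1 \<or> \<eta> = -1"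
  shows "orient_class [u, v] = orient_class [u, - \<eta> *\<^sub>R J u]"
proof (rule orient_class_eq)
  have "[u, v] = [1 *\<^sub>R u + 0 *\<^sub>R (- \<eta> *\<^sub>R J u), p *\<^sub>R u + (- \<eta> * q) *\<^sub>R (- \<eta> *\<^sub>R J u)]"
    unfolding assms(1) using assms(3) by auto
  moreover have "1 * (- \<eta> * q) - 0 * p > 0" using assms(2) by simp
  ultimately show "[u, v] \<in> orient_class [u, - \<eta> *\<^sub>R J u]" unfolding orient_class_pair by blast
qed

end

text \<open>A nonzero tangent vector is injective on spinors, so its restriction to \<open>L\<close>
  generates the complex line of homomorphisms, and this generator with its product by \<i> is an
  oriented real basis.\<close>

lemma complex_hom_line_orientation:
  assumes L: "L \<in> complex_lines Sp" "L' \<in> complex_lines Sm" and u: "u \<in> TT" "u \<noteq> 0" "cl u ` L \<subseteq> L'"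
  defines "\<rho> \<equiv> \<lambda>A x. if x \<in> L then A x else (0::'t)"
  shows "complex_orientation (\<lambda>B x. \<i> *\<^sub>C B x) id (complex_hom L L') (complex_hom L L') =
    orient_class [\<rho> (cl u), \<lambda>x. \<i> *\<^sub>C \<rho> (cl u) x]"
proof -
  obtain p where p: "p \<noteq> 0" "p \<in> Sp" "L = {c *\<^sub>C p | c. True}" "L \<subseteq> Sp" using L(1) unfolding complex_lines_iff by blast
  have cL: "csubspace L" "csubspace L'" using L by (auto simp: complex_lines_def)
  have pL: "p \<in> L" unfolding p(3) by (intro CollectI exI[of _ 1]) (simp add: scaleC_one)
  have Ap: "cl u p \<noteq> 0" "cl u p \<in> L'" using cl_zero[OF u(1) p(2,1)] u(2,3) pL by auto
  obtain p' where p': "L' = {c *\<^sub>C p' | c. True}" using L(2) unfolding complex_lines_iff by blast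
  let ?a = "\<rho> (cl u)"
  have a: "?a \<in> complex_hom L L'"
    unfolding complex_hom_def \<rho>_def
    using u(3) cL(1) p(4) cl_clin[OF u(1)] cvec.subspace_add[OF cL(1)] cvec.subspace_scale[OF cL(1)]
    by (auto simp: subset_eq)
  have comb: "r *\<^sub>R ?a + s *\<^sub>R (\<lambda>x. \<i> *\<^sub>C ?a x) = (\<lambda>x. Complex r s *\<^sub>C ?a x)" for r s
  proof -
    have "Complex r s = complex_of_real r + complex_of_real s * \<i>" by (simp add: complex_eq_iff)
    then show ?thesis by (simp add: fun_eq_iff scaleR_fun_def scaleR_scaleC cvec_algebra)
  qed
  have homI: "\<exists>k. C = (\<lambda>x. k *\<^sub>C ?a x)" if C: "C \<in> complex_hom L L'" for C
  proof -
    have "C p \<in> L'" using C pL by (auto simp: complex_hom_def)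
    then obtain c1 c2 where c: "C p = c1 *\<^sub>C p'" "cl u p = c2 *\<^sub>C p'" using Ap(2) unfolding p' by blast
    have "c2 \<noteq> 0" using Ap(1) c(2) by auto
    then have k: "C p = (c1 / c2) *\<^sub>C cl u p" unfolding c by (simp add: cvec_algebra)
    have "C x = (c1 / c2) *\<^sub>C ?a x" for x
    proof (cases "x \<in> L")
      case True
      then obtain d where d: "x = d *\<^sub>C p" using p(3) by blast
      have "C (d *\<^sub>C p + 0 *\<^sub>C p) = d *\<^sub>C C p + 0 *\<^sub>C C p" using C pL unfolding complex_hom_def by blast
      then show ?thesis using True cl_scale[OF u(1) p(2), of d] k unfolding d by (simp add: \<rho>_def cvec_algebra mult.commute)
    next
      case False
      then show ?thesis using C by (simp add: \<rho>_def complex_hom_def)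
    qed
    then show ?thesis by blast
  qed
  have homI': "(\<lambda>x. k *\<^sub>C ?a x) \<in> complex_hom L L'" for k
  proof -
    have "k *\<^sub>C ?a (a *\<^sub>C x + b *\<^sub>C y) = a *\<^sub>C k *\<^sub>C ?a x + b *\<^sub>C k *\<^sub>C ?a y" if "x \<in> L" "y \<in> L" for a b x y
    proof -
      have "?a (a *\<^sub>C x + b *\<^sub>C y) = a *\<^sub>C ?a x + b *\<^sub>C ?a y" using a that unfolding complex_hom_def by blast
      then show ?thesis by (simp add: cvec_algebra mult.commute)
    qed
    moreover have "k *\<^sub>C ?a x \<in> L'" if "x \<in> L" for x
      using a that cvec.subspace_scale[OF cL(2)] by (auto simp: complex_hom_def)
    ultimately show ?thesis by (simp add: complex_hom_def \<rho>_def)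
  qed
  have "complex_orientation (\<lambda>B x. \<i> *\<^sub>C B x) id (complex_hom L L') (complex_hom L L') =
    orient_class [id ?a, id (\<lambda>x. \<i> *\<^sub>C ?a x)]"
  proof (rule complex_orientation_line[OF a])
    have "span {?a, \<lambda>x. \<i> *\<^sub>C ?a x} = {(\<lambda>x. k *\<^sub>C ?a x) | k. True}"
    proof -
      have "\<exists>r s. (\<lambda>x. k *\<^sub>C ?a x) = (\<lambda>x. Complex r s *\<^sub>C ?a x)" for k
        by (intro exI[of _ "Re k"] exI[of _ "Im k"]) (simp add: complex_eq_iff)
      then show ?thesis unfolding span_pair comb by blast
    qed
    also have "\<dots> = complex_hom L L'" using homI homI' by blast
    finally have sp: "span {?a, \<lambda>x. \<i> *\<^sub>C ?a x} = complex_hom L L'" .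
    have "r = 0 \<and> s = 0" if "r *\<^sub>R ?a + s *\<^sub>R (\<lambda>x. \<i> *\<^sub>C ?a x) = 0" for r s
    proof -
      have "Complex r s *\<^sub>C cl u p = 0" using fun_cong[OF that[unfolded comb], of p] pL by (simp add: \<rho>_def)
      then show ?thesis using Ap(1) by (simp add: complex_eq_iff)
    qed
    then show "basis_list [id ?a, id (\<lambda>x. \<i> *\<^sub>C ?a x)] (complex_hom L L')"
      using sp independent_pair[of ?a "\<lambda>x. \<i> *\<^sub>C ?a x"] by (simp add: basis_list_pair)
  next
    fix C assume "C \<in> complex_hom L L'"
    then obtain k where k: "C = (\<lambda>x. k *\<^sub>C ?a x)" using homI by blast
    have "C = Re k *\<^sub>R ?a + Im k *\<^sub>R (\<lambda>x. \<i> *\<^sub>C ?a x)" unfolding comb k by simp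
    moreover have "(\<lambda>x. \<i> *\<^sub>C C x) = - Im k *\<^sub>R ?a + Re k *\<^sub>R (\<lambda>x. \<i> *\<^sub>C ?a x)"
    proof -
      have "\<i> * k = Complex (- Im k) (Re k)" by (simp add: complex_eq_iff)
      then show ?thesis unfolding comb k by (simp add: cvec_algebra)
    qed
    ultimately show "\<exists>p q. id C = p *\<^sub>R id ?a + q *\<^sub>R id (\<lambda>x. \<i> *\<^sub>C ?a x) \<and>
       id (\<lambda>x. \<i> *\<^sub>C C x) = - q *\<^sub>R id ?a + p *\<^sub>R id (\<lambda>x. \<i> *\<^sub>C ?a x)"
      unfolding id_apply by blast
  qed
  then show ?thesis by simp
qed

text \<open>This resolves the description defining the fibre of \<lambda>. A plane of the form
  \<open>Psi G L L'\<close> satisfies v = z u on \<open>L\<close> with Im z > 0, and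
  \<open>eline_unique\<close> applies; conversely \<open>L'\<close> can be taken as the image of the
  eigenline under \<open>u\<close>.\<close>

lemma Psi_eline_iff:
  assumes uv: "u \<in> TT" "v \<in> TT" "u \<noteq> v" "independent {u, v}"
  shows "L \<in> complex_lines Sp \<and> (\<exists>L'\<in>complex_lines Sm. map cl ` orient_class [u, v] = Psi G L L') \<longleftrightarrow> L = eline 1 u v"
proof
  assume "L \<in> complex_lines Sp \<and> (\<exists>L'\<in>complex_lines Sm. map cl ` orient_class [u, v] = Psi G L L')"
  then obtain L' where L: "L \<in> complex_lines Sp" "L' \<in> complex_lines Sm" "map cl ` orient_class [u, v] = Psi G L L'" by blast
  have "[cl u, cl v] \<in> Psi G L L'" using orient_class_refl[of "[u, v]"] unfolding L(3)[symmetric] by force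
  then have m: "basis_list [cl u, cl v] {A \<in> spinc4_space G. A ` L \<subseteq> L'}"
    "[\<lambda>x. if x \<in> L then cl u x else 0, \<lambda>x. if x \<in> L then cl v x else 0] \<in>
      complex_orientation (\<lambda>B x. \<i> *\<^sub>C B x) id (complex_hom L L') (complex_hom L L')"
    by (simp_all add: Psi_def)
  have uL: "cl u ` L \<subseteq> L'" using basis_list_subset[OF m(1)] by auto
  obtain p where p: "p \<noteq> 0" "p \<in> Sp" "L = {c *\<^sub>C p | c. True}" using L(1) unfolding complex_lines_iff by blast
  have pL: "p \<in> L" unfolding p(3) by (intro CollectI exI[of _ 1]) (simp add: scaleC_one)
  obtain k l r s where k: "(\<lambda>x. if x \<in> L then cl u x else 0) = k *\<^sub>R (\<lambda>x. if x \<in> L then cl u x else 0) + l *\<^sub>R (\<lambda>x. \<i> *\<^sub>C (if x \<in> L then cl u x else 0))"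
    "(\<lambda>x. if x \<in> L then cl v x else 0) = r *\<^sub>R (\<lambda>x. if x \<in> L then cl u x else 0) + s *\<^sub>R (\<lambda>x. \<i> *\<^sub>C (if x \<in> L then cl u x else 0))"
    "k * s - l * r > 0"
    using m(2) unfolding complex_hom_line_orientation[OF L(1,2) uv(1) u_nonzero[OF uv] uL] orient_class_pair by auto
  have "cl u p = k *\<^sub>R cl u p + l *\<^sub>R (\<i> *\<^sub>C cl u p)" "cl v p = r *\<^sub>R cl u p + s *\<^sub>R (\<i> *\<^sub>C cl u p)"
    using fun_cong[OF k(1), of p] fun_cong[OF k(2), of p] pL by (simp_all add: scaleR_fun_def)
  moreover have "Complex a b = complex_of_real a + complex_of_real b * \<i>" for a b by (simp add: complex_eq_iff)
  ultimately have e: "cl u p = Complex k l *\<^sub>C cl u p" "cl v p = Complex r s *\<^sub>C cl u p"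
    by (simp_all add: scaleR_scaleC cvec_algebra)
  have "(Complex k l - 1) *\<^sub>C cl u p = 0" using e(1) by (simp add: cvec_algebra)
  moreover have "cl u p \<noteq> 0" using cl_zero[OF uv(1) p(2,1)] u_nonzero[OF uv] by blast
  \<comment> \<open>The first entry is the reference generator itself, so the positive determinant
    \<open>k * s - l * r\<close> is just \<open>s\<close>, the imaginary part of the factor.\<close>
  ultimately have "k = 1" "l = 0" by (simp_all add: complex_eq_iff)
  then have "s > 0" using k(3) by simp
  then have "p \<in> eline 1 u v" using eline_unique[OF uv p(2,1) e(2)] by simp
  moreover obtain p' where "eline 1 u v = {c *\<^sub>C p' | c. True}" using eline_complex_line[OF uv, of 1] unfolding complex_lines_iff by blast
  ultimately obtain c where c: "p = c *\<^sub>C p'" "eline 1 u v = {c *\<^sub>C p' | c. True}" by blast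
  have "c \<noteq> 0" using c(1) p(1) by auto
  then have "d *\<^sub>C p' = (d / c) *\<^sub>C p" for d unfolding c(1) by (simp add: cvec_algebra)
  then have "eline 1 u v \<subseteq> L" unfolding c(2) p(3) by blast
  moreover have "L \<subseteq> eline 1 u v" unfolding p(3) using cvec.subspace_scale[OF eline_csubspace \<open>p \<in> eline 1 u v\<close>] by blast
  ultimately show "L = eline 1 u v" by blast
next
  assume L: "L = eline 1 u v"
  have LS: "L \<in> complex_lines Sp" unfolding L by (rule eline_complex_line[OF uv]) simp
  obtain p where p: "p \<noteq> 0" "p \<in> Sp" "L = {c *\<^sub>C p | c. True}" "L \<subseteq> Sp" using LS unfolding complex_lines_iff by blast
  have pL: "p \<in> L" unfolding p(3) by (intro CollectI exI[of _ 1]) (simp add: scaleC_one)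
  have u0: "u \<noteq> 0" by (rule u_nonzero[OF uv])
  define L' where "L' = {c *\<^sub>C cl u p | c. True}"
  have L'S: "L' \<in> complex_lines Sm"
    unfolding complex_lines_iff L'_def using cl_zero[OF uv(1) p(2,1)] u0 cl_mem[OF uv(1) p(2)] mmem(2)
    by (intro exI[of _ "cl u p"]) auto
  have cL': "csubspace L'" using L'S by (simp add: complex_lines_def)
  have uL: "cl u ` L \<subseteq> L'" unfolding L'_def using p(3) cl_scale[OF uv(1) p(2)] by blast
  define z where "z = zeta u v"
  have vz: "cl v x = z *\<^sub>C cl u x" if "x \<in> L" for x
    using eline_iff_zeta[OF uv, of x] that p(4) unfolding L z_def by blast
  have z: "Im z > 0" using zeta_Im[OF uv] by (simp add: z_def)
  let ?E = "{A \<in> spinc4_space G. A ` L \<subseteq> L'}"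
  have spanE: "span {cl u, cl v} = ?E"
  proof (intro equalityI subsetI)
    fix X assume "X \<in> span {cl u, cl v}"
    then obtain a b where X: "X = a *\<^sub>R cl u + b *\<^sub>R cl v" unfolding span_pair by blast
    then have "X = cl (a *\<^sub>R u + b *\<^sub>R v)" using cl_rlin[OF uv(1,2)] by simp
    then have "X \<in> spinc4_space G" using cl_space Tmem uv(1,2) by simp
    moreover have "X x \<in> L'" if x: "x \<in> L" for x
    proof -
      have "X x = (complex_of_real a + complex_of_real b * z) *\<^sub>C cl u x"
        unfolding X using vz[OF x] by (simp add: scaleR_fun_def scaleR_scaleC cvec_algebra)
      then show ?thesis using uL x cvec.subspace_scale[OF cL'] by auto
    qed
    ultimately show "X \<in> ?E" by blast
  next
    fix X assume X: "X \<in> ?E"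
    then have "X \<in> cl ` TT" using bij_betw_imp_surj_on[OF bij] by simp
    then obtain x where x: "x \<in> TT" "X = cl x" by blast
    obtain c where c: "cl x p = c *\<^sub>C cl u p" using X x pL unfolding L'_def by blast
    \<comment> \<open>Real solutions of c = a + b z exist because z is not real. They show that the
      plane contains every vector mapping \<open>L\<close> into \<open>L'\<close>.\<close>
    define b where "b = Im c / Im z"
    define a where "a = Re c - b * Re z"
    have ab: "c = complex_of_real a + complex_of_real b * z" using z by (simp add: complex_eq_iff a_def b_def)
    have "cl (a *\<^sub>R u + b *\<^sub>R v) p = c *\<^sub>C cl u p"
      unfolding cl_rlin_at[OF uv(1,2)] vz[OF pL] ab by (simp add: scaleR_scaleC cvec_algebra)
    then have "x = a *\<^sub>R u + b *\<^sub>R v" using cl_eq[OF x(1) _ p(2,1)] c Tmem uv(1,2) by simp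
    then show "X \<in> span {cl u, cl v}" unfolding x(2) using cl_rlin[OF uv(1,2)] span_pair by blast
  qed
  have "a = 0 \<and> b = 0" if "a *\<^sub>R cl u + b *\<^sub>R cl v = 0" for a b
  proof -
    have "cl (a *\<^sub>R u + b *\<^sub>R v) p = 0" using that cl_rlin[OF uv(1,2)] by simp
    then have "a *\<^sub>R u + b *\<^sub>R v = 0" using cl_zero[OF _ p(2,1)] Tmem uv(1,2) by simp
    then show ?thesis using uv(3,4) independent_pair by blast
  qed
  then have bE: "basis_list [cl u, cl v] ?E"
    using spanE independent_pair[of "cl u" "cl v"] by (simp add: basis_list_pair)
  define \<rho> where "\<rho> = (\<lambda>A x. if x \<in> L then A x else (0::'t))"
  have lin: "linear \<rho>" by (rule linearI) (auto simp: \<rho>_def fun_eq_iff scaleR_fun_def)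
  have inj: "A = B" if "A \<in> ?E" "B \<in> ?E" "\<rho> A = \<rho> B" for A B
  proof -
    from that(1,2) have "A \<in> cl ` TT" "B \<in> cl ` TT" using bij_betw_imp_surj_on[OF bij] by simp_all
    then obtain x y where xy: "x \<in> TT" "A = cl x" "y \<in> TT" "B = cl y" by blast
    have "cl x p = cl y p" using fun_cong[OF \<open>\<rho> A = \<rho> B\<close>, of p] pL by (simp add: \<rho>_def xy)
    then show ?thesis using cl_eq[OF xy(1,3) p(2,1)] xy by simp
  qed
  have CO: "complex_orientation (\<lambda>B x. \<i> *\<^sub>C B x) id (complex_hom L L') (complex_hom L L') = map \<rho> ` orient_class [cl u, cl v]"
  proof -
    have "\<rho> (cl v) = Re z *\<^sub>R \<rho> (cl u) + Im z *\<^sub>R (\<lambda>x. \<i> *\<^sub>C \<rho> (cl u) x)"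
    proof
      fix x
      have "z = complex_of_real (Re z) + complex_of_real (Im z) * \<i>" by (simp add: complex_eq_iff)
      then have "z *\<^sub>C y = Re z *\<^sub>R y + Im z *\<^sub>R (\<i> *\<^sub>C y)" for y :: 't by (metis scaleR_scaleC scaleC_left_distrib scaleC_scaleC)
      then show "\<rho> (cl v) x = (Re z *\<^sub>R \<rho> (cl u) + Im z *\<^sub>R (\<lambda>x. \<i> *\<^sub>C \<rho> (cl u) x)) x"
        using vz by (simp add: \<rho>_def scaleR_fun_def)
    qed
    then have "[\<rho> (cl u), \<rho> (cl v)] = [1 *\<^sub>R \<rho> (cl u) + 0 *\<^sub>R (\<lambda>x. \<i> *\<^sub>C \<rho> (cl u) x), Re z *\<^sub>R \<rho> (cl u) + Im z *\<^sub>R (\<lambda>x. \<i> *\<^sub>C \<rho> (cl u) x)]" by simp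
    moreover have "1 * Im z - 0 * Re z > 0" using z by simp
    ultimately have "[\<rho> (cl u), \<rho> (cl v)] \<in> orient_class [\<rho> (cl u), \<lambda>x. \<i> *\<^sub>C \<rho> (cl u) x]" unfolding orient_class_pair by blast
    from orient_class_eq[OF this] show ?thesis
      using complex_hom_line_orientation[OF LS L'S uv(1) u0 uL] orient_class_map_linear[OF lin, of "[cl u, cl v]"]
      by (simp add: \<rho>_def)
  qed
  have "map cl ` orient_class [u, v] = orient_class [cl u, cl v]"
    using cl_rlin[OF uv(1,2)] by (subst orient_class_map[of cl "[u, v]", simplified, symmetric]) (simp_all add: lessThan_Suc numeral_2_eq_2 add.commute)
  also have "\<dots> = Psi G L L'"
  proof (intro equalityI subsetI)
    fix bs assume "bs \<in> orient_class [cl u, cl v]"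
    then show "bs \<in> Psi G L L'" unfolding Psi_def CO using orient_class_basis_list[OF bE] by (auto simp: \<rho>_def)
  next
    fix bs assume "bs \<in> Psi G L L'"
    then have bs: "basis_list bs ?E" "map \<rho> bs \<in> map \<rho> ` orient_class [cl u, cl v]" unfolding Psi_def CO by (auto simp: \<rho>_def)
    then obtain cs where cs: "cs \<in> orient_class [cl u, cl v]" "map \<rho> bs = map \<rho> cs" by blast
    have "set cs \<subseteq> ?E" "set bs \<subseteq> ?E" using basis_list_subset bs(1) orient_class_basis_list[OF bE cs(1)] by blast+
    then have "set bs \<union> set cs \<subseteq> ?E" by blast
    moreover have "inj_on \<rho> ?E" by (rule inj_onI) (rule inj)
    \<comment> \<open>A tangent vector is determined by its action on one nonzero spinor, so a list
      of them is recovered from the restrictions to \<open>L\<close>.\<close>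
    ultimately have "inj_on \<rho> (set bs \<union> set cs)" by (rule inj_on_subset[rotated])
    then have "bs = cs" by (rule map_inj_on[OF cs(2)])
    then show "bs \<in> orient_class [cl u, cl v]" using cs(1) by simp
  qed
  finally show "L \<in> complex_lines Sp \<and> (\<exists>L'\<in>complex_lines Sm. map cl ` orient_class [u, v] = Psi G L L')"
    using LS L'S by blast
qed

end

section \<open>Vector bundles\<close>

lemma smooth_funD: "smooth_fun N W h \<Longrightarrow> c \<in> N \<Longrightarrow> smooth_on (snd c ` (fst c \<inter> W)) (\<lambda>z. h (chart_inv c z))"
  unfolding smooth_fun_def comp_def by blast

lemma smooth_funI:
  "(\<And>c. c \<in> N \<Longrightarrow> smooth_on (snd c ` (fst c \<inter> W)) (\<lambda>z. h (chart_inv c z))) \<Longrightarrow> smooth_fun N W h"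
  unfolding smooth_fun_def comp_def by blast

lemma smooth_fun_add:
  assumes "open_in N W" "smooth_fun N W f" "smooth_fun N W h"
  shows "smooth_fun N W (\<lambda>x. f x + h x)"
  by (intro smooth_funI smooth_on_add open_in_image[OF assms(1)] smooth_funD[OF assms(2)] smooth_funD[OF assms(3)])

lemma smooth_fun_linear:
  fixes L :: "'f::euclidean_space \<Rightarrow> 'g::euclidean_space"
  assumes "open_in N W" "linear L" "smooth_fun N W f"
  shows "smooth_fun N W (\<lambda>x. L (f x))"
proof (rule smooth_funI)
  fix c assume "c \<in> N"
  then show "smooth_on (snd c ` (fst c \<inter> W)) (\<lambda>z. L (f (chart_inv c z)))"
    using smooth_on_linear[OF open_in_image[OF assms(1)] assms(2) smooth_funD[OF assms(3)]] by blast
qed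

lemma smooth_fun_divide:
  fixes f h :: "'a \<Rightarrow> 'f::{euclidean_space,real_normed_field}"
  assumes "smooth_atlas N" "open_in N W" "smooth_fun N W f" "smooth_fun N W h" "\<And>x. x \<in> W \<Longrightarrow> h x \<noteq> 0"
  shows "smooth_fun N W (\<lambda>x. f x / h x)"
  unfolding smooth_fun_def comp_def
proof
  fix c assume c: "c \<in> N"
  show "smooth_on (snd c ` (fst c \<inter> W)) (\<lambda>z. f (chart_inv c z) / h (chart_inv c z))"
    using assms(3,4) c open_in_image[OF assms(2) c] assms(5) chart_inv_left[OF assms(1) c]
    unfolding smooth_fun_def comp_def by (intro smooth_on_divide) auto
qed

lemma smooth_fun_inverse_sqrt:
  fixes f :: "'a \<Rightarrow> real"
  assumes "smooth_atlas N" "open_in N W" "smooth_fun N W f" "\<And>x. x \<in> W \<Longrightarrow> f x > 0"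
  shows "smooth_fun N W (\<lambda>x. 1 / sqrt (f x))"
  unfolding smooth_fun_def comp_def
proof
  fix c assume c: "c \<in> N"
  have p: "f (chart_inv c z) > 0" if "z \<in> snd c ` (fst c \<inter> W)" for z
    using that assms(4) chart_inv_left[OF assms(1) c] by auto
  show "smooth_on (snd c ` (fst c \<inter> W)) (\<lambda>z. 1 / sqrt (f (chart_inv c z)))"
    using assms(3) c open_in_image[OF assms(2) c] p less_imp_neq[OF p]
    unfolding smooth_fun_def comp_def by (intro smooth_on_divide smooth_on_sqrt smooth_on_const) auto
qed

lemma open_in_smooth_preimage:
  assumes "smooth_atlas N" "open_in N W" "smooth_fun N W f" "open U"
  shows "open_in N {x \<in> W. f x \<in> U}"
  unfolding open_in_def
proof (intro conjI ballI)
  fix c assume c: "c \<in> N"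
  let ?O = "snd c ` (fst c \<inter> W)"
  have "continuous_on ?O (f \<circ> chart_inv c)" unfolding comp_def by (rule smooth_on_continuous_on[OF smooth_funD[OF assms(3) c]])
  then have "open (?O \<inter> (f \<circ> chart_inv c) -` U)"
    by (rule continuous_open_preimage[OF _ open_in_image[OF assms(2) c] assms(4)])
  moreover have "snd c ` ({x \<in> W. f x \<in> U} \<inter> fst c) = ?O \<inter> (f \<circ> chart_inv c) -` U"
    using chart_inv_left[OF assms(1) c] by (auto simp: image_iff)
  ultimately show "open (snd c ` ({x \<in> W. f x \<in> U} \<inter> fst c))" by simp
qed (use open_in_points[OF assms(2)] in auto)

lemma fibrewise_isoD:
  assumes "fibrewise_iso W E t" "x \<in> W"
  shows "bij_betw (t x) (E x) UNIV" "u \<in> E x \<Longrightarrow> v \<in> E x \<Longrightarrow> t x (a *\<^sub>C u + b *\<^sub>C v) = a *s t x u + b *s t x v"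
    "u \<in> E x \<Longrightarrow> t x (a *\<^sub>C u) = a *s t x u" "t x (inv_into (E x) (t x) w) = w" "inv_into (E x) (t x) w \<in> E x"
    "u \<in> E x \<Longrightarrow> inv_into (E x) (t x) (t x u) = u"
proof -
  show b: "bij_betw (t x) (E x) UNIV" using assms by (simp add: fibrewise_iso_def)
  show l: "u \<in> E x \<Longrightarrow> v \<in> E x \<Longrightarrow> t x (a *\<^sub>C u + b *\<^sub>C v) = a *s t x u + b *s t x v" for u v a b
    using assms unfolding fibrewise_iso_def by blast
  show "u \<in> E x \<Longrightarrow> t x (a *\<^sub>C u) = a *s t x u" using l[of u u a 0] by simp
  show "t x (inv_into (E x) (t x) w) = w" "inv_into (E x) (t x) w \<in> E x"
    using b by (auto simp: bij_betw_def f_inv_into_f inv_into_into)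
  show "u \<in> E x \<Longrightarrow> inv_into (E x) (t x) (t x u) = u" using b by (simp add: bij_betw_def inv_into_f_f)
qed

lemma fibrewise_iso_zero:
  assumes "fibrewise_iso W E t" "x \<in> W" "u \<in> E x" "0 \<in> E x"
  shows "t x u = 0 \<longleftrightarrow> u = 0"
proof -
  have "t x 0 = 0" using fibrewise_isoD(3)[OF assms(1,2,3), of 0] by simp
  then show ?thesis using fibrewise_isoD(1)[OF assms(1,2)] assms(3,4) by (metis bij_betw_def inj_onD)
qed

lemma vector_bundleD:
  assumes "vector_bundle M E"
  shows "x \<in> points M \<Longrightarrow> csubspace (fibre E x)"
    "(W, t) \<in> trivs E \<Longrightarrow> open_in M W" "(W, t) \<in> trivs E \<Longrightarrow> fibrewise_iso W (fibre E) t"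
    "x \<in> points M \<Longrightarrow> \<exists>(W, t)\<in>trivs E. x \<in> W"
    "(W, t) \<in> trivs E \<Longrightarrow> (W', t') \<in> trivs E \<Longrightarrow> smooth_fun M (W \<inter> W') (\<lambda>x. t' x (inv_into (fibre E x) (t x) w))"
  using assms unfolding vector_bundle_def by blast+

lemma smooth_sectionD:
  assumes "smooth_section M E W s"
  shows "x \<in> W \<Longrightarrow> s x \<in> fibre E x" "(W', t) \<in> trivs E \<Longrightarrow> smooth_fun M (W \<inter> W') (\<lambda>x. t x (s x))"
  using assms unfolding smooth_section_def by blast+

lemma smooth_sectionI:
  assumes "\<And>x. x \<in> W \<Longrightarrow> s x \<in> fibre E x" "\<And>W' t. (W', t) \<in> trivs E \<Longrightarrow> smooth_fun M (W \<inter> W') (\<lambda>x. t x (s x))"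
  shows "smooth_section M E W s"
  using assms unfolding smooth_section_def by blast

lemma smooth_section_subset: "smooth_section M E W s \<Longrightarrow> U \<subseteq> W \<Longrightarrow> smooth_section M E U s"
  unfolding smooth_section_def by (blast intro: smooth_fun_subset)

lemma linear_nth_vec: "linear (\<lambda>v::complex ^ 'n. v $ i)"
  by (rule linearI) simp_all

context
  fixes N :: "('a, 'e::euclidean_space) manifold" and E :: "('a, 's::complex_vector, 'n::finite, 'z) vbundle_scheme"
  assumes N: "smooth_atlas N" and E: "vector_bundle N E"
begin

lemma smooth_fun_scale_vec:
  fixes f :: "'a \<Rightarrow> complex" and h :: "'a \<Rightarrow> complex ^ 'm"
  assumes "open_in N W" "smooth_fun N W f" "smooth_fun N W h"
  shows "smooth_fun N W (\<lambda>x. f x *s h x)"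
proof -
  have "smooth_on (snd c ` (fst c \<inter> W)) (\<lambda>z. f (chart_inv c z) *s h (chart_inv c z))" if c: "c \<in> N" for c
  proof (rule smooth_on_vec[OF open_in_image[OF assms(1) c]])
    fix i
    show "smooth_on (snd c ` (fst c \<inter> W)) (\<lambda>z. (f (chart_inv c z) *s h (chart_inv c z)) $ i)"
      using assms(2,3) c unfolding smooth_fun_def comp_def
      by (simp, intro smooth_on_mult open_in_image[OF assms(1) c] smooth_on_nth) auto
  qed
  then show ?thesis by (simp add: smooth_fun_def comp_def)
qed

lemma smooth_section_combination:
  fixes f h :: "'a \<Rightarrow> complex"
  assumes W: "open_in N W" and "smooth_fun N W f" "smooth_fun N W h" "smooth_section N E W s" "smooth_section N E W r"
  shows "smooth_section N E W (\<lambda>x. f x *\<^sub>C s x + h x *\<^sub>C r x)"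
proof (rule smooth_sectionI)
  fix x assume x: "x \<in> W"
  then have "csubspace (fibre E x)" using vector_bundleD(1)[OF E] open_in_points[OF W] by blast
  then show "f x *\<^sub>C s x + h x *\<^sub>C r x \<in> fibre E x"
    using smooth_sectionD(1)[OF assms(4) x] smooth_sectionD(1)[OF assms(5) x]
    by (intro cvec.subspace_add cvec.subspace_scale)
next
  fix W' t assume t: "(W', t) \<in> trivs E"
  have o: "open_in N (W \<inter> W')" using open_in_Int[OF N W vector_bundleD(2)[OF E t]] .
  have "smooth_fun N (W \<inter> W') (\<lambda>x. f x *s t x (s x) + h x *s t x (r x))"
    by (intro smooth_fun_add smooth_fun_scale_vec o smooth_sectionD(2)[OF assms(4) t] smooth_sectionD(2)[OF assms(5) t]
        smooth_fun_subset[OF assms(2)] smooth_fun_subset[OF assms(3)]) auto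
  then show "smooth_fun N (W \<inter> W') (\<lambda>x. t x (f x *\<^sub>C s x + h x *\<^sub>C r x))"
    by (rule smooth_fun_cong[OF N _ o])
      (use fibrewise_isoD(2)[OF vector_bundleD(3)[OF E t]] smooth_sectionD(1)[OF assms(4)] smooth_sectionD(1)[OF assms(5)] in auto)
qed

lemma smooth_section_scale:
  fixes f :: "'a \<Rightarrow> complex"
  assumes W: "open_in N W" and "smooth_fun N W f" "smooth_section N E W s"
  shows "smooth_section N E W (\<lambda>x. f x *\<^sub>C s x)"
proof -
  have "smooth_fun N W (\<lambda>x. 0 :: complex)" by (simp add: smooth_fun_def comp_def smooth_on_const)
  from smooth_section_combination[OF W assms(2) this assms(3,3)] show ?thesis by simp
qed

lemma smooth_frame_section:
  assumes "(W, t) \<in> trivs E"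
  shows "smooth_section N E W (\<lambda>x. inv_into (fibre E x) (t x) w)"
  using fibrewise_isoD(5)[OF vector_bundleD(3)[OF E assms]] vector_bundleD(5)[OF E assms]
  by (intro smooth_sectionI) auto

text \<open>Near each point some component of \<open>e\<close> in a trivialization is nonzero, and
  there \<open>f\<close> is a quotient of components.\<close>

lemma smooth_coefficient:
  assumes V: "open_in N V" and e: "smooth_section N E V e" and s: "smooth_section N E V s"
    and f: "\<And>x. x \<in> V \<Longrightarrow> e x \<noteq> 0 \<and> s x = f x *\<^sub>C e x"
  shows "smooth_fun N V f"
proof (rule smooth_fun_local[OF N])
  fix x assume x: "x \<in> V"
  then have xN: "x \<in> points N" using open_in_points[OF V] by blast
  obtain W t where t: "(W, t) \<in> trivs E" "x \<in> W" using vector_bundleD(4)[OF E xN] by blast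
  note iso = vector_bundleD(3)[OF E t(1)]
  have o: "open_in N (V \<inter> W)" using open_in_Int[OF N V vector_bundleD(2)[OF E t(1)]] .
  have "t x (e x) \<noteq> 0"
    using fibrewise_iso_zero[OF iso t(2) smooth_sectionD(1)[OF e x]] cvec.subspace_0[OF vector_bundleD(1)[OF E xN]] f[OF x] by simp
  then obtain i where i: "t x (e x) $ i \<noteq> 0" by (auto simp: vec_eq_iff)
  have sm: "smooth_fun N (V \<inter> W) (\<lambda>y. t y (e y) $ i)" "smooth_fun N (V \<inter> W) (\<lambda>y. t y (s y) $ i)"
    using smooth_fun_linear[OF o linear_nth_vec smooth_sectionD(2)[OF e t(1)]]
      smooth_fun_linear[OF o linear_nth_vec smooth_sectionD(2)[OF s t(1)]] .
  let ?U = "{y \<in> V \<inter> W. t y (e y) $ i \<in> - {0}}"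
  have U: "open_in N ?U" by (rule open_in_smooth_preimage[OF N o sm(1)]) auto
  have "smooth_fun N ?U (\<lambda>y. t y (s y) $ i / t y (e y) $ i)"
    by (intro smooth_fun_divide[OF N U] smooth_fun_subset[OF sm(1)] smooth_fun_subset[OF sm(2)]) auto
  then have "smooth_fun N ?U f"
  proof (rule smooth_fun_cong[OF N _ U])
    fix y assume y: "y \<in> ?U"
    then have "t y (s y) = f y *s t y (e y)"
      using f[of y] fibrewise_isoD(3)[OF iso, of y "e y" "f y"] smooth_sectionD(1)[OF e, of y] by auto
    then show "t y (s y) $ i / t y (e y) $ i = f y" using y by simp
  qed
  then show "\<exists>U. open_in N U \<and> x \<in> U \<and> smooth_fun N U f" using U x t(2) i by blast
qed

section \<open>Line subbundles\<close>

lemma line_subbundle_trivD: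
  fixes L :: "'a \<Rightarrow> 's set"
  assumes "(W, t) \<in> trivs (line_subbundle N E L)"
  shows "open_in N W" "fibrewise_iso W L t" "smooth_section N E W (\<lambda>x. inv_into (L x) (t x) w)"
  using assms by (simp_all add: line_subbundle_def)

lemma line_triv_coefficient:
  assumes "fibrewise_iso W L t" "x \<in> W" "u \<in> L x" "csubspace (L x)"
  defines "e \<equiv> inv_into (L x) (t x) (1 :: complex ^ 1)"
  shows "u = (t x u $ 1) *\<^sub>C e" "e \<noteq> 0" "e \<in> L x"
proof -
  note I = fibrewise_isoD[OF assms(1,2)]
  show eL: "e \<in> L x" unfolding e_def by (rule I(5))
  have te: "t x e = 1" unfolding e_def by (rule I(4))
  have "t x ((t x u $ 1) *\<^sub>C e) = t x u"
    unfolding I(3)[OF eL] te by (simp add: vec_eq_iff forall_1)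
  moreover have "(t x u $ 1) *\<^sub>C e \<in> L x" using cvec.subspace_scale[OF assms(4) eL] .
  ultimately show "u = (t x u $ 1) *\<^sub>C e" using I(1) assms(3) unfolding bij_betw_def inj_on_def by metis
  show "e \<noteq> 0" using te fibrewise_iso_zero[OF assms(1,2) eL cvec.subspace_0[OF assms(4)]] by auto
qed

text \<open>Trivializations of the subbundle are prescribed only through the smoothness of their
  inverses. Their value on \<open>s\<close> is the coefficient of \<open>s\<close> relative to the
  frame sent to 1, so \<open>smooth_coefficient\<close> applies.\<close>

lemma smooth_section_line_subbundle:
  fixes L :: "'a \<Rightarrow> 's set"
  assumes L: "\<And>x. x \<in> points N \<Longrightarrow> csubspace (L x)" and W: "open_in N W"
    and s: "smooth_section N E W s" "\<And>x. x \<in> W \<Longrightarrow> s x \<in> L x"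
  shows "smooth_section N (line_subbundle N E L) W s"
proof (rule smooth_sectionI)
  show "s x \<in> fibre (line_subbundle N E L) x" if "x \<in> W" for x
    using s(2)[OF that] by (simp add: line_subbundle_def)
  fix W' t assume "(W', t) \<in> trivs (line_subbundle N E L)"
  note t = line_subbundle_trivD[OF this]
  have o: "open_in N (W \<inter> W')" using open_in_Int[OF N W t(1)] .
  have co: "inv_into (L x) (t x) 1 \<noteq> 0 \<and> s x = (t x (s x) $ 1) *\<^sub>C inv_into (L x) (t x) 1" if "x \<in> W \<inter> W'" for x
  proof -
    have x: "x \<in> W'" "x \<in> W" "x \<in> points N" using that open_in_points[OF W] by auto
    show ?thesis using line_triv_coefficient[OF t(2) x(1) s(2)[OF x(2)] L[OF x(3)]] by blast
  qed
  have "smooth_fun N (W \<inter> W') (\<lambda>x. t x (s x) $ 1)"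
    by (rule smooth_coefficient[OF o smooth_section_subset[OF t(3)] smooth_section_subset[OF s(1)] co]) auto
  moreover have "linear (\<lambda>c. vec c :: complex ^ 1)" by (rule linearI) (simp_all add: vec_eq_iff)
  ultimately have "smooth_fun N (W \<inter> W') (\<lambda>x. vec (t x (s x) $ 1) :: complex ^ 1)" using smooth_fun_linear[OF o, where L="\<lambda>c. vec c :: complex ^ 1"] by blast
  moreover have "vec (v $ 1) = v" for v :: "complex ^ 1" by (simp add: vec_eq_iff forall_1)
  ultimately show "smooth_fun N (W \<inter> W') (\<lambda>x. t x (s x))" by simp
qed

text \<open>The coefficient relative to the nonvanishing section \<sigma> is the
  trivialization.\<close>

lemma line_subbundle_triv:
  fixes L :: "'a \<Rightarrow> 's set"
  assumes L: "\<And>x. x \<in> points N \<Longrightarrow> L x \<in> complex_lines (fibre E x)"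
    and W: "open_in N W" "smooth_section N E W \<sigma>" "\<And>x. x \<in> W \<Longrightarrow> \<sigma> x \<in> L x \<and> \<sigma> x \<noteq> 0"
  obtains t where "(W, t) \<in> trivs (line_subbundle N E L)"
proof -
  define k where "k x u = (THE c. u = c *\<^sub>C \<sigma> x)" for x u
  have k: "u = k x u *\<^sub>C \<sigma> x" "k x (c *\<^sub>C \<sigma> x) = c" if "x \<in> W" "u \<in> L x" for x u c
  proof -
    obtain p where p: "L x = {c *\<^sub>C p | c. True}" using L[of x] open_in_points[OF W(1)] \<open>x \<in> W\<close> unfolding complex_lines_iff by blast
    have s: "\<sigma> x \<in> L x" "\<sigma> x \<noteq> 0" using W(3)[OF \<open>x \<in> W\<close>] by auto
    obtain a b where ab: "\<sigma> x = a *\<^sub>C p" "u = b *\<^sub>C p" using s(1) \<open>u \<in> L x\<close> p by blast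
    have "a \<noteq> 0" using ab(1) s(2) by auto
    then have "u = (b / a) *\<^sub>C \<sigma> x" unfolding ab by (simp add: cvec_algebra)
    moreover have u: "c = d" if "c *\<^sub>C \<sigma> x = d *\<^sub>C \<sigma> x" for c d using that s(2) by simp
    ultimately have "\<exists>!c. u = c *\<^sub>C \<sigma> x" by metis
    then show "u = k x u *\<^sub>C \<sigma> x" unfolding k_def by (rule theI')
    show "k x (c *\<^sub>C \<sigma> x) = c" unfolding k_def using u by blast
  qed
  define t where "t x u = (vec (k x u) :: complex ^ 1)" for x u
  have cs: "csubspace (L x)" if "x \<in> W" for x
    using L[of x] open_in_points[OF W(1)] that by (auto simp: complex_lines_def)
  have iv: "t x ((w $ 1) *\<^sub>C \<sigma> x) = w" "(w $ 1) *\<^sub>C \<sigma> x \<in> L x" if "x \<in> W" for x w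
    using k(2)[OF that, of "\<sigma> x" "w $ 1"] W(3)[OF that] cvec.subspace_scale[OF cs[OF that]]
    by (auto simp: t_def vec_eq_iff forall_1)
  have inj: "inj_on (t x) (L x)" if x: "x \<in> W" for x
  proof (rule inj_onI)
    fix u v assume "u \<in> L x" "v \<in> L x" "t x u = t x v"
    then show "u = v" using k(1)[OF x] by (metis t_def vec_component)
  qed
  have "fibrewise_iso W L t"
    unfolding fibrewise_iso_def
  proof (intro ballI conjI allI)
    fix x assume x: "x \<in> W"
    have "w \<in> t x ` L x" for w using iv[OF x, of w] by force
    then show "bij_betw (t x) (L x) UNIV" using inj[OF x] unfolding bij_betw_def by blast
    fix u v a b assume uv: "u \<in> L x" "v \<in> L x"
    have "a *\<^sub>C u + b *\<^sub>C v = (a * k x u + b * k x v) *\<^sub>C \<sigma> x"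
      by (subst k(1)[OF x uv(1)], subst k(1)[OF x uv(2)]) (simp add: cvec_algebra)
    then show "t x (a *\<^sub>C u + b *\<^sub>C v) = a *s t x u + b *s t x v"
      using k(2)[OF x uv(1)] by (simp add: t_def vec_eq_iff)
  qed
  moreover have "smooth_section N E W (\<lambda>x. inv_into (L x) (t x) w)" for w
  proof -
    have c: "smooth_fun N W (\<lambda>x. w $ 1)" by (simp add: smooth_fun_def comp_def smooth_on_const)
    have e: "inv_into (L x) (t x) w = (w $ 1) *\<^sub>C \<sigma> x" if "x \<in> W" for x
      using inv_into_f_f[OF inj[OF that] iv(2)[OF that]] iv(1)[OF that] by metis
    note sc = smooth_section_scale[OF W(1) c W(2)]
    show ?thesis
    proof (rule smooth_sectionI)
      show "inv_into (L x) (t x) w \<in> fibre E x" if "x \<in> W" for x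
        using smooth_sectionD(1)[OF sc that] e[OF that] by simp
      fix W' t' assume t': "(W', t') \<in> trivs E"
      show "smooth_fun N (W \<inter> W') (\<lambda>x. t' x (inv_into (L x) (t x) w))"
        by (rule smooth_fun_cong[OF N smooth_sectionD(2)[OF sc t'] open_in_Int[OF N W(1) vector_bundleD(2)[OF E t']]])
          (simp add: e)
    qed
  qed
  ultimately have "(W, t) \<in> trivs (line_subbundle N E L)" using W(1) by (simp add: line_subbundle_def)
  then show ?thesis using that by blast
qed

lemma vector_bundle_line_subbundle:
  fixes L :: "'a \<Rightarrow> 's set"
  assumes L: "\<And>x. x \<in> points N \<Longrightarrow> L x \<in> complex_lines (fibre E x)"
    and loc: "\<And>x. x \<in> points N \<Longrightarrow> \<exists>W \<sigma>. open_in N W \<and> x \<in> W \<and> smooth_section N E W \<sigma> \<and> (\<forall>y\<in>W. \<sigma> y \<in> L y \<and> \<sigma> y \<noteq> 0)"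
  shows "vector_bundle N (line_subbundle N E L)"
proof -
  have cs: "csubspace (L x)" if "x \<in> points N" for x using L[OF that] by (simp add: complex_lines_def)
  have f: "fibre (line_subbundle N E L) = L" by (simp add: line_subbundle_def)
  have 1: "\<exists>(W, t)\<in>trivs (line_subbundle N E L). x \<in> W" if "x \<in> points N" for x
  proof -
    obtain W \<sigma> where W: "open_in N W" "x \<in> W" "smooth_section N E W \<sigma>" "\<And>y. y \<in> W \<Longrightarrow> \<sigma> y \<in> L y \<and> \<sigma> y \<noteq> 0" using loc[OF \<open>x \<in> points N\<close>] by blast
    obtain t where "(W, t) \<in> trivs (line_subbundle N E L)" by (rule line_subbundle_triv[OF L W(1,3,4)])
    then show ?thesis using W(2) by blast
  qed
  have 2: "smooth_fun N (W \<inter> W') (\<lambda>x. t' x (inv_into (L x) (t x) w))"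
    if "(W, t) \<in> trivs (line_subbundle N E L)" "(W', t') \<in> trivs (line_subbundle N E L)" for W t W' t' w
  proof -
    note t = line_subbundle_trivD[OF that(1)]
    have "smooth_section N (line_subbundle N E L) W (\<lambda>x. inv_into (L x) (t x) w)"
      by (rule smooth_section_line_subbundle[OF cs t(1,3)]) (use fibrewise_isoD(5)[OF t(2)] in auto)
    from smooth_sectionD(2)[OF this that(2)] show ?thesis .
  qed
  show ?thesis unfolding vector_bundle_def f
    using cs 1 2 line_subbundle_trivD(1,2) by blast
qed

end

section \<open>The projection of the bundle of oriented planes\<close>

context
  fixes M :: "('a, real ^ 4) manifold"
  assumes M: "smooth_atlas M"
begin

lemma plane_bundleE:
  assumes "c' \<in> plane_bundle M"
  obtains c B where "c' = plane_chart M c B" "c \<in> M" "basis_list B UNIV"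
  using assms unfolding plane_bundle_def by blast

lemma plane_bundleI: "c \<in> M \<Longrightarrow> basis_list B UNIV \<Longrightarrow> plane_chart M c B \<in> plane_bundle M"
  unfolding plane_bundle_def by blast

lemma points_plane_bundle:
  "x \<in> points (plane_bundle M) \<longleftrightarrow> fst x \<in> points M \<and> snd x \<in> oriented_planes (tangent_space M (fst x))"
proof
  assume "x \<in> points (plane_bundle M)"
  then obtain c' where "c' \<in> plane_bundle M" "x \<in> fst c'" by (rule pointsE)
  then obtain c B where c: "c \<in> M" "x \<in> fst (plane_chart M c B)" by (metis plane_bundleE)
  then have "fst x \<in> fst c" "snd x \<in> oriented_planes (tangent_space M (fst x))" by (auto simp: plane_chart_def)
  then show "fst x \<in> points M \<and> snd x \<in> oriented_planes (tangent_space M (fst x))"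
    using in_points[OF c(1)] by simp
next
  assume x: "fst x \<in> points M \<and> snd x \<in> oriented_planes (tangent_space M (fst x))"
  then obtain c where c: "c \<in> M" "fst x \<in> fst c" by (auto elim: pointsE)
  obtain a b where ab: "snd x = orient_class [tvec M (fst x) c a, tvec M (fst x) c b]" "a \<noteq> b" "independent {a, b}"
    using x oriented_planes_tangent[OF M c] by blast
  obtain d e where B: "basis_list [a, b, d, e] UNIV" using extend_basis4[OF ab(2,3)] by blast
  have "x = frame_point M (fst x) c a b" unfolding frame_point_def ab(1)[symmetric] by simp
  moreover have "frame_point M (fst x) c a b \<in> fst (plane_chart M c [a, b, d, e])"
    unfolding frame_point_in_chart[OF M c B] using bcoord_basis[OF B] by (simp add: plane_minor_def)
  ultimately show "x \<in> points (plane_bundle M)" using in_points[OF plane_bundleI[OF c(1) B]] by metis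
qed

text \<open>In a chart of the plane bundle the projection to M is the first factor and every slope
  vector occurs, so the part over \<open>W\<close> is a product. This is what makes pulling back
  functions and bundles a matter of composing with \<open>fst\<close>.\<close>

lemma plane_chart_image_over:
  assumes "c \<in> M" "basis_list B UNIV"
  shows "snd (plane_chart M c B) ` (fst (plane_chart M c B) \<inter> {x \<in> points (plane_bundle M). fst x \<in> W}) = snd c ` (fst c \<inter> W) \<times> UNIV"
proof (intro equalityI subsetI)
  fix p assume "p \<in> snd (plane_chart M c B) ` (fst (plane_chart M c B) \<inter> {x \<in> points (plane_bundle M). fst x \<in> W})"
  then obtain x where x: "x \<in> fst (plane_chart M c B)" "fst x \<in> W" "p = snd (plane_chart M c B) x" by blast
  show "p \<in> snd c ` (fst c \<inter> W) \<times> UNIV" by (rule plane_chart_point[OF M assms x(1)]) (use x in auto)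
next
  fix p assume "p \<in> snd c ` (fst c \<inter> W) \<times> (UNIV :: (real ^ 4) set)"
  then obtain y q where y: "p = (snd c y, q)" "y \<in> fst c" "y \<in> W" by auto
  then have z: "snd c y \<in> snd c ` fst c" by blast
  have "fst (pchart_inv M c B (snd c y, q)) = y" by (simp add: pchart_inv_def chart_inv_left[OF M assms(1) y(2)])
  then show "p \<in> snd (plane_chart M c B) ` (fst (plane_chart M c B) \<inter> {x \<in> points (plane_bundle M). fst x \<in> W})"
    using pchart_inv_in[OF M assms z, of q] y in_points[OF plane_bundleI[OF assms]]
    by (intro image_eqI[of _ _ "pchart_inv M c B (snd c y, q)"]) auto
qed

lemma open_in_over:
  assumes "open_in M W"
  shows "open_in (plane_bundle M) {x \<in> points (plane_bundle M). fst x \<in> W}"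
  unfolding open_in_def
proof (intro conjI ballI)
  fix c' assume "c' \<in> plane_bundle M"
  then obtain c B where c: "c' = plane_chart M c B" "c \<in> M" "basis_list B UNIV" by (rule plane_bundleE)
  show "open (snd c' ` ({x \<in> points (plane_bundle M). fst x \<in> W} \<inter> fst c'))"
    unfolding Int_commute[of _ "fst c'"] unfolding c(1) plane_chart_image_over[OF c(2,3)]
    using open_in_image[OF assms c(2)] by (simp add: open_Times)
qed auto

lemma plane_chart_inv_frame:
  assumes "c \<in> M" "basis_list B UNIV" "z \<in> snd c ` fst c"
  shows "chart_inv (plane_chart M c B) (z, q) = frame_point M (chart_inv c z) c (bcomb B (graph_fst q)) (bcomb B (graph_snd q))"
  using chart_inv_plane_chart[OF M assms] by (simp add: pchart_inv_def)

lemma smooth_fun_over: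
  assumes "open_in M W" "smooth_fun M W h"
  shows "smooth_fun (plane_bundle M) {x \<in> points (plane_bundle M). fst x \<in> W} (\<lambda>x. h (fst x))"
  unfolding smooth_fun_def
proof
  fix c' assume "c' \<in> plane_bundle M"
  then obtain c B where c: "c' = plane_chart M c B" "c \<in> M" "basis_list B UNIV" by (rule plane_bundleE)
  let ?O = "snd c ` (fst c \<inter> W)"
  have O: "open ?O" using open_in_image[OF assms(1) c(2)] .
  have S: "open (?O \<times> (UNIV :: (real ^ 4) set))" using O by (simp add: open_Times)
  have "smooth_on (?O \<times> (UNIV :: (real ^ 4) set)) (\<lambda>p. (h \<circ> chart_inv c) (fst p))"
    unfolding comp_def by (rule smooth_on_compose[OF S O smooth_funD[OF assms(2) c(2)] smooth_on_linear'[OF S linear_fst]]) auto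
  then show "smooth_on (snd c' ` (fst c' \<inter> {x \<in> points (plane_bundle M). fst x \<in> W})) ((\<lambda>x. h (fst x)) \<circ> chart_inv c')"
    unfolding c(1) plane_chart_image_over[OF c(2,3)]
    by (rule smooth_on_cong[OF _ S]) (auto simp: plane_chart_inv_frame[OF c(2,3)])
qed

lemma vector_bundle_pullback:
  assumes E: "vector_bundle M E"
  shows "vector_bundle (plane_bundle M) (pullback_bundle (points (plane_bundle M)) fst E)"
proof -
  let ?N = "plane_bundle M" and ?P = "points (plane_bundle M)"
  let ?E = "pullback_bundle ?P fst E"
  have over: "fst -` W \<inter> ?P = {x \<in> ?P. fst x \<in> W}" for W by auto
  have f: "fibre ?E = (\<lambda>x. fibre E (fst x))" by (simp add: pullback_bundle_def)
  have tr: "\<exists>V s. (V, s) \<in> trivs E \<and> W = {x \<in> ?P. fst x \<in> V} \<and> t = (\<lambda>x. s (fst x))" if "(W, t) \<in> trivs ?E" for W t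
    using that unfolding pullback_bundle_def over by auto
  have 1: "csubspace (fibre ?E x)" if "x \<in> ?P" for x
    using vector_bundleD(1)[OF E] that points_plane_bundle unfolding f by blast
  have 2: "open_in ?N W \<and> fibrewise_iso W (fibre ?E) t" if tW: "(W, t) \<in> trivs ?E" for W t
  proof -
    obtain V s where V: "(V, s) \<in> trivs E" "W = {x \<in> ?P. fst x \<in> V}" "t = (\<lambda>x. s (fst x))" using tr[OF tW] by blast
    show ?thesis unfolding f V(2,3) using open_in_over[OF vector_bundleD(2)[OF E V(1)]] vector_bundleD(3)[OF E V(1)]
      by (simp add: fibrewise_iso_def)
  qed
  have 3: "\<exists>(W, t)\<in>trivs ?E. x \<in> W" if x: "x \<in> ?P" for x
  proof -
    have "fst x \<in> points M" using points_plane_bundle x by blast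
    then obtain W t where W: "(W, t) \<in> trivs E" "fst x \<in> W" using vector_bundleD(4)[OF E] by blast
    have "(fst -` W \<inter> ?P, \<lambda>x. t (fst x)) \<in> trivs ?E" using W(1) by (auto simp: pullback_bundle_def)
    then show ?thesis using W(2) x by (intro bexI[of _ "(fst -` W \<inter> ?P, \<lambda>x. t (fst x))"]) simp_all
  qed
  have 4: "smooth_fun ?N (W \<inter> W') (\<lambda>x. t' x (inv_into (fibre ?E x) (t x) w))"
    if tt: "(W, t) \<in> trivs ?E" "(W', t') \<in> trivs ?E" for W t W' t' w
  proof -
    obtain V s V' s' where V: "(V, s) \<in> trivs E" "W = {x \<in> ?P. fst x \<in> V}" "t = (\<lambda>x. s (fst x))"
      "(V', s') \<in> trivs E" "W' = {x \<in> ?P. fst x \<in> V'}" "t' = (\<lambda>x. s' (fst x))" using tr[OF tt(1)] tr[OF tt(2)] by blast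
    have "open_in M (V \<inter> V')" by (rule open_in_Int[OF M vector_bundleD(2)[OF E V(1)] vector_bundleD(2)[OF E V(4)]])
    from smooth_fun_over[OF this vector_bundleD(5)[OF E V(1) V(4)]]
    have "smooth_fun ?N {x \<in> ?P. fst x \<in> V \<inter> V'} (\<lambda>x. s' (fst x) (inv_into (fibre E (fst x)) (s (fst x)) w))" .
    moreover have "W \<inter> W' = {x \<in> ?P. fst x \<in> V \<inter> V'}" unfolding V by auto
    ultimately show ?thesis unfolding f V(3,6) by simp
  qed
  show ?thesis unfolding vector_bundle_def
  proof (intro conjI ballI)
    fix p assume "p \<in> trivs ?E"
    then show "case p of (W, t) \<Rightarrow> open_in ?N W \<and> fibrewise_iso W (fibre ?E) t" using 2 by (cases p) blast
  next
    fix p assume p: "p \<in> trivs ?E"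
    have "\<forall>w. smooth_fun ?N (fst p \<inter> fst p') (\<lambda>x. snd p' x (inv_into (fibre ?E x) (snd p x) w))" if "p' \<in> trivs ?E" for p'
      using 4[of "fst p" "snd p" "fst p'" "snd p'"] p that by simp
    then show "case p of (W, t) \<Rightarrow> \<forall>(W', t')\<in>trivs ?E. \<forall>w. smooth_fun ?N (W \<inter> W') (\<lambda>x. t' x (inv_into (fibre ?E x) (t x) w))"
      by (simp add: case_prod_beta)
  qed (use 1 3 in blast)+
qed

lemma smooth_section_pullback:
  assumes E: "vector_bundle M E" and W: "open_in M W" and s: "smooth_section M E W s"
  shows "smooth_section (plane_bundle M) (pullback_bundle (points (plane_bundle M)) fst E)
     {x \<in> points (plane_bundle M). fst x \<in> W} (\<lambda>x. s (fst x))"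
proof (rule smooth_sectionI)
  show "s (fst x) \<in> fibre (pullback_bundle (points (plane_bundle M)) fst E) x" if "x \<in> {x \<in> points (plane_bundle M). fst x \<in> W}" for x
    using that smooth_sectionD(1)[OF s] by (simp add: pullback_bundle_def)
  let ?P = "points (plane_bundle M)"
  fix W' t' assume "(W', t') \<in> trivs (pullback_bundle (points (plane_bundle M)) fst E)"
  then obtain V t where t: "(V, t) \<in> trivs E" "W' = fst -` V \<inter> ?P" "t' = (\<lambda>x. t (fst x))" by (auto simp: pullback_bundle_def)
  have "open_in M (W \<inter> V)" using open_in_Int[OF M W vector_bundleD(2)[OF E t(1)]] .
  from smooth_fun_over[OF this smooth_sectionD(2)[OF s t(1)]]
  have "smooth_fun (plane_bundle M) {x \<in> ?P. fst x \<in> W \<inter> V} (\<lambda>x. t (fst x) (s (fst x)))" .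
  moreover have "{x \<in> ?P. fst x \<in> W \<inter> V} = {x \<in> ?P. fst x \<in> W} \<inter> W'" unfolding t(2) by auto
  ultimately show "smooth_fun (plane_bundle M) ({x \<in> ?P. fst x \<in> W} \<inter> W') (\<lambda>x. t' x (s (fst x)))" unfolding t(3) by simp
qed

end

section \<open>The line bundles over the bundle of oriented planes\<close>

lemma basis_list_map:
  assumes "linear f" "inj f" "basis_list B W"
  shows "basis_list (map f B) (f ` W)"
  using assms linear_independent_injective_image[OF assms(1), of "set B"]
  by (auto simp: basis_list_def distinct_map linear_span_image[OF assms(1)] intro: inj_on_subset[OF assms(2)])

lemma basis_list_exists4: obtains B where "basis_list B (UNIV :: (real ^ 4) set)"
proof -
  have "axis 1 1 \<noteq> (axis 2 1 :: real ^ 4) \<and> independent {axis 1 1, axis 2 1 :: real ^ 4}"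
    unfolding independent_pair by (simp add: vec4_eq_iff axis_def)
  then show ?thesis using extend_basis4 that by metis
qed

lemma dim_tangent_space:
  assumes "smooth_atlas M" "y \<in> points (M :: ('a, real ^ 4) manifold)"
  shows "real_vector.dim (tangent_space M y) = 4"
proof -
  obtain c where c: "c \<in> M" "y \<in> fst c" using assms(2) by (rule pointsE)
  obtain B where B: "basis_list B (UNIV :: (real ^ 4) set)" by (rule basis_list_exists4)
  have "basis_list (map (tvec M y c) B) (tangent_space M y)"
    unfolding tangent_space_eq[OF assms(1) c]
    by (rule basis_list_map[OF linear_tvec[OF assms(1) c] inj_tvec[OF assms(1) c] B])
  from basis_list_length_dim[OF this] show ?thesis using basis_list_UNIV_length[OF B] by simp
qed

lemma smooth_on_bilinear_family:
  fixes F :: "'x \<Rightarrow> 'e::euclidean_space \<Rightarrow> 'f::euclidean_space \<Rightarrow> 'g::euclidean_space" and p :: "'d::euclidean_space \<Rightarrow> 'x"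
  assumes S: "open S" and l: "\<And>s b. s \<in> S \<Longrightarrow> linear (\<lambda>a. F (p s) a b)" "\<And>s a. s \<in> S \<Longrightarrow> linear (F (p s) a)"
    and sm: "\<And>b b'. smooth_on S (\<lambda>s. F (p s) b b')" and a: "smooth_on S a" and b: "smooth_on S b"
  shows "smooth_on S (\<lambda>s. F (p s) (a s) (b s))"
proof (rule smooth_on_linear_family[where F="\<lambda>s. F (p s) (a s)" and p="\<lambda>s. s", OF S _ _ b])
  show "linear (F (p s) (a s))" if "s \<in> S" for s using l(2)[OF that] .
  fix e :: 'f
  show "smooth_on S (\<lambda>s. F (p s) (a s) e)"
    by (rule smooth_on_linear_family[where F="\<lambda>s a. F (p s) a e" and p="\<lambda>s. s", OF S l(1) sm a])
qed

lemma smooth_section_cong: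
  assumes "smooth_atlas N" "vector_bundle N E" "open_in N W" "smooth_section N E W s" "\<And>x. x \<in> W \<Longrightarrow> s x = r x"
  shows "smooth_section N E W r"
proof (rule smooth_sectionI)
  show "r x \<in> fibre E x" if "x \<in> W" for x using smooth_sectionD(1)[OF assms(4) that] assms(5)[OF that] by simp
  fix W' t assume t: "(W', t) \<in> trivs E"
  show "smooth_fun N (W \<inter> W') (\<lambda>x. t x (r x))"
    by (rule smooth_fun_cong[OF assms(1) smooth_sectionD(2)[OF assms(4) t] open_in_Int[OF assms(1,3) vector_bundleD(2)[OF assms(2) t]]])
      (simp add: assms(5))
qed

lemma smooth_section_local:
  assumes "smooth_atlas N" "vector_bundle N E" "\<And>x. x \<in> W \<Longrightarrow> \<exists>U. open_in N U \<and> x \<in> U \<and> smooth_section N E U s"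
  shows "smooth_section N E W s"
proof (rule smooth_sectionI)
  fix x assume "x \<in> W"
  then obtain U where "x \<in> U" "smooth_section N E U s" using assms(3) by blast
  then show "s x \<in> fibre E x" using smooth_sectionD(1) by metis
next
  fix W' t assume t: "(W', t) \<in> trivs E"
  show "smooth_fun N (W \<inter> W') (\<lambda>x. t x (s x))"
  proof (rule smooth_fun_local[OF assms(1)])
    fix x assume x: "x \<in> W \<inter> W'"
    then obtain U where U: "open_in N U" "x \<in> U" "smooth_section N E U s" using assms(3) by blast
    show "\<exists>U. open_in N U \<and> x \<in> U \<and> smooth_fun N U (\<lambda>x. t x (s x))"
    proof (intro exI[of _ "U \<inter> W'"] conjI)
      show "open_in N (U \<inter> W')" by (rule open_in_Int[OF assms(1) U(1) vector_bundleD(2)[OF assms(2) t]])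
      show "smooth_fun N (U \<inter> W') (\<lambda>x. t x (s x))" by (rule smooth_sectionD(2)[OF U(3) t])
    qed (use U(2) x in simp)
  qed
qed

section \<open>The global setting and local unitary frames\<close>

locale spin_setting =
  fixes M :: "('a, real ^ 4) manifold"
    and J :: "'a \<Rightarrow> ('a, real ^ 4) tangent \<Rightarrow> ('a, real ^ 4) tangent"
    and g :: "'a \<Rightarrow> ('a, real ^ 4) tangent \<Rightarrow> ('a, real ^ 4) tangent \<Rightarrow> real"
    and S :: "('a, real ^ 4, 's::complex_vector, 't::complex_vector, 'k::complex_vector) spinc"
    and \<psi> :: "'a \<Rightarrow> 's"
  assumes manif: "smooth_manifold M"
    and herm: "almost_hermitian M J g"
    and spin: "spinc_structure M S"
    and unit: "unit_section M (sigma_plus S) \<psi>"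
    and corr: "corresponds M J g S \<psi>"
begin

abbreviation "N \<equiv> plane_bundle M"
abbreviation "over W \<equiv> {x \<in> points N. fst x \<in> W}"

lemma Ma: "smooth_atlas M" using manif by (simp add: smooth_manifold_def)
lemma Na: "smooth_atlas N" by (rule smooth_atlas_plane_bundle[OF Ma])

lemma hvb: "hermitian_vector_bundle M (sigma_plus S)" "hermitian_vector_bundle M (sigma_minus S)"
  using spin unfolding spinc_structure_def by - (elim conjE, assumption)+

lemma vb: "vector_bundle M (sigma_plus S)" "vector_bundle M (sigma_minus S)"
  using hvb unfolding hermitian_vector_bundle_def by - (elim conjE, assumption)+

lemma metric_smooth:
  "open_in M W \<Longrightarrow> smooth_section M (sigma_plus S) W s \<Longrightarrow> smooth_section M (sigma_plus S) W s' \<Longrightarrow>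
    smooth_fun M W (\<lambda>x. bundle_metric (sigma_plus S) x (s x) (s' x))"
  "open_in M W \<Longrightarrow> smooth_section M (sigma_minus S) W r \<Longrightarrow> smooth_section M (sigma_minus S) W r' \<Longrightarrow>
    smooth_fun M W (\<lambda>x. bundle_metric (sigma_minus S) x (r x) (r' x))"
proof -
  have 1: "\<forall>W s s'. open_in M W \<and> smooth_section M (sigma_plus S) W s \<and> smooth_section M (sigma_plus S) W s' \<longrightarrow>
    smooth_fun M W (\<lambda>x. bundle_metric (sigma_plus S) x (s x) (s' x))"
    using hvb(1) unfolding hermitian_vector_bundle_def by - (elim conjE, assumption)
  have 2: "\<forall>W s s'. open_in M W \<and> smooth_section M (sigma_minus S) W s \<and> smooth_section M (sigma_minus S) W s' \<longrightarrow>
    smooth_fun M W (\<lambda>x. bundle_metric (sigma_minus S) x (s x) (s' x))"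
    using hvb(2) unfolding hermitian_vector_bundle_def by - (elim conjE, assumption)
  show "open_in M W \<Longrightarrow> smooth_section M (sigma_plus S) W s \<Longrightarrow> smooth_section M (sigma_plus S) W s' \<Longrightarrow>
    smooth_fun M W (\<lambda>x. bundle_metric (sigma_plus S) x (s x) (s' x))" by (rule 1[rule_format], intro conjI)
  show "open_in M W \<Longrightarrow> smooth_section M (sigma_minus S) W r \<Longrightarrow> smooth_section M (sigma_minus S) W r' \<Longrightarrow>
    smooth_fun M W (\<lambda>x. bundle_metric (sigma_minus S) x (r x) (r' x))" by (rule 2[rule_format], intro conjI)
qed

lemma geom_sel [simp]: "plane_plus (geometry_at S y) = fibre (sigma_plus S) y" "metric_plus (geometry_at S y) = bundle_metric (sigma_plus S) y"
  "plane_minus (geometry_at S y) = fibre (sigma_minus S) y" "metric_minus (geometry_at S y) = bundle_metric (sigma_minus S) y"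
  by (simp_all add: geometry_at_def)

lemma spin_at:
  assumes "y \<in> points M"
  shows "spinc4_geometry (geometry_at S y)" "bij_betw (clifford S y) (tangent_space M y) (spinc4_space (geometry_at S y))"
    "clifford S y \<in> real_hom (tangent_space M y) (spinc4_space (geometry_at S y))"
proof -
  have "\<forall>y\<in>points M. spinc4_geometry (geometry_at S y) \<and>
        bij_betw (clifford S y) (tangent_space M y) (spinc4_space (geometry_at S y)) \<and>
        clifford S y \<in> real_hom (tangent_space M y) (spinc4_space (geometry_at S y))"
    using spin unfolding spinc_structure_def by - (elim conjE, assumption)
  note * = bspec[OF this assms]
  show "spinc4_geometry (geometry_at S y)" "bij_betw (clifford S y) (tangent_space M y) (spinc4_space (geometry_at S y))"
    "clifford S y \<in> real_hom (tangent_space M y) (spinc4_space (geometry_at S y))"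
    using * by - (elim conjE, assumption)+
qed

lemma herm_at:
  assumes "y \<in> points M"
  shows "J y \<in> real_hom (tangent_space M y) (tangent_space M y)"
    "\<forall>v\<in>tangent_space M y. J y (J y v) = - v"
    "\<forall>u\<in>tangent_space M y. \<forall>v\<in>tangent_space M y. \<forall>w\<in>tangent_space M y. \<forall>a b. g y (a *\<^sub>R u + b *\<^sub>R v) w = a * g y u w + b * g y v w"
    "\<forall>u\<in>tangent_space M y. \<forall>v\<in>tangent_space M y. g y u v = g y v u \<and> g y (J y u) (J y v) = g y u v"
    "\<forall>u\<in>tangent_space M y. u \<noteq> 0 \<longrightarrow> g y u u > 0"
proof -
  have "\<forall>y\<in>points M. J y \<in> real_hom (tangent_space M y) (tangent_space M y) \<and>
        (\<forall>v\<in>tangent_space M y. J y (J y v) = - v) \<and>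
        (\<forall>u\<in>tangent_space M y. \<forall>v\<in>tangent_space M y. \<forall>w\<in>tangent_space M y. \<forall>a b.
           g y (a *\<^sub>R u + b *\<^sub>R v) w = a * g y u w + b * g y v w) \<and>
        (\<forall>u\<in>tangent_space M y. \<forall>v\<in>tangent_space M y.
           g y u v = g y v u \<and> g y (J y u) (J y v) = g y u v) \<and>
        (\<forall>u\<in>tangent_space M y. u \<noteq> 0 \<longrightarrow> g y u u > 0)"
    using herm unfolding almost_hermitian_def by (elim conjE)
  note * = bspec[OF this assms]
  show "J y \<in> real_hom (tangent_space M y) (tangent_space M y)"
    "\<forall>v\<in>tangent_space M y. J y (J y v) = - v"
    "\<forall>u\<in>tangent_space M y. \<forall>v\<in>tangent_space M y. \<forall>w\<in>tangent_space M y. \<forall>a b. g y (a *\<^sub>R u + b *\<^sub>R v) w = a * g y u w + b * g y v w"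
    "\<forall>u\<in>tangent_space M y. \<forall>v\<in>tangent_space M y. g y u v = g y v u \<and> g y (J y u) (J y v) = g y u v"
    "\<forall>u\<in>tangent_space M y. u \<noteq> 0 \<longrightarrow> g y u u > 0"
    using * by - (elim conjE, assumption)+
qed

lemma herm_smooth:
  "open_in M W \<Longrightarrow> smooth_field M W X \<Longrightarrow> smooth_field M W (\<lambda>y. J y (X y))"
  "open_in M W \<Longrightarrow> smooth_field M W X \<Longrightarrow> smooth_field M W Y \<Longrightarrow> smooth_fun M W (\<lambda>y. g y (X y) (Y y))"
proof -
  have 1: "\<forall>W X. open_in M W \<and> smooth_field M W X \<longrightarrow> smooth_field M W (\<lambda>y. J y (X y))"
    using herm unfolding almost_hermitian_def by - (elim conjE, assumption)
  have 2: "\<forall>W X Y. open_in M W \<and> smooth_field M W X \<and> smooth_field M W Y \<longrightarrow> smooth_fun M W (\<lambda>y. g y (X y) (Y y))"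
    using herm unfolding almost_hermitian_def by - (elim conjE, assumption)
  show "open_in M W \<Longrightarrow> smooth_field M W X \<Longrightarrow> smooth_field M W (\<lambda>y. J y (X y))" by (rule 1[rule_format], intro conjI)
  show "open_in M W \<Longrightarrow> smooth_field M W X \<Longrightarrow> smooth_field M W Y \<Longrightarrow> smooth_fun M W (\<lambda>y. g y (X y) (Y y))"
    by (rule 2[rule_format], intro conjI)
qed

lemma clifford_smooth:
  "open_in M W \<Longrightarrow> smooth_field M W X \<Longrightarrow> smooth_section M (sigma_plus S) W s \<Longrightarrow>
     smooth_section M (sigma_minus S) W (\<lambda>y. clifford S y (X y) (s y))"
proof -
  have 1: "\<forall>W X s. open_in M W \<and> smooth_field M W X \<and> smooth_section M (sigma_plus S) W s \<longrightarrow>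
     smooth_section M (sigma_minus S) W (\<lambda>y. clifford S y (X y) (s y))"
    using spin unfolding spinc_structure_def by - (elim conjE, assumption)
  show "open_in M W \<Longrightarrow> smooth_field M W X \<Longrightarrow> smooth_section M (sigma_plus S) W s \<Longrightarrow>
     smooth_section M (sigma_minus S) W (\<lambda>y. clifford S y (X y) (s y))" by (rule 1[rule_format], intro conjI)
qed

lemma psi_section: "smooth_section M (sigma_plus S) (points M) \<psi>"
  and psi_norm: "y \<in> points M \<Longrightarrow> hnorm (bundle_metric (sigma_plus S) y) (\<psi> y) = 1"
  using unit by (auto simp: unit_section_def)

lemma psi_in: "y \<in> points M \<Longrightarrow> \<psi> y \<in> fibre (sigma_plus S) y"
  using smooth_sectionD(1)[OF psi_section] .

lemma spinor_fibre_at: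
  assumes y: "y \<in> points M"
  shows "spinor_fibre (geometry_at S y) (tangent_space M y) (clifford S y) (J y) (g y) (\<psi> y)"
proof (unfold_locales, goal_cases)
  case 1 then show ?case by (rule spin_at(1)[OF y])
next case 2 then show ?case by (rule spin_at(2)[OF y])
next case 3 then show ?case by (rule spin_at(3)[OF y])
next case 4 then show ?case by (rule subspace_tangent_space[OF Ma y])
next case 5 then show ?case by (rule dim_tangent_space[OF Ma y])
next case 6 then show ?case by (rule herm_at(1)[OF y])
next case (7 v) then show ?case using herm_at(2)[OF y] by blast
next case (8 u v w a b) then show ?case using herm_at(3)[OF y] by blast
next case (9 u v) then show ?case using herm_at(4)[OF y] by blast
next case (10 u v) then show ?case using herm_at(4)[OF y] by blast
next case (11 u) then show ?case using herm_at(5)[OF y] by blast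
next case 12 then show ?case using psi_in[OF y] by simp
next case 13 then show ?case using psi_norm[OF y] by simp
next case (14 v) then show ?case using corr y unfolding corresponds_def by blast
next case (15 v) then show ?case using corr y unfolding corresponds_def by blast
qed

definition is_frame :: "'a set \<Rightarrow> ('a \<Rightarrow> 's) \<Rightarrow> bool" where
  "is_frame W \<xi> \<longleftrightarrow> open_in M W \<and> smooth_section M (sigma_plus S) W \<xi> \<and>
     (\<forall>y\<in>W. spinor_frame (geometry_at S y) (tangent_space M y) (clifford S y) (J y) (g y) (\<psi> y) (\<xi> y))"

text \<open>Gram-Schmidt: from a local frame vector its \<psi>-component is subtracted and the
  remainder is normalized where it is nonzero.\<close>

lemma local_frame:
  assumes y0: "y0 \<in> points M"
  obtains W \<xi> where "is_frame W \<xi>" "y0 \<in> W"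
proof -
  let ?E = "sigma_plus S" and ?h = "bundle_metric (sigma_plus S)"
  obtain V t where t: "(V, t) \<in> trivs ?E" "y0 \<in> V" using vector_bundleD(4)[OF vb(1) y0] by blast
  have V: "open_in M V" using vector_bundleD(2)[OF vb(1) t(1)] .
  note iso = vector_bundleD(3)[OF vb(1) t(1)]
  have VM: "y \<in> points M" if "y \<in> V" for y using open_in_points[OF V] that by blast
  have H: "hermitian_space 2 (fibre ?E y) (?h y)" if "y \<in> points M" for y
    using spin_at(1)[OF that] by (simp add: spinc4_geometry_def)
  have pp: "?h y (\<psi> y) (\<psi> y) = 1" if "y \<in> points M" for y
    using herm_eq[OF H[OF that] psi_in[OF that]] herm_hnorm[OF H[OF that] psi_in[OF that]] psi_norm[OF that] by simp
  define e where "e i y = inv_into (fibre ?E y) (t y) (axis i 1)" for i y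
  have e: "smooth_section M ?E V (e i)" for i unfolding e_def by (rule smooth_frame_section[OF Ma vb(1) t(1)])
  have ps: "smooth_section M ?E V \<psi>" using smooth_section_subset[OF psi_section open_in_points[OF V]] .
  define r where "r i y = 1 *\<^sub>C e i y + (- ?h y (e i y) (\<psi> y)) *\<^sub>C \<psi> y" for i y
  have one: "smooth_fun M V (\<lambda>y. 1 :: complex)" by (rule smooth_funI) (rule smooth_on_const)
  have r: "smooth_section M ?E V (r i)" for i
    unfolding r_def using smooth_fun_linear[OF V linear_uminus metric_smooth(1)[OF V e ps]]
    by (intro smooth_section_combination[OF Ma vb(1) V one _ e ps])
  \<comment> \<open>If both frame vectors were multiples of \<psi>, the two coordinate axes of the
    trivialization would be proportional.\<close>
  have "\<exists>i. r i y0 \<noteq> 0"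
  proof (rule ccontr)
    assume "\<not> (\<exists>i. r i y0 \<noteq> 0)"
    then have *: "e i y0 = ?h y0 (e i y0) (\<psi> y0) *\<^sub>C \<psi> y0" for i by (simp add: r_def cvec_algebra)
    define k where "k i = ?h y0 (e i y0) (\<psi> y0)" for i
    have k: "e i y0 = k i *\<^sub>C \<psi> y0" for i unfolding k_def by (rule *)
    have "t y0 (e i y0) = axis i 1" for i unfolding e_def by (rule fibrewise_isoD(4)[OF iso t(2)])
    then have "axis i 1 = k i *s t y0 (\<psi> y0)" for i using fibrewise_isoD(3)[OF iso t(2) psi_in[OF y0]] k by metis
    from this[of 1] this[of 2] have "k 1 * t y0 (\<psi> y0) $ 1 = 1" "k 2 * t y0 (\<psi> y0) $ 2 = 1" "k 1 * t y0 (\<psi> y0) $ 2 = 0"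
      by (simp_all add: vec_eq_iff axis_def forall_2)
    then show False by auto
  qed
  then obtain i where i: "r i y0 \<noteq> 0" by blast
  have rin: "r i y \<in> fibre ?E y" if "y \<in> V" for y using smooth_sectionD(1)[OF r that] .
  define n where "n y = Re (?h y (r i y) (r i y))" for y
  have n: "smooth_fun M V n"
    unfolding n_def by (rule smooth_fun_linear[OF V _ metric_smooth(1)[OF V r r]]) (rule linearI; simp)
  let ?W = "{y \<in> V. n y \<in> {0<..}}"
  have W: "open_in M ?W" by (rule open_in_smooth_preimage[OF Ma V n]) simp
  have "n y0 > 0" using herm_pos[OF H[OF y0] rin[OF t(2)]] i unfolding n_def by fastforce
  define k where "k y = 1 / sqrt (n y)" for y
  have "smooth_fun M ?W k" unfolding k_def
    by (rule smooth_fun_inverse_sqrt[OF Ma W smooth_fun_subset[OF n]]) auto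
  then have kc: "smooth_fun M ?W (\<lambda>y. complex_of_real (k y))"
    by (rule smooth_fun_linear[OF W, rotated]) (rule linearI; simp add: scaleR_conv_of_real)
  define \<xi> where "\<xi> y = complex_of_real (k y) *\<^sub>C r i y" for y
  have sx: "smooth_section M ?E ?W \<xi>" unfolding \<xi>_def
    by (rule smooth_section_scale[OF Ma vb(1) W kc smooth_section_subset[OF r]]) auto
  have "spinor_frame (geometry_at S y) (tangent_space M y) (clifford S y) (J y) (g y) (\<psi> y) (\<xi> y)" if y: "y \<in> ?W" for y
  proof -
    have yM: "y \<in> points M" and yV: "y \<in> V" using y VM by auto
    note lin = herm_lin[OF H[OF yM]] and mem = herm_mem[OF H[OF yM]]
    have ei: "e i y \<in> fibre ?E y" using smooth_sectionD(1)[OF e yV] .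
    have rp: "?h y (r i y) (\<psi> y) = 0" unfolding r_def using ei psi_in[OF yM] pp[OF yM] by (simp add: lin mem)
    have kk: "k y * k y * n y = 1" using y by (simp add: k_def)
    have "?h y (\<xi> y) (\<xi> y) = complex_of_real (k y * k y) * ?h y (r i y) (r i y)"
      unfolding \<xi>_def using rin[OF yV] by (simp add: lin mem)
    also have "\<dots> = complex_of_real (k y * k y * n y)"
      using herm_eq[OF H[OF yM] rin[OF yV]] unfolding n_def by (metis of_real_mult)
    finally have x1: "?h y (\<xi> y) (\<xi> y) = 1" using kk by simp
    have x2: "?h y (\<xi> y) (\<psi> y) = 0" unfolding \<xi>_def using rin[OF yV] psi_in[OF yM] rp by (simp add: lin mem)
    have x3: "\<xi> y \<in> fibre ?E y" unfolding \<xi>_def using rin[OF yV] mem by simp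
    show ?thesis
      by (intro spinor_frame.intro spinor_fibre_at[OF yM] spinor_frame_axioms.intro) (simp_all add: x1 x2 x3)
  qed
  then have "is_frame ?W \<xi>" using W sx by (simp add: is_frame_def)
  then show ?thesis using that[of ?W \<xi>] t(2) \<open>n y0 > 0\<close> by simp
qed

text \<open>These copies of the fibrewise forms take the point as an argument, which is necessary to
  speak of smooth dependence on it; \<open>frame_consts\<close> identifies them with the constants
  of the fibre locale.\<close>

definition omega where "omega y u v = g y (J y u) v"
definition beta where "beta \<xi> y u v = bundle_metric (sigma_minus S) y (clifford S y v (\<psi> y)) (clifford S y u (\<xi> y))"
definition grm where "grm \<xi> y u v = (omega y u v)\<^sup>2 + (cmod (beta \<xi> y u v))\<^sup>2"
definition coef1 where "coef1 \<xi> \<eta> y u v = complex_of_real ((1 + \<eta> * omega y u v / sqrt (grm \<xi> y u v)) / 2)"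
definition coef2 where "coef2 \<xi> \<eta> y u v = - \<i> * complex_of_real \<eta> * beta \<xi> y u v / (2 * sqrt (grm \<xi> y u v))"

text \<open>The sign \<eta> = 1 stands for \<lambda> and \<eta> = -1 for \<mu>; the complementary
  line is \<open>eigen (- \<eta>)\<close>, so that one argument covers both components.\<close>

definition eigen :: "real \<Rightarrow> 'a plane_point \<Rightarrow> 's set" where
  "eigen \<eta> x = (if \<eta> = 1 then lambda_fibre S x else mu_fibre S x)"
definition ecomp :: "real \<Rightarrow> ('a \<Rightarrow> 's) \<Rightarrow> 'a plane_point \<Rightarrow> 's" where
  "ecomp \<eta> \<phi> x = component (eigen \<eta> x) (eigen (- \<eta>) x) (\<phi> (fst x))"

lemma frameD:
  assumes "is_frame W \<xi>"
  shows "open_in M W" "smooth_section M (sigma_plus S) W \<xi>" "y \<in> W \<Longrightarrow> y \<in> points M"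
    "y \<in> W \<Longrightarrow> spinor_frame (geometry_at S y) (tangent_space M y) (clifford S y) (J y) (g y) (\<psi> y) (\<xi> y)"
proof -
  show o: "open_in M W" "smooth_section M (sigma_plus S) W \<xi>" using assms unfolding is_frame_def by - (elim conjE, assumption)+
  show "y \<in> W \<Longrightarrow> y \<in> points M" using open_in_points[OF o(1)] by blast
  have *: "\<forall>y\<in>W. spinor_frame (geometry_at S y) (tangent_space M y) (clifford S y) (J y) (g y) (\<psi> y) (\<xi> y)"
    using assms unfolding is_frame_def by - (elim conjE, assumption)
  show "y \<in> W \<Longrightarrow> spinor_frame (geometry_at S y) (tangent_space M y) (clifford S y) (J y) (g y) (\<psi> y) (\<xi> y)"
    by (rule bspec[OF *])
qed

lemma frame_consts:
  assumes "spinor_frame (geometry_at S y) (tangent_space M y) (clifford S y) (J y) (g y) (\<psi> y) (\<xi> y)"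
  shows "spinor_frame.om (J y) (g y) = omega y" "spinor_frame.be (geometry_at S y) (clifford S y) (\<psi> y) (\<xi> y) = beta \<xi> y"
    "spinor_frame.gram (geometry_at S y) (clifford S y) (J y) (g y) (\<psi> y) (\<xi> y) = grm \<xi> y"
    "spinor_frame.sigma1 (geometry_at S y) (clifford S y) (J y) (g y) (\<psi> y) (\<xi> y) \<eta> = coef1 \<xi> \<eta> y"
    "spinor_frame.sigma2 (geometry_at S y) (clifford S y) (J y) (g y) (\<psi> y) (\<xi> y) \<eta> = coef2 \<xi> \<eta> y"
proof -
  interpret F: spinor_frame "geometry_at S y" "tangent_space M y" "clifford S y" "J y" "g y" "\<psi> y" "\<xi> y" by fact
  show 1: "F.om = omega y" by (simp add: fun_eq_iff F.om_def omega_def)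
  show 2: "F.be = beta \<xi> y" by (simp add: fun_eq_iff F.be_def beta_def)
  show 3: "F.gram = grm \<xi> y" by (simp add: fun_eq_iff F.gram_def grm_def 1 2)
  show "F.sigma1 \<eta> = coef1 \<xi> \<eta> y" by (simp add: fun_eq_iff F.sigma1_def coef1_def 1 3)
  show "F.sigma2 \<eta> = coef2 \<xi> \<eta> y" by (simp add: fun_eq_iff F.sigma2_def coef2_def 2 3)
qed

text \<open>Here the descriptions behind \<open>lambda_fibre\<close> and \<open>component\<close>
  are resolved for a plane given by a basis; what follows uses only explicit coefficients.\<close>

lemma eigen_facts:
  assumes "spinor_frame (geometry_at S y) (tangent_space M y) (clifford S y) (J y) (g y) (\<psi> y) (\<xi> y)"
    and uv: "u \<in> tangent_space M y" "v \<in> tangent_space M y" "u \<noteq> v" "independent {u, v}"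
    and \<eta>: "\<eta> = 1 \<or> \<eta> = -1"
  shows "eigen \<eta> (y, orient_class [u, v]) \<in> complex_lines (fibre (sigma_plus S) y)"
    "ecomp \<eta> \<psi> (y, orient_class [u, v]) = coef1 \<xi> \<eta> y u v *\<^sub>C \<psi> y + coef2 \<xi> \<eta> y u v *\<^sub>C \<xi> y"
    "ecomp \<eta> \<xi> (y, orient_class [u, v]) = - cnj (coef2 \<xi> (- \<eta>) y u v) *\<^sub>C \<psi> y + coef1 \<xi> (- \<eta>) y u v *\<^sub>C \<xi> y"
    "ecomp \<eta> \<psi> (y, orient_class [u, v]) \<in> eigen \<eta> (y, orient_class [u, v])"
    "ecomp \<eta> \<xi> (y, orient_class [u, v]) \<in> eigen \<eta> (y, orient_class [u, v])"
    "grm \<xi> y u v > 0"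
    "ecomp \<eta> \<psi> (y, orient_class [u, v]) = 0 \<longleftrightarrow> (\<exists>p q. v = p *\<^sub>R u + q *\<^sub>R J y u \<and> \<eta> * q < 0)"
    "coef1 \<xi> \<eta> y u v + coef1 \<xi> (- \<eta>) y u v = 1"
proof -
  interpret F: spinor_frame "geometry_at S y" "tangent_space M y" "clifford S y" "J y" "g y" "\<psi> y" "\<xi> y" by fact
  note cs = frame_consts[where y=y and \<xi>=\<xi>, OF assms(1)]
  have lam: "lambda_fibre S (y, orient_class [u, v]) = F.eline 1 u v"
    unfolding lambda_fibre_def case_prod_conv
    using F.Psi_eline_iff[OF uv] by (simp add: the_equality)
  have mu: "mu_fibre S (y, orient_class [u, v]) = F.eline (- 1) u v"
    unfolding mu_fibre_def lam using F.eline_orth[OF uv] by simp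
  have e: "eigen \<eta> (y, orient_class [u, v]) = F.eline \<eta> u v" "eigen (- \<eta>) (y, orient_class [u, v]) = F.eline (- \<eta>) u v"
    using \<eta> lam mu by (auto simp: eigen_def)
  show "eigen \<eta> (y, orient_class [u, v]) \<in> complex_lines (fibre (sigma_plus S) y)"
    unfolding e using F.eline_complex_line[OF uv \<eta>] by simp
  show 2: "ecomp \<eta> \<psi> (y, orient_class [u, v]) = coef1 \<xi> \<eta> y u v *\<^sub>C \<psi> y + coef2 \<xi> \<eta> y u v *\<^sub>C \<xi> y"
    unfolding ecomp_def e fst_conv F.component_eline(1)[OF uv \<eta>] cs ..
  show 3: "ecomp \<eta> \<xi> (y, orient_class [u, v]) = - cnj (coef2 \<xi> (- \<eta>) y u v) *\<^sub>C \<psi> y + coef1 \<xi> (- \<eta>) y u v *\<^sub>C \<xi> y"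
    unfolding ecomp_def e fst_conv F.component_eline(2)[OF uv \<eta>] cs ..
  show "ecomp \<eta> \<psi> (y, orient_class [u, v]) \<in> eigen \<eta> (y, orient_class [u, v])"
    unfolding 2 e using F.sigma_in_eline(1)[OF uv \<eta>] unfolding cs .
  show "ecomp \<eta> \<xi> (y, orient_class [u, v]) \<in> eigen \<eta> (y, orient_class [u, v])"
    unfolding 3 e using F.sigma_in_eline(2)[OF uv \<eta>] unfolding cs .
  show "grm \<xi> y u v > 0" using F.gram_pos[OF uv] unfolding cs .
  show "ecomp \<eta> \<psi> (y, orient_class [u, v]) = 0 \<longleftrightarrow> (\<exists>p q. v = p *\<^sub>R u + q *\<^sub>R J y u \<and> \<eta> * q < 0)"
    unfolding 2 using F.sigma_zero_iff[OF uv \<eta>] unfolding cs .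
  show "coef1 \<xi> \<eta> y u v + coef1 \<xi> (- \<eta>) y u v = 1"
    using F.sigma_sum(1)[OF uv] unfolding cs .
qed

lemma points_N_frame:
  assumes "x \<in> points N"
  obtains u v where "x = (fst x, orient_class [u, v])" "u \<in> tangent_space M (fst x)" "v \<in> tangent_space M (fst x)"
    "u \<noteq> v" "independent {u, v}" "fst x \<in> points M"
proof -
  have "fst x \<in> points M" "snd x \<in> oriented_planes (tangent_space M (fst x))"
    using points_plane_bundle[OF Ma] assms by blast+
  then obtain u v where "snd x = orient_class [u, v]" "u \<in> tangent_space M (fst x)" "v \<in> tangent_space M (fst x)" "u \<noteq> v" "independent {u, v}"
    unfolding oriented_planes_def by blast
  then show ?thesis using that[of u v] \<open>fst x \<in> points M\<close> by (metis prod.collapse)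
qed

text \<open>The forms are smooth on coordinate fields by hypothesis. Bilinearity extends this to
  graph vectors, which vary with the slopes, and positivity of \<open>grm\<close> makes the root and
  the quotients smooth.\<close>

lemma smooth_forms_chart:
  assumes W: "is_frame W \<xi>" and c: "c \<in> M" "basis_list B UNIV"
  defines "D \<equiv> snd c ` (fst c \<inter> W) \<times> (UNIV :: (real ^ 4) set)"
    and "fu \<equiv> \<lambda>p. tvec M (chart_inv c (fst p)) c (bcomb B (graph_fst (snd p)))"
    and "fv \<equiv> \<lambda>p. tvec M (chart_inv c (fst p)) c (bcomb B (graph_snd (snd p)))"
  shows "open D" "smooth_on D (\<lambda>p. omega (chart_inv c (fst p)) (fu p) (fv p))"
    "smooth_on D (\<lambda>p. beta \<xi> (chart_inv c (fst p)) (fu p) (fv p))"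
    "smooth_on D (\<lambda>p. coef1 \<xi> \<eta> (chart_inv c (fst p)) (fu p) (fv p))"
    "smooth_on D (\<lambda>p. coef2 \<xi> \<eta> (chart_inv c (fst p)) (fu p) (fv p))"
    "\<And>p. p \<in> D \<Longrightarrow> grm \<xi> (chart_inv c (fst p)) (fu p) (fv p) > 0"
proof -
  note Wf = frameD[OF W]
  have O: "open (snd c ` (fst c \<inter> W))" using open_in_image[OF Wf(1) c(1)] .
  show D: "open D" unfolding D_def using O by (simp add: open_Times)
  have ci: "chart_inv c (fst p) \<in> W" "chart_inv c (fst p) \<in> fst c" if "p \<in> D" for p
    using that chart_inv_left[OF Ma c(1)] by (auto simp: D_def)
  have fs: "smooth_on D fst" "smooth_on D snd" by (intro smooth_on_linear' D linear_fst linear_snd)+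
  have gs: "smooth_on D (\<lambda>p. bcomb B (graph_fst (snd p)))" "smooth_on D (\<lambda>p. bcomb B (graph_snd (snd p)))"
    using linear_graph_affine[OF D fs(2)] by (auto intro!: smooth_on_linear[OF D linear_bcomb])
  have WC: "open_in M (fst c \<inter> W)" using open_in_Int[OF Ma open_in_chart[OF Ma c(1)] Wf(1)] .
  have Xf: "smooth_field M (fst c \<inter> W) (\<lambda>y. tvec M y c e)" for e
    using smooth_field_tvec[OF Ma c(1), of e] unfolding smooth_field_def by (auto intro: smooth_on_subset)
  have lift: "smooth_on D (\<lambda>p. h (chart_inv c (fst p)))" if "smooth_fun M (fst c \<inter> W) h" for h :: "'a \<Rightarrow> 'z::euclidean_space"
  proof -
    have "smooth_on (snd c ` (fst c \<inter> W)) (\<lambda>z. h (chart_inv c z))" using smooth_funD[OF that c(1)] by (simp add: Int_assoc[symmetric])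
    from smooth_on_compose[OF D O this fs(1)] show ?thesis by (auto simp: D_def)
  qed
  have psW: "smooth_section M (sigma_plus S) (fst c \<inter> W) \<psi>" by (rule smooth_section_subset[OF psi_section open_in_points[OF WC]])
  have xiW: "smooth_section M (sigma_plus S) (fst c \<inter> W) \<xi>" by (rule smooth_section_subset[OF Wf(2)]) auto
  have om_lin: "linear (\<lambda>a. omega y (tvec M y c a) (tvec M y c b))" "linear (\<lambda>b. omega y (tvec M y c a) (tvec M y c b))"
    and be_lin: "linear (\<lambda>a. beta \<xi> y (tvec M y c a) (tvec M y c b))" "linear (\<lambda>b. beta \<xi> y (tvec M y c a) (tvec M y c b))"
    if y: "y \<in> W" "y \<in> fst c" for y a b
  proof -
    interpret F: spinor_frame "geometry_at S y" "tangent_space M y" "clifford S y" "J y" "g y" "\<psi> y" "\<xi> y" by (rule Wf(4)[OF y(1)])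
    note cs = frame_consts[where y=y and \<xi>=\<xi>, OF Wf(4)[OF y(1)]]
    have T: "tvec M y c e \<in> tangent_space M y" for e by (rule tvec_in_tangent_space[OF Ma c(1) y(2)])
    note l = linear_add[OF linear_tvec[OF Ma c(1) y(2)]] linear_cmul[OF linear_tvec[OF Ma c(1) y(2)]]
    have lin: "\<And>r s a a' w. w \<in> tangent_space M y \<Longrightarrow> omega y (tvec M y c (r *\<^sub>R a + s *\<^sub>R a')) w = r * omega y (tvec M y c a) w + s * omega y (tvec M y c a') w"
      "\<And>r s a a' w. w \<in> tangent_space M y \<Longrightarrow> omega y w (tvec M y c (r *\<^sub>R a + s *\<^sub>R a')) = r * omega y w (tvec M y c a) + s * omega y w (tvec M y c a')"
      "\<And>r s a a' w. w \<in> tangent_space M y \<Longrightarrow> beta \<xi> y (tvec M y c (r *\<^sub>R a + s *\<^sub>R a')) w = r * beta \<xi> y (tvec M y c a) w + s * beta \<xi> y (tvec M y c a') w"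
      "\<And>r s a a' w. w \<in> tangent_space M y \<Longrightarrow> beta \<xi> y w (tvec M y c (r *\<^sub>R a + s *\<^sub>R a')) = r * beta \<xi> y w (tvec M y c a) + s * beta \<xi> y w (tvec M y c a')"
      using F.om_lin[OF T T] F.be_lin[OF T T] unfolding cs l by auto
    note lin1 = lin(1)[of _ 1 _ 1, OF T] lin(2)[of _ 1 _ 1, OF T] lin(3)[of _ 1 _ 1, OF T] lin(4)[of _ 1 _ 1, OF T]
    note lin2 = lin(1)[of _ _ _ 0, OF T] lin(2)[of _ _ _ 0, OF T] lin(3)[of _ _ _ 0, OF T] lin(4)[of _ _ _ 0, OF T]
    from lin1 lin2
    show "linear (\<lambda>a. omega y (tvec M y c a) (tvec M y c b))" "linear (\<lambda>b. omega y (tvec M y c a) (tvec M y c b))"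
      "linear (\<lambda>a. beta \<xi> y (tvec M y c a) (tvec M y c b))" "linear (\<lambda>b. beta \<xi> y (tvec M y c a) (tvec M y c b))"
      by (auto intro!: linearI simp: scaleR_conv_of_real)
  qed
  have omb: "smooth_on D (\<lambda>p. omega (chart_inv c (fst p)) (tvec M (chart_inv c (fst p)) c e) (tvec M (chart_inv c (fst p)) c e'))" for e e'
    unfolding omega_def by (rule lift[OF herm_smooth(2)[OF WC herm_smooth(1)[OF WC Xf] Xf]])
  have beb: "smooth_on D (\<lambda>p. beta \<xi> (chart_inv c (fst p)) (tvec M (chart_inv c (fst p)) c e) (tvec M (chart_inv c (fst p)) c e'))" for e e'
    unfolding beta_def by (rule lift[OF metric_smooth(2)[OF WC clifford_smooth[OF WC Xf psW] clifford_smooth[OF WC Xf xiW]]])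
  show om: "smooth_on D (\<lambda>p. omega (chart_inv c (fst p)) (fu p) (fv p))" unfolding fu_def fv_def
    by (rule smooth_on_bilinear_family[where F="\<lambda>y a b. omega y (tvec M y c a) (tvec M y c b)" and p="\<lambda>p. chart_inv c (fst p)", OF D _ _ omb gs])
      (use om_lin ci in auto)
  show be: "smooth_on D (\<lambda>p. beta \<xi> (chart_inv c (fst p)) (fu p) (fv p))" unfolding fu_def fv_def
    by (rule smooth_on_bilinear_family[where F="\<lambda>y a b. beta \<xi> y (tvec M y c a) (tvec M y c b)" and p="\<lambda>p. chart_inv c (fst p)", OF D _ _ beb gs])
      (use be_lin ci in auto)
  show pos: "grm \<xi> (chart_inv c (fst p)) (fu p) (fv p) > 0" if p: "p \<in> D" for p
  proof -
    have "bcomb B (graph_fst (snd p)) \<noteq> bcomb B (graph_snd (snd p)) \<and> independent {bcomb B (graph_fst (snd p)), bcomb B (graph_snd (snd p))}"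
      by (rule plane_minor_independent[OF _ c(2)]) (simp add: bcoord_bcomb[OF c(2)] plane_coords_graph)
    then have "fu p \<noteq> fv p \<and> independent {fu p, fv p}" unfolding fu_def fv_def
      using linear_inj_independent_pair[OF linear_tvec[OF Ma c(1) ci(2)[OF p]] inj_tvec[OF Ma c(1) ci(2)[OF p]]] by blast
    moreover have "fu p \<in> tangent_space M (chart_inv c (fst p))" "fv p \<in> tangent_space M (chart_inv c (fst p))"
      unfolding fu_def fv_def using tvec_in_tangent_space[OF Ma c(1) ci(2)[OF p]] by auto
    ultimately show ?thesis using eigen_facts(6)[where y="chart_inv c (fst p)" and \<xi>=\<xi> and \<eta>=1, OF Wf(4)[OF ci(1)[OF p]]] by simp
  qed
  have "linear cnj" by (rule linearI) (simp_all add: complex_eq_iff)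
  have "linear Re" by (rule linearI) simp_all
  have gr: "smooth_on D (\<lambda>p. grm \<xi> (chart_inv c (fst p)) (fu p) (fv p))"
  proof -
    have "grm \<xi> y u v = omega y u v * omega y u v + Re (beta \<xi> y u v * cnj (beta \<xi> y u v))" for y u v
      unfolding grm_def complex_norm_square[symmetric] by (simp add: power2_eq_square)
    then show ?thesis
      by (simp only:) (intro smooth_on_add smooth_on_mult om smooth_on_linear[OF D \<open>linear Re\<close>] be smooth_on_linear[OF D \<open>linear cnj\<close>] D)
  qed
  have sq: "smooth_on D (\<lambda>p. sqrt (grm \<xi> (chart_inv c (fst p)) (fu p) (fv p)))" by (rule smooth_on_sqrt[OF D gr pos])
  have "linear complex_of_real" by (rule linearI) (simp_all add: scaleR_conv_of_real)
  show "smooth_on D (\<lambda>p. coef1 \<xi> \<eta> (chart_inv c (fst p)) (fu p) (fv p))" unfolding coef1_def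
    by (intro smooth_on_linear[OF D \<open>linear complex_of_real\<close>] smooth_on_divide smooth_on_add smooth_on_const D smooth_on_mult om sq)
      (use pos in \<open>auto simp: less_imp_neq[symmetric]\<close>)
  show "smooth_on D (\<lambda>p. coef2 \<xi> \<eta> (chart_inv c (fst p)) (fu p) (fv p))" unfolding coef2_def
    by (intro smooth_on_divide smooth_on_const D smooth_on_mult be smooth_on_linear[OF D \<open>linear complex_of_real\<close>] sq)
      (use pos in \<open>auto simp: less_imp_neq[symmetric]\<close>)
qed

end

text \<open>Reversing the first or the second vector differs by the sign -1 on both, a base change
  of determinant one.\<close>

lemma opposite_orient_class_pair: "opposite (orient_class [u, w]) = orient_class [u, - w]"
proof -
  have "opposite (orient_class [u, w]) = {[- (p *\<^sub>R u + q *\<^sub>R w), r *\<^sub>R u + s *\<^sub>R w] | p q r s. p * s - q * r > 0}"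
    unfolding opposite_def orient_class_pair by (force simp: image_iff)
  also have "\<dots> = orient_class [u, - w]"
    unfolding orient_class_pair
  proof (intro equalityI subsetI)
    fix x assume "x \<in> {[- (p *\<^sub>R u + q *\<^sub>R w), r *\<^sub>R u + s *\<^sub>R w] | p q r s. p * s - q * r > 0}"
    then obtain p q r s where x: "x = [- (p *\<^sub>R u + q *\<^sub>R w), r *\<^sub>R u + s *\<^sub>R w]" "p * s - q * r > 0" by blast
    then have "x = [(- p) *\<^sub>R u + q *\<^sub>R (- w), r *\<^sub>R u + (- s) *\<^sub>R (- w)] \<and> (- p) * (- s) - q * r > 0" by simp
    then show "x \<in> {[p *\<^sub>R u + q *\<^sub>R - w, r *\<^sub>R u + s *\<^sub>R - w] | p q r s. p * s - q * r > 0}" by blast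
  next
    fix x assume "x \<in> {[p *\<^sub>R u + q *\<^sub>R - w, r *\<^sub>R u + s *\<^sub>R - w] | p q r s. p * s - q * r > 0}"
    then obtain p q r s where x: "x = [p *\<^sub>R u + q *\<^sub>R - w, r *\<^sub>R u + s *\<^sub>R - w]" "p * s - q * r > 0" by blast
    then have "x = [- ((- p) *\<^sub>R u + q *\<^sub>R w), r *\<^sub>R u + (- s) *\<^sub>R w] \<and> (- p) * (- s) - q * r > 0" by simp
    then show "x \<in> {[- (p *\<^sub>R u + q *\<^sub>R w), r *\<^sub>R u + s *\<^sub>R w] | p q r s. p * s - q * r > 0}" by blast
  qed
  finally show ?thesis .
qed

context spinor_fibre
begin

lemma J_independent:
  assumes "u \<in> TT" "u \<noteq> 0" "e \<noteq> 0"
  shows "u \<noteq> e *\<^sub>R J u \<and> independent {u, e *\<^sub>R J u}"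
  unfolding independent_pair
proof (intro allI impI)
  fix a b assume *: "a *\<^sub>R u + b *\<^sub>R (e *\<^sub>R J u) = 0"
  have ou: "g (J u) u = 0"
  proof -
    have "g (J (J u)) (J u) = g (J u) u" by (rule gJ[OF Tmem(6)[OF assms(1)] assms(1)])
    then have "- g u (J u) = g (J u) u" using JJ[OF assms(1)] g_lin(7)[OF assms(1) Tmem(6)[OF assms(1)]] by simp
    then show ?thesis unfolding gsym[OF assms(1) Tmem(6)[OF assms(1)]] by simp
  qed
  have "g (a *\<^sub>R u + b *\<^sub>R (e *\<^sub>R J u)) u = a * g u u"
    using assms(1) ou by (simp add: g_lin Tmem)
  then have "a * g u u = 0" using * g_lin(9)[OF assms(1)] by simp
  then have a: "a = 0" using gpos[OF assms(1,2)] by simp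
  then have "(b * e) *\<^sub>R J u = 0" using * by simp
  moreover have "J u \<noteq> 0" using JJ[OF assms(1)] J_lin(3)[OF Tmem(3), of 0] assms(2) by auto
  ultimately show "a = 0 \<and> b = 0" using a assms(3) by simp
qed

lemma oriented_line_span:
  assumes "u \<in> TT" "u \<noteq> 0"
  shows "oriented_line J (span {u, J u}) = orient_class [u, J u]"
proof -
  have "complex_orientation J id (span {u, J u}) (span {u, J u}) = orient_class [id u, id (J u)]"
  proof (rule complex_orientation_line)
    show "u \<in> span {u, J u}" by (simp add: span_base)
    show "basis_list [id u, id (J u)] (span {u, J u})"
      using J_independent[OF assms, of 1] by (simp add: basis_list_pair)
    fix b assume "b \<in> span {u, J u}"
    then obtain p q where b: "b = p *\<^sub>R u + q *\<^sub>R J u" unfolding span_pair by blast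
    have "J b = p *\<^sub>R J u + q *\<^sub>R J (J u)" unfolding b by (rule J_lin(1)[OF assms(1) Tmem(6)[OF assms(1)]])
    then have "J b = - q *\<^sub>R u + p *\<^sub>R J u" using JJ[OF assms(1)] by simp
    then show "\<exists>p q. id b = p *\<^sub>R id u + q *\<^sub>R id (J u) \<and> id (J b) = - q *\<^sub>R id u + p *\<^sub>R id (J u)"
      unfolding id_apply using b by blast
  qed
  then show ?thesis by (simp add: oriented_line_def)
qed

lemma f_oriented_line:
  assumes "u \<in> TT" "u \<noteq> 0" "\<eta> = 1 \<or> \<eta> = -1"
  shows "(if \<eta> = 1 then opposite else id) (oriented_line J (span {u, J u})) = orient_class [u, - \<eta> *\<^sub>R J u]"
  using assms(3) opposite_orient_class_pair[of u "J u"] by (auto simp: oriented_line_span[OF assms(1,2)])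

end

section \<open>The components of \<psi> as sections, and their zeros\<close>

context spin_setting
begin

abbreviation "E' \<equiv> spinor_pullback M S"

lemma vbE: "vector_bundle N E'"
  unfolding spinor_pullback_def by (rule vector_bundle_pullback[OF Ma vb(1)])

lemma fibre_E: "fibre E' x = fibre (sigma_plus S) (fst x)"
  by (simp add: spinor_pullback_def pullback_bundle_def)

text \<open>Like \<open>c2\<close>, a frame coefficient of the component obtained as an inner
  product; it is thereby a function on the total space that involves no choice of a basis of the
  plane.\<close>

definition c1 where "c1 \<eta> x = bundle_metric (sigma_plus S) (fst x) (ecomp \<eta> \<psi> x) (\<psi> (fst x))"
definition c2 where "c2 \<xi> \<eta> x = bundle_metric (sigma_plus S) (fst x) (ecomp \<eta> \<psi> x) (\<xi> (fst x))"

lemma c_eq: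
  assumes W: "is_frame W \<xi>" "y \<in> W" and uv: "u \<in> tangent_space M y" "v \<in> tangent_space M y" "u \<noteq> v" "independent {u, v}"
    and \<eta>: "\<eta> = 1 \<or> \<eta> = -1"
  shows "c1 \<eta> (y, orient_class [u, v]) = coef1 \<xi> \<eta> y u v" "c2 \<xi> \<eta> (y, orient_class [u, v]) = coef2 \<xi> \<eta> y u v"
proof -
  interpret F: spinor_frame "geometry_at S y" "tangent_space M y" "clifford S y" "J y" "g y" "\<psi> y" "\<xi> y" by (rule frameD(4)[OF W])
  note ef = eigen_facts(2)[where y=y and \<xi>=\<xi>, OF frameD(4)[OF W] uv \<eta>]
  show "c1 \<eta> (y, orient_class [u, v]) = coef1 \<xi> \<eta> y u v" unfolding c1_def ef fst_conv using F.hp_frame(1) by simp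
  show "c2 \<xi> \<eta> (y, orient_class [u, v]) = coef2 \<xi> \<eta> y u v" unfolding c2_def ef fst_conv using F.hp_frame(2) by simp
qed

lemma ecomp_frame:
  assumes W: "is_frame W \<xi>" and x: "x \<in> over W" and \<eta>: "\<eta> = 1 \<or> \<eta> = -1"
  shows "eigen \<eta> x \<in> complex_lines (fibre E' x)"
    "ecomp \<eta> \<psi> x = c1 \<eta> x *\<^sub>C \<psi> (fst x) + c2 \<xi> \<eta> x *\<^sub>C \<xi> (fst x)"
    "ecomp \<eta> \<xi> x = - cnj (c2 \<xi> (- \<eta>) x) *\<^sub>C \<psi> (fst x) + c1 (- \<eta>) x *\<^sub>C \<xi> (fst x)"
    "ecomp \<eta> \<psi> x \<in> eigen \<eta> x" "ecomp \<eta> \<xi> x \<in> eigen \<eta> x" "c1 \<eta> x + c1 (- \<eta>) x = 1"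
    "ecomp \<eta> \<psi> x = 0 \<Longrightarrow> c1 \<eta> x = 0" "ecomp \<eta> \<xi> x = 0 \<Longrightarrow> c1 (- \<eta>) x = 0"
proof -
  have xN: "x \<in> points N" and xW: "fst x \<in> W" using x by auto
  obtain u v where uv: "x = (fst x, orient_class [u, v])" "u \<in> tangent_space M (fst x)" "v \<in> tangent_space M (fst x)" "u \<noteq> v" "independent {u, v}"
    by (rule points_N_frame[OF xN]) blast
  interpret F: spinor_frame "geometry_at S (fst x)" "tangent_space M (fst x)" "clifford S (fst x)" "J (fst x)" "g (fst x)" "\<psi> (fst x)" "\<xi> (fst x)"
    by (rule frameD(4)[OF W xW])
  have m: "- \<eta> = 1 \<or> - \<eta> = -1" using \<eta> by auto
  note ef = eigen_facts[where y="fst x" and \<xi>=\<xi>, OF frameD(4)[OF W xW] uv(2-5) \<eta>, folded uv(1)]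
  note ce = c_eq[OF W xW uv(2-5) \<eta>, folded uv(1)] c_eq[OF W xW uv(2-5) m, folded uv(1)]
  show "eigen \<eta> x \<in> complex_lines (fibre E' x)" unfolding fibre_E by (rule ef(1))
  show e2: "ecomp \<eta> \<psi> x = c1 \<eta> x *\<^sub>C \<psi> (fst x) + c2 \<xi> \<eta> x *\<^sub>C \<xi> (fst x)" unfolding ce by (rule ef(2))
  show e3: "ecomp \<eta> \<xi> x = - cnj (c2 \<xi> (- \<eta>) x) *\<^sub>C \<psi> (fst x) + c1 (- \<eta>) x *\<^sub>C \<xi> (fst x)" unfolding ce by (rule ef(3))
  show "ecomp \<eta> \<psi> x \<in> eigen \<eta> x" "ecomp \<eta> \<xi> x \<in> eigen \<eta> x" by (rule ef(4), rule ef(5))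
  show "c1 \<eta> x + c1 (- \<eta>) x = 1" unfolding ce by (rule ef(8))
  show "ecomp \<eta> \<psi> x = 0 \<Longrightarrow> c1 \<eta> x = 0" unfolding e2 using F.frame_inj[of "c1 \<eta> x" "c2 \<xi> \<eta> x" 0 0] by simp
  show "ecomp \<eta> \<xi> x = 0 \<Longrightarrow> c1 (- \<eta>) x = 0" unfolding e3
    using F.frame_inj[of "- cnj (c2 \<xi> (- \<eta>) x)" "c1 (- \<eta>) x" 0 0] by simp
qed

lemma plane_chart_frame_class:
  "frame_point M y c a b = (y, orient_class [tvec M y c a, tvec M y c b])"
  by (simp add: frame_point_def)

lemma graph_independent:
  assumes "c \<in> M" "basis_list B UNIV" "y \<in> fst c"
  shows "tvec M y c (bcomb B (graph_fst q)) \<noteq> tvec M y c (bcomb B (graph_snd q)) \<and>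
    independent {tvec M y c (bcomb B (graph_fst q)), tvec M y c (bcomb B (graph_snd q))}"
proof -
  have "bcomb B (graph_fst q) \<noteq> bcomb B (graph_snd q) \<and> independent {bcomb B (graph_fst q), bcomb B (graph_snd q)}"
    by (rule plane_minor_independent[OF _ assms(2)]) (simp add: bcoord_bcomb[OF assms(2)] plane_coords_graph)
  then show ?thesis
    using linear_inj_independent_pair[OF linear_tvec[OF Ma assms(1,3)] inj_tvec[OF Ma assms(1,3)]] by blast
qed

lemma c_chart:
  assumes W: "is_frame W \<xi>" and \<eta>: "\<eta> = 1 \<or> \<eta> = -1" and c: "c \<in> M" "basis_list B UNIV"
    and p: "p \<in> snd c ` (fst c \<inter> W) \<times> UNIV"
  defines "fu \<equiv> tvec M (chart_inv c (fst p)) c (bcomb B (graph_fst (snd p)))"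
    and "fv \<equiv> tvec M (chart_inv c (fst p)) c (bcomb B (graph_snd (snd p)))"
  shows "c1 \<eta> (chart_inv (plane_chart M c B) p) = coef1 \<xi> \<eta> (chart_inv c (fst p)) fu fv"
    "c2 \<xi> \<eta> (chart_inv (plane_chart M c B) p) = coef2 \<xi> \<eta> (chart_inv c (fst p)) fu fv"
proof -
  have ci: "chart_inv c (fst p) \<in> W" "chart_inv c (fst p) \<in> fst c"
    using p chart_inv_left[OF Ma c(1)] by auto
  have "fst p \<in> snd c ` fst c" using p by auto
  then have "chart_inv (plane_chart M c B) p = (chart_inv c (fst p), orient_class [fu, fv])"
    using plane_chart_inv_frame[OF Ma c, of "fst p" "snd p"] by (simp add: plane_chart_frame_class fu_def fv_def)
  moreover have "fu \<in> tangent_space M (chart_inv c (fst p))" "fv \<in> tangent_space M (chart_inv c (fst p))"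
    unfolding fu_def fv_def by (rule tvec_in_tangent_space[OF Ma c(1) ci(2)])+
  moreover have "fu \<noteq> fv \<and> independent {fu, fv}"
    unfolding fu_def fv_def by (rule graph_independent[OF c ci(2)])
  ultimately show "c1 \<eta> (chart_inv (plane_chart M c B) p) = coef1 \<xi> \<eta> (chart_inv c (fst p)) fu fv"
    "c2 \<xi> \<eta> (chart_inv (plane_chart M c B) p) = coef2 \<xi> \<eta> (chart_inv c (fst p)) fu fv"
    using c_eq[OF W ci(1) _ _ _ _ \<eta>, of fu fv] by simp_all
qed

lemma open_over: "is_frame W \<xi> \<Longrightarrow> open_in N (over W)"
  by (rule open_in_over[OF Ma frameD(1)])

lemma smooth_c:
  assumes W: "is_frame W \<xi>" and \<eta>: "\<eta> = 1 \<or> \<eta> = -1"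
  shows "smooth_fun N (over W) (c1 \<eta>)" "smooth_fun N (over W) (c2 \<xi> \<eta>)"
proof -
  have "smooth_on (snd c' ` (fst c' \<inter> over W)) (\<lambda>p. c1 \<eta> (chart_inv c' p))"
    "smooth_on (snd c' ` (fst c' \<inter> over W)) (\<lambda>p. c2 \<xi> \<eta> (chart_inv c' p))" if c': "c' \<in> N" for c'
  proof -
    obtain c B where c: "c' = plane_chart M c B" "c \<in> M" "basis_list B UNIV" by (rule plane_bundleE[OF Ma c'])
    note sf = smooth_forms_chart[OF W c(2,3)]
    show "smooth_on (snd c' ` (fst c' \<inter> over W)) (\<lambda>p. c1 \<eta> (chart_inv c' p))"
      unfolding c(1) plane_chart_image_over[OF Ma c(2,3)]
      by (rule smooth_on_cong[OF sf(4) sf(1)]) (rule c_chart(1)[OF W \<eta> c(2,3), symmetric])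
    show "smooth_on (snd c' ` (fst c' \<inter> over W)) (\<lambda>p. c2 \<xi> \<eta> (chart_inv c' p))"
      unfolding c(1) plane_chart_image_over[OF Ma c(2,3)]
      by (rule smooth_on_cong[OF sf(5) sf(1)]) (rule c_chart(2)[OF W \<eta> c(2,3), symmetric])
  qed
  then show "smooth_fun N (over W) (c1 \<eta>)" "smooth_fun N (over W) (c2 \<xi> \<eta>)" by (auto intro: smooth_funI)
qed

lemma pulled_sections:
  assumes W: "is_frame W \<xi>"
  shows "smooth_section N E' (over W) (\<lambda>x. \<psi> (fst x))" "smooth_section N E' (over W) (\<lambda>x. \<xi> (fst x))"
  unfolding spinor_pullback_def
  using smooth_section_pullback[OF Ma vb(1) frameD(1)[OF W] smooth_section_subset[OF psi_section open_in_points[OF frameD(1)[OF W]]]]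
    smooth_section_pullback[OF Ma vb(1) frameD(1,2)[OF W]] by auto

lemma ecomp_sections:
  assumes W: "is_frame W \<xi>" and \<eta>: "\<eta> = 1 \<or> \<eta> = -1"
  shows "smooth_section N E' (over W) (ecomp \<eta> \<psi>)" "smooth_section N E' (over W) (ecomp \<eta> \<xi>)"
proof -
  have m: "- \<eta> = 1 \<or> - \<eta> = -1" using \<eta> by auto
  note o = open_over[OF W] and s = smooth_c[OF W \<eta>] and s' = smooth_c[OF W m] and p = pulled_sections[OF W]
  show "smooth_section N E' (over W) (ecomp \<eta> \<psi>)"
    by (rule smooth_section_cong[OF Na vbE o smooth_section_combination[OF Na vbE o s p]])
      (rule ecomp_frame(2)[OF W _ \<eta>, symmetric])
  have "linear (\<lambda>z. - cnj z)" by (rule linearI) (simp_all add: complex_eq_iff)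
  from smooth_fun_linear[OF o this s'(2)] have "smooth_fun N (over W) (\<lambda>x. - cnj (c2 \<xi> (- \<eta>) x))" .
  from smooth_section_combination[OF Na vbE o this s'(1) p]
  show "smooth_section N E' (over W) (ecomp \<eta> \<xi>)"
    by (rule smooth_section_cong[OF Na vbE o]) (rule ecomp_frame(3)[OF W _ \<eta>, symmetric])
qed

lemma frame_over:
  assumes "x \<in> points N" obtains W \<xi> where "is_frame W \<xi>" "x \<in> over W"
proof -
  have "fst x \<in> points M" using points_plane_bundle[OF Ma] assms by blast
  then obtain W \<xi> where "is_frame W \<xi>" "fst x \<in> W" by (rule local_frame)
  then show ?thesis using that assms by blast
qed

lemma eigen_line:
  assumes "\<eta> = 1 \<or> \<eta> = -1" "x \<in> points N" shows "eigen \<eta> x \<in> complex_lines (fibre E' x)"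
proof -
  obtain W \<xi> where "is_frame W \<xi>" "x \<in> over W" by (rule frame_over[OF assms(2)])
  then show ?thesis using ecomp_frame(1) assms(1) by blast
qed

lemma eigen_csubspace: "\<eta> = 1 \<or> \<eta> = -1 \<Longrightarrow> x \<in> points N \<Longrightarrow> csubspace (eigen \<eta> x)"
  using eigen_line by (simp add: complex_lines_def)

text \<open>Since \<open>c1 \<eta> x + c1 (- \<eta>) x = 1\<close>, at every point the
  \<eta>-component of \<psi> or that of \<xi> is nonzero and generates the line nearby.\<close>

lemma vector_bundle_eigen:
  assumes \<eta>: "\<eta> = 1 \<or> \<eta> = -1"
  shows "vector_bundle N (line_subbundle N E' (eigen \<eta>))"
proof (rule vector_bundle_line_subbundle[OF Na vbE eigen_line[OF \<eta>]])
  fix x assume xN: "x \<in> points N"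
  obtain W \<xi> where W: "is_frame W \<xi>" "x \<in> over W" by (rule frame_over[OF xN])
  have m: "- \<eta> = 1 \<or> - \<eta> = -1" using \<eta> by auto
  note ef = ecomp_frame[OF W(1) _ \<eta>]
  have op: "open_in N {x \<in> over W. c1 e x \<in> - {0}}" if "e = 1 \<or> e = -1" for e
    by (rule open_in_smooth_preimage[OF Na open_over[OF W(1)] smooth_c(1)[OF W(1) that]]) auto
  show "\<exists>W \<sigma>. open_in N W \<and> x \<in> W \<and> smooth_section N E' W \<sigma> \<and> (\<forall>y\<in>W. \<sigma> y \<in> eigen \<eta> y \<and> \<sigma> y \<noteq> 0)"
  proof (cases "c1 \<eta> x = 0")
    case False
    let ?U = "{x \<in> over W. c1 \<eta> x \<in> - {0}}"
    have "smooth_section N E' ?U (ecomp \<eta> \<psi>)" by (rule smooth_section_subset[OF ecomp_sections(1)[OF W(1) \<eta>]]) auto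
    moreover have "\<forall>y\<in>?U. ecomp \<eta> \<psi> y \<in> eigen \<eta> y \<and> ecomp \<eta> \<psi> y \<noteq> 0" using ef(4,7) by auto
    moreover have "x \<in> ?U" using W(2) False by simp
    ultimately show ?thesis using op[OF \<eta>] by blast
  next
    case True
    let ?U = "{x \<in> over W. c1 (- \<eta>) x \<in> - {0}}"
    have "smooth_section N E' ?U (ecomp \<eta> \<xi>)" by (rule smooth_section_subset[OF ecomp_sections(2)[OF W(1) \<eta>]]) auto
    moreover have "\<forall>y\<in>?U. ecomp \<eta> \<xi> y \<in> eigen \<eta> y \<and> ecomp \<eta> \<xi> y \<noteq> 0" using ef(5,8) by auto
    moreover have "x \<in> ?U" using W(2) True ef(6)[OF W(2)] by simp
    ultimately show ?thesis using op[OF m] by blast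
  qed
qed

lemma ecomp_in_eigen:
  assumes "\<eta> = 1 \<or> \<eta> = -1" "x \<in> points N" shows "ecomp \<eta> \<psi> x \<in> eigen \<eta> x"
proof -
  obtain W \<xi> where "is_frame W \<xi>" "x \<in> over W" by (rule frame_over[OF assms(2)])
  then show ?thesis using ecomp_frame(4) assms(1) by blast
qed

lemma smooth_section_ecomp:
  assumes \<eta>: "\<eta> = 1 \<or> \<eta> = -1"
  shows "smooth_section N (line_subbundle N E' (eigen \<eta>)) (points N) (ecomp \<eta> \<psi>)"
proof (rule smooth_section_line_subbundle[OF Na vbE eigen_csubspace[OF \<eta>] open_in_points_self[OF Na] _ ecomp_in_eigen[OF \<eta>]])
  show "smooth_section N E' (points N) (ecomp \<eta> \<psi>)"
  proof (rule smooth_section_local[OF Na vbE])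
    fix x assume "x \<in> points N"
    then obtain W \<xi> where "is_frame W \<xi>" "x \<in> over W" by (rule frame_over)
    then show "\<exists>U. open_in N U \<and> x \<in> U \<and> smooth_section N E' U (ecomp \<eta> \<psi>)"
      using open_over ecomp_sections(1) \<eta> by blast
  qed
qed

lemma lambda_mu_eigen:
  "lambda_plus M S = line_subbundle N E' (eigen 1)" "mu_plus M S = line_subbundle N E' (eigen (- 1))"
  "lambda_component S \<psi> = ecomp 1 \<psi>" "mu_component S \<psi> = ecomp (- 1) \<psi>"
  by (simp_all add: lambda_plus_def mu_plus_def eigen_def[abs_def] ecomp_def[abs_def] lambda_component_def[abs_def] mu_component_def[abs_def])

definition Qf :: "real \<Rightarrow> ('a, real ^ 4) tangent list set \<Rightarrow> ('a, real ^ 4) tangent list set" where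
  "Qf \<eta> = (if \<eta> = 1 then opposite else id)"

lemma line_planes_iff:
  assumes \<eta>: "\<eta> = 1 \<or> \<eta> = -1"
  shows "x \<in> line_planes M J (Qf \<eta>) \<longleftrightarrow> fst x \<in> points M \<and>
    (\<exists>u\<in>tangent_space M (fst x). u \<noteq> 0 \<and> x = (fst x, orient_class [u, - \<eta> *\<^sub>R J (fst x) u]))"
proof -
  have q: "Qf \<eta> (oriented_line (J y) (span {u, J y u})) = orient_class [u, - \<eta> *\<^sub>R J y u]"
    if "y \<in> points M" "u \<in> tangent_space M y" "u \<noteq> 0" for y u
    using spinor_fibre.f_oriented_line[OF spinor_fibre_at[OF that(1)] that(2,3) \<eta>] by (simp add: Qf_def)
  show ?thesis
  proof
    assume "x \<in> line_planes M J (Qf \<eta>)"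
    then obtain y l where y: "x = (y, Qf \<eta> (oriented_line (J y) l))" "y \<in> points M" "l \<in> J_lines (J y) (tangent_space M y)"
      unfolding line_planes_def mem_Collect_eq by (elim exE conjE)
    obtain u where u: "l = span {u, J y u}" "u \<in> tangent_space M y" "u \<noteq> 0"
      using y(3) unfolding J_lines_def mem_Collect_eq by (elim exE conjE)
    have "x = (y, orient_class [u, - \<eta> *\<^sub>R J y u])" using y(1) q[OF y(2) u(2,3)] by (simp add: u(1))
    then show "fst x \<in> points M \<and> (\<exists>u\<in>tangent_space M (fst x). u \<noteq> 0 \<and> x = (fst x, orient_class [u, - \<eta> *\<^sub>R J (fst x) u]))"
      using y(2) u(2,3) by (intro conjI bexI[of _ u]) simp_all
  next
    assume "fst x \<in> points M \<and> (\<exists>u\<in>tangent_space M (fst x). u \<noteq> 0 \<and> x = (fst x, orient_class [u, - \<eta> *\<^sub>R J (fst x) u]))"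
    then obtain u where u: "fst x \<in> points M" "u \<in> tangent_space M (fst x)" "u \<noteq> 0" "x = (fst x, orient_class [u, - \<eta> *\<^sub>R J (fst x) u])"
      by (elim conjE bexE)
    have "x = (fst x, Qf \<eta> (oriented_line (J (fst x)) (span {u, J (fst x) u})))" unfolding q[OF u(1-3)] by (rule u(4))
    moreover have "span {u, J (fst x) u} \<in> J_lines (J (fst x)) (tangent_space M (fst x))"
      unfolding J_lines_def using u(2,3) by blast
    ultimately show "x \<in> line_planes M J (Qf \<eta>)" unfolding line_planes_def mem_Collect_eq using u(1)
      by (intro exI[of _ "fst x"] exI[of _ "span {u, J (fst x) u}"] conjI)
  qed
qed

lemma zero_set_ecomp:
  assumes \<eta>: "\<eta> = 1 \<or> \<eta> = -1"
  shows "zero_set N (ecomp \<eta> \<psi>) = line_planes M J (Qf \<eta>)"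
proof (intro equalityI subsetI)
  fix x assume "x \<in> zero_set N (ecomp \<eta> \<psi>)"
  then have x: "x \<in> points N" "ecomp \<eta> \<psi> x = 0" by (auto simp: zero_set_def)
  obtain W \<xi> where W: "is_frame W \<xi>" "x \<in> over W" by (rule frame_over[OF x(1)])
  then have xW: "fst x \<in> W" by simp
  obtain u v where uv: "x = (fst x, orient_class [u, v])" "u \<in> tangent_space M (fst x)" "v \<in> tangent_space M (fst x)" "u \<noteq> v" "independent {u, v}"
    by (rule points_N_frame[OF x(1)]) blast
  interpret F: spinor_frame "geometry_at S (fst x)" "tangent_space M (fst x)" "clifford S (fst x)" "J (fst x)" "g (fst x)" "\<psi> (fst x)" "\<xi> (fst x)"
    by (rule frameD(4)[OF W(1) xW])
  obtain p q where pq: "v = p *\<^sub>R u + q *\<^sub>R J (fst x) u" "\<eta> * q < 0"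
    using eigen_facts(7)[where y="fst x" and \<xi>=\<xi>, OF frameD(4)[OF W(1) xW] uv(2-5) \<eta>, folded uv(1)] x(2) by blast
  have "x = (fst x, orient_class [u, - \<eta> *\<^sub>R J (fst x) u])"
    using uv(1) F.orient_class_J_plane[OF uv(2-5) pq \<eta>] by simp
  moreover have "u \<noteq> 0" using F.u_nonzero[OF uv(2-5)] .
  ultimately show "x \<in> line_planes M J (Qf \<eta>)"
    unfolding line_planes_iff[OF \<eta>] using uv(2) frameD(3)[OF W(1) xW] by blast
next
  fix x assume "x \<in> line_planes M J (Qf \<eta>)"
  then obtain u where u: "fst x \<in> points M" "u \<in> tangent_space M (fst x)" "u \<noteq> 0" "x = (fst x, orient_class [u, - \<eta> *\<^sub>R J (fst x) u])"
    unfolding line_planes_iff[OF \<eta>] by blast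
  interpret F: spinor_fibre "geometry_at S (fst x)" "tangent_space M (fst x)" "clifford S (fst x)" "J (fst x)" "g (fst x)" "\<psi> (fst x)"
    by (rule spinor_fibre_at[OF u(1)])
  let ?v = "- \<eta> *\<^sub>R J (fst x) u"
  have e0: "- \<eta> \<noteq> 0" using \<eta> by auto
  have v: "?v \<in> tangent_space M (fst x)" "u \<noteq> ?v" "independent {u, ?v}"
    using F.J_independent[OF u(2,3) e0] F.Tmem(2)[OF F.Tmem(6)[OF u(2)], of "- \<eta>"] by blast+
  have "snd x \<in> oriented_planes (tangent_space M (fst x))"
    using arg_cong[OF u(4), of snd] u(2) v unfolding oriented_planes_def by auto
  then have xN: "x \<in> points N" using points_plane_bundle[OF Ma] u(1) by blast
  obtain W \<xi> where W: "is_frame W \<xi>" "x \<in> over W" by (rule frame_over[OF xN])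
  then have xW: "fst x \<in> W" by simp
  have "?v = 0 *\<^sub>R u + (- \<eta>) *\<^sub>R J (fst x) u \<and> \<eta> * (- \<eta>) < 0" using \<eta> by auto
  then have "ecomp \<eta> \<psi> x = 0"
    using eigen_facts(7)[where y="fst x" and \<xi>=\<xi>, OF frameD(4)[OF W(1) xW] u(2) v \<eta>, folded u(4)] by blast
  then show "x \<in> zero_set N (ecomp \<eta> \<psi>)" using xN by (simp add: zero_set_def)
qed

end

section \<open>Orientations at the zeros\<close>

text \<open>Lifts of a basis of the image followed by a basis of the kernel. It is applied to
  horizontal and vertical vectors, with \<open>f\<close> the projection to the base.\<close>

lemma basis_list_append:
  assumes f: "linear f" and W: "subspace W" and hs: "set hs \<subseteq> W" "basis_list (map f hs) V" "f ` W \<subseteq> V"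
    and ks: "basis_list ks {w \<in> W. f w = 0}"
  shows "basis_list (hs @ ks) W"
proof -
  have ksW: "set ks \<subseteq> W" "\<And>k. k \<in> set ks \<Longrightarrow> f k = 0" using basis_list_subset[OF ks] by auto
  have s: "sum h {..<n + m} = sum h {..<n} + (\<Sum>j<m. h (n + j))" for h :: "nat \<Rightarrow> 'a" and n m
    by (induction m) (simp_all add: add.assoc)
  have "\<forall>j<length (hs @ ks). c j = 0" if c: "(\<Sum>j<length (hs @ ks). c j *\<^sub>R (hs @ ks) ! j) = 0" for c
  proof -
    have e: "(\<Sum>j<length hs. c j *\<^sub>R hs ! j) + (\<Sum>j<length ks. c (length hs + j) *\<^sub>R ks ! j) = 0"
      using c unfolding length_append by (subst (asm) s) (simp add: nth_append)
    have "f (\<Sum>j<length ks. c (length hs + j) *\<^sub>R ks ! j) = 0"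
      using ksW(2) by (simp add: linear_sum[OF f] linear_cmul[OF f])
    then have "f (\<Sum>j<length hs. c j *\<^sub>R hs ! j) = 0" using arg_cong[OF e, of f] by (simp add: linear_add[OF f] linear_0[OF f])
    then have "(\<Sum>j<length (map f hs). c j *\<^sub>R map f hs ! j) = 0" by (simp add: linear_sum[OF f] linear_cmul[OF f])
    moreover have "\<forall>c. (\<Sum>j<length (map f hs). c j *\<^sub>R map f hs ! j) = 0 \<longrightarrow> (\<forall>j<length (map f hs). c j = 0)"
      using independent_list_iff[of "map f hs"] hs(2) by (simp only: basis_list_def simp_thms)
    ultimately have 1: "\<forall>j<length hs. c j = 0" by simp
    then have "(\<Sum>j<length ks. c (length hs + j) *\<^sub>R ks ! j) = 0" using e by simp
    moreover have "\<forall>c. (\<Sum>j<length ks. c j *\<^sub>R ks ! j) = 0 \<longrightarrow> (\<forall>j<length ks. c j = 0)"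
      using independent_list_iff[of ks] ks by (simp only: basis_list_def simp_thms)
    ultimately have 2: "\<forall>j<length ks. c (length hs + j) = 0" by (auto dest: spec[of _ "\<lambda>j. c (length hs + j)"])
    show ?thesis
    proof (intro allI impI)
      fix j assume "j < length (hs @ ks)"
      then show "c j = 0" using 1 2[rule_format, of "j - length hs"] by (cases "j < length hs") auto
    qed
  qed
  then have i: "distinct (hs @ ks) \<and> independent (set (hs @ ks))" using independent_list_iff[of "hs @ ks"] by blast
  have "W \<subseteq> span (set (hs @ ks))"
  proof
    fix w assume w: "w \<in> W"
    then have "f w \<in> span (set (map f hs))" using hs(2,3) by (auto simp: basis_list_def)
    then obtain c where c: "f w = (\<Sum>j<length hs. c j *\<^sub>R map f hs ! j)" using in_span_list[of "f w" "map f hs"] by auto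
    define h where "h = (\<Sum>j<length hs. c j *\<^sub>R hs ! j)"
    have hspan: "h \<in> span (set hs)" unfolding h_def by (rule span_list_combination)
    have "f h = f w" unfolding c h_def by (simp add: linear_sum[OF f] linear_cmul[OF f])
    moreover have "h \<in> W" using hspan span_minimal[OF hs(1) W] by blast
    ultimately have "w - h \<in> {w \<in> W. f w = 0}" using subspace_diff[OF W w] by (simp add: linear_diff[OF f])
    then have "w - h \<in> span (set ks)" using ks by (simp add: basis_list_def)
    then have "h + (w - h) \<in> span (set (hs @ ks))"
      using hspan span_mono[of "set hs" "set (hs @ ks)"] span_mono[of "set ks" "set (hs @ ks)"] by (intro span_add) auto
    then show "w \<in> span (set (hs @ ks))" by simp
  qed
  moreover have "span (set (hs @ ks)) \<subseteq> W" using hs(1) ksW(1) by (intro span_minimal W) auto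
  ultimately show ?thesis using i by (auto simp: basis_list_def)
qed

lemma det4_basis_list:
  assumes "basis_list ps UNIV" shows "det4 ps \<noteq> 0"
proof
  assume z: "det4 ps = 0"
  have l: "length ps = 4" using basis_list_UNIV_length[OF assms] .
  obtain A where A: "A \<in> carrier_mat 4 4" "[axis 1 1, axis 2 1, axis 3 1, axis 4 1 :: real ^ 4] = mat_act A ps"
    using mat_act_exists[of "[axis 1 1, axis 2 1, axis 3 1, axis 4 1 :: real ^ 4]" ps] assms l by (auto simp: basis_list_def)
  have "det4 [axis 1 1, axis 2 1, axis 3 1, axis 4 1 :: real ^ 4] = 0"
    unfolding A(2) using det4_mat_act[OF l A(1)] z by simp
  then show False by (simp add: det4_list axis_def)
qed

lemma det4_nonzero_basis_list:
  assumes "length ps = 4" "det4 ps \<noteq> 0" shows "basis_list ps UNIV"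
proof -
  let ?e = "[axis 1 1, axis 2 1, axis 3 1, axis 4 1 :: real ^ 4]"
  have "v = (\<Sum>j<length ?e. v $ of_nat (Suc j) *\<^sub>R ?e ! j)" for v :: "real ^ 4"
    by (simp add: vec4_eq_iff axis_def lessThan_Suc numeral_eq_Suc)
  then have "v \<in> span (set ?e)" for v using span_list_combination[of "\<lambda>j. v $ of_nat (Suc j)" ?e] by metis
  then have sp: "span (set ?e) = UNIV" by blast
  have "card (set ?e) = 4" by (simp add: vec4_eq_iff axis_def)
  then have "independent (set ?e)"
    using card_eq_dim[of "set ?e" UNIV] sp by simp
  then have e: "basis_list ?e UNIV" using sp by (simp add: basis_list_def vec4_eq_iff axis_def)
  obtain A where A: "A \<in> carrier_mat 4 4" "ps = mat_act A ?e"
    using mat_act_exists[of ps ?e] sp assms(1) by (auto simp: numeral_eq_Suc)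
  have "det4 ps = Determinant.det A * det4 ?e" unfolding A(2) by (rule det4_mat_act[OF _ A(1)]) simp
  then have "Determinant.det A \<noteq> 0" using assms(2) by auto
  then show ?thesis unfolding A(2) using mat_act_basis_list[OF e] A(1) by (simp add: numeral_eq_Suc)
qed

text \<open>The base change matrix has determinant det4 ps / det4 qs.\<close>

lemma orient_class_det4:
  assumes "length ps = 4" "length qs = 4" "det4 ps * det4 qs > 0"
  shows "ps \<in> orient_class qs"
proof -
  have q: "det4 qs \<noteq> 0" using assms(3) by auto
  have "basis_list qs UNIV" by (rule det4_nonzero_basis_list[OF assms(2) q])
  then obtain A where A: "A \<in> carrier_mat 4 4" "ps = mat_act A qs"
    using mat_act_exists[of ps qs] assms(1,2) by (auto simp: basis_list_def)
  have "det4 ps = Determinant.det A * det4 qs" unfolding A(2) by (rule det4_mat_act[OF assms(2) A(1)])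
  then have "Determinant.det A * (det4 qs * det4 qs) > 0" using assms(3) by (simp add: mult.assoc)
  then have "Determinant.det A > 0" using q by (simp add: zero_less_mult_iff not_less)
  then show ?thesis using A assms(2) by (intro orient_class_mat_actI[of ps A qs]) auto
qed

lemma det4_orient_class:
  assumes "length qs = 4" "ps \<in> orient_class qs" "det4 qs < 0" shows "det4 ps < 0"
proof -
  obtain A where A: "A \<in> carrier_mat 4 4" "ps = mat_act A qs" "Determinant.det A > 0"
    using assms(1,2) unfolding orient_class_mat_act by auto
  then show ?thesis using det4_mat_act[OF assms(1) A(1)] assms(3) by (simp add: mult_pos_neg)
qed

section \<open>The linear model of the orientation comparison\<close>

definition cross2 :: "complex \<Rightarrow> complex \<Rightarrow> real" where "cross2 z w = Re z * Im w - Im z * Re w"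

text \<open>\<open>cross2\<close> is the real area form of the complex plane, and a complex factor
  is a rotation with a positive dilation unless it is zero. Hence the choice of a trivialization
  does not influence orientations.\<close>

lemma cross2_mult: "cross2 (k * z) (k * w) = (cmod k)\<^sup>2 * cross2 z w"
  unfolding cross2_def cmod_power2 by (simp add: power2_eq_square algebra_simps)

text \<open>The model at a zero: \<open>Db\<close> is the derivative of \<open>\<beta>\<close> in the coordinates \<open>(a, q)\<close> of a chart of the
  bundle of oriented planes, and \<open>OM\<close>, \<open>oN\<close>, \<open>oK\<close> are the orientations of \<open>M\<close>, of the total space and of
  \<open>Q\<close> or \<open>Qbar\<close>, read in that chart.\<close>

locale orientation_core =
  fixes Db :: "(real ^ 4) \<times> (real ^ 4) \<Rightarrow> complex" and OM :: "(real ^ 4) list set" and \<epsilon> :: real and b0 :: complex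
  assumes lin: "linear Db" and b0: "b0 \<noteq> 0" and \<epsilon>: "\<epsilon> = 1 \<or> \<epsilon> = -1"
    and Db: "Db (0, q) = b0 * Complex (q $ 3 + \<epsilon> * q $ 2) (q $ 4 - \<epsilon> * q $ 1)"
    and OM: "as \<in> OM \<Longrightarrow> basis_list as UNIV"
begin

text \<open>In the application, \<open>k1\<close> and \<open>k2\<close> are the slopes of the
  J-linear homomorphisms that send u to w and u to J w. They span the vertical part of the kernel of
  \<open>Db\<close>.\<close>

definition k1 where "k1 = vec4 1 0 0 \<epsilon>"
definition k2 where "k2 = vec4 0 1 (- \<epsilon>) 0"
text \<open>The condition \<open>det4 vs < 0\<close> encodes that the complex orientation of the
  Grassmannian is the negative one in the slopes. Similarly the sign of \<open>k2\<close> in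
  \<open>oK\<close> encodes the reversed orientation of the fibres of Q and Qbar.\<close>

definition oN where "oN = {bs. \<exists>hs vs. map fst hs \<in> OM \<and> length vs = 4 \<and> det4 vs < 0 \<and> bs \<in> orient_class (hs @ map (Pair 0) vs)}"
definition oK where "oK = {bs. \<exists>hs vs. (\<forall>h\<in>set hs. Db h = 0) \<and> map fst hs \<in> OM \<and> vs \<in> orient_class [(0, k1), (0, - k2)] \<and> bs \<in> orient_class (hs @ vs)}"

text \<open>As \<open>b0\<close> is nonzero, the slopes \<open>q $ 3\<close> and
  \<open>q $ 4\<close> alone realize every value. So every base vector lifts into the kernel, and
  normal vectors can be chosen vertical.\<close>

lemma lift: obtains q where "Db (a, q) = z"
proof -
  let ?k = "(z - Db (a, 0)) / b0"
  have "Db (a, vec4 0 0 (Re ?k) (Im ?k)) = Db (a, 0) + Db (0, vec4 0 0 (Re ?k) (Im ?k))"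
    using linear_add[OF lin, of "(a, 0)" "(0, vec4 0 0 (Re ?k) (Im ?k))"] by simp
  also have "\<dots> = z" using b0 by (simp add: Db)
  finally show ?thesis using that by blast
qed

lemma kernel_pair: "basis_list [(0 :: real ^ 4, k1), (0, - k2)] {w \<in> {e. Db e = 0}. fst w = 0}"
  "basis_list [(0 :: real ^ 4, k1), (0, k2)] {w \<in> {e. Db e = 0}. fst w = 0}"
proof -
  have "{w \<in> {e. Db e = 0}. fst w = 0} = span {(0, k1), (0, - k2)}"
  proof (intro equalityI subsetI)
    fix w assume "w \<in> {w \<in> {e. Db e = 0}. fst w = 0}"
    then obtain q where q: "w = (0, q)" "Db (0, q) = 0" by (cases w) auto
    then have "Complex (q $ 3 + \<epsilon> * q $ 2) (q $ 4 - \<epsilon> * q $ 1) = 0" using b0 Db[of q] by simp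
    then have "q $ 3 = - \<epsilon> * q $ 2" "q $ 4 = \<epsilon> * q $ 1" by (simp_all add: complex_eq_iff)
    then have "w = (q $ 1) *\<^sub>R (0, k1) + (- q $ 2) *\<^sub>R (0, - k2)" by (simp add: q(1) k1_def k2_def vec4_eq_iff)
    then show "w \<in> span {(0, k1), (0, - k2)}" unfolding span_pair by blast
  next
    fix w assume "w \<in> span {(0 :: real ^ 4, k1), (0, - k2)}"
    then obtain a b where w: "w = a *\<^sub>R (0, k1) + b *\<^sub>R (0, - k2)" unfolding span_pair by blast
    have "Db (0, k1) = 0" "Db (0, - k2) = 0" using \<epsilon> by (auto simp: Db k1_def k2_def complex_eq_iff)
    then have "Db w = 0" unfolding w linear_add[OF lin] linear_cmul[OF lin] by simp
    then show "w \<in> {w \<in> {e. Db e = 0}. fst w = 0}" by (simp add: w)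
  qed
  moreover have "(0 :: real ^ 4, k1) \<noteq> (0, - k2) \<and> independent {(0 :: real ^ 4, k1), (0, - k2)}"
    unfolding independent_pair by (simp add: k1_def k2_def vec4_eq_iff prod_eq_iff)
  ultimately show k: "basis_list [(0 :: real ^ 4, k1), (0, - k2)] {w \<in> {e. Db e = 0}. fst w = 0}" by (simp add: basis_list_pair)
  have "span {(0 :: real ^ 4, k1), (0, k2)} = span {(0, k1), (0, - k2)}"
  proof -
    have "{a *\<^sub>R (0 :: real ^ 4, k1) + b *\<^sub>R (0, k2) | a b. True} = {a *\<^sub>R (0, k1) + b *\<^sub>R (0, - k2) | a b. True}"
      by (intro equalityI subsetI; clarify; rename_tac a b; rule_tac x=a in exI; rule_tac x="-b" in exI; simp)
    then show ?thesis unfolding span_pair .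
  qed
  moreover have "(0 :: real ^ 4, k1) \<noteq> (0, k2) \<and> independent {(0 :: real ^ 4, k1), (0, k2)}"
    unfolding independent_pair by (simp add: k1_def k2_def vec4_eq_iff prod_eq_iff)
  ultimately show "basis_list [(0 :: real ^ 4, k1), (0, k2)] {w \<in> {e. Db e = 0}. fst w = 0}"
    using k by (simp add: basis_list_pair)
qed

lemma ker_subspace: "subspace {e. Db e = 0}"
  by (simp add: subspace_def linear_add[OF lin] linear_cmul[OF lin] linear_0[OF lin])

lemma kernel_basis:
  assumes "\<forall>h\<in>set hs. Db h = 0" "map fst hs \<in> OM"
  shows "basis_list (hs @ [(0, k1), (0, - k2)]) {e. Db e = 0}"
  by (rule basis_list_append[OF linear_fst ker_subspace _ OM[OF assms(2)] _ kernel_pair(1)]) (use assms(1) in auto)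

lemma total_basis:
  fixes vs :: "(real ^ 4) list"
  assumes "map fst hs \<in> OM" "basis_list vs UNIV"
  shows "basis_list (hs @ map (Pair 0) vs) UNIV"
proof (rule basis_list_append[OF linear_fst subspace_UNIV _ OM[OF assms(1)]])
  have l: "linear (Pair (0 :: real ^ 4) :: real ^ 4 \<Rightarrow> _)" by (rule linearI) simp_all
  have j: "inj (Pair (0 :: real ^ 4) :: real ^ 4 \<Rightarrow> _)" by (simp add: inj_on_def)
  have "basis_list (map (Pair (0 :: real ^ 4)) vs) (Pair 0 ` UNIV)" by (rule basis_list_map[OF l j assms(2)])
  moreover have "Pair (0 :: real ^ 4) ` (UNIV :: (real ^ 4) set) = {w \<in> UNIV. fst w = 0}" by (auto simp: image_iff)
  ultimately show "basis_list (map (Pair (0 :: real ^ 4)) vs) {w \<in> UNIV. fst w = 0}" by simp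
qed auto

text \<open>The decisive sign: it is the same for Q and Qbar because \<epsilon>^2 = 1. The factor
  \<open>b0\<close> is left out, as it would only contribute |b0|^2.\<close>

lemma det4_frame: "det4 [k1, - k2, p, q] = - cross2 (Complex (p $ 3 + \<epsilon> * p $ 2) (p $ 4 - \<epsilon> * p $ 1)) (Complex (q $ 3 + \<epsilon> * q $ 2) (q $ 4 - \<epsilon> * q $ 1))"
  using \<epsilon> by (auto simp: det4_list k1_def k2_def cross2_def algebra_simps)

lemma det4_frame_neg:
  assumes "cross2 (Db (0, p)) (Db (0, q)) > 0" shows "det4 [k1, - k2, p, q] < 0"
  using assms b0 unfolding Db cross2_mult det4_frame by (simp add: zero_less_mult_iff)

text \<open>Both orientations are insensitive to shears: horizontal vectors may be moved into the
  kernel and normal vectors made vertical. What remains is the orientation of the fibre, settled by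
  \<open>det4_frame\<close>.\<close>

theorem orientation_eq:
  "{bs. basis_list bs {e. Db e = 0} \<and> (\<exists>e1 e2. cross2 (Db e1) (Db e2) > 0 \<and> bs @ [e1, e2] \<in> oN)} = oK"
proof (intro equalityI subsetI)
  fix bs assume "bs \<in> {bs. basis_list bs {e. Db e = 0} \<and> (\<exists>e1 e2. cross2 (Db e1) (Db e2) > 0 \<and> bs @ [e1, e2] \<in> oN)}"
  then obtain e1 e2 hs vs where bs: "basis_list bs {e. Db e = 0}" and cr: "cross2 (Db e1) (Db e2) > 0"
    and hs: "map fst hs \<in> OM" and vs: "length vs = 4" "det4 vs < 0" and o: "bs @ [e1, e2] \<in> orient_class (hs @ map (Pair 0) vs)"
    unfolding oN_def by blast
  have "\<forall>a. \<exists>q. Db (a, q) = 0" using lift by metis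
  then obtain l where l: "\<And>a. Db (a, l a) = 0" by metis
  \<comment> \<open>Lifts of the same base vectors into the kernel; they differ from
    \<open>hs\<close> by vertical vectors, so that a shear relates the two lists.\<close>
  define hs' where "hs' = map (\<lambda>h. (fst h, l (fst h))) hs"
  have hs': "\<forall>h\<in>set hs'. Db h = 0" "map fst hs' \<in> OM" "length hs' = length hs" using l hs by (auto simp: hs'_def comp_def)
  obtain q1 where q1: "Db (0, q1) = Db e1" using lift[of 0 "Db e1"] by blast
  obtain q2 where q2: "Db (0, q2) = Db e2" using lift[of 0 "Db e2"] by blast
  let ?cs = "[(0, q1), (0, q2)]" and ?vs = "[(0 :: real ^ 4, k1), (0, - k2)]"
  have "det4 [k1, - k2, q1, q2] < 0" using det4_frame_neg cr q1 q2 by simp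
  then have "[k1, - k2, q1, q2] \<in> orient_class vs" using vs by (intro orient_class_det4) (simp_all add: mult_neg_neg)
  moreover have lP: "linear (Pair (0 :: real ^ 4) :: real ^ 4 \<Rightarrow> _)" by (rule linearI) simp_all
  ultimately have "?vs @ ?cs \<in> orient_class (map (Pair 0) vs)" unfolding orient_class_map_linear[OF lP] by force
  then have hsA: "hs' @ ?vs @ ?cs \<in> orient_class (hs' @ map (Pair 0) vs)" by (intro orient_class_append orient_class_refl)
  have vb: "basis_list vs UNIV" using det4_nonzero_basis_list vs by simp
  have "(0, q) \<in> span (set (map (Pair (0 :: real ^ 4)) vs))" for q
    using linear_span_image[OF lP, of "set vs"] vb by (auto simp: basis_list_def)
  moreover have "(a, x) - h = (0, x - snd h)" if "a = fst h" for a x and h :: "(real ^ 4) \<times> (real ^ 4)"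
    using that by (simp add: prod_eq_iff)
  ultimately have sh: "\<forall>i<length hs. hs' ! i - hs ! i \<in> span (set (map (Pair 0) vs))"
    by (simp add: hs'_def)
  have "hs' @ map (Pair 0) vs \<in> orient_class (hs @ map (Pair 0) vs)"
    by (rule orient_class_shear_left) (use sh hs'(3) in auto)
  from hsA this have XC: "hs' @ ?vs @ ?cs \<in> orient_class (hs @ map (Pair 0) vs)" by (rule orient_class_trans)
  have "bs @ ?cs \<in> orient_class (bs @ [e1, e2])"
  proof (rule orient_class_shear_right)
    have "Db ((0, q1) - e1) = 0" "Db ((0, q2) - e2) = 0" using q1 q2 by (simp_all only: linear_diff[OF lin] diff_self)
    then show "\<forall>i<length [e1, e2]. ?cs ! i - [e1, e2] ! i \<in> span (set bs)"
      using bs by (auto simp: basis_list_def less_Suc_eq)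
  qed simp
  then have bc: "bs @ ?cs \<in> orient_class (hs @ map (Pair 0) vs)" using o by (rule orient_class_trans)
  have X: "basis_list (hs' @ ?vs) {e. Db e = 0}" by (rule kernel_basis[OF hs'(1,2)])
  have "bs \<in> orient_class (hs' @ ?vs)"
  proof (rule ccontr)
    \<comment> \<open>Otherwise the reversed list is positive in the kernel, and appending the same
      normal vectors puts a list and its reversal into one orientation class of the total
      space.\<close>
    assume "bs \<notin> orient_class (hs' @ ?vs)"
    then have fl: "flip_head bs \<in> orient_class (hs' @ ?vs)" using orient_class_dichotomy[OF X bs] by simp
    have ne: "bs \<noteq> []" using basis_list_length[OF X bs] by auto
    have "flip_head bs @ ?cs \<in> orient_class ((hs' @ ?vs) @ ?cs)" by (intro orient_class_append fl orient_class_refl)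
    then have "flip_head (bs @ ?cs) \<in> orient_class (hs @ map (Pair 0) vs)"
      using XC orient_class_trans ne by (auto simp: flip_head_def)
    moreover have "distinct (hs @ map (Pair 0) vs)" "independent (set (hs @ map (Pair 0) vs))"
      using total_basis[OF hs vb] unfolding basis_list_def by blast+
    moreover have "hs @ map (Pair 0) vs \<noteq> []" using vs(1) by auto
    ultimately show False using orient_class_exclusive bc by blast
  qed
  then show "bs \<in> oK" unfolding oK_def using hs'(1,2) orient_class_refl by blast
next
  fix bs assume "bs \<in> oK"
  then obtain hs vs where hs: "\<forall>h\<in>set hs. Db h = 0" "map fst hs \<in> OM" and vs: "vs \<in> orient_class [(0, k1), (0, - k2)]" and bs: "bs \<in> orient_class (hs @ vs)"
    unfolding oK_def by blast
  let ?vs = "[(0 :: real ^ 4, k1), (0, - k2)]"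
  have "hs @ vs \<in> orient_class (hs @ ?vs)" by (intro orient_class_append vs orient_class_refl)
  then have bX: "bs \<in> orient_class (hs @ ?vs)" using bs orient_class_trans by blast
  then have "basis_list bs {e. Db e = 0}" using orient_class_basis_list[OF kernel_basis[OF hs]] by blast
  \<comment> \<open>Vertical vectors with the values 1 and \<i> provide a positively oriented
    complement.\<close>
  moreover obtain q1 where q1: "Db (0, q1) = 1" using lift[of 0 1] by blast
  moreover obtain q2 where q2: "Db (0, q2) = \<i>" using lift[of 0 \<i>] by blast
  moreover have cr: "cross2 (Db (0, q1)) (Db (0, q2)) > 0" unfolding q1 q2 by (simp add: cross2_def)
  moreover have "bs @ [(0, q1), (0, q2)] \<in> orient_class ((hs @ ?vs) @ [(0, q1), (0, q2)])"
    by (intro orient_class_append bX orient_class_refl)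
  then have "bs @ [(0, q1), (0, q2)] \<in> orient_class (hs @ map (Pair 0) [k1, - k2, q1, q2])" by simp
  then have "bs @ [(0, q1), (0, q2)] \<in> oN" unfolding oN_def using hs(2) det4_frame_neg[OF cr]
    by (intro CollectI exI[of _ hs] exI[of _ "[k1, - k2, q1, q2]"]) simp
  ultimately show "bs \<in> {bs. basis_list bs {e. Db e = 0} \<and> (\<exists>e1 e2. cross2 (Db e1) (Db e2) > 0 \<and> bs @ [e1, e2] \<in> oN)}" by blast
qed

end

text \<open>Otherwise J w = z + d w with z in the complex line of u and d real; applying J once more
  places (1 + d^2) w in that J-invariant line.\<close>

lemma (in spinor_fibre) line_complement:
  assumes "u \<in> TT" "w \<in> TT" "w \<notin> span {u, J u}"
  shows "J w \<notin> span {u, e *\<^sub>R J u, w}"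
proof
  assume "J w \<in> span {u, e *\<^sub>R J u, w}"
  then obtain d where "J w - d *\<^sub>R w \<in> span {u, e *\<^sub>R J u}"
    using span_insert[of w "{u, e *\<^sub>R J u}"] by (simp add: insert_commute[of w]) blast
  then obtain a b where "J w - d *\<^sub>R w = a *\<^sub>R u + b *\<^sub>R e *\<^sub>R J u" unfolding span_pair by blast
  then have Jw: "J w = a *\<^sub>R u + (b * e) *\<^sub>R J u + d *\<^sub>R w" by (simp add: diff_eq_eq)
  have m: "J u \<in> TT" by (rule Tmem(6)[OF assms(1)])
  have "J (J w) = J (a *\<^sub>R u + (b * e) *\<^sub>R J u) + J (d *\<^sub>R w)"
    unfolding Jw by (rule J_lin(2)) (intro Tmem assms(1,2))+
  also have "\<dots> = a *\<^sub>R J u + (b * e) *\<^sub>R J (J u) + d *\<^sub>R J w" by (simp only: J_lin(1)[OF assms(1) m] J_lin(3)[OF assms(2)])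
  also have "\<dots> = a *\<^sub>R J u - (b * e) *\<^sub>R u + d *\<^sub>R (a *\<^sub>R u + (b * e) *\<^sub>R J u + d *\<^sub>R w)"
    unfolding JJ[OF assms(1)] by (subst Jw) simp
  finally have "- w = a *\<^sub>R J u - (b * e) *\<^sub>R u + d *\<^sub>R (a *\<^sub>R u + (b * e) *\<^sub>R J u + d *\<^sub>R w)" unfolding JJ[OF assms(2)] .
  then have "(1 + d * d) *\<^sub>R w = (b * e - d * a) *\<^sub>R u + (- a - d * (b * e)) *\<^sub>R J u"
    by (simp add: algebra_simps)
  moreover have "(b * e - d * a) *\<^sub>R u + (- a - d * (b * e)) *\<^sub>R J u \<in> span {u, J u}" unfolding span_pair by blast
  ultimately have "(1 / (1 + d * d)) *\<^sub>R (1 + d * d) *\<^sub>R w \<in> span {u, J u}" using span_scale by metis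
  moreover have "1 + d * d \<noteq> 0" using zero_le_square[of d] by linarith
  ultimately show False using assms(3) by simp
qed

text \<open>At a zero of \<open>f\<close> the term with the derivative of \<open>h\<close> drops
  out, so \<open>h\<close> enters only through its value there.\<close>

lemma has_derivative_mult_zero:
  fixes f h :: "'e::real_normed_vector \<Rightarrow> complex"
  assumes "(f has_derivative D) (at p)" "f p = 0" "h differentiable (at p)"
  shows "((\<lambda>x. h x * f x) has_derivative (\<lambda>e. h p * D e)) (at p)"
proof -
  obtain D' where "(h has_derivative D') (at p)" using assms(3) unfolding differentiable_def by blast
  from has_derivative_mult[OF this assms(1)] show ?thesis by (simp add: assms(2))
qed

lemma basis_list_map_iff:
  assumes f: "linear f" "inj f"
  shows "basis_list (map f as) (f ` V) \<longleftrightarrow> basis_list as V"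
proof
  assume b: "basis_list (map f as) (f ` V)"
  have "\<forall>j<length as. k j = 0" if "(\<Sum>j<length as. k j *\<^sub>R as ! j) = 0" for k
  proof -
    have "(\<Sum>j<length (map f as). k j *\<^sub>R map f as ! j) = 0"
      using arg_cong[OF that, of f] by (simp add: linear_sum[OF f(1)] linear_cmul[OF f(1)] linear_0[OF f(1)])
    moreover have "\<forall>c. (\<Sum>j<length (map f as). c j *\<^sub>R map f as ! j) = 0 \<longrightarrow> (\<forall>j<length (map f as). c j = 0)"
      using independent_list_iff[of "map f as"] b by (simp only: basis_list_def simp_thms)
    ultimately show ?thesis by simp
  qed
  then have "distinct as \<and> independent (set as)" using independent_list_iff[of as] by blast
  moreover have "f ` span (set as) = f ` V"
    using b linear_span_image[OF f(1), of "set as"] by (simp add: basis_list_def)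
  ultimately show "basis_list as V" using inj_image_eq_iff[OF f(2)] by (simp add: basis_list_def)
qed (rule basis_list_map[OF f])

text \<open>The vector 1 is a complex basis, and \<open>cross2\<close> is the determinant relative
  to (1, \<i>).\<close>

lemma fibre_orientation_iff:
  "ws \<in> (fibre_orientation :: (complex ^ 1) list set) \<longleftrightarrow> (\<exists>a b. ws = [a, b] \<and> cross2 (a $ 1) (b $ 1) > 0)"
proof -
  let ?one = "1 :: complex ^ 1"
  have e: "z = Re (z $ 1) *\<^sub>R ?one + Im (z $ 1) *\<^sub>R (\<i> *s ?one)" for z :: "complex ^ 1"
    by (simp add: vec_eq_iff complex_eq_iff)
  have co: "(fibre_orientation :: (complex ^ 1) list set) = orient_class [id ?one, id (\<i> *s ?one)]"
    unfolding fibre_orientation_def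
  proof (rule complex_orientation_line)
    show "basis_list [id ?one, id (\<i> *s ?one)] UNIV"
      unfolding basis_list_pair id_apply conj_assoc[symmetric] independent_pair
    proof
      show "\<forall>a b. a *\<^sub>R ?one + b *\<^sub>R (\<i> *s ?one) = 0 \<longrightarrow> a = 0 \<and> b = 0" by (simp add: vec_eq_iff complex_eq_iff)
      show "span {?one, \<i> *s ?one} = UNIV" using e unfolding span_pair by blast
    qed
    fix b :: "complex ^ 1"
    show "\<exists>p q. id b = p *\<^sub>R id ?one + q *\<^sub>R id (\<i> *s ?one) \<and> id (\<i> *s b) = - q *\<^sub>R id ?one + p *\<^sub>R id (\<i> *s ?one)"
      by (rule exI[of _ "Re (b $ 1)"], rule exI[of _ "Im (b $ 1)"]) (simp add: vec_eq_iff complex_eq_iff)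
  qed simp
  show ?thesis
  proof
    assume "ws \<in> (fibre_orientation :: (complex ^ 1) list set)"
    then obtain p q r s where "ws = [p *\<^sub>R ?one + q *\<^sub>R (\<i> *s ?one), r *\<^sub>R ?one + s *\<^sub>R (\<i> *s ?one)]" "p * s - q * r > 0"
      unfolding co id_apply orient_class_pair by blast
    then show "\<exists>a b. ws = [a, b] \<and> cross2 (a $ 1) (b $ 1) > 0" by (simp add: cross2_def)
  next
    assume "\<exists>a b. ws = [a, b] \<and> cross2 (a $ 1) (b $ 1) > 0"
    then obtain a b where "ws = [a, b]" "cross2 (a $ 1) (b $ 1) > 0" by blast
    then show "ws \<in> (fibre_orientation :: (complex ^ 1) list set)"
      unfolding co id_apply orient_class_pair cross2_def using e[of a] e[of b] by blast
  qed
qed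

lemma map_range: "set hs \<subseteq> f ` A \<Longrightarrow> \<exists>hs'. set hs' \<subseteq> A \<and> hs = map f hs'"
  by (induction hs) (auto, metis insert_subset list.simps(15) list.simps(9))

section \<open>First-order behaviour at a zero\<close>

text \<open>Near a zero \<open>x\<close> of the \<open>\<eta>\<close>-component of \<open>\<psi>\<close> the chart of \<open>M\<close> is fixed, and the basis
  \<open>(u, \<epsilon> J u, w, J w)\<close> makes \<open>x\<close> the point with fibre coordinate \<open>0\<close> of the chart \<open>C\<close>.\<close>

locale zero_point = spin_setting M J g S \<psi>
  for M :: "('a, real ^ 4) manifold"
    and J :: "'a \<Rightarrow> ('a, real ^ 4) tangent \<Rightarrow> ('a, real ^ 4) tangent"
    and g :: "'a \<Rightarrow> ('a, real ^ 4) tangent \<Rightarrow> ('a, real ^ 4) tangent \<Rightarrow> real"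
    and S :: "('a, real ^ 4, 's::complex_vector, 't::complex_vector, 'k::complex_vector) spinc"
    and \<psi> :: "'a \<Rightarrow> 's" +
  fixes \<eta> :: real and y c u w W \<xi>
  assumes eta: "\<eta> = 1 \<or> \<eta> = -1" and c: "c \<in> M" "y \<in> fst c"
    and u: "u \<in> tangent_space M y" "u \<noteq> 0"
    and w: "w \<in> tangent_space M y" "w \<notin> span {u, J y u}"
    and W: "is_frame W \<xi>" "y \<in> W"
begin

abbreviation "TT \<equiv> tangent_space M y"
abbreviation "\<epsilon> \<equiv> - \<eta>"
abbreviation "z0 \<equiv> snd c y"
abbreviation "tM \<equiv> tvec M y c"
definition v where "v = \<epsilon> *\<^sub>R J y u"
definition B where "B = [u c, v c, w c, J y w c]"
abbreviation "C \<equiv> plane_chart M c B"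
definition x where "x = (y, orient_class [u, v])"
abbreviation "tN \<equiv> tvec N x C"
abbreviation "K \<equiv> line_planes M J (Qf \<eta>)"
definition fu where "fu p = tvec M (chart_inv c (fst p)) c (bcomb B (graph_fst (snd p)))"
definition fv where "fv p = tvec M (chart_inv c (fst p)) c (bcomb B (graph_snd (snd p)))"
text \<open>The form \<beta> on the graph basis, as a function of the coordinates of
  \<open>C\<close>. It depends on the bases chosen, but up to a nonvanishing factor it is the
  intrinsic coefficient \<open>c2\<close>.\<close>

definition bt where "bt p = beta \<xi> (chart_inv c (fst p)) (fu p) (fv p)"
definition Db where "Db = frechet_derivative bt (at (z0, 0))"
definition b0 where "b0 = beta \<xi> y u w"
abbreviation "D \<equiv> snd c ` (fst c \<inter> W) \<times> (UNIV :: (real ^ 4) set)"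

lemma eps: "\<epsilon> = 1 \<or> \<epsilon> = -1" "\<epsilon> \<noteq> 0" "\<epsilon> * \<epsilon> = 1" using eta by auto
lemma yM: "y \<in> points M" using in_points[OF c] .
lemma F: "spinor_frame (geometry_at S y) TT (clifford S y) (J y) (g y) (\<psi> y) (\<xi> y)" by (rule frameD(4)[OF W])
lemma G: "spinor_fibre (geometry_at S y) TT (clifford S y) (J y) (g y) (\<psi> y)" by (rule spinor_fibre_at[OF yM])

lemma J_mem: "a \<in> TT \<Longrightarrow> J y a \<in> TT" by (rule spinor_fibre.Tmem(6)[OF G])
lemma JJ: "a \<in> TT \<Longrightarrow> J y (J y a) = - a" by (rule spinor_fibre.JJ[OF G])
lemma v_mem: "v \<in> TT" unfolding v_def using spinor_fibre.Tmem(2)[OF G J_mem[OF u(1)]] .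
lemma Jv: "J y v = - \<epsilon> *\<^sub>R u"
  unfolding v_def spinor_fibre.J_lin(3)[OF G J_mem[OF u(1)]] JJ[OF u(1)] by simp
lemma Ju: "J y u = \<epsilon> *\<^sub>R v" unfolding v_def using eps(3) by simp
lemma tM: "a \<in> TT \<Longrightarrow> tM (a c) = a" using tangent_vector_tvec[OF Ma c] by simp
lemma uv: "u \<noteq> v" "independent {u, v}" using spinor_fibre.J_independent[OF G u eps(2)] by (auto simp: v_def)
lemma linear_tM: "linear tM" by (rule linear_tvec[OF Ma c])
lemma inj_tM: "inj tM" by (rule inj_tvec[OF Ma c])

lemma basis_B: "basis_list B UNIV"
proof -
  note lin = linear_add[OF linear_tM] linear_cmul[OF linear_tM]
  note mem = u(1) v_mem w(1) J_mem[OF w(1)]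
  have 1: "u c \<noteq> v c \<and> independent {u c, v c}"
    using linear_inj_independent_pair[OF linear_tM inj_tM, of "u c" "v c"] uv by (simp add: tM mem)
  have 2: "w c \<notin> span {u c, v c}"
  proof
    assume "w c \<in> span {u c, v c}"
    then have "tM (w c) \<in> span (tM ` {u c, v c})" using linear_span_image[OF linear_tM] by blast
    then have "w \<in> span {u, v}" by (simp add: tM mem)
    moreover have "span {u, v} \<subseteq> span {u, J y u}"
      unfolding v_def by (rule span_minimal) (use span_scale[OF span_base[of "J y u" "{u, J y u}"], of \<epsilon>] in \<open>simp_all add: span_base\<close>)
    ultimately show False using w(2) by blast
  qed
  have 3: "J y w c \<notin> span {u c, v c, w c}"
  proof
    assume "J y w c \<in> span {u c, v c, w c}"
    then have "tM (J y w c) \<in> span (tM ` {u c, v c, w c})" using linear_span_image[OF linear_tM] by blast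
    then have "J y w \<in> span {u, v, w}" by (simp add: tM mem)
    then show False using spinor_fibre.line_complement[OF G u(1) w, of \<epsilon>] by (simp add: v_def)
  qed
  show ?thesis unfolding B_def by (rule basis_list4I[OF _ _ 2 3]) (use 1 in auto)
qed

lemma bcoord_B: "bcoord B (u c) = vec4 1 0 0 0" "bcoord B (v c) = vec4 0 1 0 0"
    "bcoord B (w c) = vec4 0 0 1 0" "bcoord B (J y w c) = vec4 0 0 0 1"
  using bcoord_basis[OF basis_B] by (simp_all add: B_def)

lemma x_frame: "x = frame_point M y c (u c) (v c)"
  by (simp add: x_def frame_point_def tM u(1) v_mem)

lemma x_chart: "x \<in> fst C" "snd C x = (z0, 0)"
proof -
  have m: "plane_minor (bcoord B (u c)) (bcoord B (v c)) > 0" by (simp add: bcoord_B plane_minor_def)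
  show "x \<in> fst C" unfolding x_frame using frame_point_in_chart[OF Ma c basis_B] m by blast
  show "snd C x = (z0, 0)" unfolding x_frame frame_point_coords[OF Ma c basis_B m]
    by (simp add: bcoord_B plane_coords_def plane_minor_def vec4_eq_iff)
qed

lemma C: "C \<in> N" by (rule plane_bundleI[OF Ma c(1) basis_B])
lemma xN: "x \<in> points N" by (rule in_points[OF C x_chart(1)])
lemma linear_tN: "linear tN" by (rule linear_tvec[OF Na C x_chart(1)])
lemma inj_tN: "inj tN" using tvec_inj[OF Na C x_chart(1)] by (simp add: inj_def)
lemma tangent_N: "tangent_space N x = range tN" by (rule tangent_space_eq[OF Na C x_chart(1)])
lemma xK: "x \<in> K"
  unfolding line_planes_iff[OF eta] using u yM by (auto simp: x_def v_def)
lemma z0_in: "z0 \<in> snd c ` fst c" "(z0, 0) \<in> D" using c W by auto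
lemma chart_z0: "chart_inv c z0 = y" by (rule chart_inv_left[OF Ma c])

lemma open_D: "open D" and smooth_bt: "smooth_on D bt"
  and smooth_grm: "smooth_on D (\<lambda>p. grm \<xi> (chart_inv c (fst p)) (fu p) (fv p))"
  and grm_pos: "p \<in> D \<Longrightarrow> grm \<xi> (chart_inv c (fst p)) (fu p) (fv p) > 0"
proof -
  note s = smooth_forms_chart[OF W(1) c(1) basis_B, folded fu_def fv_def]
  show o: "open D" by (rule s(1))
  show b: "smooth_on D bt" unfolding bt_def[abs_def] by (rule s(3))
  show "p \<in> D \<Longrightarrow> grm \<xi> (chart_inv c (fst p)) (fu p) (fv p) > 0" by (rule s(6))
  show "smooth_on D (\<lambda>p. grm \<xi> (chart_inv c (fst p)) (fu p) (fv p))"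
    unfolding grm_def power2_norm_eq_inner bt_def[symmetric]
    unfolding power2_eq_square
    by (intro smooth_on_add[OF o] smooth_on_mult[OF o] smooth_on_bilinear[OF o bounded_bilinear_inner] b s(2))
qed

lemma Db: "(bt has_derivative Db) (at (z0, 0))"
  unfolding Db_def by (rule smooth_on_has_derivative[OF smooth_bt z0_in(2)])
lemma linear_Db: "linear Db" using has_derivative_linear[OF Db] .

text \<open>If \<beta>(u, w) vanished, \<open>be_zero_imp\<close> would place \<open>w\<close> in
  the complex line of \<open>u\<close>.\<close>

lemma b0: "b0 \<noteq> 0"
proof
  interpret F: spinor_frame "geometry_at S y" TT "clifford S y" "J y" "g y" "\<psi> y" "\<xi> y" by (rule F)
  assume z: "b0 = 0"
  have "u \<noteq> w \<and> independent {u, w}"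
    unfolding independent_pair
  proof (intro allI impI)
    fix a b assume e: "a *\<^sub>R u + b *\<^sub>R w = 0"
    have "b = 0"
    proof (rule ccontr)
      assume b: "b \<noteq> 0"
      have "b *\<^sub>R w = - (a *\<^sub>R u)" using e by (simp add: eq_neg_iff_add_eq_0 add.commute)
      moreover have "- (a *\<^sub>R u) \<in> span {u, J y u}" by (intro span_neg span_scale span_base) simp
      ultimately have "(1 / b) *\<^sub>R b *\<^sub>R w \<in> span {u, J y u}" using span_scale by metis
      then show False using w(2) b by simp
    qed
    then show "a = 0 \<and> b = 0" using e u(2) by simp
  qed
  moreover have "F.be u w = 0" using z by (simp add: b0_def frame_consts[where y=y and \<xi>=\<xi>, OF F])
  ultimately have "g y u u *\<^sub>R w = g y u w *\<^sub>R u + F.om u w *\<^sub>R J y u"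
    using F.be_zero_imp[OF u(1) w(1)] by blast
  then have "g y u u *\<^sub>R w \<in> span {u, J y u}" unfolding span_pair by blast
  then have "(1 / g y u u) *\<^sub>R g y u u *\<^sub>R w \<in> span {u, J y u}" by (rule span_scale)
  then show False using w(2) F.gpos[OF u] by simp
qed

text \<open>Along a ray in the fibre \<beta> is a quadratic polynomial in t. Its constant term is
  \<beta>(u, \<epsilon> J u) = 0, and complex bilinearity with alternation expresses the linear term
  through \<beta>(u, w).\<close>

lemma bt_line:
  "bt (z0, t *\<^sub>R q) = complex_of_real t * (b0 * Complex (q $ 3 + \<epsilon> * q $ 2) (q $ 4 - \<epsilon> * q $ 1)) +
     complex_of_real (t * t) * beta \<xi> y (q $ 1 *\<^sub>R w + q $ 2 *\<^sub>R J y w) (q $ 3 *\<^sub>R w + q $ 4 *\<^sub>R J y w)"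
proof -
  interpret F: spinor_frame "geometry_at S y" TT "clifford S y" "J y" "g y" "\<psi> y" "\<xi> y" by (rule F)
  note cs = frame_consts[where y=y and \<xi>=\<xi>, OF F]
  note lin = linear_add[OF linear_tM] linear_cmul[OF linear_tM]
  note mem = u(1) v_mem w(1) J_mem[OF w(1)]
  let ?a = "q $ 1 *\<^sub>R w + q $ 2 *\<^sub>R J y w" and ?b = "q $ 3 *\<^sub>R w + q $ 4 *\<^sub>R J y w"
  have f: "fu (z0, t *\<^sub>R q) = 1 *\<^sub>R u + t *\<^sub>R ?a" "fv (z0, t *\<^sub>R q) = 1 *\<^sub>R v + t *\<^sub>R ?b"
    by (simp_all add: fu_def fv_def chart_z0 bcomb_def B_def graph_fst_def graph_snd_def lin tM mem algebra_simps)
  have ab: "?a \<in> TT" "?b \<in> TT" by (intro F.Tmem mem)+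
  have b: "1 *\<^sub>R v + t *\<^sub>R ?b \<in> TT" by (intro F.Tmem mem)
  have be: "F.be u v = 0" "F.be u w = b0" "F.be u (J y w) = \<i> * b0" "F.be w v = - \<epsilon> * \<i> * b0" "F.be (J y w) v = \<epsilon> * b0"
  proof -
    have l: "F.be a v = \<epsilon> * F.be a (J y u)" if "a \<in> TT" for a
      using F.be_lin(1)[OF J_mem[OF u(1)] J_mem[OF u(1)] that, of \<epsilon> 0] by (simp add: v_def)
    show "F.be u v = 0" using l[OF u(1)] F.be_J(1)[OF u(1) u(1)] F.be_self[OF u(1)] by simp
    show b: "F.be u w = b0" by (simp add: b0_def cs)
    show "F.be u (J y w) = \<i> * b0" using F.be_J(1)[OF u(1) w(1)] b by simp
    have wv: "F.be w v = - \<epsilon> * \<i> * b0" using l[OF w(1)] F.be_J(1)[OF w(1) u(1)] F.be_alt[OF u(1) w(1)] b by simp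
    then show "F.be w v = - \<epsilon> * \<i> * b0" .
    show "F.be (J y w) v = \<epsilon> * b0" unfolding F.be_J(2)[OF w(1) v_mem] wv by (simp add: complex_eq_iff)
  qed
  have "bt (z0, t *\<^sub>R q) = F.be (1 *\<^sub>R u + t *\<^sub>R ?a) (1 *\<^sub>R v + t *\<^sub>R ?b)"
    by (simp only: bt_def f cs fst_conv chart_z0)
  also have "\<dots> = F.be u v + t * F.be u ?b + t * (F.be ?a v + t * F.be ?a ?b)"
    unfolding F.be_lin(2)[OF u(1) ab(1) b] F.be_lin(1)[OF v_mem ab(2) u(1)] F.be_lin(1)[OF v_mem ab(2) ab(1)] by simp
  also have "\<dots> = t * (q $ 3 * b0 + q $ 4 * (\<i> * b0)) + t * (q $ 1 * (- \<epsilon> * \<i> * b0) + q $ 2 * (\<epsilon> * b0)) + t * t * F.be ?a ?b"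
    unfolding F.be_lin(1)[OF w(1) J_mem[OF w(1)] u(1)] F.be_lin(2)[OF w(1) J_mem[OF w(1)] v_mem] be
    by (simp add: distrib_left)
  finally show ?thesis unfolding cs by (simp add: Complex_eq algebra_simps)
qed

lemma Db_vertical: "Db (0, q) = b0 * Complex (q $ 3 + \<epsilon> * q $ 2) (q $ 4 - \<epsilon> * q $ 1)" (is "_ = ?L")
proof -
  let ?Q = "beta \<xi> y (q $ 1 *\<^sub>R w + q $ 2 *\<^sub>R J y w) (q $ 3 *\<^sub>R w + q $ 4 *\<^sub>R J y w)"
  have "((\<lambda>t. (z0, t *\<^sub>R q)) has_vector_derivative (0, q)) (at 0)"
    by (auto intro!: derivative_eq_intros)
  moreover have "(bt has_derivative Db) (at (z0, 0 *\<^sub>R q))" using Db by simp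
  ultimately have "((\<lambda>t. bt (z0, t *\<^sub>R q)) has_vector_derivative Db (0, q)) (at 0)"
    by (rule has_vector_derivative_chain)
  moreover have "((\<lambda>t. bt (z0, t *\<^sub>R q)) has_vector_derivative ?L) (at 0)"
    unfolding bt_line by (auto intro!: derivative_eq_intros)
  ultimately show ?thesis by (rule vector_derivative_unique_at)
qed

lemma bt_z0: "bt (z0, 0) = 0" using bt_line[of 0 0] by simp

lemma coef2_bt: "coef2 \<xi> \<eta> (chart_inv c (fst p)) (fu p) (fv p) =
    - \<i> * complex_of_real \<eta> * bt p / (2 * sqrt (grm \<xi> (chart_inv c (fst p)) (fu p) (fv p)))"
  by (simp add: coef2_def bt_def)

lemma c2_bt: "p \<in> D \<Longrightarrow> c2 \<xi> \<eta> (chart_inv C p) = - \<i> * complex_of_real \<eta> * bt p / (2 * sqrt (grm \<xi> (chart_inv c (fst p)) (fu p) (fv p)))"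
  using c_chart(2)[OF W(1) eta c(1) basis_B, of p, folded fu_def fv_def] by (simp add: coef2_bt)

lemma over_chart: "snd C ` (fst C \<inter> over W) = D" by (rule plane_chart_image_over[OF Ma c(1) basis_B])

lemma bt_zero:
  assumes "p \<in> D" "chart_inv C p \<in> K" shows "bt p = 0"
proof -
  have o: "chart_inv C p \<in> over W" using assms(1) chart_inv_left[OF Na C] unfolding over_chart[symmetric] by auto
  then have f: "fst (chart_inv C p) \<in> W" by simp
  interpret F: spinor_frame "geometry_at S (fst (chart_inv C p))" "tangent_space M (fst (chart_inv C p))" "clifford S (fst (chart_inv C p))"
    "J (fst (chart_inv C p))" "g (fst (chart_inv C p))" "\<psi> (fst (chart_inv C p))" "\<xi> (fst (chart_inv C p))" by (rule frameD(4)[OF W(1) f])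
  have "ecomp \<eta> \<psi> (chart_inv C p) = 0" using assms(2) zero_set_ecomp[OF eta] by (auto simp: zero_set_def)
  then have "c2 \<xi> \<eta> (chart_inv C p) = 0"
    using ecomp_frame(2)[OF W(1) o eta] F.frame_inj[of "c1 \<eta> (chart_inv C p)" "c2 \<xi> \<eta> (chart_inv C p)" 0 0] by simp
  then show ?thesis using c2_bt[OF assms(1)] eta grm_pos[OF assms(1)] by auto
qed

text \<open>The \<eta>-component of \<xi> generates the line near \<open>x\<close>, where
  \<open>c1 (- \<eta>)\<close> takes the value 1. Relating it and the \<eta>-component of \<psi>
  within one trivialization shows the section to be a smooth factor \<open>H\<close> times
  \<open>bt\<close>. Since \<open>bt\<close> vanishes at the zero, the derivative there is the value
  of \<open>H\<close>, which is \<kappa>, times \<open>Db\<close>.\<close>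

lemma section_derivative:
  assumes t: "(V, t) \<in> trivs (line_subbundle N E' (eigen \<eta>))" and V: "x \<in> V"
  obtains \<kappa> where "\<kappa> \<noteq> 0" "\<And>e. deriv_along N (\<lambda>z. t z (ecomp \<eta> \<psi> z)) x (tN e) = (\<chi> i. \<kappa> * Db e)"
proof -
  have m: "- \<eta> = 1 \<or> - \<eta> = -1" using eta by auto
  note T = line_subbundle_trivD[OF Na vbE t]
  \<comment> \<open>The local frame that the trivialization sends to 1; \<open>k\<close> and
    \<open>r\<close> are the coefficients of the two components relative to it.\<close>
  define e where "e z = inv_into (eigen \<eta> z) (t z) 1" for z
  define O' where "O' = {z \<in> V \<inter> over W. c1 (- \<eta>) z \<in> - {0}}"
  have VW: "open_in N (V \<inter> over W)" by (rule open_in_Int[OF Na T(1) open_over[OF W(1)]])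
  have O: "open_in N O'" unfolding O'_def
    by (rule open_in_smooth_preimage[OF Na VW smooth_fun_subset[OF smooth_c(1)[OF W(1) m]]]) auto
  have Osub: "z \<in> V" "z \<in> over W" "z \<in> points N" "c1 (- \<eta>) z \<noteq> 0" if "z \<in> O'" for z using that by (auto simp: O'_def)
  have xW: "x \<in> over W" using xN W(2) by (simp add: x_def)
  have zx: "ecomp \<eta> \<psi> x = 0" using xK zero_set_ecomp[OF eta] by (auto simp: zero_set_def)
  have c1x: "c1 (- \<eta>) x = 1" using ecomp_frame(6)[OF W(1) xW eta] ecomp_frame(7)[OF W(1) xW eta zx] by simp
  have xO: "x \<in> O'" using V xW c1x by (simp add: O'_def)
  define k where "k z = t z (ecomp \<eta> \<xi> z) $ 1" for z
  define r where "r z = t z (ecomp \<eta> \<psi> z) $ 1" for z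
  have cf: "ecomp \<eta> \<xi> z = k z *\<^sub>C e z" "ecomp \<eta> \<psi> z = r z *\<^sub>C e z" "e z \<noteq> 0" if z: "z \<in> O'" for z
    unfolding k_def r_def e_def
    using line_triv_coefficient[OF Na vbE T(2) Osub(1)[OF z] _ eigen_csubspace[OF eta Osub(3)[OF z]]]
      ecomp_frame(4,5)[OF W(1) Osub(2)[OF z] eta] by blast+
  have e: "smooth_section N E' O' e" unfolding e_def[abs_def] by (rule smooth_section_subset[OF T(3)]) (auto simp: O'_def)
  have sk: "smooth_fun N O' k"
    by (rule smooth_coefficient[OF Na vbE O e smooth_section_subset[OF ecomp_sections(2)[OF W(1) eta]]]) (use cf in \<open>auto simp: O'_def\<close>)
  have k0: "k z \<noteq> 0" if "z \<in> O'" for z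
    using cf(1)[OF that] ecomp_frame(8)[OF W(1) Osub(2)[OF that] eta] Osub(4)[OF that] by (auto simp: cvec_algebra)
  have rk: "r z = k z / c1 (- \<eta>) z * c2 \<xi> \<eta> z" if z: "z \<in> O'" for z
  proof -
    have f: "fst z \<in> W" using Osub(2)[OF z] by simp
    interpret F: spinor_frame "geometry_at S (fst z)" "tangent_space M (fst z)" "clifford S (fst z)"
      "J (fst z)" "g (fst z)" "\<psi> (fst z)" "\<xi> (fst z)" by (rule frameD(4)[OF W(1) f])
    \<comment> \<open>Both components lie on one line; comparing \<xi>-coefficients determines the
      quotient of \<open>r\<close> and \<open>k\<close>.\<close>
    have "k z *\<^sub>C ecomp \<eta> \<psi> z = r z *\<^sub>C ecomp \<eta> \<xi> z" using cf(1,2)[OF z] by (simp add: scaleC_scaleC mult.commute)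
    then have "k z *\<^sub>C (c1 \<eta> z *\<^sub>C \<psi> (fst z) + c2 \<xi> \<eta> z *\<^sub>C \<xi> (fst z)) =
        r z *\<^sub>C (- cnj (c2 \<xi> (- \<eta>) z) *\<^sub>C \<psi> (fst z) + c1 (- \<eta>) z *\<^sub>C \<xi> (fst z))"
      unfolding ecomp_frame(2,3)[OF W(1) Osub(2)[OF z] eta] .
    then have "k z * c2 \<xi> \<eta> z = r z * c1 (- \<eta>) z"
      unfolding scaleC_right_distrib scaleC_scaleC F.frame_inj by blast
    then show ?thesis using Osub(4)[OF z] by (simp add: field_simps)
  qed
  let ?D = "snd C ` (fst C \<inter> O')"
  define H where "H p = k (chart_inv C p) / c1 (- \<eta>) (chart_inv C p) *
     ((- \<i> * complex_of_real \<eta>) / complex_of_real (2 * sqrt (grm \<xi> (chart_inv c (fst p)) (fu p) (fv p))))" for p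
  have oD: "open ?D" by (rule open_in_image[OF O C])
  have DD: "p \<in> D" "chart_inv C p \<in> O'" if p: "p \<in> ?D" for p
  proof -
    have "?D \<subseteq> snd C ` (fst C \<inter> over W)" using Osub(2) by blast
    then show "p \<in> D" using p unfolding over_chart by blast
    obtain z where z: "p = snd C z" "z \<in> fst C" "z \<in> O'" using p by blast
    show "chart_inv C p \<in> O'" unfolding z(1) chart_inv_left[OF Na C z(2)] by (rule z(3))
  qed
  have gp: "2 * sqrt (grm \<xi> (chart_inv c (fst p)) (fu p) (fv p)) > 0" if "p \<in> ?D" for p using grm_pos[OF DD(1)[OF that]] by simp
  have sg: "smooth_on ?D (\<lambda>p. complex_of_real (2 * sqrt (grm \<xi> (chart_inv c (fst p)) (fu p) (fv p))))"
  proof -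
    have l: "linear (\<lambda>r. complex_of_real (2 * r))" by (rule linearI) (simp_all add: scaleR_conv_of_real algebra_simps)
    show ?thesis
      by (rule smooth_on_linear[OF oD l smooth_on_sqrt[OF oD smooth_on_subset[OF smooth_grm]]]) (use DD grm_pos in blast)+
  qed
  have sH: "smooth_on ?D H"
    unfolding H_def[abs_def]
  proof (intro smooth_on_mult[OF oD] smooth_on_divide[OF oD] smooth_on_const sg smooth_funD[OF sk C])
    show "smooth_on ?D (\<lambda>p. c1 (- \<eta>) (chart_inv C p))"
      by (rule smooth_funD[OF smooth_fun_subset[OF smooth_c(1)[OF W(1) m]] C]) (auto simp: O'_def)
    show "c1 (- \<eta>) (chart_inv C p) \<noteq> 0" if "p \<in> ?D" for p by (rule Osub(4)[OF DD(2)[OF that]])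
    show "complex_of_real (2 * sqrt (grm \<xi> (chart_inv c (fst p)) (fu p) (fv p))) \<noteq> 0" if "p \<in> ?D" for p using gp[OF that] by auto
  qed
  have p0: "(z0, 0) \<in> ?D" using x_chart xO by force
  have rH: "r (chart_inv C p) = H p * bt p" if p: "p \<in> ?D" for p
    unfolding rk[OF DD(2)[OF p]] c2_bt[OF DD(1)[OF p]] H_def by simp
  have H0: "H (z0, 0) \<noteq> 0"
    unfolding H_def using k0[OF DD(2)[OF p0]] Osub(4)[OF DD(2)[OF p0]] gp[OF p0] eta by auto
  have "((\<lambda>p. H p * bt p) has_derivative (\<lambda>e. H (z0, 0) * Db e)) (at (z0, 0))"
    by (rule has_derivative_mult_zero[OF Db bt_z0 smooth_on_differentiable[OF sH p0]])
  then have "((\<lambda>p. r (chart_inv C p)) has_derivative (\<lambda>e. H (z0, 0) * Db e)) (at (z0, 0))"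
    by (rule has_derivative_transform_within_open[OF _ oD p0]) (simp add: rH)
  moreover have bl: "bounded_linear (\<lambda>z :: complex. (\<chi> i. z) :: complex ^ 1)"
    unfolding linear_conv_bounded_linear[symmetric] by (rule linearI) (simp_all add: vec_eq_iff)
  ultimately have "((\<lambda>p. (\<chi> i. r (chart_inv C p)) :: complex ^ 1) has_derivative (\<lambda>e. \<chi> i. H (z0, 0) * Db e)) (at (z0, 0))"
    using bounded_linear.has_derivative by blast
  moreover have "(\<chi> i. r z) = t z (ecomp \<eta> \<psi> z)" for z by (simp add: r_def vec_eq_iff)
  ultimately have "(((\<lambda>z. t z (ecomp \<eta> \<psi> z)) \<circ> chart_inv C) has_derivative (\<lambda>e. \<chi> i. H (z0, 0) * Db e)) (at (snd C x))"
    by (simp add: comp_def x_chart(2))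
  from that[OF H0 deriv_along_tvec[OF Na C x_chart(1) this]] show ?thesis .
qed

lemma core: "orientation_core Db {as. map tM as \<in> almost_complex_orientation M J y} \<epsilon> b0"
proof (rule orientation_core.intro, goal_cases)
  case 1 show ?case by (rule linear_Db)
next case 2 show ?case by (rule b0)
next case 3 show ?case by (rule eps(1))
next case (4 q) show ?case by (rule Db_vertical)
next
  case (5 as)
  then have b: "basis_list (map tM as) (tangent_space M y)"
    unfolding almost_complex_orientation_def complex_orientation_def using orient_class_basis_list by blast
  then show ?case using basis_list_map_iff[OF linear_tM inj_tM, of as UNIV] tangent_space_eq[OF Ma c] by simp
qed

text \<open>Vertical directions alone exhaust the fibre of the line bundle.\<close>

lemma transverse:
  "\<exists>(V, t)\<in>trivs (line_subbundle N E' (eigen \<eta>)). x \<in> V \<and>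
     deriv_along N (\<lambda>z. t z (ecomp \<eta> \<psi> z)) x ` tangent_space N x = UNIV"
proof -
  interpret O: orientation_core Db "{as. map tM as \<in> almost_complex_orientation M J y}" \<epsilon> b0 by (rule core)
  obtain V t where t: "(V, t) \<in> trivs (line_subbundle N E' (eigen \<eta>))" "x \<in> V"
    using vector_bundleD(4)[OF vector_bundle_eigen[OF eta] xN] by blast
  obtain \<kappa> where k: "\<kappa> \<noteq> 0" "\<And>e. deriv_along N (\<lambda>z. t z (ecomp \<eta> \<psi> z)) x (tN e) = (\<chi> i. \<kappa> * Db e)"
    by (rule section_derivative[OF t]) blast
  have "a \<in> deriv_along N (\<lambda>z. t z (ecomp \<eta> \<psi> z)) x ` tangent_space N x" for a
  proof -
    obtain q where "Db (0, q) = a $ 1 / \<kappa>" by (rule O.lift)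
    then have "deriv_along N (\<lambda>z. t z (ecomp \<eta> \<psi> z)) x (tN (0, q)) = a" using k by (simp add: vec_eq_iff)
    moreover have "tN (0, q) \<in> tangent_space N x" unfolding tangent_N by blast
    ultimately show ?thesis by (intro image_eqI) (rule sym)
  qed
  then have "deriv_along N (\<lambda>z. t z (ecomp \<eta> \<psi> z)) x ` tangent_space N x = UNIV" by (intro equalityI subset_UNIV subsetI)
  then show ?thesis using t by blast
qed

end

section \<open>Tangent and vertical spaces in coordinates\<close>

lemma underlying_pair: "underlying (orient_class [u, v]) = span {u, v}"
proof -
  have "(\<Union>bs\<in>orient_class [u, v]. set bs) \<subseteq> span {u, v}"
    unfolding orient_class_pair by (auto intro!: span_add span_scale intro: span_base)
  moreover have "[u, v] \<in> orient_class [u, v]" by (rule orient_class_refl)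
  then have "{u, v} \<subseteq> (\<Union>bs\<in>orient_class [u, v]. set bs)" by force
  ultimately show ?thesis unfolding underlying_def
    by (intro equalityI span_minimal subspace_span span_mono)
qed

context spinor_fibre
begin

lemma g_J_self: "z \<in> TT \<Longrightarrow> g z (J z) = 0"
  using gJ[of z "J z"] gsym[of "J z" z] by (simp add: JJ Tmem(6) g_lin(8))

text \<open>The pair (z, e J z) is orthogonal, of equal lengths and positively oriented. Any other
  candidate for the description is r z + s e J z, where orthogonality gives r = 0, equality of
  lengths s^2 = 1, and the orientation s > 0.\<close>

lemma rotation_plane:
  assumes u: "u \<in> TT" "u \<noteq> 0" and e: "e = 1 \<or> e = -1" and z: "z \<in> span {u, e *\<^sub>R J u}"
  shows "rotation g (orient_class [u, e *\<^sub>R J u]) z = e *\<^sub>R J z"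
proof (cases "z = 0")
  case True
  then show ?thesis using J_lin(3)[OF Tmem(3), of 0] by (simp add: rotation_def)
next
  case False
  have ee: "e * e = 1" "e \<noteq> 0" using e by auto
  note mJ = Tmem(6)[OF u(1)]
  obtain a b where ab: "z = a *\<^sub>R u + b *\<^sub>R e *\<^sub>R J u" using z unfolding span_pair by blast
  have zT: "z \<in> TT" unfolding ab by (intro Tmem u mJ)
  have "J z = a *\<^sub>R J u + (b * e) *\<^sub>R J (J u)" unfolding ab using J_lin(1)[OF u(1) mJ, of a "b * e"] by simp
  then have ez: "e *\<^sub>R J z = - b *\<^sub>R u + a *\<^sub>R e *\<^sub>R J u"
    using e by (elim disjE) (simp_all add: JJ[OF u(1)])
  have "a \<noteq> 0 \<or> b \<noteq> 0" using False ab by auto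
  then have "a * a - b * (- b) > 0" by (simp add: sum_squares_gt_zero_iff)
  then have o: "[z, e *\<^sub>R J z] \<in> orient_class [u, e *\<^sub>R J u]" unfolding orient_class_pair ez by (subst ab) blast
  have zz: "g z z > 0" by (rule gpos[OF zT False])
  have ind: "z \<noteq> e *\<^sub>R J z \<and> independent {z, e *\<^sub>R J z}" by (rule J_independent[OF zT False ee(2)])
  have gz: "g z (e *\<^sub>R J z) = 0" "g (e *\<^sub>R J z) (e *\<^sub>R J z) = g z z"
    using g_J_self[OF zT] gJ[OF zT zT] ee by (simp_all add: g_lin Tmem zT)
  have "(THE w. [z, w] \<in> orient_class [u, e *\<^sub>R J u] \<and> g z w = 0 \<and> g w w = g z z) = e *\<^sub>R J z"
  proof (rule the_equality)
    fix w assume w: "[z, w] \<in> orient_class [u, e *\<^sub>R J u] \<and> g z w = 0 \<and> g w w = g z z"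
    then have "[z, w] \<in> orient_class [z, e *\<^sub>R J z]" using orient_class_eq[OF o] by simp
    then obtain p q r s where d: "z = p *\<^sub>R z + q *\<^sub>R e *\<^sub>R J z" "w = r *\<^sub>R z + s *\<^sub>R e *\<^sub>R J z" "p * s - q * r > 0"
      unfolding orient_class_pair by blast
    have "(p - 1) *\<^sub>R z + q *\<^sub>R (e *\<^sub>R J z) = 0" using d(1) by (simp add: algebra_simps)
    then have "p - 1 = 0 \<and> q = 0" using ind unfolding independent_pair by blast
    then have s: "s > 0" using d(3) by simp
    have m: "e *\<^sub>R J z \<in> TT" by (intro Tmem zT)
    have "g z w = r * g z z" unfolding d(2) g_lin(3)[OF Tmem(2)[OF zT] Tmem(2)[OF m] zT] g_lin(4)[OF zT zT] g_lin(4)[OF m zT] gz by simp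
    then have r: "r = 0" using w zz by simp
    have w2: "w = s *\<^sub>R (e *\<^sub>R J z)" using d(2) unfolding r by (simp only: scaleR_zero_left add_0)
    have "g w w = s * s * g z z" unfolding w2 g_lin(2)[OF m Tmem(2)[OF m]] g_lin(4)[OF m m] gz(2) by simp
    then have "s * s = 1" using w zz by simp
    then have "s = 1" using s by (simp add: square_eq_1_iff)
    then show "w = e *\<^sub>R J z" unfolding d(2) r by simp
  qed (use o gz in blast)
  then show ?thesis using False by (simp add: rotation_def)
qed

end

lemma orient_class_map_pair:
  assumes "\<And>a b. f (a *\<^sub>R u + b *\<^sub>R v) = a *\<^sub>R f u + b *\<^sub>R f v"
  shows "map f ` orient_class [u, v] = orient_class [f u, f v]"
  using orient_class_map[of f "[u, v]"] assms by (simp add: lessThan_Suc add.commute)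

text \<open>Smoothness on coordinate fields and linearity on each tangent space combine to joint
  smoothness in the point and the vector.\<close>

lemma (in spin_setting) smooth_J_chart:
  assumes c: "c \<in> M"
  shows "smooth_on (snd c ` fst c \<times> UNIV) (\<lambda>p. J (chart_inv c (fst p)) (tvec M (chart_inv c (fst p)) c (snd p)) c)"
proof -
  let ?O = "snd c ` fst c \<times> (UNIV :: (real ^ 4) set)"
  have o: "open ?O" by (rule open_Times[OF open_chart_image[OF Ma c] open_UNIV])
  have lJ: "linear (\<lambda>b. J (chart_inv c (fst p)) (tvec M (chart_inv c (fst p)) c b) c)" if "p \<in> ?O" for p
  proof -
    have Y: "chart_inv c (fst p) \<in> fst c" using that by (auto intro: chart_inv_in)
    note T = tvec_in_tangent_space[OF Ma c Y] and l = linear_tvec[OF Ma c Y]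
    note J = spinor_fibre.J_lin[OF spinor_fibre_at[OF in_points[OF c Y]]]
    show ?thesis
    proof (rule linearI)
      show "J (chart_inv c (fst p)) (tvec M (chart_inv c (fst p)) c (b + b')) c =
          J (chart_inv c (fst p)) (tvec M (chart_inv c (fst p)) c b) c + J (chart_inv c (fst p)) (tvec M (chart_inv c (fst p)) c b') c" for b b'
        unfolding linear_add[OF l] J(2)[OF T T] by (simp add: plus_fun_def)
      show "J (chart_inv c (fst p)) (tvec M (chart_inv c (fst p)) c (r *\<^sub>R b)) c =
          r *\<^sub>R J (chart_inv c (fst p)) (tvec M (chart_inv c (fst p)) c b) c" for r b
        unfolding linear_cmul[OF l] J(3)[OF T] by (simp add: scaleR_fun_def)
    qed
  qed
  have sJ: "smooth_on ?O (\<lambda>p. J (chart_inv c (fst p)) (tvec M (chart_inv c (fst p)) c b) c)" for b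
  proof -
    have "smooth_field M (fst c) (\<lambda>y. J y (tvec M y c b))"
      by (rule herm_smooth(1)[OF open_in_chart[OF Ma c] smooth_field_tvec[OF Ma c]])
    then have s: "smooth_on (snd c ` fst c) (\<lambda>z. J (chart_inv c z) (tvec M (chart_inv c z) c b) c)"
      unfolding smooth_field_def using c by fastforce
    have "smooth_on ?O fst" by (rule smooth_on_linear'[OF o linear_fst])
    from smooth_on_compose[OF o open_chart_image[OF Ma c] s this] show ?thesis by auto
  qed
  show ?thesis
    by (rule smooth_on_linear_family[where F="\<lambda>p b. J (chart_inv c (fst p)) (tvec M (chart_inv c (fst p)) c b) c" and p="\<lambda>p. p", OF o lJ sJ
        smooth_on_linear'[OF o linear_snd]])
qed

context zero_point
begin

text \<open>The coordinates of a tangent vector at \<open>y\<close> in the basis (u, v, w, J w),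
  read through the chart \<open>c\<close>.\<close>

abbreviation "cB a \<equiv> bcoord B (a c)"
lemma linear_cB: "linear cB"
proof -
  have "linear (\<lambda>a :: ('a, real ^ 4) tangent. a c)" by (rule linearI) (simp_all add: scaleR_fun_def plus_fun_def)
  from linear_compose[OF this linear_bcoord[OF basis_B]] show ?thesis by (simp add: comp_def)
qed
lemmas cB_lin = linear_add[OF linear_cB] linear_cmul[OF linear_cB] linear_neg[OF linear_cB]

lemma cB_expand:
  assumes "a \<in> TT"
  shows "a = cB a $ 1 *\<^sub>R u + cB a $ 2 *\<^sub>R v + cB a $ 3 *\<^sub>R w + cB a $ 4 *\<^sub>R J y w"
proof -
  have "a = tM (bcomb B (cB a))" using tM[OF assms] bcomb_bcoord[OF basis_B] by simp
  also have "\<dots> = cB a $ 1 *\<^sub>R tM (u c) + cB a $ 2 *\<^sub>R tM (v c) + cB a $ 3 *\<^sub>R tM (w c) + cB a $ 4 *\<^sub>R tM (J y w c)"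
    by (simp add: bcomb_def B_def linear_add[OF linear_tM] linear_cmul[OF linear_tM])
  finally show ?thesis unfolding tM[OF u(1)] tM[OF v_mem] tM[OF w(1)] tM[OF J_mem[OF w(1)]] .
qed

lemma cB_J:
  assumes a: "a \<in> TT"
  shows "cB (J y a) = vec4 (- \<epsilon> * cB a $ 2) (\<epsilon> * cB a $ 1) (- cB a $ 4) (cB a $ 3)"
proof -
  note lin = spinor_fibre.J_lin[OF G] and mem = spinor_fibre.Tmem[OF G] u(1) v_mem w(1)
  have "J y a = J y (cB a $ 1 *\<^sub>R u + cB a $ 2 *\<^sub>R v + cB a $ 3 *\<^sub>R w + cB a $ 4 *\<^sub>R J y w)"
    using cB_expand[OF a] by simp
  also have "\<dots> = cB a $ 1 *\<^sub>R J y u + cB a $ 2 *\<^sub>R J y v + cB a $ 3 *\<^sub>R J y w + cB a $ 4 *\<^sub>R J y (J y w)"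
    by (simp add: lin(2,3) mem)
  also have "\<dots> = (\<epsilon> * cB a $ 1) *\<^sub>R v + (- \<epsilon> * cB a $ 2) *\<^sub>R u + cB a $ 3 *\<^sub>R J y w + (- cB a $ 4) *\<^sub>R w"
    unfolding Jv JJ[OF w(1)] Ju by (simp add: mult.commute)
  finally have e: "J y a = (\<epsilon> * cB a $ 1) *\<^sub>R v + (- \<epsilon> * cB a $ 2) *\<^sub>R u + cB a $ 3 *\<^sub>R J y w + (- cB a $ 4) *\<^sub>R w" .
  show ?thesis unfolding e by (simp only: cB_lin bcoord_B) (simp add: vec4_eq_iff)
qed

text \<open>Only the w and J w components of \<open>a\<close> and \<open>b\<close> count, in keeping
  with homomorphisms modulo the plane. The prescribed form is demanded only near 0, where the minor
  stays positive.\<close>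

lemma curve_velocity:
  assumes ev: "\<forall>\<^sub>F t in nhds 0. \<gamma> t = (y, orient_class [u + t *\<^sub>R a, v + t *\<^sub>R b])" and ab: "a \<in> TT" "b \<in> TT"
  shows "velocity N \<gamma> = tN (0, vec4 (cB a $ 3) (cB a $ 4) (cB b $ 3) (cB b $ 4))"
proof -
  define U V where "U t = cB u + t *\<^sub>R cB a" and "V t = cB v + t *\<^sub>R cB b" for t
  have U: "(U has_vector_derivative cB a) (at 0)" and V: "(V has_vector_derivative cB b) (at 0)"
    unfolding U_def V_def by (auto intro!: derivative_eq_intros)
  have UV: "U 0 = vec4 1 0 0 0" "V 0 = vec4 0 1 0 0" by (simp_all add: U_def V_def bcoord_B)
  note d = plane_coords_derivative[OF U V UV]
  have "((\<lambda>t. plane_minor (U t) (V t)) \<longlongrightarrow> plane_minor (U 0) (V 0)) (nhds 0)"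
    unfolding plane_minor_def U_def V_def by (intro tendsto_intros filterlim_ident)
  then have "\<forall>\<^sub>F t in nhds 0. plane_minor (U t) (V t) > 0"
    by (rule order_tendstoD(1)) (simp add: UV plane_minor_def)
  with ev have e: "\<forall>\<^sub>F t in nhds 0. \<gamma> t \<in> fst C \<and> snd C (\<gamma> t) = (z0, plane_coords (U t) (V t))"
  proof eventually_elim
    case (elim t)
    have f: "\<gamma> t = frame_point M y c (u c + t *\<^sub>R a c) (v c + t *\<^sub>R b c)"
      by (simp add: elim frame_point_def linear_add[OF linear_tM] linear_cmul[OF linear_tM] tM ab u(1) v_mem)
    have c': "bcoord B (u c + t *\<^sub>R a c) = U t" "bcoord B (v c + t *\<^sub>R b c) = V t"
      by (simp_all add: U_def V_def linear_add[OF linear_bcoord[OF basis_B]] linear_cmul[OF linear_bcoord[OF basis_B]])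
    show ?case unfolding f using frame_point_in_chart[OF Ma c basis_B, of "u c + t *\<^sub>R a c" "v c + t *\<^sub>R b c"]
      frame_point_coords[OF Ma c basis_B, of "u c + t *\<^sub>R a c" "v c + t *\<^sub>R b c"] elim(2) unfolding c' by blast
  qed
  have g0: "\<gamma> 0 = x" using eventually_nhds_x_imp_x[OF ev] by (simp add: x_def)
  have ea: "\<forall>\<^sub>F t in at 0. \<gamma> t \<in> fst C" "\<forall>\<^sub>F t in at 0. (z0, plane_coords (U t) (V t)) = snd C (\<gamma> t)"
    using e by (auto simp: eventually_at_filter elim: eventually_mono)
  have "((\<lambda>t. (z0, plane_coords (U t) (V t))) has_vector_derivative (0, vec4 (cB a $ 3) (cB a $ 4) (cB b $ 3) (cB b $ 4))) (at 0)"
    by (rule has_vector_derivative_Pair[OF has_vector_derivative_const d])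
  then have "((\<lambda>t. snd C (\<gamma> t)) has_vector_derivative (0, vec4 (cB a $ 3) (cB a $ 4) (cB b $ 3) (cB b $ 4))) (at 0)"
    unfolding has_vector_derivative_def
    by (rule has_derivative_transform_eventually[OF _ ea(2)]) (use eventually_nhds_x_imp_x[OF e] in simp_all)
  from velocity_tvec[OF Na C _ this ea(1)] show ?thesis using g0 x_chart(1) by simp
qed

text \<open>\<open>bt\<close> vanishes along every curve in \<open>K\<close>, hence so does its
  derivative along the velocity.\<close>

lemma tangent_K_sub:
  assumes "a \<in> tangent_space_of N K x" shows "\<exists>e. a = tN e \<and> Db e = 0"
proof -
  obtain \<gamma> r where g: "a = velocity N \<gamma>" "smooth_curve_at N x \<gamma>" "r > 0" "\<gamma> ` {-r<..<r} \<subseteq> K"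
    using assms unfolding tangent_space_of_def by blast
  obtain e where e: "velocity N \<gamma> = tN e" "((\<lambda>t. snd C (\<gamma> t)) has_vector_derivative e) (at 0)" "\<forall>\<^sub>F t in at 0. \<gamma> t \<in> fst C"
    by (rule smooth_curve_velocity[OF Na g(2) C x_chart(1)]) blast
  have g0: "snd C (\<gamma> 0) = (z0, 0)" using g(2) x_chart(2) by (simp add: smooth_curve_at_def)
  have "((\<lambda>t. snd C (\<gamma> t)) \<longlongrightarrow> (z0, 0)) (at 0)"
    using has_vector_derivative_continuous[OF e(2)] g0 by (simp add: continuous_within)
  then have eD: "\<forall>\<^sub>F t in at 0. snd C (\<gamma> t) \<in> D" by (rule topological_tendstoD[OF _ open_D z0_in(2)])
  have eK: "\<forall>\<^sub>F t in at 0. \<gamma> t \<in> K" by (rule eventually_at_0_interval[OF g(3)]) (use g(4) in blast)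
  have z: "\<forall>\<^sub>F t in at 0. bt (snd C (\<gamma> t)) = 0"
    using e(3) eD eK by eventually_elim (rule bt_zero; simp add: chart_inv_left[OF Na C])
  have "((\<lambda>t. bt (snd C (\<gamma> t))) has_vector_derivative Db e) (at 0)"
    by (rule has_vector_derivative_chain[OF e(2)]) (simp only: g0 Db)
  then have "((\<lambda>t. 0 :: complex) has_vector_derivative Db e) (at 0)"
    unfolding has_vector_derivative_def
    by (rule has_derivative_transform_eventually[OF _ z]) (simp_all add: g0 bt_z0)
  then have "Db e = 0" using vector_derivative_unique_at[OF _ has_vector_derivative_const] by blast
  then show ?thesis using g(1) e(1) by blast
qed

lemma vertical_sub:
  assumes "a \<in> vertical_space M K' x" shows "\<exists>q. a = tN (0, q)"
proof -
  obtain \<gamma> r where g: "a = velocity N \<gamma>" "smooth_curve_at N x \<gamma>" "r > 0" "\<gamma> ` {-r<..<r} \<subseteq> {z \<in> K'. fst z = fst x}"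
    using assms unfolding vertical_space_def tangent_space_of_def by blast
  obtain e where e: "velocity N \<gamma> = tN e" "((\<lambda>t. snd C (\<gamma> t)) has_vector_derivative e) (at 0)" "\<forall>\<^sub>F t in at 0. \<gamma> t \<in> fst C"
    by (rule smooth_curve_velocity[OF Na g(2) C x_chart(1)]) blast
  have g0: "snd C (\<gamma> 0) = (z0, 0)" using g(2) x_chart(2) by (simp add: smooth_curve_at_def)
  have eK: "\<forall>\<^sub>F t in at 0. fst (\<gamma> t) = y"
  proof (rule eventually_at_0_interval[OF g(3)])
    fix t assume "t \<in> {-r<..<r}"
    then have "\<gamma> t \<in> {z \<in> K'. fst z = fst x}" using g(4) by blast
    then show "fst (\<gamma> t) = y" by (simp add: x_def)
  qed
  have z: "\<forall>\<^sub>F t in at 0. fst (snd C (\<gamma> t)) = z0"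
    using e(3) eK
  proof eventually_elim
    case (elim t)
    from plane_chart_point[OF Ma c(1) basis_B elim(1)] obtain q where "snd C (\<gamma> t) = (snd c (fst (\<gamma> t)), q)" by blast
    then show ?case using elim(2) by simp
  qed
  have "((\<lambda>t. fst (snd C (\<gamma> t))) has_vector_derivative fst e) (at 0)"
    by (rule has_vector_derivative_chain[OF e(2)]) (rule bounded_linear.has_derivative[OF bounded_linear_fst has_derivative_ident])
  then have "((\<lambda>t. z0) has_vector_derivative fst e) (at 0)"
    unfolding has_vector_derivative_def
    by (rule has_derivative_transform_eventually[OF _ z]) (simp_all add: g0)
  then have "fst e = 0" using vector_derivative_unique_at[OF _ has_vector_derivative_const] by blast
  then show ?thesis using g(1) e(1) by (metis prod.collapse)
qed

text \<open>For a kernel vector (a, q) the base point moves along \<open>a\<close>, \<open>u\<close>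
  is perturbed by the first two slopes to U, and the plane of U and \<epsilon> J U stays in
  \<open>K\<close> automatically. The other two slopes of the velocity need no computation, being
  determined by membership in the kernel. The parameter \<open>K'\<close> allows for both
  \<open>K\<close> and its fibre over \<open>y\<close>.\<close>

lemma complex_line_curve:
  assumes q: "Db (a, q) = 0"
    and K': "K' \<subseteq> K" "\<And>z. z \<in> K \<Longrightarrow> fst z \<in> fst c \<Longrightarrow> (\<exists>t. snd c (fst z) = z0 + t *\<^sub>R a) \<Longrightarrow> z \<in> K'"
  shows "tN (a, q) \<in> tangent_space_of N K' x"
proof -
  define Y U V where "Y t = chart_inv c (z0 + t *\<^sub>R a)"
    and "U t = u c + t *\<^sub>R (q $ 1 *\<^sub>R w c + q $ 2 *\<^sub>R J y w c)"
    and "V t = \<epsilon> *\<^sub>R J (Y t) (tvec M (Y t) c (U t)) c" for t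
  let ?A = "\<lambda>t. z0 + t *\<^sub>R a"
  define O1 where "O1 = {t. ?A t \<in> snd c ` fst c}"
  have o1: "open O1" unfolding O1_def
    using continuous_open_vimage[OF open_chart_image[OF Ma c(1)], of ?A] by (simp add: vimage_def continuous_intros)
  have Y: "Y t \<in> fst c" "snd c (Y t) = ?A t" if "t \<in> O1" for t
    using that chart_inv_in[of "?A t" c] chart_inv_right[of "?A t" c] by (simp_all add: O1_def Y_def)
  have sA: "smooth_on O1 ?A"
    by (intro smooth_on_add[OF o1] smooth_on_const smooth_on_linear'[OF o1]) (rule linearI; simp add: algebra_simps)
  have sU: "smooth_on O1 U" unfolding U_def
    by (intro smooth_on_add[OF o1] smooth_on_const smooth_on_linear'[OF o1]) (rule linearI; simp add: algebra_simps)
  have sV: "smooth_on O1 V"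
  proof -
    have "smooth_on O1 (\<lambda>t. (?A t, U t))" by (rule smooth_on_Pair[OF o1 sA sU])
    from smooth_on_compose[OF o1 open_Times[OF open_chart_image[OF Ma c(1)] open_UNIV] smooth_J_chart[OF c(1)] this]
    have "smooth_on O1 (\<lambda>t. J (chart_inv c (?A t)) (tvec M (chart_inv c (?A t)) c (U t)) c)" by (auto simp: O1_def)
    then show ?thesis unfolding V_def Y_def by (intro smooth_on_scaleR[OF o1] smooth_on_const)
  qed
  note sB = smooth_on_linear[OF o1 linear_bcoord[OF basis_B]]
  define O2 where "O2 = {t \<in> O1. plane_minor (bcoord B (U t)) (bcoord B (V t)) > 0}"
  have sm: "smooth_on O1 (\<lambda>t. plane_minor (bcoord B (U t)) (bcoord B (V t)))" unfolding plane_minor_def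
    by (intro smooth_on_diff[OF o1] smooth_on_mult[OF o1] smooth_on_nth[OF o1] sB[OF sU] sB[OF sV])
  have "open (O1 \<inter> (\<lambda>t. plane_minor (bcoord B (U t)) (bcoord B (V t))) -` {0<..})"
    by (rule continuous_open_preimage[OF smooth_on_continuous_on[OF sm] o1]) simp
  then have o2: "open O2" by (simp add: O2_def vimage_def Collect_conj_eq)
  have O12: "O2 \<subseteq> O1" by (auto simp: O2_def)
  have Y0: "Y 0 = y" by (simp add: Y_def chart_z0)
  have U0: "U 0 = u c" by (simp add: U_def)
  have V0: "V 0 = v c" by (simp add: V_def Y0 U0 tM[OF u(1)] v_def scaleR_fun_def)
  have bc: "bcoord B (U t) = vec4 1 0 (t * q $ 1) (t * q $ 2)" for t
    unfolding U_def by (simp only: linear_add[OF linear_bcoord[OF basis_B]] linear_cmul[OF linear_bcoord[OF basis_B]] bcoord_B)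
      (simp add: vec4_eq_iff)
  have "0 \<in> O2" using c by (simp add: O2_def O1_def U0 V0 bcoord_B plane_minor_def)
  then obtain r where r: "r > 0" "ball 0 r \<subseteq> O2" using o2 openE by blast
  have rI: "{-r<..<r} \<subseteq> O2" using r(2) by (simp add: ball_eq_greaterThanLessThan)
  define \<gamma> where "\<gamma> t = frame_point M (Y t) c (U t) (V t)" for t
  have gC: "\<gamma> t \<in> fst C" "snd C (\<gamma> t) = (?A t, plane_coords (bcoord B (U t)) (bcoord B (V t)))" if t: "t \<in> O2" for t
  proof -
    have t1: "t \<in> O1" and m: "plane_minor (bcoord B (U t)) (bcoord B (V t)) > 0" using t by (auto simp: O2_def)
    show "\<gamma> t \<in> fst C" "snd C (\<gamma> t) = (?A t, plane_coords (bcoord B (U t)) (bcoord B (V t)))"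
      unfolding \<gamma>_def using frame_point_in_chart[OF Ma c(1) Y(1)[OF t1] basis_B] frame_point_coords[OF Ma c(1) Y(1)[OF t1] basis_B m] m Y(2)[OF t1]
      by auto
  qed
  have gK: "\<gamma> t \<in> K'" if t: "t \<in> O2" for t
  proof -
    have t1: "t \<in> O1" using t O12 by blast
    note YM = in_points[OF c(1) Y(1)[OF t1]]
    let ?u = "tvec M (Y t) c (U t)"
    have uT: "?u \<in> tangent_space M (Y t)" by (rule tvec_in_tangent_space[OF Ma c(1) Y(1)[OF t1]])
    have "bcoord B (U t) $ 1 \<noteq> bcoord B 0 $ 1" unfolding bc linear_0[OF linear_bcoord[OF basis_B]] by simp
    then have "U t \<noteq> 0" by metis
    then have u0: "?u \<noteq> 0"
      using tvec_inj[OF Ma c(1) Y(1)[OF t1], of "U t" 0] linear_0[OF linear_tvec[OF Ma c(1) Y(1)[OF t1]]] by simp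
    note tm = spinor_fibre.Tmem[OF spinor_fibre_at[OF YM]]
    have "tvec M (Y t) c (V t) = \<epsilon> *\<^sub>R J (Y t) ?u"
      using tangent_vector_tvec[OF Ma c(1) Y(1)[OF t1] tm(2)[OF tm(6)[OF uT], of \<epsilon>]] by (simp add: V_def scaleR_fun_def)
    then have "\<gamma> t = (Y t, orient_class [?u, - \<eta> *\<^sub>R J (Y t) ?u])" by (simp add: \<gamma>_def frame_point_def)
    then have "\<gamma> t \<in> K" unfolding line_planes_iff[OF eta] using YM uT u0 by auto
    moreover have "fst (\<gamma> t) = Y t" by (simp add: \<gamma>_def)
    ultimately show ?thesis using K'(2)[of "\<gamma> t"] Y[OF t1] by auto
  qed
  have oI: "open {-r<..<r}" by simp
  obtain V' where V': "((\<lambda>t. bcoord B (V t)) has_vector_derivative V') (at 0)"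
    using has_derivative_imp_has_vector_derivative[OF smooth_on_has_derivative[OF sB[OF sV], of 0]] \<open>0 \<in> O2\<close> O12 by blast
  have U': "((\<lambda>t. bcoord B (U t)) has_vector_derivative vec4 0 0 (q $ 1) (q $ 2)) (at 0)"
    unfolding bc by (rule has_vector_derivative_vec4) (auto intro!: derivative_eq_intros)
  let ?q = "vec4 (q $ 1) (q $ 2) (V' $ 3) (V' $ 4)"
  have "((\<lambda>t. plane_coords (bcoord B (U t)) (bcoord B (V t))) has_vector_derivative ?q) (at 0)"
    using plane_coords_derivative[OF U' V'] by (simp add: U0 V0 bcoord_B)
  moreover have "(?A has_vector_derivative a) (at 0)" by (auto intro!: derivative_eq_intros)
  ultimately have "((\<lambda>t. (?A t, plane_coords (bcoord B (U t)) (bcoord B (V t)))) has_vector_derivative (a, ?q)) (at 0)"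
    by (intro has_vector_derivative_Pair)
  then have d: "((\<lambda>t. snd C (\<gamma> t)) has_vector_derivative (a, ?q)) (at 0)"
    by (rule has_vector_derivative_transform_within_open[OF _ o2 \<open>0 \<in> O2\<close>]) (simp add: gC)
  have s: "smooth_on {-r<..<r} (\<lambda>t. snd C (\<gamma> t))"
  proof (rule smooth_on_cong[OF _ oI])
    show "smooth_on {-r<..<r} (\<lambda>t. (?A t, plane_coords (bcoord B (U t)) (bcoord B (V t))))"
    proof (intro smooth_on_Pair[OF oI] smooth_plane_coords[OF oI])
      show "smooth_on {-r<..<r} ?A" "smooth_on {-r<..<r} (\<lambda>t. bcoord B (U t))" "smooth_on {-r<..<r} (\<lambda>t. bcoord B (V t))"
        using smooth_on_subset[OF sA] smooth_on_subset[OF sB[OF sU]] smooth_on_subset[OF sB[OF sV]] rI O12 by blast+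
      show "plane_minor (bcoord B (U t)) (bcoord B (V t)) > 0" if "t \<in> {-r<..<r}" for t using that rI by (auto simp: O2_def)
    qed
  qed (use gC rI in auto)
  have gg: "\<gamma> ` {-r<..<r} \<subseteq> fst C \<inter> K'" using gC(1) gK rI by blast
  have g0: "\<gamma> 0 = x" by (simp add: \<gamma>_def x_frame Y0 U0 V0)
  have e: "tN (a, ?q) \<in> tangent_space_of N K' x" by (rule tangent_space_ofI[OF Na C r(1) gg s d g0])
  moreover have "tangent_space_of N K' x \<subseteq> tangent_space_of N K x" unfolding tangent_space_of_def using K'(1) by blast
  ultimately obtain e' where "tN (a, ?q) = tN e'" "Db e' = 0" using tangent_K_sub by blast
  then have "Db (a, ?q) = 0" using injD[OF inj_tN] by metis
  \<comment> \<open>Both vectors lie in the kernel and can differ only in the last two slopes, on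
    which \<open>Db\<close> is injective.\<close>
  then have "Db ((a, ?q) - (a, q)) = 0" unfolding linear_diff[OF linear_Db] q by simp
  then have "Complex (V' $ 3 - q $ 3) (V' $ 4 - q $ 4) = 0" using b0 by (simp add: Db_vertical)
  then have "?q = q" by (simp add: vec4_eq_iff complex_eq_iff)
  then show ?thesis using e by simp
qed

lemma tangent_K: "tangent_space_of N K x = tN ` {e. Db e = 0}"
proof (intro equalityI subsetI)
  fix a assume "a \<in> tN ` {e. Db e = 0}"
  then obtain b q where "a = tN (b, q)" "Db (b, q) = 0" by auto
  then show "a \<in> tangent_space_of N K x" using complex_line_curve[of b q K] by blast
qed (use tangent_K_sub in blast)

text \<open>For base velocity 0 the curve constructed above remains over \<open>y\<close>.\<close>

lemma vertical_K: "vertical_space M K x = tN ` {e \<in> {e. Db e = 0}. fst e = 0}"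
proof (intro equalityI subsetI)
  fix a assume a: "a \<in> vertical_space M K x"
  then have "a \<in> tangent_space_of N K x" unfolding vertical_space_def tangent_space_of_def by blast
  then obtain e where e: "a = tN e" "Db e = 0" using tangent_K_sub by blast
  obtain q where "a = tN (0, q)" using vertical_sub[OF a] by blast
  then have "e = (0, q)" using e(1) injD[OF inj_tN] by metis
  then show "a \<in> tN ` {e \<in> {e. Db e = 0}. fst e = 0}" using e by auto
next
  fix a assume "a \<in> tN ` {e \<in> {e. Db e = 0}. fst e = 0}"
  then obtain q where q: "a = tN (0, q)" "Db (0, q) = 0" by auto
  have "tN (0, q) \<in> tangent_space_of N {z \<in> K. fst z = fst x} x"
  proof (rule complex_line_curve[OF q(2)])
    fix z assume "z \<in> K" "fst z \<in> fst c" "\<exists>t. snd c (fst z) = z0 + t *\<^sub>R 0"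
    then show "z \<in> {z \<in> K. fst z = fst x}" using chart_inv_left[OF Ma c(1)] c(2) by (auto simp: x_def) metis
  qed blast
  then show "a \<in> vertical_space M K x" unfolding vertical_space_def q(1) .
qed

lemma vertical_N: "vertical_space M (points N) x = (\<lambda>q. tN (0, q)) ` UNIV"
proof (intro equalityI subsetI)
  fix a assume "a \<in> range (\<lambda>q. tN (0, q))"
  then obtain q where a: "a = tN (0, q)" by blast
  define \<gamma> where "\<gamma> t = chart_inv C (snd C x + t *\<^sub>R (0, q))" for t
  note cc = chart_curve[OF Na C x_chart(1), of \<gamma> "(0, q)", OF \<gamma>_def]
  obtain r where r: "r > 0" "\<gamma> ` {-r<..<r} \<subseteq> fst C" "\<forall>t\<in>{-r<..<r}. snd C (\<gamma> t) = snd C x + t *\<^sub>R (0, q)" using cc(3) by blast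
  have oI: "open {-r<..<r}" by simp
  have "smooth_on {-r<..<r} (\<lambda>t. snd C x + t *\<^sub>R (0, q))"
    by (intro smooth_on_add[OF oI] smooth_on_const smooth_on_linear'[OF oI]) (rule linearI; simp add: algebra_simps)
  then have s: "smooth_on {-r<..<r} (\<lambda>t. snd C (\<gamma> t))" by (rule smooth_on_cong[OF _ oI]) (use r(3) in simp)
  have "fst (\<gamma> t) = y" if "t \<in> {-r<..<r}" for t
  proof -
    have t: "\<gamma> t \<in> fst C" "fst (snd C (\<gamma> t)) = z0" using that r(2,3) x_chart(2) by auto
    from plane_chart_point[OF Ma c(1) basis_B t(1)] have "fst (\<gamma> t) \<in> fst c" "snd c (fst (\<gamma> t)) = z0" using t(2) by (metis fst_conv)+
    then show ?thesis using chart_inv_left[OF Ma c(1)] chart_z0 by metis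
  qed
  then have "\<gamma> ` {-r<..<r} \<subseteq> fst C \<inter> {z \<in> points N. fst z = fst x}" using r(2) in_points[OF C] by (auto simp: x_def)
  from tangent_space_ofI[OF Na C r(1) this s cc(2) cc(1)] show "a \<in> vertical_space M (points N) x"
    unfolding vertical_space_def a .
qed (use vertical_sub in blast)

end

text \<open>The determinant is minus the squared modulus of a complex one.\<close>

lemma complex_plane_det4:
  "det4 [p, vec4 (p $ 3) (p $ 4) (- p $ 1) (- p $ 2), r, vec4 (r $ 3) (r $ 4) (- r $ 1) (- r $ 2)] \<le> 0"
proof -
  have "det4 [p, vec4 (p $ 3) (p $ 4) (- p $ 1) (- p $ 2), r, vec4 (r $ 3) (r $ 4) (- r $ 1) (- r $ 2)] =
      - ((p $ 1 * r $ 2 - p $ 3 * r $ 4 - p $ 2 * r $ 1 + p $ 4 * r $ 3)\<^sup>2 +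
         (p $ 2 * r $ 3 + p $ 4 * r $ 1 - p $ 1 * r $ 4 - p $ 3 * r $ 2)\<^sup>2)"
    by (simp add: det4_list power2_eq_square algebra_simps)
  then show ?thesis by simp
qed

section \<open>Orientations of the fibres in slopes\<close>

context zero_point
begin

lemma linear_P0: "linear (\<lambda>q. tN (0, q))"
proof -
  have "linear (Pair (0 :: real ^ 4) :: real ^ 4 \<Rightarrow> _)" by (rule linearI) simp_all
  from linear_compose[OF this linear_tN] show ?thesis by (simp add: comp_def)
qed

lemma inj_P0: "inj (\<lambda>q. tN (0, q))"
  using inj_tN by (auto simp: inj_def)

abbreviation "Hom \<equiv> real_hom (span {u, v}) TT"
abbreviation "ev A \<equiv> vec4 (cB (A u) $ 3) (cB (A u) $ 4) (cB (A v) $ 3) (cB (A v) $ 4)"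
abbreviation "rot \<equiv> rotation (g y) (orient_class [u, v])"

lemma HomD:
  assumes "A \<in> Hom"
  shows "A (a *\<^sub>R u + b *\<^sub>R v) = a *\<^sub>R A u + b *\<^sub>R A v" "A u \<in> TT" "A v \<in> TT"
  using assms span_base[of u "{u, v}"] span_base[of v "{u, v}"] unfolding real_hom_def by auto

lemma HomI:
  assumes "\<And>z. z \<in> span {u, v} \<Longrightarrow> A z \<in> TT"
    "\<And>z z' a b. z \<in> span {u, v} \<Longrightarrow> z' \<in> span {u, v} \<Longrightarrow> A (a *\<^sub>R z + b *\<^sub>R z') = a *\<^sub>R A z + b *\<^sub>R A z'"
  shows "A \<in> Hom"
  using assms unfolding real_hom_def by blast

lemma J_plane: "J y (a *\<^sub>R u + b *\<^sub>R v) = (- \<epsilon> * b) *\<^sub>R u + (\<epsilon> * a) *\<^sub>R v"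
  unfolding spinor_fibre.J_lin(1)[OF G u(1) v_mem] Ju Jv by (simp add: mult.commute)

lemma rot_plane: "rot (a *\<^sub>R u + b *\<^sub>R v) = (- b) *\<^sub>R u + a *\<^sub>R v"
proof -
  have "a *\<^sub>R u + b *\<^sub>R v \<in> span {u, v}" unfolding span_pair by blast
  then have "rot (a *\<^sub>R u + b *\<^sub>R v) = \<epsilon> *\<^sub>R J y (a *\<^sub>R u + b *\<^sub>R v)"
    unfolding v_def by (rule spinor_fibre.rotation_plane[OF G u eps(1)])
  moreover have "\<epsilon> *\<^sub>R ((- \<epsilon> * b) *\<^sub>R u + (\<epsilon> * a) *\<^sub>R v) = (- b) *\<^sub>R u + a *\<^sub>R v" by (rule disjE[OF eta]) simp_all
  ultimately show ?thesis unfolding J_plane by (rule trans)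
qed

text \<open>The rotation is \<epsilon> J on this plane, so \<epsilon> cancels when it is expressed
  in the basis (u, v).\<close>

lemma rot_uv: "rot u = v" "rot v = - u"
  using rot_plane[of 1 0] rot_plane[of 0 1] by simp_all

lemma Hom_rot:
  assumes "A \<in> Hom" shows "A \<circ> rot \<in> Hom"
proof (rule HomI)
  note A = HomD[OF assms]
  fix z assume "z \<in> span {u, v}"
  then obtain p q where z: "z = p *\<^sub>R u + q *\<^sub>R v" unfolding span_pair by blast
  show "(A \<circ> rot) z \<in> TT" unfolding z comp_def rot_plane A(1) by (intro spinor_fibre.Tmem[OF G] A)
  fix z' a b assume "z' \<in> span {u, v}"
  then obtain p' q' where z': "z' = p' *\<^sub>R u + q' *\<^sub>R v" unfolding span_pair by blast
  have e: "a *\<^sub>R z + b *\<^sub>R z' = (a * p + b * p') *\<^sub>R u + (a * q + b * q') *\<^sub>R v" unfolding z z' by (simp add: algebra_simps)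
  show "(A \<circ> rot) (a *\<^sub>R z + b *\<^sub>R z') = a *\<^sub>R (A \<circ> rot) z + b *\<^sub>R (A \<circ> rot) z'"
    unfolding e comp_def unfolding z z' rot_plane A(1) by (simp add: algebra_simps)
qed

lemma ev_rot:
  assumes "A \<in> Hom"
  shows "ev (A \<circ> rot) = vec4 (ev A $ 3) (ev A $ 4) (- ev A $ 1) (- ev A $ 2)"
proof -
  have "A (- u) = - A u" using HomD(1)[OF assms, of "-1" 0] by simp
  then show ?thesis unfolding comp_def rot_uv cB_lin(3)[symmetric] by (simp only: cB_lin(3) vec4_nth vector_uminus_component)
qed

lemma Hom_velocity:
  assumes "A \<in> Hom"
  shows "velocity N (\<lambda>t. (y, map (\<lambda>z. z + t *\<^sub>R A z) ` orient_class [u, v])) = tN (0, ev A)"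
proof (rule curve_velocity[OF always_eventually HomD(2,3)[OF assms]], rule allI)
  fix t
  have "map (\<lambda>z. z + t *\<^sub>R A z) ` orient_class [u, v] = orient_class [u + t *\<^sub>R A u, v + t *\<^sub>R A v]"
    by (rule orient_class_map_pair) (simp add: HomD(1)[OF assms] algebra_simps)
  then show "(y, map (\<lambda>z. z + t *\<^sub>R A z) ` orient_class [u, v]) = (y, orient_class [u + t *\<^sub>R A u, v + t *\<^sub>R A v])" by simp
qed

lemma ev_exists:
  assumes a: "a \<in> TT" "b \<in> TT"
  obtains A where "A \<in> Hom" "A u = a" "A v = b"
proof
  have m: "cB z $ 1 *\<^sub>R a + cB z $ 2 *\<^sub>R b \<in> TT" for z by (intro spinor_fibre.Tmem[OF G] a)
  have l: "linear (\<lambda>z. cB z $ 1 *\<^sub>R a + cB z $ 2 *\<^sub>R b)"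
    by (rule linearI; simp only: cB_lin; simp add: algebra_simps)
  show "(\<lambda>z. cB z $ 1 *\<^sub>R a + cB z $ 2 *\<^sub>R b) \<in> Hom"
    by (rule HomI[OF m]) (simp only: linear_add[OF l] linear_cmul[OF l])
qed (simp_all add: bcoord_B)

text \<open>Composition with the rotation changes the values (A u, A v) into (A v, - A u), that is,
  slopes (a, b, c, d) into (c, d, -a, -b). A complex basis thus has determinant at most 0 by
  \<open>complex_plane_det4\<close>, hence negative by independence, and one explicit complex basis
  reaches all negative quadruples.\<close>

lemma plane_fibre:
  "plane_fibre_orientation M g x = {vs. \<exists>qs. length qs = 4 \<and> det4 qs < 0 \<and> vs = map (\<lambda>q. tN (0, q)) qs}"
proof -
  let ?P = "\<lambda>q. tN (0, q)"
  let ?I = "\<lambda>q :: real ^ 4. vec4 (q $ 3) (q $ 4) (- q $ 1) (- q $ 2)"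
  define e where "e A = velocity N (\<lambda>t. (y, map (\<lambda>z. z + t *\<^sub>R A z) ` orient_class [u, v]))" for A
  have e: "e A = ?P (ev A)" "e (A \<circ> rot) = ?P (?I (ev A))" if "A \<in> Hom" for A
    unfolding e_def Hom_velocity[OF that] Hom_velocity[OF Hom_rot[OF that]] ev_rot[OF that] by simp_all
  let ?L = "\<lambda>as. concat (map (\<lambda>A. [ev A, ?I (ev A)]) as)"
  have L: "concat (map (\<lambda>A. [e A, e (A \<circ> rot)]) as) = map ?P (?L as)" if "set as \<subseteq> Hom" for as
  proof -
    have "map (\<lambda>A. [e A, e (A \<circ> rot)]) as = map (map ?P \<circ> (\<lambda>A. [ev A, ?I (ev A)])) as"
    proof (rule map_cong[OF refl])
      fix A assume "A \<in> set as"
      then have A: "A \<in> Hom" using that by blast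
      show "[e A, e (A \<circ> rot)] = (map ?P \<circ> (\<lambda>A. [ev A, ?I (ev A)])) A"
        unfolding e[OF A] by simp
    qed
    then show ?thesis by (simp only: map_concat map_map)
  qed
  have pf: "plane_fibre_orientation M g x = complex_orientation (\<lambda>A. A \<circ> rot) e Hom (range ?P)"
    unfolding plane_fibre_orientation_def x_def case_prod_conv underlying_pair e_def[abs_def]
    unfolding x_def[symmetric] vertical_N ..
  show ?thesis
  proof (intro equalityI subsetI)
    fix bs assume "bs \<in> plane_fibre_orientation M g x"
    then obtain as where as: "set as \<subseteq> Hom" "basis_list (map ?P (?L as)) (range ?P)" "bs \<in> orient_class (map ?P (?L as))"
      unfolding pf complex_orientation_def using L by auto
    then have b: "basis_list (?L as) UNIV" using basis_list_map_iff[OF linear_P0 inj_P0] by blast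
    have "length (?L as) = 2 * length as" by (simp add: length_concat comp_def sum_list_triv)
    then have "length as = 2" using basis_list_UNIV_length[OF b] by simp
    then obtain A1 A2 where A: "as = [A1, A2]" by (auto simp: length_Suc_conv numeral_2_eq_2)
    have "det4 (?L as) \<le> 0" unfolding A using complex_plane_det4[of "ev A1" "ev A2"] by simp
    moreover have "det4 (?L as) \<noteq> 0" by (rule det4_basis_list[OF b])
    ultimately have d: "det4 (?L as) < 0" by simp
    obtain qs where qs: "bs = map ?P qs" "qs \<in> orient_class (?L as)"
      using as(3) unfolding orient_class_map_linear[OF linear_P0] by blast
    have "det4 qs < 0" by (rule det4_orient_class[OF basis_list_UNIV_length[OF b] qs(2) d])
    moreover have "length qs = 4" using basis_list_UNIV_length[OF orient_class_basis_list[OF b qs(2)]] .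
    ultimately show "bs \<in> {vs. \<exists>qs. length qs = 4 \<and> det4 qs < 0 \<and> vs = map ?P qs}" using qs(1) by blast
  next
    fix bs assume "bs \<in> {vs. \<exists>qs. length qs = 4 \<and> det4 qs < 0 \<and> vs = map ?P qs}"
    then obtain qs where qs: "length qs = 4" "det4 qs < 0" "bs = map ?P qs" by blast
    have z: "0 \<in> TT" by (rule spinor_fibre.Tmem(3)[OF G])
    have cz: "cB 0 = 0" by (rule linear_0[OF linear_cB])
    \<comment> \<open>The homomorphisms that kill v and send u to w or to J w form a complex basis
      modulo the plane.\<close>
    obtain A1 where A1: "A1 \<in> Hom" "A1 u = w" "A1 v = 0" by (rule ev_exists[OF w(1) z])
    obtain A2 where A2: "A2 \<in> Hom" "A2 u = J y w" "A2 v = 0" by (rule ev_exists[OF J_mem[OF w(1)] z])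
    have L': "?L [A1, A2] = [vec4 1 0 0 0, vec4 0 0 (-1) 0, vec4 0 1 0 0, vec4 0 0 0 (-1)]"
      unfolding concat.simps list.map A1(2,3) A2(2,3) bcoord_B cz by simp
    have d: "det4 (?L [A1, A2]) < 0" unfolding L' by (simp add: det4_list)
    have l: "length (?L [A1, A2]) = 4" by simp
    have "basis_list (?L [A1, A2]) UNIV" by (rule det4_nonzero_basis_list[OF l]) (use d in linarith)
    then have b: "basis_list (map ?P (?L [A1, A2])) (range ?P)" using basis_list_map_iff[OF linear_P0 inj_P0] by blast
    have "qs \<in> orient_class (?L [A1, A2])" by (rule orient_class_det4[OF qs(1) l mult_neg_neg[OF qs(2) d]])
    then have o: "bs \<in> orient_class (map ?P (?L [A1, A2]))" unfolding orient_class_map_linear[OF linear_P0] qs(3) by blast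
    have s: "set [A1, A2] \<subseteq> Hom" using A1(1) A2(1) by simp
    show "bs \<in> plane_fibre_orientation M g x" unfolding pf complex_orientation_def mem_Collect_eq
      by (rule exI[of _ "[A1, A2]"], unfold L[OF s]) (intro conjI s b o)
  qed
qed

abbreviation "JHom \<equiv> J_hom (J y) (span {u, v}) TT"

text \<open>J-linearity forces A v = \<epsilon> J (A u), so modulo the plane only the w and J w
  components of A u remain free. Their coefficient vectors are \<open>k1\<close> and
  \<open>k2\<close> of the linear model.\<close>

lemma JHomD:
  assumes "A \<in> JHom"
  shows "A \<in> Hom" "A v = \<epsilon> *\<^sub>R J y (A u)"
    "ev A = cB (A u) $ 3 *\<^sub>R vec4 1 0 0 \<epsilon> + cB (A u) $ 4 *\<^sub>R vec4 0 1 (- \<epsilon>) 0"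
proof -
  show A: "A \<in> Hom" using assms by (simp add: J_hom_def)
  have "A (J y u) = J y (A u)" using assms span_base[of u "{u, v}"] unfolding J_hom_def by auto
  moreover have "A (J y u) = \<epsilon> *\<^sub>R A v" unfolding Ju using HomD(1)[OF A, of 0 \<epsilon>] by simp
  ultimately show v: "A v = \<epsilon> *\<^sub>R J y (A u)" using eps(3) by (metis scaleR_scaleR scaleR_one)
  show "ev A = cB (A u) $ 3 *\<^sub>R vec4 1 0 0 \<epsilon> + cB (A u) $ 4 *\<^sub>R vec4 0 1 (- \<epsilon>) 0"
    unfolding v cB_lin(2) cB_J[OF HomD(2)[OF A]] by (simp add: vec4_eq_iff)
qed

lemma JHom_J:
  assumes "A \<in> JHom" shows "J y \<circ> A \<in> JHom"
proof -
  note A = JHomD(1)[OF assms]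
  have m: "A z \<in> TT" if "z \<in> span {u, v}" for z using A that unfolding real_hom_def by blast
  have "J y \<circ> A \<in> Hom"
  proof (rule HomI)
    show "(J y \<circ> A) z \<in> TT" if "z \<in> span {u, v}" for z using J_mem[OF m[OF that]] by simp
    fix z z' a b assume z: "z \<in> span {u, v}" "z' \<in> span {u, v}"
    have "A (a *\<^sub>R z + b *\<^sub>R z') = a *\<^sub>R A z + b *\<^sub>R A z'" using A z unfolding real_hom_def by blast
    then show "(J y \<circ> A) (a *\<^sub>R z + b *\<^sub>R z') = a *\<^sub>R (J y \<circ> A) z + b *\<^sub>R (J y \<circ> A) z'"
      using spinor_fibre.J_lin(1)[OF G m[OF z(1)] m[OF z(2)]] by simp
  qed
  moreover have "\<forall>z\<in>span {u, v}. (J y \<circ> A) (J y z) = J y ((J y \<circ> A) z)"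
    using assms unfolding J_hom_def by simp
  ultimately show ?thesis by (simp add: J_hom_def)
qed

text \<open>The image of the line under id + t A is the J-line of U = u + t A u whenever U is
  nonzero, which its first coordinate guarantees for small t; its orientation follows from
  \<open>f_oriented_line\<close>.\<close>

lemma JHom_velocity:
  assumes A: "A \<in> JHom"
  shows "velocity N (\<lambda>t. (y, Qf \<eta> (oriented_line (J y) ((\<lambda>z. z + t *\<^sub>R A z) ` span {u, v})))) = tN (0, ev A)"
proof (rule curve_velocity[OF _ HomD(2,3)[OF JHomD(1)[OF A]]])
  note H = HomD[OF JHomD(1)[OF A]]
  have "((\<lambda>t. 1 + t * cB (A u) $ 1) \<longlongrightarrow> 1 + 0 * cB (A u) $ 1) (nhds 0)"
    by (intro tendsto_intros filterlim_ident)
  then have "\<forall>\<^sub>F t in nhds 0. 1 + t * cB (A u) $ 1 \<noteq> 0" by (rule tendsto_imp_eventually_ne) simp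
  then show "\<forall>\<^sub>F t in nhds 0. (y, Qf \<eta> (oriented_line (J y) ((\<lambda>z. z + t *\<^sub>R A z) ` span {u, v}))) =
     (y, orient_class [u + t *\<^sub>R A u, v + t *\<^sub>R A v])"
  proof eventually_elim
    case (elim t)
    let ?U = "u + t *\<^sub>R A u"
    have UT: "?U \<in> TT" by (intro spinor_fibre.Tmem[OF G] u H)
    have cU: "cB ?U $ 1 \<noteq> 0" unfolding cB_lin bcoord_B using elim by simp
    have U0: "?U \<noteq> 0"
    proof
      assume "?U = 0"
      then have "cB ?U $ 1 = 0" by (simp only: linear_0[OF linear_cB] zero_index)
      then show False using cU by blast
    qed
    have JU: "J y ?U = \<epsilon> *\<^sub>R v + t *\<^sub>R \<epsilon> *\<^sub>R A v"
      using spinor_fibre.J_lin(1)[OF G u(1) H(2), of 1 t] Ju eps(3) by (simp add: JHomD(2)[OF A])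
    have f: "(a *\<^sub>R u + b *\<^sub>R v) + t *\<^sub>R A (a *\<^sub>R u + b *\<^sub>R v) = a *\<^sub>R ?U + b *\<^sub>R (v + t *\<^sub>R A v)" for a b
      by (simp add: H(1) algebra_simps)
    have "(\<lambda>z. z + t *\<^sub>R A z) ` span {u, v} = {(a *\<^sub>R u + b *\<^sub>R v) + t *\<^sub>R A (a *\<^sub>R u + b *\<^sub>R v) | a b. True}"
      unfolding span_pair by blast
    also have "\<dots> = {a *\<^sub>R ?U + b *\<^sub>R (v + t *\<^sub>R A v) | a b. True}" unfolding f ..
    also have "\<dots> = span {?U, J y ?U}"
    proof -
      have 1: "v + t *\<^sub>R A v = \<epsilon> *\<^sub>R J y ?U" unfolding JU by (rule disjE[OF eta]) simp_all
      have "{a *\<^sub>R ?U + b *\<^sub>R \<epsilon> *\<^sub>R J y ?U | a b. True} = {a *\<^sub>R ?U + b *\<^sub>R J y ?U | a b. True}"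
      proof (intro equalityI subsetI)
        fix z assume "z \<in> {a *\<^sub>R ?U + b *\<^sub>R J y ?U | a b. True}"
        then obtain a b where "z = a *\<^sub>R ?U + b *\<^sub>R J y ?U" by blast
        then have "z = a *\<^sub>R ?U + (b * \<epsilon>) *\<^sub>R \<epsilon> *\<^sub>R J y ?U" using eps(3) by simp
        then show "z \<in> {a *\<^sub>R ?U + b *\<^sub>R \<epsilon> *\<^sub>R J y ?U | a b. True}" by blast
      next
        fix z assume "z \<in> {a *\<^sub>R ?U + b *\<^sub>R \<epsilon> *\<^sub>R J y ?U | a b. True}"
        then obtain a b where "z = a *\<^sub>R ?U + b *\<^sub>R \<epsilon> *\<^sub>R J y ?U" by blast
        then have "z = a *\<^sub>R ?U + (b * \<epsilon>) *\<^sub>R J y ?U" by simp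
        then show "z \<in> {a *\<^sub>R ?U + b *\<^sub>R J y ?U | a b. True}" by blast
      qed
      then show ?thesis unfolding 1 span_pair .
    qed
    finally have s: "(\<lambda>z. z + t *\<^sub>R A z) ` span {u, v} = span {?U, J y ?U}" .
    have "Qf \<eta> (oriented_line (J y) (span {?U, J y ?U})) = orient_class [?U, \<epsilon> *\<^sub>R J y ?U]"
      using spinor_fibre.f_oriented_line[OF G UT U0 eta] by (simp add: Qf_def)
    also have "\<epsilon> *\<^sub>R J y ?U = v + t *\<^sub>R A v" unfolding JU by (rule disjE[OF eta]) simp_all
    finally show ?case unfolding s by (rule arg_cong[where f="Pair y"])
  qed
qed

text \<open>The J-linear map \<open>A0\<close> with u sent to w and its product with J have the
  velocities \<open>k1\<close> and \<open>k2\<close>. The reversal prescribed for the fibres changes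
  the sign of the second.\<close>

lemma line_fibre:
  "line_fibre_orientation M J (Qf \<eta>) x = orient_class [tN (0, vec4 1 0 0 \<epsilon>), - tN (0, vec4 0 1 (- \<epsilon>) 0)]"
proof -
  interpret O: orientation_core Db "{as. map tM as \<in> almost_complex_orientation M J y}" \<epsilon> b0 by (rule core)
  let ?k1 = "vec4 1 0 0 \<epsilon>" and ?k2 = "vec4 0 1 (- \<epsilon>) 0"
  define e where "e A = velocity N (\<lambda>t. (y, Qf \<eta> (oriented_line (J y) ((\<lambda>z. z + t *\<^sub>R A z) ` span {u, v}))))" for A
  obtain A0 where A0: "A0 \<in> Hom" "A0 u = w" "A0 v = \<epsilon> *\<^sub>R J y w"
    by (rule ev_exists[OF w(1) spinor_fibre.Tmem(2)[OF G J_mem[OF w(1)]]])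
  have A0J: "A0 \<in> JHom"
  proof -
    have "A0 (J y z) = J y (A0 z)" if "z \<in> span {u, v}" for z
    proof -
      obtain a b where z: "z = a *\<^sub>R u + b *\<^sub>R v" using \<open>z \<in> span {u, v}\<close> unfolding span_pair by blast
      have "J y (A0 z) = J y (a *\<^sub>R w + (b * \<epsilon>) *\<^sub>R J y w)" unfolding z HomD(1)[OF A0(1)] A0(2,3) by simp
      also have "\<dots> = a *\<^sub>R J y w - (b * \<epsilon>) *\<^sub>R w"
        unfolding spinor_fibre.J_lin(1)[OF G w(1) J_mem[OF w(1)]] JJ[OF w(1)] by simp
      also have "\<dots> = A0 (J y z)" unfolding z J_plane HomD(1)[OF A0(1)] A0(2,3) using eps(3)
        by (simp add: mult.commute mult.left_commute)
      finally show ?thesis by simp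
    qed
    then show ?thesis using A0(1) by (simp add: J_hom_def)
  qed
  have ee: "e A = cB (A u) $ 3 *\<^sub>R tN (0, ?k1) + cB (A u) $ 4 *\<^sub>R tN (0, ?k2)" if "A \<in> JHom" for A
    unfolding e_def JHom_velocity[OF that] JHomD(3)[OF that] linear_add[OF linear_P0] linear_cmul[OF linear_P0] ..
  have eA0: "e A0 = tN (0, ?k1)" "e (J y \<circ> A0) = tN (0, ?k2)"
    unfolding ee[OF A0J] ee[OF JHom_J[OF A0J]] unfolding comp_apply A0(2) bcoord_B by simp_all
  have "complex_orientation (\<lambda>A. J y \<circ> A) e JHom (vertical_space M K x) = orient_class [e A0, e (J y \<circ> A0)]"
  proof (rule complex_orientation_line[OF A0J])
    have "basis_list (map tN [(0, ?k1), (0, ?k2)]) (tN ` {w \<in> {e. Db e = 0}. fst w = 0})"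
      by (rule basis_list_map[OF linear_tN inj_tN O.kernel_pair(2)[unfolded O.k1_def O.k2_def]])
    then show "basis_list [e A0, e (J y \<circ> A0)] (vertical_space M K x)" unfolding eA0 vertical_K by simp
    fix A assume A: "A \<in> JHom"
    have c: "cB ((J y \<circ> A) u) $ 3 = - cB (A u) $ 4" "cB ((J y \<circ> A) u) $ 4 = cB (A u) $ 3"
      by (simp_all add: cB_J[OF HomD(2)[OF JHomD(1)[OF A]]])
    show "\<exists>p q. e A = p *\<^sub>R e A0 + q *\<^sub>R e (J y \<circ> A0) \<and> e (J y \<circ> A) = - q *\<^sub>R e A0 + p *\<^sub>R e (J y \<circ> A0)"
      unfolding eA0 ee[OF A] ee[OF JHom_J[OF A]] c by blast
  qed
  then show ?thesis
    unfolding line_fibre_orientation_def x_def case_prod_conv underlying_pair e_def[abs_def, symmetric]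
    unfolding x_def[symmetric] by (simp add: eA0 opposite_orient_class_pair)
qed

text \<open>In the charts \<open>C\<close> and \<open>c\<close> the projection is the linear map
  \<open>fst\<close>.\<close>

lemma differential_tN: "differential N M fst x (tN e) = tM (fst e)"
proof
  fix d
  show "differential N M fst x (tN e) d = tM (fst e) d"
  proof (cases "d \<in> M \<and> y \<in> fst d")
    case True
    let ?T = "frechet_derivative (snd d \<circ> chart_inv c) (at z0)"
    have "((\<lambda>p. (snd d \<circ> chart_inv c) (fst p)) has_derivative (\<lambda>e. ?T (fst e))) (at (z0, 0 :: real ^ 4))"
    proof -
      have 1: "(fst has_derivative fst) (at (z0, 0 :: real ^ 4))" by (rule bounded_linear.has_derivative[OF bounded_linear_fst has_derivative_ident])
      have 2: "((snd d \<circ> chart_inv c) has_derivative ?T) (at (fst (z0, 0 :: real ^ 4)))"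
        using transition_derivative[OF Ma c(1) _ c(2)] True by simp
      show ?thesis using diff_chain_at[OF 1 2] by (simp add: comp_def)
    qed
    then have "(((snd d \<circ> fst) \<circ> chart_inv C) has_derivative (\<lambda>e. ?T (fst e))) (at (z0, 0))"
    proof (rule has_derivative_transform_within_open[OF _ open_D z0_in(2)])
      fix p assume "p \<in> D"
      then have p: "fst p \<in> snd c ` fst c" by auto
      have "fst (chart_inv C (fst p, snd p)) = chart_inv c (fst p)"
        unfolding plane_chart_inv_frame[OF Ma c(1) basis_B p] by simp
      then show "(snd d \<circ> chart_inv c) (fst p) = ((snd d \<circ> fst) \<circ> chart_inv C) p" by simp
    qed
    then have D: "(((snd d \<circ> fst) \<circ> chart_inv C) has_derivative (\<lambda>e. ?T (fst e))) (at (snd C x))" unfolding x_chart(2) .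
    have "differential N M fst x (tN e) d = deriv_along N (snd d \<circ> fst) x (tN e)"
      unfolding differential_def using True by (simp add: x_def)
    also have "\<dots> = ?T (fst e)" by (rule deriv_along_tvec[OF Na C x_chart(1) D])
    also have "\<dots> = tM (fst e) d" unfolding tvec_def using True by simp
    finally show ?thesis .
  next
    case False
    then show ?thesis by (auto simp: differential_def tvec_def x_def)
  qed
qed

text \<open>\<open>tN\<close> is an isomorphism from the linear model, under which all orientations
  involved are images of those of \<open>orientation_core\<close>; the factor \<kappa> from the
  trivialization is harmless by \<open>cross2_mult\<close>.\<close>

lemma orientation_at_zero:
  "zero_set_orientation N (plane_bundle_orientation M J g) (line_subbundle N E' (eigen \<eta>)) (ecomp \<eta> \<psi>) x =
     line_planes_orientation M J (Qf \<eta>) x"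
proof -
  interpret O: orientation_core Db "{as. map tM as \<in> almost_complex_orientation M J y}" \<epsilon> b0 by (rule core)
  have fx: "fst x = y" by (simp add: x_def)
  have OM: "map (differential N M fst x) (map tN hs) \<in> almost_complex_orientation M J (fst x) \<longleftrightarrow>
      map fst hs \<in> {as. map tM as \<in> almost_complex_orientation M J y}" for hs
    by (simp add: comp_def differential_tN fx)
  have oN: "plane_bundle_orientation M J g x = map tN ` O.oN"
  proof (intro equalityI subsetI)
    fix bs assume "bs \<in> plane_bundle_orientation M J g x"
    then obtain hs vs where h: "set hs \<subseteq> range tN" "map (differential N M fst x) hs \<in> almost_complex_orientation M J (fst x)"
        "vs \<in> plane_fibre_orientation M g x" "bs \<in> orient_class (hs @ vs)"
      unfolding plane_bundle_orientation_def bundle_orientation_def tangent_N by blast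
    obtain hs' where hs': "hs = map tN hs'" using map_range[OF h(1)] by blast
    obtain qs where qs: "length qs = 4" "det4 qs < 0" "vs = map (\<lambda>q. tN (0, q)) qs" using h(3) unfolding plane_fibre by blast
    have e: "hs @ vs = map tN (hs' @ map (Pair 0) qs)" by (simp add: hs' qs(3))
    obtain bs' where "bs = map tN bs'" "bs' \<in> orient_class (hs' @ map (Pair 0) qs)"
      using h(4) unfolding e orient_class_map_linear[OF linear_tN] by blast
    then show "bs \<in> map tN ` O.oN" unfolding O.oN_def using h(2) qs(1,2) unfolding hs' OM by blast
  next
    fix bs assume "bs \<in> map tN ` O.oN"
    then obtain bs' hs qs where h: "bs = map tN bs'" "map fst hs \<in> {as. map tM as \<in> almost_complex_orientation M J y}"
        "length qs = 4" "det4 qs < 0" "bs' \<in> orient_class (hs @ map (Pair 0) qs)"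
      unfolding O.oN_def by blast
    have "bs \<in> orient_class (map tN (hs @ map (Pair 0) qs))"
      unfolding orient_class_map_linear[OF linear_tN] h(1) using h(5) by blast
    then have "bs \<in> orient_class (map tN hs @ map (\<lambda>q. tN (0, q)) qs)" by (simp add: comp_def)
    moreover have "map (\<lambda>q. tN (0, q)) qs \<in> plane_fibre_orientation M g x" unfolding plane_fibre using h(3,4) by blast
    moreover have "set (map tN hs) \<subseteq> tangent_space N x" unfolding tangent_N by auto
    ultimately show "bs \<in> plane_bundle_orientation M J g x"
      unfolding plane_bundle_orientation_def bundle_orientation_def using h(2)[folded OM] by blast
  qed
  have oK: "line_planes_orientation M J (Qf \<eta>) x = map tN ` O.oK"
  proof -
    let ?ks = "[(0 :: real ^ 4, O.k1), (0, - O.k2)]"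
    have ks: "line_fibre_orientation M J (Qf \<eta>) x = map tN ` orient_class ?ks"
      unfolding line_fibre orient_class_map_linear[OF linear_tN, symmetric]
      using linear_neg[OF linear_P0, of O.k2] by (simp add: O.k1_def O.k2_def)
    show ?thesis
    proof (intro equalityI subsetI)
      fix bs assume "bs \<in> line_planes_orientation M J (Qf \<eta>) x"
      then obtain hs vs where h: "set hs \<subseteq> tN ` {e. Db e = 0}" "map (differential N M fst x) hs \<in> almost_complex_orientation M J (fst x)"
          "vs \<in> map tN ` orient_class ?ks" "bs \<in> orient_class (hs @ vs)"
        unfolding line_planes_orientation_def bundle_orientation_def tangent_K ks by blast
      obtain hs' where hs': "set hs' \<subseteq> {e. Db e = 0}" "hs = map tN hs'" using map_range[OF h(1)] by blast
      obtain vs' where vs': "vs = map tN vs'" "vs' \<in> orient_class ?ks" using h(3) by blast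
      have e: "hs @ vs = map tN (hs' @ vs')" by (simp add: hs' vs')
      obtain bs' where "bs = map tN bs'" "bs' \<in> orient_class (hs' @ vs')"
        using h(4) unfolding e orient_class_map_linear[OF linear_tN] by blast
      moreover have "\<forall>h\<in>set hs'. Db h = 0" using hs'(1) by blast
      ultimately show "bs \<in> map tN ` O.oK" unfolding O.oK_def using h(2) vs'(2) unfolding hs'(2) OM by blast
    next
      fix bs assume "bs \<in> map tN ` O.oK"
      then obtain bs' hs vs where h: "bs = map tN bs'" "map fst hs \<in> {as. map tM as \<in> almost_complex_orientation M J y}"
          "\<forall>h\<in>set hs. Db h = 0" "vs \<in> orient_class ?ks" "bs' \<in> orient_class (hs @ vs)"
        unfolding O.oK_def by blast
      have "bs \<in> orient_class (map tN (hs @ vs))"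
        unfolding orient_class_map_linear[OF linear_tN] h(1) using h(5) by blast
      then have "bs \<in> orient_class (map tN hs @ map tN vs)" by simp
      moreover have "map tN vs \<in> line_fibre_orientation M J (Qf \<eta>) x" unfolding ks using h(4) by blast
      moreover have "set (map tN hs) \<subseteq> tangent_space_of N K x" unfolding tangent_K using h(3) by auto
      ultimately show "bs \<in> line_planes_orientation M J (Qf \<eta>) x"
        unfolding line_planes_orientation_def bundle_orientation_def using h(2)[folded OM] by blast
    qed
  qed
  let ?L = "line_subbundle N E' (eigen \<eta>)" and ?s = "ecomp \<eta> \<psi>"
  have "zero_set_orientation N (plane_bundle_orientation M J g) ?L ?s x =
      map tN ` {bs. basis_list bs {e. Db e = 0} \<and> (\<exists>e1 e2. cross2 (Db e1) (Db e2) > 0 \<and> bs @ [e1, e2] \<in> O.oN)}"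
  proof (intro equalityI subsetI)
    fix bs assume "bs \<in> zero_set_orientation N (plane_bundle_orientation M J g) ?L ?s x"
    then obtain V t cs where b: "basis_list bs (tN ` {e. Db e = 0})" and t: "(V, t) \<in> trivs ?L" "x \<in> V"
      and cs: "set cs \<subseteq> range tN" "map (deriv_along N (\<lambda>z. t z (?s z)) x) cs \<in> fibre_orientation" "bs @ cs \<in> map tN ` O.oN"
      unfolding zero_set_orientation_def zero_set_ecomp[OF eta] tangent_K tangent_N oN by blast
    obtain \<kappa> where k: "\<kappa> \<noteq> 0" "\<And>e. deriv_along N (\<lambda>z. t z (ecomp \<eta> \<psi> z)) x (tN e) = (\<chi> i. \<kappa> * Db e)"
      by (rule section_derivative[OF t]) blast
    obtain bs' where bs': "bs = map tN bs'" using map_range[OF basis_list_subset[OF b]] by blast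
    obtain cs' where cs': "cs = map tN cs'" using map_range[OF cs(1)] by blast
    have m: "map (deriv_along N (\<lambda>z. t z (?s z)) x) cs = map (\<lambda>e. \<chi> i. \<kappa> * Db e) cs'" by (simp add: cs' k(2))
    obtain a1 a2 where a: "map (\<lambda>e. (\<chi> i. \<kappa> * Db e) :: complex ^ 1) cs' = [a1, a2]" "cross2 (a1 $ 1) (a2 $ 1) > 0"
      using cs(2) unfolding m fibre_orientation_iff by (elim exE conjE) (rule that)
    then obtain e1 e2 where e: "cs' = [e1, e2]" by (auto simp: map_eq_Cons_conv)
    have "cross2 (\<kappa> * Db e1) (\<kappa> * Db e2) > 0" using a unfolding e by auto
    then have cr: "cross2 (Db e1) (Db e2) > 0" unfolding cross2_mult by (simp add: zero_less_mult_iff)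
    have "map tN (bs' @ [e1, e2]) \<in> map tN ` O.oN" using cs(3) unfolding bs' cs' e by simp
    then have "bs' @ [e1, e2] \<in> O.oN" using inj_image_mem_iff[OF inj_mapI[OF inj_tN]] by blast
    moreover have "basis_list bs' {e. Db e = 0}" using b unfolding bs' basis_list_map_iff[OF linear_tN inj_tN] .
    ultimately show "bs \<in> map tN ` {bs. basis_list bs {e. Db e = 0} \<and> (\<exists>e1 e2. cross2 (Db e1) (Db e2) > 0 \<and> bs @ [e1, e2] \<in> O.oN)}"
      using cr bs' by blast
  next
    fix bs assume "bs \<in> map tN ` {bs. basis_list bs {e. Db e = 0} \<and> (\<exists>e1 e2. cross2 (Db e1) (Db e2) > 0 \<and> bs @ [e1, e2] \<in> O.oN)}"
    then obtain bs' e1 e2 where b: "bs = map tN bs'" "basis_list bs' {e. Db e = 0}" "cross2 (Db e1) (Db e2) > 0" "bs' @ [e1, e2] \<in> O.oN"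
      by blast
    obtain V t where t: "(V, t) \<in> trivs ?L" "x \<in> V"
      using vector_bundleD(4)[OF vector_bundle_eigen[OF eta] xN] by blast
    obtain \<kappa> where k: "\<kappa> \<noteq> 0" "\<And>e. deriv_along N (\<lambda>z. t z (ecomp \<eta> \<psi> z)) x (tN e) = (\<chi> i. \<kappa> * Db e)"
      by (rule section_derivative[OF t]) blast
    have "cross2 (\<kappa> * Db e1) (\<kappa> * Db e2) > 0" unfolding cross2_mult using b(3) k(1) by simp
    then have f: "map (deriv_along N (\<lambda>z. t z (?s z)) x) [tN e1, tN e2] \<in> fibre_orientation"
      unfolding fibre_orientation_iff by (simp add: k(2))
    have "bs @ [tN e1, tN e2] = map tN (bs' @ [e1, e2])" by (simp add: b(1))
    then have o: "bs @ [tN e1, tN e2] \<in> map tN ` O.oN" using b(4) by blast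
    have B: "basis_list bs (tN ` {e. Db e = 0})" unfolding b(1) basis_list_map_iff[OF linear_tN inj_tN] by (rule b(2))
    have s: "set [tN e1, tN e2] \<subseteq> range tN" by simp
    show "bs \<in> zero_set_orientation N (plane_bundle_orientation M J g) ?L ?s x"
      unfolding zero_set_orientation_def zero_set_ecomp[OF eta] tangent_K tangent_N oN
      using B t f o s by blast
  qed
  then show ?thesis unfolding O.orientation_eq oK .
qed

end

context spin_setting
begin

lemma zero_point_exists:
  assumes \<eta>: "\<eta> = 1 \<or> \<eta> = -1" and x: "x \<in> line_planes M J (Qf \<eta>)"
  obtains y c u w W \<xi> where "zero_point M J g S \<psi> \<eta> y c u w W \<xi>" "x = zero_point.x J \<eta> y u"
proof -
  obtain u where u: "fst x \<in> points M" "u \<in> tangent_space M (fst x)" "u \<noteq> 0" "x = (fst x, orient_class [u, - \<eta> *\<^sub>R J (fst x) u])"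
    using x unfolding line_planes_iff[OF \<eta>] by blast
  obtain c where c: "c \<in> M" "fst x \<in> fst c" by (rule pointsE[OF u(1)])
  obtain W \<xi> where W: "is_frame W \<xi>" "fst x \<in> W" by (rule local_frame[OF u(1)])
  obtain w where w: "w \<in> tangent_space M (fst x)" "w \<notin> span {u, J (fst x) u}"
    by (rule spinor_fibre.span_J_proper[OF spinor_fibre_at[OF u(1)]])
  have z: "zero_point M J g S \<psi> \<eta> (fst x) c u w W \<xi>"
    by (intro zero_point.intro spin_setting_axioms zero_point_axioms.intro) (use \<eta> c u w W in auto)
  moreover have "x = zero_point.x J \<eta> (fst x) u"
    unfolding zero_point.x_def[OF z] zero_point.v_def[OF z] by (rule u(4))
  ultimately show ?thesis by (rule that)
qed

theorem transverse_section_ecomp: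
  assumes \<eta>: "\<eta> = 1 \<or> \<eta> = -1"
  shows "transverse_section_with_zeros N (plane_bundle_orientation M J g) (line_subbundle N E' (eigen \<eta>)) (ecomp \<eta> \<psi>)
    (line_planes M J (Qf \<eta>)) (line_planes_orientation M J (Qf \<eta>))"
  unfolding transverse_section_with_zeros_def transverse_to_zero_def zero_set_ecomp[OF \<eta>]
proof (intro conjI ballI refl smooth_section_ecomp[OF \<eta>])
  fix x assume "x \<in> line_planes M J (Qf \<eta>)"
  then obtain y c u w W \<xi> where z: "zero_point M J g S \<psi> \<eta> y c u w W \<xi>" "x = zero_point.x J \<eta> y u"
    by (rule zero_point_exists[OF \<eta>])
  show "\<exists>(V, t)\<in>trivs (line_subbundle N E' (eigen \<eta>)). x \<in> V \<and>
     deriv_along N (\<lambda>z. t z (ecomp \<eta> \<psi> z)) x ` tangent_space N x = UNIV"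
    unfolding z(2) by (rule zero_point.transverse[OF z(1)])
  show "zero_set_orientation N (plane_bundle_orientation M J g) (line_subbundle N E' (eigen \<eta>)) (ecomp \<eta> \<psi>) x =
     line_planes_orientation M J (Qf \<eta>) x"
    unfolding z(2) by (rule zero_point.orientation_at_zero[OF z(1)])
qed

end

section \<open>Compactness\<close>

lemma topspace_manifold:
  assumes "smooth_atlas N" shows "topspace (manifold_topology N) = points N"
  unfolding topspace_def openin_manifold_topology[OF assms]
  using open_in_points open_in_points_self[OF assms] by blast

context spin_setting
begin

text \<open>The plane of a vector and its image under - \<eta> J, in terms of a chart of M. Unlike a
  chart of the plane bundle, it reaches all J-lines over the chart domain at once.\<close>

definition line_point where
  "line_point \<eta> c p = frame_point M (chart_inv c (fst p)) c (snd p)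
     (- \<eta> *\<^sub>R J (chart_inv c (fst p)) (tvec M (chart_inv c (fst p)) c (snd p)) c)"

lemma line_point_tvec:
  assumes "c \<in> M" "z \<in> snd c ` fst c"
  defines "y \<equiv> chart_inv c z"
  shows "line_point \<eta> c (z, a) = (y, orient_class [tvec M y c a, - \<eta> *\<^sub>R J y (tvec M y c a)])"
proof -
  have y: "y \<in> fst c" unfolding y_def by (rule chart_inv_in[OF assms(2)])
  note tm = spinor_fibre.Tmem[OF spinor_fibre_at[OF in_points[OF assms(1) y]]]
  have "- \<eta> *\<^sub>R J y (tvec M y c a) \<in> tangent_space M y" by (intro tm tvec_in_tangent_space[OF Ma assms(1) y])
  from tangent_vector_tvec[OF Ma assms(1) y this] show ?thesis
    by (simp add: line_point_def frame_point_def y_def[symmetric] scaleR_fun_def)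
qed

lemma tvec_nonzero: "c \<in> M \<Longrightarrow> y \<in> fst c \<Longrightarrow> a \<noteq> 0 \<Longrightarrow> tvec M y c a \<noteq> 0"
  using tvec_inj[OF Ma, of c y a 0] linear_0[OF linear_tvec[OF Ma, of c y]] by simp

text \<open>At each point the vector and its image under - \<eta> J extend to a basis, and in the
  plane chart of that basis the map has smooth slopes nearby.\<close>

lemma continuous_line_point:
  assumes \<eta>: "\<eta> = 1 \<or> \<eta> = -1" and c: "c \<in> M"
  shows "continuous_map (top_of_set (snd c ` fst c \<times> - {0})) (manifold_topology N) (line_point \<eta> c)"
proof -
  let ?O = "snd c ` fst c \<times> - {0 :: real ^ 4}"
  define V where "V p = - \<eta> *\<^sub>R J (chart_inv c (fst p)) (tvec M (chart_inv c (fst p)) c (snd p)) c" for p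
  have o: "open ?O" by (intro open_Times open_chart_image[OF Ma c]) auto
  have sV: "smooth_on ?O V" unfolding V_def
    by (intro smooth_on_scaleR[OF o] smooth_on_const smooth_on_subset[OF smooth_J_chart[OF c]]) auto
  have ln: "line_point \<eta> c p = frame_point M (chart_inv c (fst p)) c (snd p) (V p)" for p by (simp add: line_point_def V_def)
  have y: "chart_inv c (fst p) \<in> fst c" "snd c (chart_inv c (fst p)) = fst p" if "p \<in> ?O" for p
    using that chart_inv_in[of "fst p" c] chart_inv_right[of "fst p" c] by auto
  have ind: "snd p \<noteq> V p \<and> independent {snd p, V p}" if p: "p \<in> ?O" for p
  proof -
    let ?y = "chart_inv c (fst p)"
    have e: "- \<eta> \<noteq> 0" using \<eta> by auto
    have "tvec M ?y c (V p) = - \<eta> *\<^sub>R J ?y (tvec M ?y c (snd p))"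
    proof -
      note tm = spinor_fibre.Tmem[OF spinor_fibre_at[OF in_points[OF c y(1)[OF p]]]]
      have "- \<eta> *\<^sub>R J ?y (tvec M ?y c (snd p)) \<in> tangent_space M ?y" by (intro tm tvec_in_tangent_space[OF Ma c y(1)[OF p]])
      from tangent_vector_tvec[OF Ma c y(1)[OF p] this] show ?thesis by (simp add: V_def scaleR_fun_def)
    qed
    moreover have "snd p \<noteq> 0" using p by auto
    ultimately show ?thesis
      using spinor_fibre.J_independent[OF spinor_fibre_at[OF in_points[OF c y(1)[OF p]]] tvec_in_tangent_space[OF Ma c y(1)[OF p]] tvec_nonzero[OF c y(1)[OF p]] e]
        linear_inj_independent_pair[OF linear_tvec[OF Ma c y(1)[OF p]] inj_tvec[OF Ma c y(1)[OF p]], of "snd p" "V p"] by metis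
  qed
  have opn: "open {p \<in> ?O. line_point \<eta> c p \<in> U}" if U: "open_in N U" for U
  proof (subst open_subopen, intro ballI)
    fix p0 assume "p0 \<in> {p \<in> ?O. line_point \<eta> c p \<in> U}"
    then have p0: "p0 \<in> ?O" "line_point \<eta> c p0 \<in> U" by auto
    obtain b1 b2 where B: "basis_list [snd p0, V p0, b1, b2] UNIV" using extend_basis4 ind[OF p0(1)] by metis
    let ?B = "[snd p0, V p0, b1, b2]"
    let ?C = "plane_chart M c ?B"
    have CN: "?C \<in> N" by (rule plane_bundleI[OF Ma c B])
    define P where "P p = plane_minor (bcoord ?B (snd p)) (bcoord ?B (V p))" for p
    define H where "H p = (fst p, plane_coords (bcoord ?B (snd p)) (bcoord ?B (V p)))" for p
    note sB = smooth_on_linear[OF o linear_bcoord[OF B]]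
    have ss: "smooth_on ?O fst" "smooth_on ?O snd" by (intro smooth_on_linear'[OF o] linear_fst linear_snd)+
    have sP: "smooth_on ?O P" unfolding P_def plane_minor_def
      by (intro smooth_on_diff[OF o] smooth_on_mult[OF o] smooth_on_nth[OF o] sB[OF ss(2)] sB[OF sV])
    define O' where "O' = {p \<in> ?O. P p > 0}"
    have "open (?O \<inter> P -` {0<..})" by (rule continuous_open_preimage[OF smooth_on_continuous_on[OF sP] o]) simp
    then have o': "open O'" by (simp add: O'_def vimage_def Collect_conj_eq)
    have sub: "O' \<subseteq> ?O" by (auto simp: O'_def)
    have "smooth_on O' H" unfolding H_def
      by (intro smooth_on_Pair[OF o'] smooth_plane_coords[OF o'] smooth_on_subset[OF ss(1) sub] smooth_on_subset[OF sB[OF ss(2)] sub] smooth_on_subset[OF sB[OF sV] sub])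
        (simp add: O'_def P_def)
    then have "open (O' \<inter> H -` (snd ?C ` (fst ?C \<inter> U)))"
      by (rule continuous_open_preimage[OF smooth_on_continuous_on o' open_in_image[OF U CN]])
    moreover have in_C: "line_point \<eta> c p \<in> fst ?C" "snd ?C (line_point \<eta> c p) = H p" if "p \<in> O'" for p
    proof -
      have p: "p \<in> ?O" "P p > 0" using that by (auto simp: O'_def)
      show "line_point \<eta> c p \<in> fst ?C" unfolding ln using frame_point_in_chart[OF Ma c y(1)[OF p(1)] B] p(2) unfolding P_def by blast
      show "snd ?C (line_point \<eta> c p) = H p" unfolding ln H_def
        using frame_point_coords[OF Ma c y(1)[OF p(1)] B p(2)[unfolded P_def]] y(2)[OF p(1)] by simp
    qed
    moreover have "p0 \<in> O'"
      using p0(1) bcoord_basis(1,2)[OF B] by (simp add: O'_def P_def plane_minor_def)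
    moreover have "O' \<inter> H -` (snd ?C ` (fst ?C \<inter> U)) \<subseteq> {p \<in> ?O. line_point \<eta> c p \<in> U}"
    proof
      fix p assume p: "p \<in> O' \<inter> H -` (snd ?C ` (fst ?C \<inter> U))"
      then obtain z where z: "snd ?C (line_point \<eta> c p) = snd ?C z" "z \<in> fst ?C" "z \<in> U" using in_C(2)[of p] by auto
      have "line_point \<eta> c p = z" using inj_onD[OF inj_plane_chart[OF Ma c B] z(1) in_C(1) z(2)] p by blast
      then show "p \<in> {p \<in> ?O. line_point \<eta> c p \<in> U}" using z(3) p sub by blast
    qed
    moreover have "p0 \<in> O' \<inter> H -` (snd ?C ` (fst ?C \<inter> U))" if "p0 \<in> O'"
      using in_C[OF that] p0(2) that by (metis IntI image_eqI vimageI2)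
    ultimately show "\<exists>T. open T \<and> p0 \<in> T \<and> T \<subseteq> {p \<in> ?O. line_point \<eta> c p \<in> U}" by blast
  qed
  have pts: "line_point \<eta> c p \<in> points N" if p: "p \<in> ?O" for p
    unfolding points_plane_bundle[OF Ma] ln frame_point_def fst_conv snd_conv oriented_planes_tangent[OF Ma c y(1)[OF p]]
    using ind[OF p] in_points[OF c y(1)[OF p]] by blast
  show ?thesis
    unfolding continuous_map_def openin_manifold_topology[OF Na] topspace_manifold[OF Na] topspace_euclidean_subtopology openin_open_eq[OF o]
  proof (intro conjI allI impI funcsetI)
    show "line_point \<eta> c p \<in> points N" if "p \<in> ?O" for p using pts that .
    fix U assume "open_in N U"
    then show "open {p \<in> ?O. line_point \<eta> c p \<in> U}" by (rule opn)
  qed blast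
qed

text \<open>Every J-line has a generator of norm one in the components of the chart, so the set is
  the continuous image of \<open>Z\<close> times a unit sphere.\<close>

lemma compactin_line_planes_chart:
  assumes \<eta>: "\<eta> = 1 \<or> \<eta> = -1" and c: "c \<in> M" and Z: "compact Z" "Z \<subseteq> snd c ` fst c"
  shows "compactin (manifold_topology N) {x \<in> line_planes M J (Qf \<eta>). fst x \<in> fst c \<and> snd c (fst x) \<in> Z}"
proof -
  let ?S = "Z \<times> sphere (0 :: real ^ 4) 1"
  have "compactin (top_of_set (snd c ` fst c \<times> - {0})) ?S"
    using Z by (auto simp: compactin_subtopology compact_Times)
  then have "compactin (manifold_topology N) (line_point \<eta> c ` ?S)"
    by (rule image_compactin[OF _ continuous_line_point[OF \<eta> c]])
  moreover have "line_point \<eta> c ` ?S = {x \<in> line_planes M J (Qf \<eta>). fst x \<in> fst c \<and> snd c (fst x) \<in> Z}" (is "_ = ?R")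
  proof (intro equalityI subsetI)
    fix x assume "x \<in> line_point \<eta> c ` ?S"
    then obtain z a where za: "x = line_point \<eta> c (z, a)" "z \<in> Z" "norm a = 1" by auto
    have z: "z \<in> snd c ` fst c" using za(2) Z(2) by blast
    let ?y = "chart_inv c z"
    have y: "?y \<in> fst c" "snd c ?y = z" by (rule chart_inv_in[OF z], rule chart_inv_right[OF z])
    have x: "x = (?y, orient_class [tvec M ?y c a, - \<eta> *\<^sub>R J ?y (tvec M ?y c a)])"
      unfolding za(1) by (rule line_point_tvec[OF c z])
    have "a \<noteq> 0" using za(3) by auto
    then have "tvec M ?y c a \<noteq> 0" by (rule tvec_nonzero[OF c y(1)])
    moreover have "tvec M ?y c a \<in> tangent_space M ?y" by (rule tvec_in_tangent_space[OF Ma c y(1)])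
    ultimately have "x \<in> line_planes M J (Qf \<eta>)" unfolding line_planes_iff[OF \<eta>] x fst_conv using in_points[OF c y(1)] by blast
    then show "x \<in> ?R" using y za(2) x by simp
  next
    fix x assume x: "x \<in> ?R"
    then have f: "fst x \<in> fst c" "snd c (fst x) \<in> Z" by auto
    obtain u where u: "u \<in> tangent_space M (fst x)" "u \<noteq> 0" "x = (fst x, orient_class [u, - \<eta> *\<^sub>R J (fst x) u])"
      using x unfolding line_planes_iff[OF \<eta>] by blast
    have y: "chart_inv c (snd c (fst x)) = fst x" by (rule chart_inv_left[OF Ma c f(1)])
    have uc: "u = tvec M (fst x) c (u c)" by (rule tangent_vector_tvec[OF Ma c f(1) u(1)])
    then have n: "norm (u c) > 0" using u(2) linear_0[OF linear_tvec[OF Ma c f(1)]] by auto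
    let ?k = "1 / norm (u c)"
    have k: "tvec M (fst x) c (?k *\<^sub>R u c) = ?k *\<^sub>R u" using uc linear_cmul[OF linear_tvec[OF Ma c f(1)]] by metis
    have in_chart: "snd c (fst x) \<in> snd c ` fst c" using f(1) by blast
    note J = spinor_fibre.J_lin(3)[OF spinor_fibre_at[OF in_points[OF c f(1)]] u(1)]
    have "line_point \<eta> c (snd c (fst x), ?k *\<^sub>R u c) = (fst x, orient_class [?k *\<^sub>R u, - \<eta> *\<^sub>R J (fst x) (?k *\<^sub>R u)])"
      using line_point_tvec[OF c in_chart, of \<eta> "?k *\<^sub>R u c"] unfolding y k .
    also have "[?k *\<^sub>R u, - \<eta> *\<^sub>R J (fst x) (?k *\<^sub>R u)] = [?k *\<^sub>R u + 0 *\<^sub>R (- \<eta> *\<^sub>R J (fst x) u), 0 *\<^sub>R u + ?k *\<^sub>R (- \<eta> *\<^sub>R J (fst x) u)]"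
      unfolding J by simp
    also have "orient_class \<dots> = orient_class [u, - \<eta> *\<^sub>R J (fst x) u]"
    proof (rule orient_class_eq)
      have "?k * ?k - 0 * 0 > 0" using n by simp
      then show "[?k *\<^sub>R u + 0 *\<^sub>R (- \<eta> *\<^sub>R J (fst x) u), 0 *\<^sub>R u + ?k *\<^sub>R (- \<eta> *\<^sub>R J (fst x) u)] \<in> orient_class [u, - \<eta> *\<^sub>R J (fst x) u]"
        unfolding orient_class_pair by blast
    qed
    also have "(fst x, orient_class [u, - \<eta> *\<^sub>R J (fst x) u]) = x" by (rule u(3)[symmetric])
    finally have "x = line_point \<eta> c (snd c (fst x), ?k *\<^sub>R u c)" by (rule sym)
    moreover have "(snd c (fst x), ?k *\<^sub>R u c) \<in> ?S" using f(2) n by simp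
    ultimately show "x \<in> line_point \<eta> c ` ?S" by (rule image_eqI)
  qed
  ultimately show ?thesis by simp
qed

text \<open>M is covered by coordinate balls whose closed balls still lie in a chart image. Finitely
  many open ones suffice, and each closed one contributes a compact piece.\<close>

lemma compactin_line_planes:
  assumes \<eta>: "\<eta> = 1 \<or> \<eta> = -1" and cp: "compact_space (manifold_topology M)"
  shows "compactin (manifold_topology N) (line_planes M J (Qf \<eta>))"
proof -
  let ?K = "line_planes M J (Qf \<eta>)"
  define \<U> where "\<U> = {{y \<in> fst c. snd c y \<in> ball z r} | c z r. c \<in> M \<and> cball z r \<subseteq> snd c ` fst c}"
  have op: "openin (manifold_topology M) U" if U: "U \<in> \<U>" for U
  proof -
    obtain c z r where "U = {y \<in> fst c. snd c y \<in> ball z r}" "c \<in> M" using U unfolding \<U>_def by blast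
    then show ?thesis using open_in_preimage[OF Ma _ open_ball] by (simp add: openin_manifold_topology[OF Ma])
  qed
  have "topspace (manifold_topology M) \<subseteq> \<Union>\<U>"
  proof
    fix y assume "y \<in> topspace (manifold_topology M)"
    then have "y \<in> points M" by (simp add: topspace_manifold[OF Ma])
    then obtain c where c: "c \<in> M" "y \<in> fst c" by (rule pointsE)
    have "snd c y \<in> snd c ` fst c" using c(2) by blast
    then obtain r where r: "r > 0" "cball (snd c y) r \<subseteq> snd c ` fst c"
      using open_contains_cball open_chart_image[OF Ma c(1)] by blast
    have "y \<in> {x \<in> fst c. snd c x \<in> ball (snd c y) r}" using c(2) r(1) by simp
    then show "y \<in> \<Union>\<U>" unfolding \<U>_def using c(1) r(2) by blast
  qed
  then obtain \<F> where F: "finite \<F>" "\<F> \<subseteq> \<U>" "points M \<subseteq> \<Union>\<F>"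
    using compactinD[OF cp[unfolded compact_space_def], of \<U>] op by (auto simp: topspace_manifold[OF Ma])
  have "\<forall>U\<in>\<F>. \<exists>L. compactin (manifold_topology N) L \<and> L \<subseteq> ?K \<and> {x \<in> ?K. fst x \<in> U} \<subseteq> L"
  proof
    fix U assume U: "U \<in> \<F>"
    obtain c z r where c: "U = {y \<in> fst c. snd c y \<in> ball z r}" "c \<in> M" "cball z r \<subseteq> snd c ` fst c"
      using U F(2) unfolding \<U>_def by blast
    show "\<exists>L. compactin (manifold_topology N) L \<and> L \<subseteq> ?K \<and> {x \<in> ?K. fst x \<in> U} \<subseteq> L"
      by (rule exI[of _ "{x \<in> ?K. fst x \<in> fst c \<and> snd c (fst x) \<in> cball z r}"], intro conjI
          compactin_line_planes_chart[OF \<eta> c(2) compact_cball c(3)]) (auto simp: c(1))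
  qed
  from bchoice[OF this] obtain L where
    L: "\<forall>U\<in>\<F>. compactin (manifold_topology N) (L U) \<and> L U \<subseteq> ?K \<and> {x \<in> ?K. fst x \<in> U} \<subseteq> L U" ..
  have "\<Union>(L ` \<F>) = ?K"
  proof (intro equalityI subsetI)
    fix x assume x: "x \<in> ?K"
    then have "fst x \<in> points M" unfolding line_planes_iff[OF \<eta>] by blast
    then obtain U where "U \<in> \<F>" "fst x \<in> U" using F(3) by blast
    moreover have "{x \<in> ?K. fst x \<in> U} \<subseteq> L U" using L \<open>U \<in> \<F>\<close> by simp
    ultimately show "x \<in> \<Union>(L ` \<F>)" using x by blast
  next
    fix x assume "x \<in> \<Union>(L ` \<F>)"
    then obtain U where "U \<in> \<F>" "x \<in> L U" by blast
    moreover have "L U \<subseteq> ?K" using L \<open>U \<in> \<F>\<close> by simp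
    ultimately show "x \<in> ?K" by blast
  qed
  moreover have "compactin (manifold_topology N) (\<Union>(L ` \<F>))"
    by (rule compactin_Union) (use F(1) L in auto)
  ultimately show ?thesis by simp
qed

end

theorem theorem12p1:
  fixes M :: "('a, real ^ 4) manifold"
    and J :: "'a \<Rightarrow> ('a, real ^ 4) tangent \<Rightarrow> ('a, real ^ 4) tangent"
    and g :: "'a \<Rightarrow> ('a, real ^ 4) tangent \<Rightarrow> ('a, real ^ 4) tangent \<Rightarrow> real"
    and S :: "('a, real ^ 4, 's::complex_vector, 't::complex_vector, 'k::complex_vector) spinc"
    and \<psi> :: "'a \<Rightarrow> 's"
  assumes "smooth_manifold M"
    and "connected_space (manifold_topology M)"
    and "almost_hermitian M J g"
    and "spinc_structure M S"
    and "unit_section M (sigma_plus S) \<psi>"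
    and "corresponds M J g S \<psi>"
  shows "poincare_dual (plane_bundle M) (plane_bundle_orientation M J g)
           (lambda_plus M S) (Qbar_set M J) (Qbar_orientation M J) \<and>
         poincare_dual (plane_bundle M) (plane_bundle_orientation M J g)
           (mu_plus M S) (Q_set M J) (Q_orientation M J) \<and>
         transverse_section_with_zeros (plane_bundle M) (plane_bundle_orientation M J g)
           (lambda_plus M S) (lambda_component S \<psi>) (Qbar_set M J) (Qbar_orientation M J) \<and>
         transverse_section_with_zeros (plane_bundle M) (plane_bundle_orientation M J g)
           (mu_plus M S) (mu_component S \<psi>) (Q_set M J) (Q_orientation M J) \<and>
         (compact_space (manifold_topology M) \<longrightarrow>
            compactin (manifold_topology (plane_bundle M)) (Q_set M J) \<and>
            compactin (manifold_topology (plane_bundle M)) (Qbar_set M J))"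
proof -
  interpret spin_setting M J g S \<psi>
    using assms by unfold_locales
  have e: "1 = (1 :: real) \<or> 1 = (-1 :: real)" "-1 = (1 :: real) \<or> -1 = (-1 :: real)" by simp_all
  \<comment> \<open>The sign \<eta> = 1 of \<lambda> goes with reversed complex lines, hence with
    Qbar, and \<eta> = -1 of \<mu> with Q.\<close>
  have Q: "Qf 1 = opposite" "Qf (-1) = id" by (simp_all add: Qf_def)
  note t = transverse_section_ecomp[OF e(1), unfolded Q(1)] transverse_section_ecomp[OF e(2), unfolded Q(2)]
  show ?thesis
    unfolding lambda_mu_eigen Q_set_def Qbar_set_def Q_orientation_def[abs_def] Qbar_orientation_def[abs_def] poincare_dual_def
    using t vector_bundle_eigen[OF e(1)] vector_bundle_eigen[OF e(2)] compactin_line_planes[OF e(1), unfolded Q(1)] compactin_line_planes[OF e(2), unfolded Q(2)]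
    by blast
qed

end
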